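(* Fix $d\ge 1$ and $\beta>0$. For each $\varepsilon>0$ let $V_\varepsilon\in C^1(\mathbb{T}^d)$ and let $(Q^\varepsilon_t,P^\varepsilon_t)_{t\ge 0}$, with values in $\mathbb{T}^d\times\mathbb{R}^d$, be a weak solution of the Langevin SDE $$\begin{cases} dQ^\varepsilon_t=\frac1\varepsilon P^\varepsilon_t\,dt,\\ dP^\varepsilon_t=-\frac1\varepsilon\nabla V_\varepsilon(Q^\varepsilon_t)\,dt-\frac1{\varepsilon^2}P^\varepsilon_t\,dt+\frac1\varepsilon\sqrt{2\beta^{-1}}\,dW_t,\end{cases}$$ where $W$ is a standard $d$-dimensional Brownian motion. Let $V:\mathbb{T}^d\to\mathbb{R}$ be a $C^1$ function. Assume that: (1) $\|\nabla V_\varepsilon-\nabla V\|_\infty\to 0$ as $\varepsilon\to 0$; (2) $\lim_{\varepsilon\to 0}\varepsilon\,\mathbb{E}\big(|P^\varepsilon_0|^3\big)=0$; (3) the law of $Q^\varepsilon_0$ converges weakly, as $\varepsilon\to 0$, to the law of some $\mathbb{T}^d$-valued random variable $Q_0$. Then, as $\varepsilon\to 0$, the process $(Q^\varepsilon_t)_{t\ge 0}$, viewed as a random element of $C(\mathbb{R}_+,\mathbb{T}^d)$, converges in distribution to the unique weak solution $(Q_t)_{t\ge0}$, with initial distribution $\mathrm{Law}(Q_0)$, of the overdamped Langevin SDE on $\mathbb{T}^d$ $$dQ_t=-\nabla V(Q_t)\,dt+\sqrt{2\beta^{-1}}\,dB_t,$$ where $B$ is a standard $d$-dimensional Brownian 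motion.
   Context: $\mathbb{T}^d=\mathbb{R}^d/\mathbb{Z}^d$ is the $d$-dimensional torus. SDEs on $\mathbb{T}^d$ (or $\mathbb{T}^d\times\mathbb{R}^d$) are understood by periodically extending the coefficients to $\mathbb{R}^d$ and projecting the position by the canonical map $\mathbb{R}^d\to\mathbb{T}^d$. A weak solution of an SDE $dX_t=b(X_t)dt+\sigma(X_t)dW_t$ is a continuous process $X$ for which there is a filtered probability space $(\Omega,\mathcal{F},\mathbf{P},(\mathcal{F}_t)_{t\ge0})$ carrying an $(\mathcal{F}_t)$-Brownian motion $W$ such that $X$ is $(\mathcal{F}_t)$-adapted and $X_t=X_0+\int_0^t b(X_s)ds+\int_0^t\sigma(X_s)dW_s$ almost surely for all $t\ge 0$. The solutions for different $\varepsilon$ may be defined on different probability spaces. The path space $C(\mathbb{R}_+,\mathbb{T}^d)$ is endowed with the topology of uniform convergence on compact sets. *)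

theory Defs
  imports "HOL-Probability.Probability"
begin

section \<open>The torus\<close>

quotient_type (overloaded) 'n torus = "real ^ 'n::finite" / "\<lambda>x y. \<forall>i. x $ i - y $ i \<in> \<int>"
  morphisms rep_torus to_torus
proof (rule equivpI)
  show "reflp (\<lambda>x y :: real ^ 'n. \<forall>i. x $ i - y $ i \<in> \<int>)"
    by (simp add: reflp_def)
  show "symp (\<lambda>x y :: real ^ 'n. \<forall>i. x $ i - y $ i \<in> \<int>)"
    unfolding symp_def by (metis minus_diff_eq Ints_minus)
  show "transp (\<lambda>x y :: real ^ 'n. \<forall>i. x $ i - y $ i \<in> \<int>)"
    unfolding transp_def
  proof (intro allI impI)
    fix x y z :: "real ^ 'n" and i
    assume "\<forall>i. x $ i - y $ i \<in> \<int>" "\<forall>i. y $ i - z $ i \<in> \<int>"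
    then have "(x $ i - y $ i) + (y $ i - z $ i) \<in> \<int>"
      by (intro Ints_add) auto
    then show "x $ i - z $ i \<in> \<int>"
      by simp
  qed
qed

definition int_lattice :: "(real ^ 'n::finite) set" where
  "int_lattice = {k. \<forall>i. k $ i \<in> \<int>}"

lemma to_torus_eq_iff: "to_torus x = to_torus y \<longleftrightarrow> x - y \<in> int_lattice"
  by (simp add: torus.abs_eq_iff int_lattice_def)

lemma to_torus_rep [simp]: "to_torus (rep_torus q) = q"
  by (rule Quotient_abs_rep[OF Quotient_torus])

lemma int_lattice_0 [simp]: "0 \<in> int_lattice"
  by (simp add: int_lattice_def)

lemma int_lattice_add: "x \<in> int_lattice \<Longrightarrow> y \<in> int_lattice \<Longrightarrow> x + y \<in> int_lattice"
  by (simp add: int_lattice_def)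

lemma int_lattice_minus: "x \<in> int_lattice \<Longrightarrow> - x \<in> int_lattice"
  by (simp add: int_lattice_def)

lemma closed_int_lattice: "closed (int_lattice :: (real ^ 'n::finite) set)"
proof -
  have eq: "int_lattice = (\<Inter>i. (\<lambda>x :: real ^ 'n. x $ i) -` \<int>)"
    by (auto simp: int_lattice_def)
  show ?thesis
    unfolding eq by (intro closed_INT ballI closed_vimage closed_Ints continuous_intros)
qed

lemma infdist_int_latticeE:
  fixes x :: "real ^ 'n::finite"
  obtains k where "k \<in> int_lattice" "infdist x int_lattice = norm (x - k)"
  using infdist_attains_inf[OF closed_int_lattice, of x] int_lattice_0
  by (metis dist_norm empty_iff)

lemma infdist_int_lattice_le: "k \<in> int_lattice \<Longrightarrow> infdist x int_lattice \<le> norm (x - k)"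
  by (metis infdist_le dist_norm)

lemma infdist_int_lattice_cong:
  assumes "x - y \<in> int_lattice"
  shows "infdist x int_lattice = infdist y int_lattice"
proof -
  have "infdist x int_lattice \<le> infdist y int_lattice" if "x - y \<in> int_lattice" for x y :: "real ^ 'n"
  proof -
    obtain k where k: "k \<in> int_lattice" "infdist y int_lattice = norm (y - k)"
      by (rule infdist_int_latticeE)
    have "infdist x int_lattice \<le> norm (x - (x - y + k))"
      by (intro infdist_int_lattice_le int_lattice_add that k)
    then show ?thesis
      using k by simp
  qed
  then show ?thesis
    using assms int_lattice_minus[OF assms] by (metis minus_diff_eq order_antisym)
qed

text \<open>The flat metric: the distance of two points is the least Euclidean distance of
  representatives.\<close>

instantiation torus :: (finite) metric_space
begin

definition dist_torus :: "'a torus \<Rightarrow> 'a torus \<Rightarrow> real" where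
  "dist_torus p q = infdist (rep_torus p - rep_torus q) int_lattice"

definition uniformity_torus :: "('a torus \<times> 'a torus) filter" where
  "uniformity_torus = (INF e\<in>{0<..}. principal {(x, y). dist x y < e})"

definition open_torus :: "'a torus set \<Rightarrow> bool" where
  "open_torus U \<longleftrightarrow> (\<forall>x\<in>U. \<forall>\<^sub>F (x', y) in uniformity. x' = x \<longrightarrow> y \<in> U)"

instance
proof
  show "uniformity = (INF e\<in>{0<..}. principal {(x::'a torus, y). dist x y < e})"
    by (rule uniformity_torus_def)
  show "open U \<longleftrightarrow> (\<forall>x\<in>U. \<forall>\<^sub>F (x', y) in uniformity. x' = x \<longrightarrow> y \<in> U)" for U :: "'a torus set"
    by (rule open_torus_def)
  show "dist x y = 0 \<longleftrightarrow> x = y" for x y :: "'a torus"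
  proof -
    have "dist x y = 0 \<longleftrightarrow> rep_torus x - rep_torus y \<in> int_lattice"
      unfolding dist_torus_def
      using in_closed_iff_infdist_zero[OF closed_int_lattice] int_lattice_0 by blast
    also have "\<dots> \<longleftrightarrow> x = y"
      by (metis to_torus_eq_iff to_torus_rep)
    finally show ?thesis .
  qed
  show "dist x y \<le> dist x z + dist y z" for x y z :: "'a torus"
  proof -
    obtain k where k: "k \<in> int_lattice" "dist x z = norm (rep_torus x - rep_torus z - k)"
      unfolding dist_torus_def by (rule infdist_int_latticeE)
    obtain l where l: "l \<in> int_lattice" "dist y z = norm (rep_torus y - rep_torus z - l)"
      unfolding dist_torus_def by (rule infdist_int_latticeE)
    have "dist x y \<le> norm (rep_torus x - rep_torus y - (k + - l))"
      unfolding dist_torus_def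
      by (intro infdist_int_lattice_le int_lattice_add int_lattice_minus k l)
    also have "\<dots> = norm ((rep_torus x - rep_torus z - k) - (rep_torus y - rep_torus z - l))"
      by (simp add: algebra_simps)
    also have "\<dots> \<le> dist x z + dist y z"
      unfolding k l by (rule norm_triangle_ineq4)
    finally show ?thesis .
  qed
qed

end

lemma rep_to_torus: "rep_torus (to_torus x) - x \<in> int_lattice"
  by (metis to_torus_eq_iff to_torus_rep)

lemma dist_to_torus: "dist (to_torus x) (to_torus y) = infdist (x - y) int_lattice"
  unfolding dist_torus_def
proof (rule infdist_int_lattice_cong)
  have "(rep_torus (to_torus x) - x) + - (rep_torus (to_torus y) - y) \<in> int_lattice"
    by (intro int_lattice_add int_lattice_minus rep_to_torus)
  then show "rep_torus (to_torus x) - rep_torus (to_torus y) - (x - y) \<in> int_lattice"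
    by (simp add: algebra_simps)
qed

text \<open>The metric topology is the quotient topology.\<close>

lemma open_torus_iff:
  fixes U :: "'a::finite torus set"
  shows "open U \<longleftrightarrow> open (to_torus -` U)"
proof
  assume "open U"
  have "dist (to_torus x) (to_torus y) \<le> dist x y" for x y :: "real ^ 'a"
    using infdist_int_lattice_le[OF int_lattice_0, of "x - y"] by (simp add: dist_to_torus dist_norm)
  then have "continuous_on UNIV (to_torus :: real ^ 'a \<Rightarrow> 'a torus)"
    unfolding continuous_on_iff by (meson le_less_trans)
  with \<open>open U\<close> show "open (to_torus -` U)"
    by (simp add: open_vimage)
next
  assume op: "open (to_torus -` U)"
  show "open U"
    unfolding open_dist
  proof
    fix q assume "q \<in> U"
    then have "rep_torus q \<in> to_torus -` U"
      by simp
    then have "\<exists>e>0. \<forall>y. dist y (rep_torus q) < e \<longrightarrow> y \<in> to_torus -` U"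
      using op unfolding open_dist by blast
    then obtain e where e: "e > 0" "\<And>y. dist y (rep_torus q) < e \<Longrightarrow> to_torus y \<in> U"
      by auto
    have "p \<in> U" if p: "dist p q < e" for p
    proof -
      obtain k where k: "k \<in> int_lattice" "dist p q = norm (rep_torus p - rep_torus q - k)"
        unfolding dist_torus_def by (rule infdist_int_latticeE)
      have "to_torus (rep_torus p - k) \<in> U"
        using k p by (intro e) (simp add: dist_norm algebra_simps)
      moreover have "to_torus (rep_torus p - k) = p"
        using to_torus_eq_iff[of "rep_torus p - k" "rep_torus p"] int_lattice_minus[OF k(1)] by simp
      ultimately show ?thesis
        by simp
    qed
    with e show "\<exists>e>0. \<forall>y. dist y q < e \<longrightarrow> y \<in> U"
      by blast
  qed
qed

text \<open>Functions on the torus are differentiated through their periodic lift.\<close>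

definition torus_grad :: "('n::finite torus \<Rightarrow> real) \<Rightarrow> 'n torus \<Rightarrow> real ^ 'n" where
  "torus_grad V q = (THE D. \<forall>x. to_torus x = q \<longrightarrow> (GDERIV (\<lambda>y. V (to_torus y)) x :> D))"

definition C1_torus :: "('n::finite torus \<Rightarrow> real) \<Rightarrow> bool" where
  "C1_torus V \<longleftrightarrow>
     (\<forall>x. (\<lambda>y. V (to_torus y)) differentiable (at x)) \<and> continuous_on UNIV (torus_grad V)"

lemma torus_grad_eq:
  assumes "GDERIV (\<lambda>y. V (to_torus y)) x :> D"
  shows "torus_grad V (to_torus x) = D"
  unfolding torus_grad_def
proof (rule the_equality)
  show "\<forall>z. to_torus z = to_torus x \<longrightarrow> (GDERIV (\<lambda>y. V (to_torus y)) z :> D)"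
  proof (intro allI impI)
    fix z assume "to_torus z = to_torus x"
    then have k: "x - z \<in> int_lattice"
      using to_torus_eq_iff[of x z] by simp
    have per: "V (to_torus (y + (x - z))) = V (to_torus y)" for y
      using k to_torus_eq_iff[of "y + (x - z)" y] by simp
    have shift: "((\<lambda>y. y + (x - z)) has_derivative (\<lambda>h. h)) (at z)"
      by (auto intro!: derivative_eq_intros)
    have "((\<lambda>y. V (to_torus y)) has_derivative (\<lambda>h. h \<bullet> D)) (at (z + (x - z)))"
      using assms by (simp add: gderiv_def)
    from has_derivative_compose[OF shift this]
    have "((\<lambda>y. V (to_torus (y + (x - z)))) has_derivative (\<lambda>h. h \<bullet> D)) (at z)" .
    then show "GDERIV (\<lambda>y. V (to_torus y)) z :> D"
      by (simp add: gderiv_def per)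
  qed
next
  fix D'
  assume "\<forall>z. to_torus z = to_torus x \<longrightarrow> (GDERIV (\<lambda>y. V (to_torus y)) z :> D')"
  then have "GDERIV (\<lambda>y. V (to_torus y)) x :> D'"
    by blast
  with assms have "(\<lambda>h. h \<bullet> D) = (\<lambda>h. h \<bullet> D')"
    unfolding gderiv_def by (rule has_derivative_unique)
  then have "\<forall>h. h \<bullet> D = h \<bullet> D'"
    by (intro allI) (rule fun_cong)
  then show "D' = D"
    unfolding vector_eq_ldot by (rule sym)
qed

section \<open>Continuous paths with the topology of uniform convergence on compact sets\<close>

text \<open>Paths are functions on \<open>{0..}\<close>; values at negative times are fixed by convention.\<close>

typedef (overloaded) 'a cpath =
  "{f :: real \<Rightarrow> 'a::metric_space. continuous_on {0..} f \<and> (\<forall>t<0. f t = f 0)}"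
  morphisms eval_path Abs_cpath
  by (rule exI[of _ "\<lambda>_. undefined"]) simp

instantiation cpath :: (metric_space) topological_space
begin

definition open_cpath :: "'a cpath set \<Rightarrow> bool" where
  "open_cpath U \<longleftrightarrow>
     (\<forall>f\<in>U. \<exists>K e. compact K \<and> K \<subseteq> {0..} \<and> e > 0 \<and>
        (\<forall>g. (\<forall>t\<in>K. dist (eval_path g t) (eval_path f t) < e) \<longrightarrow> g \<in> U))"

instance
proof
  show "open (UNIV :: 'a cpath set)"
    unfolding open_cpath_def by (auto intro!: exI[of _ "{}"] exI[of _ "1::real"])
next
  fix S T :: "'a cpath set"
  assume S: "open S" and T: "open T"
  show "open (S \<inter> T)"
    unfolding open_cpath_def
  proof
    fix f assume f: "f \<in> S \<inter> T"
    have "\<exists>K e. compact K \<and> K \<subseteq> {0..} \<and> e > 0 \<and>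
        (\<forall>g. (\<forall>t\<in>K. dist (eval_path g t) (eval_path f t) < e) \<longrightarrow> g \<in> S)"
      using f by (intro bspec[OF S[unfolded open_cpath_def]]) simp
    then obtain K e where K: "compact K" "K \<subseteq> {0..}" "e > 0"
        "\<And>g. \<forall>t\<in>K. dist (eval_path g t) (eval_path f t) < e \<Longrightarrow> g \<in> S"
      by (elim exE conjE) (rule that, assumption+, simp)
    have "\<exists>K e. compact K \<and> K \<subseteq> {0..} \<and> e > 0 \<and>
        (\<forall>g. (\<forall>t\<in>K. dist (eval_path g t) (eval_path f t) < e) \<longrightarrow> g \<in> T)"
      using f by (intro bspec[OF T[unfolded open_cpath_def]]) simp
    then obtain L d where L: "compact L" "L \<subseteq> {0..}" "d > 0"
        "\<And>g. \<forall>t\<in>L. dist (eval_path g t) (eval_path f t) < d \<Longrightarrow> g \<in> T"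
      by (elim exE conjE) (rule that, assumption+, simp)
    show "\<exists>K e. compact K \<and> K \<subseteq> {0..} \<and> e > 0 \<and>
        (\<forall>g. (\<forall>t\<in>K. dist (eval_path g t) (eval_path f t) < e) \<longrightarrow> g \<in> S \<inter> T)"
    proof (intro exI[of _ "K \<union> L"] exI[of _ "min e d"] conjI allI impI)
      show "compact (K \<union> L)" "K \<union> L \<subseteq> {0..}" "min e d > 0"
        using K(1-3) L(1-3) by auto
      fix g assume "\<forall>t\<in>K \<union> L. dist (eval_path g t) (eval_path f t) < min e d"
      then show "g \<in> S \<inter> T"
        by (intro IntI K(4) L(4)) auto
    qed
  qed
next
  fix \<U> :: "'a cpath set set"
  assume op: "\<forall>U\<in>\<U>. open U"
  show "open (\<Union>\<U>)"
    unfolding open_cpath_def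
  proof
    fix f assume "f \<in> \<Union>\<U>"
    then obtain U where U: "U \<in> \<U>" "f \<in> U"
      by blast
    then have "\<exists>K e. compact K \<and> K \<subseteq> {0..} \<and> e > 0 \<and>
        (\<forall>g. (\<forall>t\<in>K. dist (eval_path g t) (eval_path f t) < e) \<longrightarrow> g \<in> U)"
      by (intro bspec[OF op[rule_format, unfolded open_cpath_def]])
    with U(1) show "\<exists>K e. compact K \<and> K \<subseteq> {0..} \<and> e > 0 \<and>
        (\<forall>g. (\<forall>t\<in>K. dist (eval_path g t) (eval_path f t) < e) \<longrightarrow> g \<in> \<Union>\<U>)"
      by (elim ex_forward conj_forward all_forward imp_forward) auto
  qed
qed

end

lemma tendsto_cpath_iff:
  fixes f :: "'i \<Rightarrow> 'a::metric_space cpath"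
  shows "(f \<longlongrightarrow> l) F \<longleftrightarrow>
    (\<forall>K. compact K \<and> K \<subseteq> {0..} \<longrightarrow> uniform_limit K (\<lambda>i. eval_path (f i)) (eval_path l) F)"
proof safe
  fix K :: "real set"
  assume lim: "(f \<longlongrightarrow> l) F" and K: "compact K" "K \<subseteq> {0..}"
  show "uniform_limit K (\<lambda>i. eval_path (f i)) (eval_path l) F"
  proof (rule uniform_limitI)
    fix e :: real assume "e > 0"
    let ?U = "{g. \<forall>t\<in>K. dist (eval_path g t) (eval_path l t) < e}"
    have "open ?U"
      unfolding open_cpath_def
    proof
      fix g assume g: "g \<in> ?U"
      have "continuous_on K (\<lambda>t. dist (eval_path g t) (eval_path l t))"
        using eval_path[of g] eval_path[of l]
        by (intro continuous_on_dist continuous_on_subset[OF _ K(2)]) simp_all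
      obtain d where d: "d > 0" "\<And>t. t \<in> K \<Longrightarrow> dist (eval_path g t) (eval_path l t) + d \<le> e"
      proof (cases "K = {}")
        case False
        then obtain s where s: "s \<in> K" "\<And>t. t \<in> K \<Longrightarrow>
            dist (eval_path g t) (eval_path l t) \<le> dist (eval_path g s) (eval_path l s)"
          using continuous_attains_sup[OF K(1) False
              \<open>continuous_on K (\<lambda>t. dist (eval_path g t) (eval_path l t))\<close>] by blast
        with g show thesis
          by (intro that[of "e - dist (eval_path g s) (eval_path l s)"]) auto
      qed (auto intro: that[of 1])
      have "h \<in> ?U" if h: "\<forall>t\<in>K. dist (eval_path h t) (eval_path g t) < d" for h
      proof safe
        fix t assume "t \<in> K"
        then show "dist (eval_path h t) (eval_path l t) < e"
          using d(2)[of t] h dist_triangle[of "eval_path h t" "eval_path l t" "eval_path g t"] by fastforce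
      qed
      with d(1) K show "\<exists>L d. compact L \<and> L \<subseteq> {0..} \<and> d > 0 \<and>
          (\<forall>h. (\<forall>t\<in>L. dist (eval_path h t) (eval_path g t) < d) \<longrightarrow> h \<in> ?U)"
        by (intro exI[of _ K] exI[of _ d] conjI allI impI) assumption+
    qed
    then have "\<forall>\<^sub>F i in F. f i \<in> ?U"
      using lim \<open>e > 0\<close> by (intro topological_tendstoD) auto
    then show "\<forall>\<^sub>F i in F. \<forall>t\<in>K. dist (eval_path (f i) t) (eval_path l t) < e"
      by simp
  qed
next
  assume R: "\<forall>K. compact K \<and> K \<subseteq> {0..} \<longrightarrow> uniform_limit K (\<lambda>i. eval_path (f i)) (eval_path l) F"
  show "(f \<longlongrightarrow> l) F"
  proof (rule topological_tendstoI)
    fix U assume "open U" "l \<in> U"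
    have "\<exists>K e. compact K \<and> K \<subseteq> {0..} \<and> e > 0 \<and>
        (\<forall>g. (\<forall>t\<in>K. dist (eval_path g t) (eval_path l t) < e) \<longrightarrow> g \<in> U)"
      using \<open>l \<in> U\<close> by (intro bspec[OF \<open>open U\<close>[unfolded open_cpath_def]])
    then obtain K e where K: "compact K" "K \<subseteq> {0..}" "e > 0"
        "\<And>g. \<forall>t\<in>K. dist (eval_path g t) (eval_path l t) < e \<Longrightarrow> g \<in> U"
      by (elim exE conjE) (rule that, assumption+, simp)
    have "\<forall>\<^sub>F i in F. \<forall>t\<in>K. dist (eval_path (f i) t) (eval_path l t) < e"
      using R K by (intro uniform_limitD) auto
    then show "\<forall>\<^sub>F i in F. f i \<in> U"
      by (rule eventually_mono) (rule K(4))
  qed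
qed

definition path_of :: "(real \<Rightarrow> 'a) \<Rightarrow> 'a::metric_space cpath" where
  "path_of f = Abs_cpath (\<lambda>t. f (max 0 t))"

lemma eval_path_of:
  assumes "continuous_on {0..} f" "t \<ge> 0"
  shows "eval_path (path_of f) t = f t"
proof -
  have "continuous_on {0..} (\<lambda>t. f (max 0 t))"
    by (rule continuous_on_compose2[OF assms(1)]) (auto intro!: continuous_intros)
  then have "eval_path (path_of f) = (\<lambda>t. f (max 0 t))"
    unfolding path_of_def by (intro Abs_cpath_inverse) auto
  with assms(2) show ?thesis
    by simp
qed

text \<open>The map from outcomes to paths is measurable, so \<open>path_law\<close> below is a genuine image
  measure.\<close>

instance torus :: (finite) second_countable_topology
proof
  obtain B :: "(real ^ 'a) set set" where B: "countable B" "topological_basis B"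
    using ex_countable_basis by blast
  have op: "open (to_torus ` C)" if "open C" for C :: "(real ^ 'a) set"
  proof -
    have "to_torus -` to_torus ` C = (\<Union>k\<in>int_lattice. (+) k ` C)"
    proof (intro equalityI subsetI)
      fix x assume "x \<in> to_torus -` to_torus ` C"
      then obtain y where "y \<in> C" "x - y \<in> int_lattice"
        using to_torus_eq_iff by blast
      then show "x \<in> (\<Union>k\<in>int_lattice. (+) k ` C)"
        by (intro UN_I[of "x - y"] image_eqI[of _ _ y]) auto
    next
      fix x assume "x \<in> (\<Union>k\<in>int_lattice. (+) k ` C)"
      then obtain k y where "k \<in> int_lattice" "y \<in> C" "x = k + y"
        by blast
      then show "x \<in> to_torus -` to_torus ` C"
        using to_torus_eq_iff[of x y] by auto
    qed
    then show ?thesis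
      using that by (auto simp: open_torus_iff intro!: open_translation)
  qed
  show "\<exists>B :: 'a torus set set. countable B \<and> open = generate_topology B"
  proof (intro exI conjI)
    show "countable ((`) to_torus ` B)"
      using B(1) by simp
    have "topological_basis ((`) to_torus ` B)"
    proof (rule topological_basisI)
      show "open C" if "C \<in> (`) to_torus ` B" for C
        using that op topological_basis_open[OF B(2)] by blast
      fix S and q :: "'a torus"
      assume "open S" "q \<in> S"
      then have "open (to_torus -` S)" "rep_torus q \<in> to_torus -` S"
        by (simp_all add: open_torus_iff[symmetric])
      then obtain C where C: "C \<in> B" "rep_torus q \<in> C" "C \<subseteq> to_torus -` S"
        by (rule topological_basisE[OF B(2)])
      from C(2) have "to_torus (rep_torus q) \<in> to_torus ` C"
        by (rule imageI)
      with C(1,3) show "\<exists>C\<in>(`) to_torus ` B. q \<in> C \<and> C \<subseteq> S"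
        by (intro bexI[of _ "to_torus ` C"]) auto
    qed
    then show "open = generate_topology ((`) to_torus ` B)"
      by (rule topological_basis_imp_subbasis)
  qed
qed

lemma borel_measurable_path_of:
  fixes X :: "real \<Rightarrow> 'w \<Rightarrow> 'a::{metric_space, second_countable_topology}"
  assumes cont: "\<And>\<omega>. \<omega> \<in> space M \<Longrightarrow> continuous_on {0..} (\<lambda>t. X t \<omega>)"
    and meas: "\<And>t. t \<ge> 0 \<Longrightarrow> X t \<in> borel_measurable M"
  shows "(\<lambda>\<omega>. path_of (\<lambda>t. X t \<omega>)) \<in> borel_measurable M"
proof (rule borel_measurableI)
  fix U :: "'a cpath set" assume "open U"
  obtain D :: "'a set" where D: "countable D" "\<And>S. open S \<Longrightarrow> S \<noteq> {} \<Longrightarrow> \<exists>d\<in>D. d \<in> S"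
    using countable_dense_setE by blast
  define I where "I n i = {real i / real (Suc n) .. real (Suc i) / real (Suc n)}" for n i :: nat
  define A where "A = (\<lambda>(n, m, qs). {g :: 'a cpath.
      \<forall>i\<in>{..<length qs}. \<forall>t\<in>I n i. dist (eval_path g t) (qs ! i) \<le> 1 / real (Suc m)})"
  define J where "J = (UNIV :: nat set) \<times> (UNIV :: nat set) \<times> lists D"
  have "\<exists>j\<in>J. f \<in> A j \<and> A j \<subseteq> U" if "f \<in> U" for f
  proof -
    have "\<exists>K e. compact K \<and> K \<subseteq> {0..} \<and> e > 0 \<and>
        (\<forall>g. (\<forall>t\<in>K. dist (eval_path g t) (eval_path f t) < e) \<longrightarrow> g \<in> U)"
      using that by (intro bspec[OF \<open>open U\<close>[unfolded open_cpath_def]])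
    then obtain K e where K: "compact K" "K \<subseteq> {0..}" "e > 0"
        and KU: "\<And>g. \<forall>t\<in>K. dist (eval_path g t) (eval_path f t) < e \<Longrightarrow> g \<in> U"
      by (elim exE conjE) (rule that, assumption+, simp)
    obtain b where b: "\<And>t. t \<in> K \<Longrightarrow> norm t \<le> b"
      using compact_imp_bounded[OF K(1)] unfolding bounded_iff by blast
    obtain N :: nat where "b < real N"
      using reals_Archimedean2 by blast
    have N: "t < real N" if "t \<in> K" for t
      using b[OF that] \<open>b < real N\<close> by simp
    obtain m :: nat where m: "1 / real (Suc m) < e / 2"
      using nat_approx_posE[of "e / 2"] K(3) by auto
    have "continuous_on {0..real N} (eval_path f)"
      using eval_path[of f] by (intro continuous_on_subset[of "{0..}" _ "{0..real N}"]) simp_all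
    then have "uniformly_continuous_on {0..real N} (eval_path f)"
      by (rule compact_uniformly_continuous) simp
    moreover have "1 / real (Suc m) / 2 > 0"
      by simp
    ultimately have "\<exists>d>0. \<forall>s\<in>{0..real N}. \<forall>t\<in>{0..real N}. dist t s < d \<longrightarrow>
        dist (eval_path f t) (eval_path f s) < 1 / real (Suc m) / 2"
      unfolding uniformly_continuous_on_def by blast
    then obtain d where d: "d > 0" "\<And>s t. s \<in> {0..real N} \<Longrightarrow> t \<in> {0..real N} \<Longrightarrow> dist t s < d \<Longrightarrow>
        dist (eval_path f t) (eval_path f s) < 1 / real (Suc m) / 2"
      by (elim exE conjE) (rule that, assumption, simp)
    obtain n :: nat where n: "1 / real (Suc n) < d"
      using nat_approx_posE[of d] d(1) by auto
    have "\<exists>q\<in>D. q \<in> ball (eval_path f (real i / real (Suc n))) (1 / real (Suc m) / 2)" for i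
      by (rule D(2)) simp_all
    then obtain q where q: "\<And>i. q i \<in> D"
        "\<And>i. dist (eval_path f (real i / real (Suc n))) (q i) < 1 / real (Suc m) / 2"
      unfolding mem_ball by metis
    define qs where "qs = map q [0..<N * Suc n]"
    have len: "length qs = N * Suc n" and nth: "\<And>i. i < N * Suc n \<Longrightarrow> qs ! i = q i"
      by (simp_all add: qs_def)
    have "f \<in> A (n, m, qs)"
      unfolding A_def prod.case len
    proof (intro CollectI ballI)
      fix i t assume i: "i \<in> {..<N * Suc n}" and t: "t \<in> I n i"
      have "real (Suc i) \<le> real (N * Suc n)"
        using i by (intro of_nat_mono) simp
      then have "real (Suc i) / real (Suc n) \<le> real N"
        by (simp only: divide_le_eq of_nat_mult) simp
      moreover have "real i / real (Suc n) \<ge> 0"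
        by simp
      ultimately have "t \<in> {0..real N}" "real i / real (Suc n) \<in> {0..real N}"
        using t unfolding I_def atLeastAtMost_iff by linarith+
      moreover have "dist t (real i / real (Suc n)) < d"
        using t n by (simp add: I_def dist_real_def add_divide_distrib)
      ultimately have "dist (eval_path f t) (eval_path f (real i / real (Suc n))) < 1 / real (Suc m) / 2"
        by (intro d(2))
      with q(2)[of i] dist_triangle[of "eval_path f t" "q i" "eval_path f (real i / real (Suc n))"]
      have "dist (eval_path f t) (q i) \<le> 1 / real (Suc m)"
        by linarith
      with i show "dist (eval_path f t) (qs ! i) \<le> 1 / real (Suc m)"
        by (simp add: nth)
    qed
    moreover have "A (n, m, qs) \<subseteq> U"
    proof
      fix g assume g: "g \<in> A (n, m, qs)"
      show "g \<in> U"
      proof (intro KU ballI)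
        fix t assume t: "t \<in> K"
        then have "t \<ge> 0" "t < real N"
          using K(2) N by auto
        define i where "i = nat \<lfloor>t * real (Suc n)\<rfloor>"
        have i: "real i \<le> t * real (Suc n)" "t * real (Suc n) < real (Suc i)"
          using \<open>t \<ge> 0\<close> unfolding i_def by (simp_all add: algebra_simps) linarith
        then have "t \<in> I n i"
          unfolding I_def by (simp add: divide_le_eq le_divide_eq del: of_nat_Suc)
        moreover have "real i < real (N * Suc n)"
          using i(1) mult_strict_right_mono[OF \<open>t < real N\<close>, of "real (Suc n)"]
          unfolding of_nat_mult by (rule le_less_trans) simp
        then have "i < length qs"
          by (simp only: len of_nat_less_iff)
        ultimately have "dist (eval_path h t) (qs ! i) \<le> 1 / real (Suc m)" if "h \<in> A (n, m, qs)" for h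
          using that by (auto simp: A_def)
        from this[OF g] this[OF \<open>f \<in> A (n, m, qs)\<close>] m
        show "dist (eval_path g t) (eval_path f t) < e"
          using dist_triangle2[of "eval_path g t" "eval_path f t" "qs ! i"] by linarith
      qed
    qed
    moreover have "(n, m, qs) \<in> J"
      using q(1) by (auto simp: J_def qs_def)
    ultimately show ?thesis
      by blast
  qed
  then have U: "U = (\<Union>j\<in>{j \<in> J. A j \<subseteq> U}. A j)"
    by blast
  have "countable J"
    unfolding J_def using D(1) by auto
  have "{\<omega> \<in> space M. path_of (\<lambda>t. X t \<omega>) \<in> A j} \<in> sets M" for j
  proof -
    obtain n m qs where j: "j = (n, m, qs)"
      by (cases j)
    define I' where "I' i = {real i / real (Suc n) <..< real (Suc i) / real (Suc n)}" for i
    have I': "closure (I' i \<inter> \<rat>) = I n i" and I_pos: "I n i \<subseteq> {0..}" for i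
    proof -
      have "closure (I' i \<inter> \<rat>) = closure (I' i)"
        by (rule closure_open_Int_superset) (simp_all add: I'_def Rats_closure_real)
      then show "closure (I' i \<inter> \<rat>) = I n i"
        by (simp add: I'_def I_def divide_strict_right_mono)
      have "0 \<le> real i / real (Suc n)"
        by simp
      then show "I n i \<subseteq> {0..}"
        unfolding I_def by (meson atLeastAtMost_iff atLeast_iff order_trans subsetI)
    qed
    have I'_pos: "t \<ge> 0" if "t \<in> I' i \<inter> \<rat>" for t i
      using that closure_subset[of "I' i \<inter> \<rat>"] I'[of i] I_pos[of i] by fastforce
    have "path_of (\<lambda>t. X t \<omega>) \<in> A j \<longleftrightarrow>
        (\<forall>i\<in>{..<length qs}. \<forall>t\<in>I' i \<inter> \<rat>. dist (X t \<omega>) (qs ! i) \<le> 1 / real (Suc m))"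
      if \<omega>: "\<omega> \<in> space M" for \<omega>
    proof -
      have "(\<forall>t\<in>I n i. dist (eval_path (path_of (\<lambda>t. X t \<omega>)) t) y \<le> c) \<longleftrightarrow>
          (\<forall>t\<in>I' i \<inter> \<rat>. dist (X t \<omega>) y \<le> c)" for i y c
      proof -
        have "(\<forall>t\<in>I n i. dist (eval_path (path_of (\<lambda>t. X t \<omega>)) t) y \<le> c) \<longleftrightarrow>
            (\<forall>t\<in>I n i. dist (X t \<omega>) y \<le> c)"
          using I_pos[of i] by (intro ball_cong refl) (subst eval_path_of[OF cont[OF \<omega>]], auto)
        also have "\<dots> \<longleftrightarrow> (\<forall>t\<in>I' i \<inter> \<rat>. dist (X t \<omega>) y \<le> c)"
        proof
          assume "\<forall>t\<in>I n i. dist (X t \<omega>) y \<le> c"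
          then show "\<forall>t\<in>I' i \<inter> \<rat>. dist (X t \<omega>) y \<le> c"
            using closure_subset[of "I' i \<inter> \<rat>"] I'[of i] by auto
        next
          assume *: "\<forall>t\<in>I' i \<inter> \<rat>. dist (X t \<omega>) y \<le> c"
          show "\<forall>t\<in>I n i. dist (X t \<omega>) y \<le> c"
          proof
            fix t assume "t \<in> I n i"
            then have "t \<in> closure (I' i \<inter> \<rat>)"
              by (simp add: I')
            have "continuous_on (closure (I' i \<inter> \<rat>)) (\<lambda>t. dist (X t \<omega>) y)"
              unfolding I' using continuous_on_subset[OF cont[OF \<omega>] I_pos]
              by (intro continuous_on_dist continuous_on_const)
            from continuous_le_on_closure[OF this \<open>t \<in> closure (I' i \<inter> \<rat>)\<close>]
            show "dist (X t \<omega>) y \<le> c"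
              using * by blast
          qed
        qed
        finally show ?thesis .
      qed
      then show ?thesis
        by (simp only: j A_def prod.case mem_Collect_eq)
    qed
    then have "{\<omega> \<in> space M. path_of (\<lambda>t. X t \<omega>) \<in> A j} = {\<omega> \<in> space M.
        \<forall>i\<in>{..<length qs}. \<forall>t\<in>I' i \<inter> \<rat>. dist (X t \<omega>) (qs ! i) \<le> 1 / real (Suc m)}"
      by blast
    also have "\<dots> \<in> sets M"
    proof (intro sets.sets_Collect_countable_All')
      fix i t assume "i \<in> {..<length qs}" "t \<in> I' i \<inter> \<rat>"
      then have [measurable]: "X t \<in> borel_measurable M"
        by (intro meas I'_pos[of t i])
      show "{\<omega> \<in> space M. dist (X t \<omega>) (qs ! i) \<le> 1 / real (Suc m)} \<in> sets M"
        by measurable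
    qed (simp_all add: countable_rat countable_Int2)
    finally show ?thesis .
  qed
  then have "(\<Union>j\<in>{j \<in> J. A j \<subseteq> U}. {\<omega> \<in> space M. path_of (\<lambda>t. X t \<omega>) \<in> A j}) \<in> sets M"
    using \<open>countable J\<close> by (intro sets.countable_UN'') auto
  also have "(\<Union>j\<in>{j \<in> J. A j \<subseteq> U}. {\<omega> \<in> space M. path_of (\<lambda>t. X t \<omega>) \<in> A j}) =
      (\<lambda>\<omega>. path_of (\<lambda>t. X t \<omega>)) -` U \<inter> space M"
    by (subst (2) U) blast
  finally show "(\<lambda>\<omega>. path_of (\<lambda>t. X t \<omega>)) -` U \<inter> space M \<in> sets M" .
qed

definition path_law :: "'w measure \<Rightarrow> (real \<Rightarrow> 'w \<Rightarrow> 'a::metric_space) \<Rightarrow> 'a cpath measure" where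
  "path_law M X = distr M borel (\<lambda>\<omega>. path_of (\<lambda>t. X t \<omega>))"

definition weakly_converges ::
  "('i \<Rightarrow> 'a::topological_space measure) \<Rightarrow> 'a measure \<Rightarrow> 'i filter \<Rightarrow> bool" where
  "weakly_converges \<mu> \<nu> F \<longleftrightarrow>
     (\<forall>f :: 'a \<Rightarrow> real. continuous_on UNIV f \<and> bounded (range f) \<longrightarrow>
        ((\<lambda>i. \<integral>x. f x \<partial>\<mu> i) \<longlongrightarrow> (\<integral>x. f x \<partial>\<nu>)) F)"

section \<open>Weak solutions\<close>

text \<open>Only times \<open>t \<ge> 0\<close> matter; the library locale indexes a filtration by the whole type, and a
  filtration on \<open>{0..}\<close> extends to negative times by its value at 0.\<close>

definition filtered_prob_space :: "'w measure \<Rightarrow> (real \<Rightarrow> 'w measure) \<Rightarrow> bool" where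
  "filtered_prob_space M F \<longleftrightarrow>
     prob_space M \<and> filtration (space M) F \<and> (\<forall>t. subalgebra M (F t))"

definition adapted :: "(real \<Rightarrow> 'w measure) \<Rightarrow> (real \<Rightarrow> 'w \<Rightarrow> 'a::topological_space) \<Rightarrow> bool" where
  "adapted F X \<longleftrightarrow> (\<forall>t\<ge>0. X t \<in> borel_measurable (F t))"

definition brownian_motion ::
  "'w measure \<Rightarrow> (real \<Rightarrow> 'w measure) \<Rightarrow> (real \<Rightarrow> 'w \<Rightarrow> 'b::euclidean_space) \<Rightarrow> bool" where
  "brownian_motion M F W \<longleftrightarrow>
     adapted F W \<and>
     (AE \<omega> in M. W 0 \<omega> = 0) \<and>
     (AE \<omega> in M. continuous_on {0..} (\<lambda>t. W t \<omega>)) \<and>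
     (\<forall>s t. 0 \<le> s \<and> s < t \<longrightarrow>
        distributed M lborel (\<lambda>\<omega>. W t \<omega> - W s \<omega>)
          (\<lambda>x. ennreal (\<Prod>b\<in>Basis. normal_density 0 (sqrt (t - s)) (x \<bullet> b))) \<and>
        prob_space.indep_set M (sets (F s))
          (sets (vimage_algebra (space M) (\<lambda>\<omega>. W t \<omega> - W s \<omega>) borel)))"

text \<open>Weak solution \<open>X\<close>, on the probability space \<open>M\<close>, of \<open>dX = b(X) dt + \<sigma> dW\<close> with a constant
  linear map \<open>\<sigma>\<close>. The Ito integral of the constant integrand \<open>\<sigma>\<close> over \<open>[0, t]\<close> is
  \<open>\<sigma> (W t - W 0)\<close>.\<close>

definition weak_solution ::
  "('a::euclidean_space \<Rightarrow> 'a) \<Rightarrow> ('b::euclidean_space \<Rightarrow> 'a) \<Rightarrow> 'w measure \<Rightarrow> (real \<Rightarrow> 'w \<Rightarrow> 'a) \<Rightarrow> bool" where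
  "weak_solution b \<sigma> M X \<longleftrightarrow>
     (\<forall>\<omega>\<in>space M. continuous_on {0..} (\<lambda>t. X t \<omega>)) \<and>
     (\<exists>F W. filtered_prob_space M F \<and> brownian_motion M F W \<and> adapted F X \<and>
        (AE \<omega> in M. \<forall>t\<ge>0.
           set_integrable lborel {0..t} (\<lambda>s. b (X s \<omega>)) \<and>
           X t \<omega> = X 0 \<omega> + (LINT s:{0..t}|lborel. b (X s \<omega>)) + \<sigma> (W t \<omega> - W 0 \<omega>)))"

text \<open>SDEs on the torus: solve with periodically extended coefficients, then project the position.\<close>

definition langevin_solution ::
  "real \<Rightarrow> ('n::finite torus \<Rightarrow> real) \<Rightarrow> real \<Rightarrow> 'w measure
     \<Rightarrow> (real \<Rightarrow> 'w \<Rightarrow> 'n torus) \<Rightarrow> (real \<Rightarrow> 'w \<Rightarrow> real ^ 'n) \<Rightarrow> bool" where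
  "langevin_solution \<beta> V \<epsilon> M Q P \<longleftrightarrow>
     (\<exists>X. weak_solution
            (\<lambda>(x, p). ((1 / \<epsilon>) *\<^sub>R p,
                       - (1 / \<epsilon>) *\<^sub>R torus_grad V (to_torus x) - (1 / \<epsilon>\<^sup>2) *\<^sub>R p))
            (\<lambda>w :: real ^ 'n. (0, (1 / \<epsilon> * sqrt (2 * inverse \<beta>)) *\<^sub>R w))
            M (\<lambda>t \<omega>. (X t \<omega>, P t \<omega>)) \<and>
          (\<forall>t\<ge>0. \<forall>\<omega>\<in>space M. Q t \<omega> = to_torus (X t \<omega>)))"

definition overdamped_solution ::
  "real \<Rightarrow> ('n::finite torus \<Rightarrow> real) \<Rightarrow> 'w measure \<Rightarrow> (real \<Rightarrow> 'w \<Rightarrow> 'n torus) \<Rightarrow> bool" where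
  "overdamped_solution \<beta> V M Q \<longleftrightarrow>
     (\<exists>X. weak_solution
            (\<lambda>x. - torus_grad V (to_torus x))
            (\<lambda>w :: real ^ 'n. sqrt (2 * inverse \<beta>) *\<^sub>R w)
            M X \<and>
          (\<forall>t\<ge>0. \<forall>\<omega>\<in>space M. Q t \<omega> = to_torus (X t \<omega>)))"

end

theory Submission
  imports Defs
begin

text \<open>The corrected position \<open>A\<^sub>t = X\<^sub>t + \<epsilon> (P\<^sub>t - P\<^sub>0)\<close>, where \<open>X\<close> is a lift of \<open>Q\<close>, satisfies
  \<open>dA = - \<nabla>V\<^sub>\<epsilon>(Q) dt + \<sigma> dW\<close> exactly, without any singular term. As \<open>\<epsilon> P\<close> solves a linear equation with
  damping \<open>1 / \<epsilon>\<^sup>2\<close>, it is bounded pathwise by \<open>\<epsilon> |P\<^sub>0|\<close> and the modulus of continuity of \<open>W\<close> on the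
  scale \<open>\<epsilon>\<^sup>2\<close>; hence \<open>Q\<close> and \<open>A\<close> are uniformly close in probability. The paths of \<open>A\<close> differ from those
  of \<open>\<sigma> W\<close> by uniformly Lipschitz paths, so the joint laws of \<open>(A, W)\<close> are tight, and every limit along a
  subsequence is a weak solution of the overdamped equation. Its law is unique although \<open>\<nabla>V\<close> is merely
  continuous: for two solutions with the same cylinder expectations up to time \<open>s\<close>, Duhamel's formula
  for the heat semigroup, whose Lipschitz constant at time \<open>t\<close> is of order \<open>1 / sqrt t\<close>, bounds the difference
  after time \<open>s\<close> by a contraction on short intervals.\<close>

section \<open>Gaussian measures and the heat semigroup\<close>

text \<open>No stochastic integral beyond \<open>\<sigma> (W t - W 0)\<close> occurs: all that is
  used of \<open>W\<close> is the Gaussian law of its increments, their independence of the past and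
  path continuity. This is why limits are taken for pairs of corrected position and noise. On the
  space of pair paths the limiting Brownian motion is simply the second coordinate, and the equation
  says that a continuous functional of the pair vanishes, a property that survives weak limits; no
  martingale problem and no representation theorem is involved.

  Two solutions live on different probability spaces and a merely continuous drift admits no
  Gronwall estimate, so uniqueness compares expectations, not paths. A bounded functional of the
  past is carried along as a weight; it turns a statement on the law at one time into one on all
  finite-dimensional laws. Each Duhamel step uses the drift only inside a test function of the
  current state, so that the unknown difference of expectations bounds itself. These test functions
  are lattice-periodic, because initial laws are prescribed on the torus and not on its
  cover.\<close>

definition gauss :: "real \<Rightarrow> 'a::euclidean_space measure" where
  "gauss t = density lborel (\<lambda>x. ennreal (\<Prod>b\<in>Basis. normal_density 0 (sqrt t) (x \<bullet> b)))"

lemma sets_gauss [simp, measurable_cong]: "sets (gauss t) = sets borel"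
  by (simp add: gauss_def)

lemma space_gauss [simp]: "space (gauss t) = UNIV"
  by (simp add: gauss_def)

lemma prob_space_gauss:
  assumes "t > 0"
  shows "prob_space (gauss t :: 'a::euclidean_space measure)"
proof
  have "emeasure (gauss t :: 'a measure) (space (gauss t)) =
      (\<integral>\<^sup>+x. (\<Prod>b\<in>Basis. ennreal (normal_density 0 (sqrt t) ((x :: 'a) \<bullet> b))) \<partial>lborel)"
    by (simp add: gauss_def emeasure_density prod_ennreal)
  also have "\<dots> = (\<Prod>b\<in>(Basis::'a set). \<integral>\<^sup>+x. ennreal (normal_density 0 (sqrt t) x) \<partial>lborel)"
    by (rule nn_integral_lborel_prod) auto
  also have "(\<integral>\<^sup>+x. ennreal (normal_density 0 (sqrt t) x) \<partial>lborel) = 1"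
    using assms by (subst nn_integral_eq_integral) (auto simp: integrable_normal_density integral_normal_density)
  finally show "emeasure (gauss t :: 'a measure) (space (gauss t)) = 1"
    by simp
qed

text \<open>Finite-dimensional Cameron-Martin formula: expanding the square coordinatewise turns a
  shift of the Gaussian density into an exponential weight.\<close>

lemma gauss_density_shift:
  fixes z h :: "'a::euclidean_space"
  assumes "t > 0"
  shows "(\<Prod>b\<in>Basis. normal_density 0 (sqrt t) ((z - h) \<bullet> b)) =
    (\<Prod>b\<in>Basis. normal_density 0 (sqrt t) (z \<bullet> b)) * exp ((z \<bullet> h - (h \<bullet> h) / 2) / t)"
proof -
  have "normal_density 0 (sqrt t) ((z - h) \<bullet> b) =
      normal_density 0 (sqrt t) (z \<bullet> b) * exp (((z \<bullet> b) * (h \<bullet> b) - (h \<bullet> b) * (h \<bullet> b) / 2) / t)" for b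
    using assms
    by (simp add: normal_density_def exp_add[symmetric] inner_diff_left power2_eq_square field_simps)
  then have "(\<Prod>b\<in>Basis. normal_density 0 (sqrt t) ((z - h) \<bullet> b)) =
      (\<Prod>b\<in>Basis. normal_density 0 (sqrt t) (z \<bullet> b)) *
      exp (\<Sum>b\<in>Basis. ((z \<bullet> b) * (h \<bullet> b) - (h \<bullet> b) * (h \<bullet> b) / 2) / t)"
    by (simp add: prod.distrib exp_sum)
  also have "(\<Sum>b\<in>Basis. ((z \<bullet> b) * (h \<bullet> b) - (h \<bullet> b) * (h \<bullet> b) / 2) / t) = (z \<bullet> h - (h \<bullet> h) / 2) / t"
    by (simp add: euclidean_inner[of z h] euclidean_inner[of h h] sum_subtractf
      sum_divide_distrib[symmetric])
  finally show ?thesis .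
qed

text \<open>Translation invariance of Lebesgue measure moves the shift from \<open>f\<close> to the
  density. The version for nonnegative functions comes first because it yields the integrability of
  the weight in the next lemma.\<close>

lemma nn_integral_gauss_shift:
  fixes f :: "'a::euclidean_space \<Rightarrow> ennreal"
  assumes "t > 0" and [measurable]: "f \<in> borel_measurable borel"
  shows "(\<integral>\<^sup>+z. f (z + h) \<partial>gauss t) = (\<integral>\<^sup>+z. f z * ennreal (exp ((z \<bullet> h - (h \<bullet> h) / 2) / t)) \<partial>gauss t)"
proof -
  let ?g = "\<lambda>z::'a. \<Prod>b\<in>Basis. normal_density 0 (sqrt t) (z \<bullet> b)"
  have g0: "?g z \<ge> 0" for z
    by (intro prod_nonneg) simp
  have "(\<integral>\<^sup>+z. f (z + h) \<partial>gauss t) = (\<integral>\<^sup>+z. ennreal (?g z) * f (z + h) \<partial>lborel)"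
    by (simp add: gauss_def nn_integral_density)
  also have "\<dots> = (\<integral>\<^sup>+z. ennreal (?g (h + z - h)) * f (h + z) \<partial>lborel)"
    by (simp add: add.commute)
  also have "\<dots> = (\<integral>\<^sup>+z. ennreal (?g (z - h)) * f z \<partial>distr lborel borel ((+) h))"
    by (subst nn_integral_distr) auto
  also have "\<dots> = (\<integral>\<^sup>+z. ennreal (?g (z - h)) * f z \<partial>lborel)"
    by (simp only: lborel_distr_plus)
  also have "\<dots> = (\<integral>\<^sup>+z. ennreal (?g z) * (f z * ennreal (exp ((z \<bullet> h - (h \<bullet> h) / 2) / t))) \<partial>lborel)"
    unfolding gauss_density_shift[OF assms(1)] using g0
    by (intro nn_integral_cong) (simp add: ennreal_mult mult_ac)
  also have "\<dots> = (\<integral>\<^sup>+z. f z * ennreal (exp ((z \<bullet> h - (h \<bullet> h) / 2) / t)) \<partial>gauss t)"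
    by (simp add: gauss_def nn_integral_density)
  finally show ?thesis .
qed

text \<open>The shift formula for the constant function 1: the weight is a probability density. Used
  with \<open>h\<close> and with \<open>2 *\<^sub>R h\<close>, it supplies the first two moments in
  \<open>gauss_shift_bound\<close>.\<close>

lemma gauss_exp:
  fixes h :: "'a::euclidean_space"
  assumes "t > 0"
  shows "has_bochner_integral (gauss t) (\<lambda>z. exp ((z \<bullet> h - (h \<bullet> h) / 2) / t)) 1"
proof -
  interpret prob_space "gauss t :: 'a measure"
    by (rule prob_space_gauss) fact
  show ?thesis
    using nn_integral_gauss_shift[OF assms, of "\<lambda>_. 1" h] emeasure_space_1
    by (intro has_bochner_integral_nn_integral) (auto simp del: space_gauss)
qed

lemma integral_gauss_shift:
  fixes f :: "'a::euclidean_space \<Rightarrow> real"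
  assumes t: "t > 0" and f [measurable]: "f \<in> borel_measurable borel" and bd: "\<And>x. \<bar>f x\<bar> \<le> c"
  shows "(\<integral>z. f (z + h) \<partial>gauss t) = (\<integral>z. f z * exp ((z \<bullet> h - (h \<bullet> h) / 2) / t) \<partial>gauss t)"
proof -
  interpret prob_space "gauss t :: 'a measure"
    by (rule prob_space_gauss) fact
  let ?E = "\<lambda>z::'a. exp ((z \<bullet> h - (h \<bullet> h) / 2) / t)"
  have E: "integrable (gauss t) ?E" "integral\<^sup>L (gauss t) ?E = 1"
    using gauss_exp[OF t, of h] by (auto simp: has_bochner_integral_iff)
  \<comment> \<open>Adding \<open>c\<close> makes the function nonnegative; as the weight has mean
    1, the summand \<open>c\<close> contributes equally to both sides and cancels at the
    end.\<close>
  have nn: "f x + c \<ge> 0" for x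
    using bd[of x] by linarith
  have int1: "integrable (gauss t) (\<lambda>z. f (z + h))"
    by (rule integrable_const_bound[of _ c]) (use bd in auto)
  have int2: "integrable (gauss t) (\<lambda>z. f z * ?E z)"
    by (rule Bochner_Integration.integrable_bound[OF integrable_mult_right[OF E(1), of c]])
      (auto simp: abs_mult intro!: mult_mono order_trans[OF bd])
  have "(\<integral>z. (f (z + h) + c) \<partial>gauss t) = enn2real (\<integral>\<^sup>+z. ennreal (f (z + h) + c) \<partial>gauss t)"
    using nn by (intro integral_eq_nn_integral) auto
  also have "(\<integral>\<^sup>+z. ennreal (f (z + h) + c) \<partial>gauss t) = (\<integral>\<^sup>+z. ennreal (f z + c) * ennreal (?E z) \<partial>gauss t)"
    by (rule nn_integral_gauss_shift[OF t]) simp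
  also have "\<dots> = (\<integral>\<^sup>+z. ennreal ((f z + c) * ?E z) \<partial>gauss t)"
    by (intro nn_integral_cong) (simp add: ennreal_mult'')
  also have "enn2real \<dots> = (\<integral>z. (f z + c) * ?E z \<partial>gauss t)"
    using nn by (intro integral_eq_nn_integral[symmetric]) auto
  finally show ?thesis
    using int1 int2 E prob_space by (simp add: distrib_right del: space_gauss)
qed

text \<open>Cauchy--Schwarz with the exponential moments of the previous lemmas.\<close>

lemma gauss_shift_bound:
  fixes f :: "'a::euclidean_space \<Rightarrow> real"
  assumes t: "t > 0" and f [measurable]: "f \<in> borel_measurable borel" and bd: "\<And>x. \<bar>f x\<bar> \<le> 1"
  shows "\<bar>(\<integral>z. f (z + h) \<partial>gauss t) - (\<integral>z. f z \<partial>gauss t)\<bar> \<le> 2 * norm h / sqrt t"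
proof -
  interpret prob_space "gauss t :: 'a measure"
    by (rule prob_space_gauss) fact
  define E where "E z = exp ((z \<bullet> h - (h \<bullet> h) / 2) / t)" for z :: 'a
  \<comment> \<open>The claimed bound is \<open>2 * sqrt r\<close>. For \<open>r \<le> 1\<close> the
    weight has variance \<open>exp r - 1 \<le> 2 * r\<close>; for larger \<open>r\<close> the
    trivial bound 2 suffices.\<close>
  define r where "r = (norm h)\<^sup>2 / t"
  have r0: "r \<ge> 0" and sr: "sqrt r = norm h / sqrt t"
    using t by (auto simp: r_def real_sqrt_divide)
  have E: "integrable (gauss t) E" "expectation E = 1"
    using gauss_exp[OF t, of h] unfolding E_def[abs_def] by (auto simp: has_bochner_integral_iff)
  have int: "integrable (gauss t) g" if [measurable]: "g \<in> borel_measurable borel" and "\<And>x. \<bar>g x\<bar> \<le> 1"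
    for g :: "'a \<Rightarrow> real"
    by (rule integrable_const_bound[of _ 1]) (use that in auto)
  show ?thesis
  proof (cases "r \<le> 1")
    case True
    \<comment> \<open>The square of the weight for \<open>h\<close> is, up to the factor
      \<open>exp r\<close>, the weight for twice \<open>h\<close>, whose mean is 1.\<close>
    have sq: "E z ^ 2 = exp r * exp ((z \<bullet> (2 *\<^sub>R h) - ((2 *\<^sub>R h) \<bullet> (2 *\<^sub>R h)) / 2) / t)" for z
      using t by (simp add: E_def r_def exp_add[symmetric] dot_square_norm power2_eq_square field_simps)
    have E2: "integrable (gauss t) (\<lambda>z. E z ^ 2)" "expectation (\<lambda>z. E z ^ 2) = exp r"
      using gauss_exp[OF t, of "2 *\<^sub>R h"] unfolding sq by (auto simp: has_bochner_integral_iff)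
    have [measurable]: "E \<in> borel_measurable borel"
      unfolding E_def by measurable
    have int1: "integrable (gauss t) (\<lambda>z. \<bar>E z - 1\<bar>)"
      using E(1) by simp
    have eq2: "\<bar>E z - 1\<bar> ^ 2 = E z ^ 2 - 2 * E z + 1" for z
      by (simp add: power2_eq_square algebra_simps)
    have int2: "integrable (gauss t) (\<lambda>z. \<bar>E z - 1\<bar> ^ 2)"
      unfolding eq2 using E(1) E2(1) by simp
    have "expectation (\<lambda>z. \<bar>E z - 1\<bar> ^ 2) = exp r - 1"
      unfolding eq2 using E E2 prob_space by (simp del: space_gauss)
    \<comment> \<open>Nonnegativity of the variance serves as the Cauchy-Schwarz inequality between
      the first and the second moment of \<open>\<bar>E z - 1\<bar>\<close>.\<close>
    with variance_eq[OF int1 int2] variance_positive[of "\<lambda>z. \<bar>E z - 1\<bar>"]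
    have "(expectation (\<lambda>z. \<bar>E z - 1\<bar>))\<^sup>2 \<le> exp r - 1"
      by simp
    also have "\<dots> \<le> 2 * r"
    proof -
      have "exp r \<le> 1 + r + r\<^sup>2"
        using True r0 by (intro exp_bound)
      moreover have "r\<^sup>2 \<le> r"
        using True r0 by (simp add: power2_eq_square mult_left_le)
      ultimately show ?thesis
        by simp
    qed
    also have "\<dots> \<le> (2 * sqrt r)\<^sup>2"
      using r0 by (simp add: power_mult_distrib)
    finally have L1: "expectation (\<lambda>z. \<bar>E z - 1\<bar>) \<le> 2 * sqrt r"
      using r0 by (rule_tac power2_le_imp_le) auto
    have intfE: "integrable (gauss t) (\<lambda>z. f z * E z)"
      by (rule Bochner_Integration.integrable_bound[OF E(1)])
        (auto simp: abs_mult E_def intro!: mult_left_le_one_le bd)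
    have "(\<integral>z. f (z + h) \<partial>gauss t) - (\<integral>z. f z \<partial>gauss t) = (\<integral>z. f z * (E z - 1) \<partial>gauss t)"
      using int[OF f bd] intfE integral_gauss_shift[OF t f bd, of h]
      by (simp add: right_diff_distrib E_def)
    moreover have "\<bar>\<integral>z. f z * (E z - 1) \<partial>gauss t\<bar> \<le> expectation (\<lambda>z. \<bar>E z - 1\<bar>)"
    proof (rule order_trans[OF integral_abs_bound], rule integral_mono[OF _ int1])
      have "integrable (gauss t) (\<lambda>z. f z * E z - f z)"
        using int[OF f bd] intfE by simp
      then show "integrable (gauss t) (\<lambda>z. \<bar>f z * (E z - 1)\<bar>)"
        by (simp add: right_diff_distrib)
      show "\<bar>f z * (E z - 1)\<bar> \<le> \<bar>E z - 1\<bar>" for z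
        unfolding abs_mult by (intro mult_left_le_one_le bd) auto
    qed
    ultimately show ?thesis
      using L1 sr by (simp add: r_def)
  next
    case False
    have "\<bar>(\<integral>z. g z \<partial>gauss t)\<bar> \<le> 1" if "g \<in> borel_measurable borel" "\<And>x. \<bar>g x\<bar> \<le> 1"
      for g :: "'a \<Rightarrow> real"
    proof -
      have "\<bar>(\<integral>z. g z \<partial>gauss t)\<bar> \<le> (\<integral>z. \<bar>g z\<bar> \<partial>gauss t)"
        by (rule integral_abs_bound)
      also have "\<dots> \<le> (\<integral>z. 1 \<partial>(gauss t :: 'a measure))"
        using that by (intro integral_mono integrable_abs int) auto
      finally show ?thesis
        using prob_space by (simp del: space_gauss)
    qed
    from this[of f] this[of "\<lambda>z. f (z + h)"] bd
    have "\<bar>(\<integral>z. f (z + h) \<partial>gauss t) - (\<integral>z. f z \<partial>gauss t)\<bar> \<le> 2"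
      by simp
    also have "\<dots> \<le> 2 * sqrt r"
      using False by simp
    finally show ?thesis
      using sr by simp
  qed
qed

text \<open>Transition semigroup of \<open>\<sigma>\<close> times Brownian motion; its generator is
  the Laplacian times half the square of \<open>\<sigma>\<close>.\<close>

definition heat :: "real \<Rightarrow> real \<Rightarrow> ('a::euclidean_space \<Rightarrow> real) \<Rightarrow> 'a \<Rightarrow> real" where
  "heat \<sigma> t f x = (\<integral>z. f (x + \<sigma> *\<^sub>R z) \<partial>gauss t)"

text \<open>A displacement \<open>x - y\<close> of the starting point is a shift of the Gaussian by
  \<open>(1 / \<sigma>) *\<^sub>R (x - y)\<close>, so boundedness of \<open>f\<close> gives a
  Lipschitz bound. The rate \<open>1 / sqrt t\<close> is integrable at 0, which the uniqueness proof
  rests on.\<close>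

lemma heat_lipschitz:
  fixes f :: "'a::euclidean_space \<Rightarrow> real"
  assumes t: "t > 0" and \<sigma>: "\<sigma> > 0"
    and f [measurable]: "f \<in> borel_measurable borel" and bd: "\<And>x. \<bar>f x\<bar> \<le> 1"
  shows "\<bar>heat \<sigma> t f x - heat \<sigma> t f y\<bar> \<le> 2 / (\<sigma> * sqrt t) * norm (x - y)"
proof -
  have "\<bar>(\<integral>z. f (y + \<sigma> *\<^sub>R (z + (1 / \<sigma>) *\<^sub>R (x - y))) \<partial>gauss t) - (\<integral>z. f (y + \<sigma> *\<^sub>R z) \<partial>gauss t)\<bar>
      \<le> 2 * norm ((1 / \<sigma>) *\<^sub>R (x - y)) / sqrt t"
    using t by (intro gauss_shift_bound bd) auto
  moreover have "y + \<sigma> *\<^sub>R (z + (1 / \<sigma>) *\<^sub>R (x - y)) = x + \<sigma> *\<^sub>R z" for z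
    using \<sigma> by (simp add: scaleR_add_right)
  moreover have "2 * norm ((1 / \<sigma>) *\<^sub>R (x - y)) / sqrt t = 2 / (\<sigma> * sqrt t) * norm (x - y)"
    using \<sigma> by simp
  ultimately show ?thesis
    by (simp only: heat_def)
qed

lemma abs_heat_le:
  fixes f :: "'a::euclidean_space \<Rightarrow> real"
  assumes t: "t > 0" and f [measurable]: "f \<in> borel_measurable borel" and bd: "\<And>x. \<bar>f x\<bar> \<le> c"
  shows "\<bar>heat \<sigma> t f x\<bar> \<le> c"
proof -
  interpret prob_space "gauss t :: 'a measure"
    by (rule prob_space_gauss) fact
  have "\<bar>heat \<sigma> t f x\<bar> \<le> (\<integral>z. \<bar>f (x + \<sigma> *\<^sub>R z)\<bar> \<partial>gauss t)"
    unfolding heat_def by (rule integral_abs_bound)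
  also have "\<dots> \<le> (\<integral>z. c \<partial>(gauss t :: 'a measure))"
    using bd order_trans[OF abs_ge_zero bd] by (intro integral_mono integrable_const_bound[of _ c]) auto
  finally show ?thesis
    using prob_space by (simp del: space_gauss)
qed

section \<open>Path space\<close>

lemma continuous_on_eval_path: "continuous_on {0..} (eval_path p)"
  using eval_path[of p] by simp

lemma cpath_eqI:
  assumes "\<And>t. t \<ge> 0 \<Longrightarrow> eval_path p t = eval_path q t"
  shows "p = q"
proof -
  have "eval_path p t = eval_path q t" for t
    using assms eval_path[of p] eval_path[of q] by (cases "t \<ge> 0") auto
  then show ?thesis
    by (intro eval_path_inject[THEN iffD1] ext)
qed

lemma path_of_eval_path [simp]: "path_of (eval_path p) = p"
  by (rule cpath_eqI) (simp add: eval_path_of continuous_on_eval_path)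

lemma path_of_cong: "(\<And>t. t \<ge> 0 \<Longrightarrow> f t = g t) \<Longrightarrow> path_of f = path_of g"
  unfolding path_of_def by (intro arg_cong[where f = Abs_cpath] ext) simp

lemma tendsto_eval_path:
  assumes "(f \<longlongrightarrow> l) F" "t \<ge> 0"
  shows "((\<lambda>i. eval_path (f i) t) \<longlongrightarrow> eval_path l t) F"
proof -
  have "uniform_limit {t} (\<lambda>i. eval_path (f i)) (eval_path l) F"
    using assms unfolding tendsto_cpath_iff by (elim allE[of _ "{t}"]) auto
  then show ?thesis
    by (rule tendsto_uniform_limitI) simp
qed

lemma continuous_on_eval: "t \<ge> 0 \<Longrightarrow> continuous_on UNIV (\<lambda>p. eval_path p t)"
  unfolding continuous_on_def by (intro ballI tendsto_eval_path tendsto_ident_at)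

lemma measurable_eval_path: "t \<ge> 0 \<Longrightarrow> (\<lambda>p. eval_path p t) \<in> borel_measurable borel"
  by (intro borel_measurable_continuous_onI continuous_on_eval)

definition cpath_map :: "('a::metric_space \<Rightarrow> 'b::metric_space) \<Rightarrow> 'a cpath \<Rightarrow> 'b cpath" where
  "cpath_map h p = path_of (\<lambda>t. h (eval_path p t))"

lemma eval_cpath_map:
  assumes "continuous_on UNIV h" "t \<ge> 0"
  shows "eval_path (cpath_map h p) t = h (eval_path p t)"
  unfolding cpath_map_def
  by (rule eval_path_of)
    (use assms in \<open>auto intro!: continuous_on_compose2[OF assms(1) continuous_on_eval_path]\<close>)

lemma continuous_on_cpath_map:
  assumes h: "uniformly_continuous_on UNIV h"
  shows "continuous_on UNIV (cpath_map h)"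
  unfolding continuous_on_def
proof
  fix p :: "'a cpath"
  have c: "continuous_on UNIV h"
    using h by (rule uniformly_continuous_imp_continuous)
  have *: "uniform_limit K eval_path (eval_path p) (at p)" if "compact K \<and> K \<subseteq> {0..}" for K
    using that tendsto_ident_at[of p UNIV] unfolding tendsto_cpath_iff by simp
  show "(cpath_map h \<longlongrightarrow> cpath_map h p) (at p within UNIV)"
    unfolding tendsto_cpath_iff
  proof (intro allI impI uniform_limitI)
    fix K :: "real set" and e :: real
    assume K: "compact K \<and> K \<subseteq> {0..}" and "e > 0"
    then obtain d where d: "d > 0" "\<And>x y. dist x y < d \<Longrightarrow> dist (h x) (h y) < e"
      using h unfolding uniformly_continuous_on_def by (metis UNIV_I dist_commute)
    from uniform_limitD[OF *[OF K] d(1)]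
    show "\<forall>\<^sub>F q in at p. \<forall>t\<in>K. dist (eval_path (cpath_map h q) t) (eval_path (cpath_map h p) t) < e"
      by eventually_elim (use K in \<open>auto simp: eval_cpath_map[OF c] subset_iff intro!: d(2)\<close>)
  qed
qed

text \<open>Freezing a path at time \<open>s\<close> keeps exactly the information up to
  \<open>s\<close>; the canonical filtration is generated by these maps.\<close>

definition stop_path :: "real \<Rightarrow> 'a::metric_space cpath \<Rightarrow> 'a cpath" where
  "stop_path s p = path_of (\<lambda>t. eval_path p (min t s))"

lemma eval_stop_path:
  assumes "s \<ge> 0" "t \<ge> 0"
  shows "eval_path (stop_path s p) t = eval_path p (min t s)"
  unfolding stop_path_def
  by (rule eval_path_of)
    (use assms in \<open>auto intro!: continuous_on_compose2[OF continuous_on_eval_path] continuous_intros\<close>)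

section \<open>Lipschitz approximations of indicators and equality of measures\<close>

definition bump :: "nat \<Rightarrow> 'a::metric_space set \<Rightarrow> 'a \<Rightarrow> real" where
  "bump n C x = max 0 (1 - real n * infdist x C)"

lemma bump_range: "0 \<le> bump n C x" "bump n C x \<le> 1"
  by (auto simp: bump_def infdist_nonneg)

lemma abs_bump_le: "\<bar>bump n C x\<bar> \<le> 1"
  using bump_range[of n C x] by simp

lemma uniformly_continuous_on_bump: "uniformly_continuous_on UNIV (bump n C)"
proof -
  have "(real n)-lipschitz_on UNIV (bump n C)"
  proof (rule lipschitz_onI)
    fix x y :: 'a
    have "dist (bump n C x) (bump n C y) \<le> \<bar>real n * infdist x C - real n * infdist y C\<bar>"
      by (auto simp: bump_def dist_real_def max_def)
    also have "\<dots> = real n * \<bar>infdist x C - infdist y C\<bar>"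
      by (simp add: right_diff_distrib[symmetric] abs_mult)
    also have "\<dots> \<le> real n * dist x y"
      by (intro mult_left_mono infdist_triangle_abs) simp
    finally show "dist (bump n C x) (bump n C y) \<le> real n * dist x y" .
  qed simp
  then show ?thesis
    by (rule lipschitz_on_uniformly_continuous)
qed

lemma continuous_on_bump: "continuous_on UNIV (bump n C)"
  by (rule uniformly_continuous_imp_continuous[OF uniformly_continuous_on_bump])

lemma borel_measurable_bump [measurable]: "bump n C \<in> borel_measurable borel"
  by (intro borel_measurable_continuous_onI continuous_on_bump)

lemma bump_in: "x \<in> C \<Longrightarrow> bump n C x = 1"
  by (simp add: bump_def)

text \<open>Nonemptiness matters: \<open>infdist\<close> to the empty set is 0 by convention, so
  \<open>bump n {}\<close> is constantly 1.\<close>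

lemma tendsto_bump:
  assumes "closed C" "C \<noteq> {}"
  shows "(\<lambda>n. bump n C x) \<longlonglongrightarrow> indicator C x"
proof (cases "x \<in> C")
  case False
  then have pos: "infdist x C > 0"
    using in_closed_iff_infdist_zero[OF assms] infdist_nonneg[of x C] by force
  then obtain N where N: "1 < real N * infdist x C"
    using ex_less_of_nat_mult by blast
  have "bump n C x = 0" if "n \<ge> N" for n
  proof -
    have "real N * infdist x C \<le> real n * infdist x C"
      using that pos by (intro mult_right_mono) auto
    with N show ?thesis
      by (simp add: bump_def)
  qed
  then have "\<forall>\<^sub>F n in sequentially. bump n C x = indicator C x"
    using False unfolding eventually_sequentially by auto
  then show ?thesis
    by (rule tendsto_eventually)
qed (simp add: bump_in)

text \<open>The generator is restricted to nonempty sets because \<open>bump\<close> approximates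
  the indicator only of those.\<close>

lemma borel_eq_sigma_closed: "sets borel = sigma_sets UNIV {C :: 'a::topological_space set. closed C \<and> C \<noteq> {}}"
proof (rule antisym)
  show "sets borel \<subseteq> sigma_sets UNIV {C :: 'a set. closed C \<and> C \<noteq> {}}"
    unfolding borel_def
  proof (simp, rule sigma_sets_mono, rule subsetI)
    fix U :: "'a set" assume "U \<in> {S. open S}"
    then have "closed (UNIV - U)"
      by auto
    then have "UNIV - U \<in> sigma_sets UNIV {C. closed C \<and> C \<noteq> {}}"
      by (cases "UNIV - U = {}") (simp only: sigma_sets.Empty, auto intro!: sigma_sets.Basic)
    from sigma_sets.Compl[OF this] show "U \<in> sigma_sets UNIV {C. closed C \<and> C \<noteq> {}}"
      by (simp add: double_diff)
  qed
  show "sigma_sets UNIV {C. closed C \<and> C \<noteq> {}} \<subseteq> sets (borel :: 'a measure)"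
    by (rule sets.sigma_sets_subset[of _ borel, unfolded space_borel]) auto
qed

text \<open>Bumps are uniformly continuous and converge to indicators of closed sets, a generator
  stable under intersection once the empty set is put back: two nonempty closed sets may be
  disjoint.\<close>

lemma finite_measure_eqI_uniformly_continuous:
  fixes M N :: "'a::metric_space measure"
  assumes fin: "finite_measure M" "finite_measure N" and s: "sets M = sets borel" "sets N = sets borel"
    and eq: "\<And>f :: 'a \<Rightarrow> real. uniformly_continuous_on UNIV f \<Longrightarrow> (\<And>x. 0 \<le> f x \<and> f x \<le> 1) \<Longrightarrow>
      integral\<^sup>L M f = integral\<^sup>L N f"
  shows "M = N"
proof (rule measure_eqI_generator_eq[where E = "{C. closed C \<and> C \<noteq> {}} \<union> {{}}" and A = "\<lambda>_. UNIV" and \<Omega> = UNIV])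
  have sg: "sigma_sets UNIV ({C :: 'a set. closed C \<and> C \<noteq> {}} \<union> {{}}) = sets borel"
    unfolding borel_eq_sigma_closed
    by (intro antisym sigma_sets_mono subsetI)
      (auto intro: sigma_sets.Basic sigma_sets.Empty)
  show "sets M = sigma_sets UNIV ({C. closed C \<and> C \<noteq> {}} \<union> {{}})"
    "sets N = sigma_sets UNIV ({C. closed C \<and> C \<noteq> {}} \<union> {{}})"
    using s sg by auto
  interpret M: finite_measure M by fact
  interpret N: finite_measure N by fact
  show "emeasure M UNIV \<noteq> \<infinity>"
    by simp
  show "emeasure M X = emeasure N X" if X: "X \<in> {C. closed C \<and> C \<noteq> {}} \<union> {{}}" for X
  proof (cases "X = {}")
    case False
    with X have C: "closed X" "X \<noteq> {}"
      by auto
    have lim: "(\<lambda>n. integral\<^sup>L L (bump n X)) \<longlonglongrightarrow> measure L X"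
      if "finite_measure L" and sL [measurable_cong]: "sets L = sets borel" for L
    proof -
      interpret L: finite_measure L by fact
      have "(\<lambda>n. integral\<^sup>L L (bump n X)) \<longlonglongrightarrow> (\<integral>x. indicator X x \<partial>L)"
        by (rule integral_dominated_convergence[where w = "\<lambda>_. 1"])
          (use C sL tendsto_bump[OF C] in
            \<open>auto simp: measurable_cong_sets[OF sL refl] abs_bump_le\<close>)
      then show ?thesis
        using C sL by simp
    qed
    have "measure M X = measure N X"
      by (rule LIMSEQ_unique[OF lim[OF fin(1) s(1)]])
        (use lim[OF fin(2) s(2)] eq[OF uniformly_continuous_on_bump conjI[OF bump_range]] in auto)
    then show ?thesis
      by (simp add: M.emeasure_eq_measure N.emeasure_eq_measure)
  qed simp
qed (auto simp: Int_stable_def)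

section \<open>Cylinder functions and finite-dimensional distributions\<close>

definition cyl :: "(real \<times> ('a \<Rightarrow> real)) list \<Rightarrow> (real \<Rightarrow> 'a) \<Rightarrow> real" where
  "cyl I x = prod_list (map (\<lambda>(t, f). f (x t)) I)"

lemma cyl_Nil [simp]: "cyl [] x = 1"
  and cyl_Cons [simp]: "cyl ((t, f) # I) x = f (x t) * cyl I x"
  and cyl_append: "cyl (I @ J) x = cyl I x * cyl J x"
  by (simp_all add: cyl_def)

lemma cyl_sort_key: "cyl (sort_key fst I) x = cyl I x"
proof -
  have "cyl J x = prod_mset (image_mset (\<lambda>(t, f). f (x t)) (mset J))" for J
    by (simp add: cyl_def prod_mset_prod_list[symmetric])
  then show ?thesis
    by simp
qed

definition test_list :: "(real \<times> ('a::metric_space \<Rightarrow> real)) list \<Rightarrow> bool" where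
  "test_list I \<longleftrightarrow> (\<forall>(t, f)\<in>set I. 0 \<le> t \<and> uniformly_continuous_on UNIV f \<and> (\<forall>x. 0 \<le> f x \<and> f x \<le> 1))"

lemma cyl_range:
  assumes "test_list I"
  shows "0 \<le> cyl I x \<and> cyl I x \<le> 1"
  using assms
proof (induction I)
  case (Cons a I)
  obtain t f where a: "a = (t, f)"
    by (cases a)
  from Cons have "0 \<le> cyl I x \<and> cyl I x \<le> 1" "0 \<le> f (x t) \<and> f (x t) \<le> 1"
    by (auto simp: test_list_def a)
  then show ?case
    by (auto simp: a mult_le_one)
qed simp

lemma borel_measurable_cyl:
  assumes "test_list I" and X: "\<And>t f. (t, f) \<in> set I \<Longrightarrow> (\<lambda>\<omega>. X \<omega> t) \<in> borel_measurable M"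
  shows "(\<lambda>\<omega>. cyl I (X \<omega>)) \<in> borel_measurable M"
  using assms
proof (induction I)
  case (Cons a I)
  obtain t f where a: "a = (t, f)"
    by (cases a)
  have "f \<in> borel_measurable borel"
    using Cons.prems(1)
    by (intro borel_measurable_continuous_onI uniformly_continuous_imp_continuous)
      (auto simp: test_list_def a)
  from measurable_compose[OF Cons.prems(2)[of t f] this] Cons
  show ?case
    by (auto simp: a test_list_def intro!: borel_measurable_times)
qed simp

text \<open>Finite-dimensional laws determine the law: sets of paths lying in given closed sets at
  finitely many times generate the Borel sets, and products of bumps approximate their indicators.
  Sorted lists suffice, as \<open>cyl\<close> does not see the order of its factors.\<close>

lemma cpath_measure_eqI:
  fixes \<mu> \<nu> :: "'a::{metric_space, second_countable_topology} cpath measure"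
  assumes fin: "finite_measure \<mu>" "finite_measure \<nu>" and s: "sets \<mu> = sets borel" "sets \<nu> = sets borel"
    and eq: "\<And>I. test_list I \<Longrightarrow> sorted (map fst I) \<Longrightarrow>
      (\<integral>p. cyl I (eval_path p) \<partial>\<mu>) = (\<integral>p. cyl I (eval_path p) \<partial>\<nu>)"
  shows "\<mu> = \<nu>"
proof -
  define ok where "ok J \<longleftrightarrow> (\<forall>(t, C)\<in>set J. 0 \<le> t \<and> closed C \<and> C \<noteq> {})" for J :: "(real \<times> 'a set) list"
  define S where "S J = {p. \<forall>(t, C)\<in>set J. eval_path p t \<in> C}" for J :: "(real \<times> 'a set) list"
  define E where "E = {S J | J. ok J}"
  have clS: "closed (S J)" if "ok J" for J
  proof -
    have "S J = (\<Inter>(t, C)\<in>set J. (\<lambda>p. eval_path p t) -` C)"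
      by (auto simp: S_def)
    moreover have "closed \<dots>"
      using that by (intro closed_INT) (auto simp: ok_def intro!: closed_vimage continuous_on_eval)
    ultimately show ?thesis
      by simp
  qed
  have sE: "sigma_sets UNIV E = sets (borel :: 'a cpath measure)"
  proof (rule antisym)
    show "sigma_sets UNIV E \<subseteq> sets borel"
      by (rule sets.sigma_sets_subset[of _ borel, unfolded space_borel])
        (use clS in \<open>auto simp: E_def\<close>)
    have [simp]: "space (sigma UNIV E) = UNIV" "sets (sigma UNIV E) = sigma_sets UNIV E"
      by auto
    \<comment> \<open>The coordinate process is considered on the sigma-algebra generated by
      \<open>E\<close> alone. Measurability of its path map says that the identity is measurable,
      that is, that every Borel set lies in this sigma-algebra.\<close>
    have "(\<lambda>p. path_of (eval_path p)) \<in> borel_measurable (sigma UNIV E)"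
    proof (rule borel_measurable_path_of)
      fix t :: real assume t: "t \<ge> 0"
      show "(\<lambda>p. eval_path p t) \<in> borel_measurable (sigma UNIV E)"
      proof (rule measurable_sigma_sets[OF borel_eq_sigma_closed])
        fix C :: "'a set" assume "C \<in> {C. closed C \<and> C \<noteq> {}}"
        then have "S [(t, C)] \<in> E"
          unfolding E_def using t by (force simp: ok_def)
        moreover have "S [(t, C)] = (\<lambda>p. eval_path p t) -` C"
          by (auto simp: S_def)
        ultimately show "(\<lambda>p. eval_path p t) -` C \<inter> space (sigma UNIV E) \<in> sets (sigma UNIV E)"
          by (auto intro: sigma_sets.Basic)
      qed auto
    qed (rule continuous_on_eval_path)
    then have "(\<lambda>p. p) \<in> borel_measurable (sigma UNIV E)"
      by simp
    from measurable_sets[OF this] show "sets borel \<subseteq> sigma_sets UNIV E"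
      by auto
  qed
  show ?thesis
  proof (rule measure_eqI_generator_eq[where E = E and A = "\<lambda>_. UNIV" and \<Omega> = UNIV])
    interpret M: finite_measure \<mu> by fact
    interpret N: finite_measure \<nu> by fact
    show "sets \<mu> = sigma_sets UNIV E" "sets \<nu> = sigma_sets UNIV E"
      using s sE by auto
    show "Int_stable E"
    proof (rule Int_stableI)
      fix a b assume "a \<in> E" "b \<in> E"
      then obtain J J' where *: "ok J" "ok J'" "a = S J" "b = S J'"
        by (auto simp: E_def)
      then have "a \<inter> b = S (J @ J')" "ok (J @ J')"
        by (auto simp: S_def ok_def)
      then show "a \<inter> b \<in> E"
        by (auto simp: E_def)
    qed
    have "UNIV = S []" "ok []"
      by (auto simp: S_def ok_def)
    then show "range (\<lambda>_. UNIV) \<subseteq> E"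
      by (auto simp: E_def)
    show "emeasure \<mu> UNIV \<noteq> \<infinity>"
      by simp
    show "emeasure \<mu> X = emeasure \<nu> X" if XE: "X \<in> E" for X
    proof -
      obtain J where J: "ok J" "X = S J"
        using XE by (auto simp: E_def)
      define I where "I n = sort_key fst (map (\<lambda>(t, C). (t, bump n C)) J)" for n
      have tI: "test_list (I n)" for n
        using J(1) bump_range uniformly_continuous_on_bump
        by (auto simp: I_def test_list_def ok_def)
      have so: "sorted (map fst (I n))" for n
        by (simp add: I_def)
      have conv: "(\<lambda>n. cyl (I n) (eval_path p)) \<longlonglongrightarrow> indicator (S J) p" for p
      proof -
        have "(\<lambda>n. cyl (map (\<lambda>(t, C). (t, bump n C)) J) (eval_path p)) \<longlonglongrightarrow> indicator (S J) p"
          using J(1)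
        proof (induction J)
          case (Cons a J)
          obtain t C where a: "a = (t, C)"
            by (cases a)
          with Cons.prems have C: "closed C" "C \<noteq> {}" and ok: "ok J"
            by (auto simp: ok_def)
          have "indicator (S (a # J)) p = indicator C (eval_path p t) * (indicator (S J) p :: real)"
            by (auto simp: S_def a indicator_def)
          then show ?case
            using tendsto_mult[OF tendsto_bump[OF C] Cons.IH[OF ok]] by (simp add: a)
        qed (simp add: S_def)
        then show ?thesis
          by (simp add: I_def cyl_sort_key)
      qed
      have lim: "(\<lambda>n. \<integral>p. cyl (I n) (eval_path p) \<partial>L) \<longlonglongrightarrow> measure L X"
        if "finite_measure L" and sL: "sets L = sets borel" for L
      proof -
        interpret L: finite_measure L by fact
        have [simp]: "X \<in> sets L"
          using clS[OF J(1)] J(2) sL by simp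
        have "(\<lambda>n. \<integral>p. cyl (I n) (eval_path p) \<partial>L) \<longlonglongrightarrow> (\<integral>x. indicator X x \<partial>L)"
        proof (rule integral_dominated_convergence[where w = "\<lambda>_. 1"])
          show "(\<lambda>p. cyl (I n) (eval_path p)) \<in> borel_measurable L" for n
            unfolding measurable_cong_sets[OF sL refl]
            using tI[of n] by (intro borel_measurable_cyl measurable_eval_path) (auto simp: test_list_def)
          show "(indicator X :: _ \<Rightarrow> real) \<in> borel_measurable L"
            by (rule borel_measurable_indicator) simp
        qed (use cyl_range[OF tI] conv J(2) in auto)
        then show ?thesis
          by simp
      qed
      have "measure \<mu> X = measure \<nu> X"
        by (rule LIMSEQ_unique[OF lim[OF fin(1) s(1)]])
          (use lim[OF fin(2) s(2)] eq[OF tI so] in auto)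
      then show ?thesis
        by (simp add: M.emeasure_eq_measure N.emeasure_eq_measure)
    qed
  qed auto
qed

section \<open>Compact sets of paths\<close>

lemma continuous_on_atLeast_0I:
  fixes g :: "real \<Rightarrow> 'a::metric_space"
  assumes "\<And>T. continuous_on {0..T} g"
  shows "continuous_on {0..} g"
  unfolding continuous_on_iff
proof (intro ballI allI impI)
  fix t e :: real assume t: "t \<in> {0..}" and "e > 0"
  with assms[of "t + 1"] obtain d where d: "d > 0"
      "\<And>s. s \<in> {0..t + 1} \<Longrightarrow> dist s t < d \<Longrightarrow> dist (g s) (g t) < e"
    unfolding continuous_on_iff by (metis atLeastAtMost_iff atLeast_iff less_add_one less_imp_le)
  show "\<exists>d>0. \<forall>s\<in>{0..}. dist s t < d \<longrightarrow> dist (g s) (g t) < e"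
    using d by (intro exI[of _ "min d 1"]) (auto simp: dist_real_def)
qed

text \<open>Arzela-Ascoli on the half line. A diagonal sequence converges at all nonnegative
  rational times; equicontinuity makes it uniformly Cauchy on each \<open>{0..T}\<close>.\<close>

lemma seq_compact_cpath:
  fixes K :: "'a::euclidean_space cpath set"
  assumes bd: "bounded ((\<lambda>p. eval_path p 0) ` K)"
    and equi: "\<And>T e. e > 0 \<Longrightarrow> \<exists>d>0. \<forall>p\<in>K. \<forall>s\<in>{0..T}. \<forall>t\<in>{0..T}. \<bar>s - t\<bar> < d \<longrightarrow>
      dist (eval_path p s) (eval_path p t) < e"
    and cl: "closed K"
  shows "seq_compact K"
  unfolding seq_compact_def
proof (intro allI impI)
  fix f :: "nat \<Rightarrow> 'a cpath" assume fK: "\<forall>n. f n \<in> K"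
  have bdt: "bounded ((\<lambda>p. eval_path p t) ` K)" if "t \<ge> 0" for t
  proof -
    obtain d where d: "d > 0" "\<And>p s s'. p \<in> K \<Longrightarrow> s \<in> {0..t} \<Longrightarrow> s' \<in> {0..t} \<Longrightarrow> \<bar>s - s'\<bar> < d \<Longrightarrow>
        dist (eval_path p s) (eval_path p s') < 1"
      using equi[of 1 t] by auto
    \<comment> \<open>Chaining: steps of length \<open>d / 2\<close>, safely below \<open>d\<close>,
      cost at most 1 each, which carries boundedness from time 0 to time \<open>t\<close>.\<close>
    have *: "dist (eval_path p s) (eval_path p 0) \<le> real n"
      if "p \<in> K" "s \<in> {0..t}" "s \<le> real n * (d / 2)" for p n s
      using that
    proof (induction n arbitrary: s)
      case (Suc n)
      define s' where "s' = max 0 (s - d / 2)"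
      have s': "s' \<in> {0..t}" "s' \<le> real n * (d / 2)" "\<bar>s - s'\<bar> < d"
        using Suc.prems d(1) by (auto simp: s'_def max_def algebra_simps)
      show ?case
        using Suc.IH[OF Suc.prems(1) s'(1,2)] d(2)[OF Suc.prems(1,2) s'(1,3)]
          dist_triangle[of "eval_path p s" "eval_path p 0" "eval_path p s'"] by simp
    qed auto
    obtain n :: nat where n: "t \<le> real n * (d / 2)"
      using d(1) by (metis ex_less_of_nat_mult half_gt_zero less_imp_le)
    obtain c x where c: "\<And>p. p \<in> K \<Longrightarrow> dist x (eval_path p 0) \<le> c"
      using bd unfolding bounded_def by auto
    have "dist x (eval_path p t) \<le> c + real n" if "p \<in> K" for p
      using c[OF that] *[OF that, of t n] n \<open>t \<ge> 0\<close>
        dist_triangle[of x "eval_path p t" "eval_path p 0"] by (simp add: dist_commute)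
    then show ?thesis
      unfolding bounded_def by (intro exI[of _ x] exI[of _ "c + real n"]) auto
  qed
  define q where "q = from_nat_into (\<rat> \<inter> {0::real..})"
  have ne: "\<rat> \<inter> {0::real..} \<noteq> {}" and cnt: "countable (\<rat> \<inter> {0::real..})"
    by (auto intro!: countable_Int1 countable_rat)
  have q0: "q n \<ge> 0" for n
    using from_nat_into[OF ne, of n] by (simp add: q_def)
  interpret subseqs "\<lambda>n s. convergent (\<lambda>k. eval_path (f (s k)) (q n))"
  proof
    fix n and s :: "nat \<Rightarrow> nat"
    have "range (\<lambda>k. eval_path (f (s k)) (q n)) \<subseteq> (\<lambda>p. eval_path p (q n)) ` K"
      using fK by auto
    then have "bounded (range (\<lambda>k. eval_path (f (s k)) (q n)))"
      using bdt[OF q0] bounded_subset by blast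
    from bounded_imp_convergent_subsequence[OF this]
    show "\<exists>r'. strict_mono r' \<and> convergent (\<lambda>k. eval_path (f ((s \<circ> r') k)) (q n))"
      by (auto simp: convergent_def o_def)
  qed
  define r where "r = diagseq"
  have r: "strict_mono r"
    unfolding r_def by (rule subseq_diagseq)
  have conv_q: "Cauchy (\<lambda>k. eval_path (f (r k)) (q n))" for n
  proof -
    \<comment> \<open>The diagonal sequence is a subsequence of the \<open>n\<close>-th one only
      after an initial segment; the shift by \<open>Suc n\<close> is undone below.\<close>
    have "convergent (\<lambda>k. eval_path (f ((diagseq \<circ> (+) (Suc n)) k)) (q n))"
    proof (rule diagseq_holds)
      show "convergent (\<lambda>k. eval_path (f ((s \<circ> r) k)) (q n))"
        if "strict_mono r" "convergent (\<lambda>k. eval_path (f (s k)) (q n))" for r s n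
        using convergent_subseq_convergent[OF that(2,1)] by (simp add: o_def)
    qed
    then have "convergent (\<lambda>k. eval_path (f (r (k + Suc n))) (q n))"
      by (simp add: r_def add.commute)
    then show ?thesis
      by (subst (asm) convergent_ignore_initial_segment) (rule convergent_Cauchy)
  qed
  have conv_rat: "Cauchy (\<lambda>k. eval_path (f (r k)) p)" if "p \<in> \<rat>" "p \<ge> 0" for p
    using conv_q[of "to_nat_on (\<rat> \<inter> {0::real..}) p"] that cnt by (simp add: q_def)
  have "uniformly_convergent_on {0..T} (\<lambda>k. eval_path (f (r k)))" for T
  proof (rule Cauchy_uniformly_convergent, unfold uniformly_Cauchy_on_def, intro allI impI)
    fix e :: real assume "e > 0"
    then obtain d where d: "d > 0" "\<And>p s s'. p \<in> K \<Longrightarrow> s \<in> {0..T} \<Longrightarrow> s' \<in> {0..T} \<Longrightarrow> \<bar>s - s'\<bar> < d \<Longrightarrow>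
        dist (eval_path p s) (eval_path p s') < e / 3"
      using equi[of "e / 3" T] by auto
    \<comment> \<open>A rational mesh puts all grid points at times where convergence is known. Only
      finitely many lie in \<open>{0..T}\<close>, so one index \<open>N\<close> serves them all, and
      the bound \<open>e / 3\<close> is used three times.\<close>
    obtain h :: real where h: "h \<in> \<rat>" "0 < h" "h < d"
      using Rats_dense_in_real[OF d(1)] by blast
    have "\<exists>M. \<forall>m\<ge>M. \<forall>n\<ge>M. dist (eval_path (f (r m)) (real i * h)) (eval_path (f (r n)) (real i * h)) < e / 3" for i
    proof -
      have "real i * h \<in> \<rat>" "real i * h \<ge> 0" "e / 3 > 0"
        using h \<open>e > 0\<close> by auto
      then show ?thesis
        using conv_rat unfolding Cauchy_def by blast
    qed
    then obtain M where M: "\<And>i m n. m \<ge> M i \<Longrightarrow> n \<ge> M i \<Longrightarrow>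
        dist (eval_path (f (r m)) (real i * h)) (eval_path (f (r n)) (real i * h)) < e / 3"
      by metis
    define N where "N = Max (M ` {..nat \<lfloor>T / h\<rfloor>})"
    have "dist (eval_path (f (r m)) t) (eval_path (f (r n)) t) < e"
      if t: "t \<in> {0..T}" and mn: "m \<ge> N" "n \<ge> N" for t m n
    proof -
      define i where "i = nat \<lfloor>t / h\<rfloor>"
      have i1: "real i \<le> t / h" "t / h < real i + 1"
        using t h(2) by (auto simp: i_def of_nat_nat)
      then have i2: "real i * h \<le> t" "t - real i * h < h"
        using h(2) by (auto simp: field_simps)
      have "i \<le> nat \<lfloor>T / h\<rfloor>"
        unfolding i_def using t h(2) by (intro nat_mono floor_mono divide_right_mono) auto
      then have "M i \<le> N"
        by (auto simp: N_def)
      then have "dist (eval_path (f (r m)) (real i * h)) (eval_path (f (r n)) (real i * h)) < e / 3"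
        using mn by (intro M) auto
      moreover have "dist (eval_path (f (r k)) t) (eval_path (f (r k)) (real i * h)) < e / 3" for k
        using fK t i2 h by (intro d(2)) auto
      from this[of m] this[of n]
      have "dist (eval_path (f (r m)) t) (eval_path (f (r m)) (real i * h)) < e / 3"
        "dist (eval_path (f (r n)) t) (eval_path (f (r n)) (real i * h)) < e / 3" .
      ultimately show ?thesis
        using dist_triangle[of "eval_path (f (r m)) t" "eval_path (f (r n)) t" "eval_path (f (r m)) (real i * h)"]
          dist_triangle2[of "eval_path (f (r m)) (real i * h)" "eval_path (f (r n)) t" "eval_path (f (r n)) (real i * h)"]
        by linarith
    qed
    then show "\<exists>N. \<forall>t\<in>{0..T}. \<forall>m\<ge>N. \<forall>n\<ge>N. dist (eval_path (f (r m)) t) (eval_path (f (r n)) t) < e"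
      by (intro exI[of _ N]) auto
  qed
  then have lim: "uniform_limit {0..T} (\<lambda>k. eval_path (f (r k))) (\<lambda>t. lim (\<lambda>k. eval_path (f (r k)) t)) sequentially" for T
    unfolding uniformly_convergent_uniform_limit_iff .
  define g where "g t = lim (\<lambda>k. eval_path (f (r k)) t)" for t
  have cont: "continuous_on {0..} g"
  proof (rule continuous_on_atLeast_0I)
    fix T
    have "continuous_on {0..T} (eval_path (f (r k)))" for k
      by (rule continuous_on_subset[OF continuous_on_eval_path]) auto
    then show "continuous_on {0..T} g"
      unfolding g_def by (intro uniform_limit_theorem[OF _ lim]) auto
  qed
  have l: "(f \<circ> r) \<longlonglongrightarrow> path_of g"
    unfolding tendsto_cpath_iff
  proof (intro allI impI)
    fix C :: "real set" assume C: "compact C \<and> C \<subseteq> {0..}"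
    then obtain T where T: "\<And>t. t \<in> C \<Longrightarrow> norm t \<le> T"
      using compact_imp_bounded[of C] unfolding bounded_iff by auto
    have "C \<subseteq> {0..T}"
      using C T by fastforce
    from uniform_limit_on_subset[OF lim this]
    show "uniform_limit C (\<lambda>i. eval_path ((f \<circ> r) i)) (eval_path (path_of g)) sequentially"
      by (rule uniform_limit_cong'[THEN iffD1, rotated -1])
        (use C eval_path_of[OF cont] in \<open>auto simp: g_def\<close>)
  qed
  have "path_of g \<in> K"
    by (rule Lim_in_closed_set[OF cl _ _ l]) (use fK in auto)
  with l r show "\<exists>l\<in>K. \<exists>r. strict_mono r \<and> (f \<circ> r) \<longlonglongrightarrow> l"
    by blast
qed

section \<open>Tight sequences of measures\<close>

text \<open>A bit stands for the largest digit \<open>\<beta> - 1\<close>: base 2 gives ordinary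
  binary expansions, base 3 the points of the Cantor set.\<close>

definition digits_val :: "real \<Rightarrow> (nat \<Rightarrow> bool) \<Rightarrow> real" where
  "digits_val \<beta> b = (\<Sum>k. (if b k then \<beta> - 1 else 0) / \<beta> ^ Suc k)"

lemma digits_geometric:
  assumes "\<beta> \<ge> (2 :: real)"
  shows "(\<lambda>k. (\<beta> - 1) / \<beta> ^ Suc k) sums 1"
proof -
  have "(\<lambda>k. (1 / \<beta>) ^ k) sums (1 / (1 - 1 / \<beta>))"
    using assms by (intro geometric_sums) auto
  from sums_mult[OF this, of "(\<beta> - 1) / \<beta>"] show ?thesis
    using assms by (simp add: power_divide field_simps)
qed

lemma summable_digits:
  assumes "\<beta> \<ge> (2 :: real)"
  shows "summable (\<lambda>k. (if b k then \<beta> - 1 else 0) / \<beta> ^ Suc k)"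
  by (rule summable_comparison_test'[OF sums_summable[OF digits_geometric[OF assms]], of 0])
    (use assms in auto)

lemma digits_val_range:
  assumes "\<beta> \<ge> 2"
  shows "0 \<le> digits_val \<beta> b" "digits_val \<beta> b \<le> 1"
proof -
  show "0 \<le> digits_val \<beta> b"
    unfolding digits_val_def using assms by (intro suminf_nonneg summable_digits) auto
  have "digits_val \<beta> b \<le> (\<Sum>k. (\<beta> - 1) / \<beta> ^ Suc k)"
    unfolding digits_val_def using assms
    by (intro suminf_le summable_digits sums_summable[OF digits_geometric]) (auto intro!: divide_right_mono)
  then show "digits_val \<beta> b \<le> 1"
    using sums_unique[OF digits_geometric[OF assms]] by simp
qed

lemma digits_val_rec:
  assumes "\<beta> \<ge> 2"
  shows "digits_val \<beta> b = ((if b 0 then \<beta> - 1 else 0) + digits_val \<beta> (\<lambda>k. b (Suc k))) / \<beta>"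
proof -
  have "digits_val \<beta> b = (if b 0 then \<beta> - 1 else 0) / \<beta> +
      (\<Sum>k. (if b (Suc k) then \<beta> - 1 else 0) / \<beta> ^ Suc (Suc k))"
    unfolding digits_val_def using suminf_split_head[OF summable_digits[OF assms], of b] by simp
  also have "(\<Sum>k. (if b (Suc k) then \<beta> - 1 else 0) / \<beta> ^ Suc (Suc k)) =
      digits_val \<beta> (\<lambda>k. b (Suc k)) / \<beta>"
    unfolding digits_val_def
    using suminf_divide[OF summable_digits[OF assms, of "\<lambda>k. b (Suc k)"], of \<beta>] by (simp add: mult_ac)
  finally show ?thesis
    by (simp add: add_divide_distrib)
qed

lemma digits_val_agree:
  assumes "\<beta> \<ge> 2" "\<And>k. k < n \<Longrightarrow> b k = b' k"
  shows "\<bar>digits_val \<beta> b - digits_val \<beta> b'\<bar> \<le> 1 / \<beta> ^ n"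
  using assms(2)
proof (induction n arbitrary: b b')
  case 0
  then show ?case
    using digits_val_range[OF assms(1), of b] digits_val_range[OF assms(1), of b'] by simp
next
  case (Suc n)
  have "b 0 = b' 0" and IH: "\<bar>digits_val \<beta> (\<lambda>k. b (Suc k)) - digits_val \<beta> (\<lambda>k. b' (Suc k))\<bar> \<le> 1 / \<beta> ^ n"
    using Suc.prems by (auto intro!: Suc.IH)
  then have "\<bar>digits_val \<beta> b - digits_val \<beta> b'\<bar> =
      \<bar>digits_val \<beta> (\<lambda>k. b (Suc k)) - digits_val \<beta> (\<lambda>k. b' (Suc k))\<bar> / \<beta>"
    using assms(1) by (subst (1 2) digits_val_rec[OF assms(1)]) (simp add: diff_divide_distrib[symmetric] add_divide_distrib)
  also have "\<dots> \<le> 1 / \<beta> ^ n / \<beta>"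
    using assms(1) by (intro divide_right_mono IH) auto
  finally show ?case
    by (simp add: mult.commute)
qed

text \<open>A first digit 0 puts the value between 0 and 1/3, a first digit 2 between 2/3 and 1: the
  removed middle third separates them.\<close>

lemma digits_val_3_head:
  assumes "\<bar>digits_val 3 b - digits_val 3 b'\<bar> < 1 / 3"
  shows "b 0 = b' 0"
proof -
  have "digits_val 3 c = ((if c 0 then 2 else 0) + digits_val 3 (\<lambda>k. c (Suc k))) / 3"
    "0 \<le> digits_val 3 (\<lambda>k. c (Suc k))" "digits_val 3 (\<lambda>k. c (Suc k)) \<le> 1" for c
    using digits_val_rec[of 3 c] digits_val_range[of 3 "\<lambda>k. c (Suc k)"] by simp_all
  from this[of b] this[of b'] assms show ?thesis
    by (cases "b 0"; cases "b' 0") (simp_all add: abs_less_iff field_simps)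
qed

text \<open>In base 3 only the digits 0 and 2 occur, so the expansion determines the digits (Cantor set).\<close>

lemma digits_val_3_inj:
  assumes "\<bar>digits_val 3 b - digits_val 3 b'\<bar> < 1 / 3 ^ Suc n" "k \<le> n"
  shows "b k = b' k"
  using assms
proof (induction n arbitrary: b b' k)
  case 0
  then show ?case
    using digits_val_3_head[of b b'] by simp
next
  case (Suc n)
  have *: "b 0 = b' 0"
  proof -
    have "\<bar>digits_val 3 b - digits_val 3 b'\<bar> < 1 / 3"
    proof (rule less_le_trans[OF Suc.prems(1)])
      have "(1 :: real) \<le> 3 ^ Suc n"
        by (rule one_le_power) simp
      then show "1 / 3 ^ Suc (Suc n) \<le> (1 / 3 :: real)"
        by (simp add: field_simps)
    qed
    then show ?thesis
      by (rule digits_val_3_head)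
  qed
  then have "\<bar>digits_val 3 b - digits_val 3 b'\<bar> =
      \<bar>digits_val 3 (\<lambda>k. b (Suc k)) - digits_val 3 (\<lambda>k. b' (Suc k))\<bar> / 3"
    by (subst (1 2) digits_val_rec) (simp_all add: diff_divide_distrib[symmetric] add_divide_distrib)
  with Suc.prems(1) have "\<bar>digits_val 3 (\<lambda>k. b (Suc k)) - digits_val 3 (\<lambda>k. b' (Suc k))\<bar> < 1 / 3 ^ Suc n"
    by simp
  from Suc.IH[OF this, of "k - 1"] * Suc.prems(2) show ?case
    by (cases k) auto
qed

text \<open>Continuity for the product topology on bit sequences: once \<open>N\<close> digits
  agree, the tails contribute a difference of at most \<open>1 / \<beta> ^ N\<close>.\<close>

lemma tendsto_digits_val:
  assumes "\<beta> \<ge> 2" "\<And>k. \<forall>\<^sub>F n in sequentially. b n k = b' k"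
  shows "(\<lambda>n. digits_val \<beta> (b n)) \<longlonglongrightarrow> digits_val \<beta> b'"
proof (rule tendstoI)
  fix e :: real assume "e > 0"
  obtain N where N: "(1 / \<beta>) ^ N < e"
    using assms(1) real_arch_pow_inv[OF \<open>e > 0\<close>, of "1 / \<beta>"] by auto
  have "\<forall>\<^sub>F n in sequentially. \<forall>k\<in>{..<N}. b n k = b' k"
    using assms(2) by (intro eventually_ball_finite) auto
  then show "\<forall>\<^sub>F n in sequentially. dist (digits_val \<beta> (b n)) (digits_val \<beta> b') < e"
  proof eventually_elim
    case (elim n)
    then have "\<bar>digits_val \<beta> (b n) - digits_val \<beta> b'\<bar> \<le> 1 / \<beta> ^ N"
      by (intro digits_val_agree assms(1)) auto
    with N show ?case
      by (simp add: dist_real_def power_divide)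
  qed
qed

lemma digits_val_binary:
  assumes y: "0 \<le> y" "y < 1"
  shows "digits_val 2 (\<lambda>i. odd \<lfloor>2 ^ Suc i * y\<rfloor>) = y"
proof -
  \<comment> \<open>Partial sums are the dyadic approximations from below; the empty sum 0 is the
    integer part of \<open>y\<close> because \<open>y < 1\<close>.\<close>
  have partial: "(\<Sum>i<n. (if odd \<lfloor>2 ^ Suc i * y\<rfloor> then 2 - 1 else 0) / 2 ^ Suc i) = real_of_int \<lfloor>2 ^ n * y\<rfloor> / 2 ^ n"
    for n
  proof (induction n)
    case 0
    then show ?case
      using y by (simp add: floor_eq_iff)
  next
    case (Suc n)
    have "\<lfloor>2 ^ n * y\<rfloor> = \<lfloor>2 ^ Suc n * y\<rfloor> div 2"
      using floor_divide_real_eq_div[of 2 "2 ^ Suc n * y"] by simp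
    moreover have "m = 2 * (m div 2) + (if odd m then 1 else 0)" for m :: int
      by (cases "odd m") auto
    ultimately have "\<lfloor>2 ^ Suc n * y\<rfloor> = 2 * \<lfloor>2 ^ n * y\<rfloor> + (if odd \<lfloor>2 ^ Suc n * y\<rfloor> then 1 else 0)"
      by metis
    from arg_cong[OF this, of real_of_int]
    have "real_of_int \<lfloor>2 ^ Suc n * y\<rfloor> = 2 * real_of_int \<lfloor>2 ^ n * y\<rfloor> + (if odd \<lfloor>2 ^ Suc n * y\<rfloor> then 1 else 0)"
      by (simp del: power_Suc split: if_splits)
    then show ?case
      unfolding sum.lessThan_Suc Suc by (simp add: field_simps)
  qed
  have "(\<lambda>n. real_of_int \<lfloor>2 ^ n * y\<rfloor> / 2 ^ n) \<longlonglongrightarrow> y"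
  proof (rule real_tendsto_sandwich[where f = "\<lambda>n. y - (1 / 2) ^ n" and h = "\<lambda>_. y"])
    show "\<forall>\<^sub>F n in sequentially. y - (1 / 2) ^ n \<le> real_of_int \<lfloor>2 ^ n * y\<rfloor> / 2 ^ n"
    proof (intro always_eventually allI)
      fix n
      have "2 ^ n * y - 1 \<le> real_of_int \<lfloor>2 ^ n * y\<rfloor>"
        by linarith
      then have "(2 ^ n * y - 1) / 2 ^ n \<le> real_of_int \<lfloor>2 ^ n * y\<rfloor> / 2 ^ n"
        by (intro divide_right_mono) auto
      then show "y - (1 / 2) ^ n \<le> real_of_int \<lfloor>2 ^ n * y\<rfloor> / 2 ^ n"
        by (simp add: diff_divide_distrib power_divide)
    qed
    show "\<forall>\<^sub>F n in sequentially. real_of_int \<lfloor>2 ^ n * y\<rfloor> / 2 ^ n \<le> y"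
    proof (intro always_eventually allI)
      fix n
      have "real_of_int \<lfloor>2 ^ n * y\<rfloor> / 2 ^ n \<le> 2 ^ n * y / 2 ^ n"
        by (intro divide_right_mono) auto
      then show "real_of_int \<lfloor>2 ^ n * y\<rfloor> / 2 ^ n \<le> y"
        by simp
    qed
    have "(\<lambda>n. y - (1 / 2) ^ n) \<longlonglongrightarrow> y - 0"
      by (intro tendsto_intros LIMSEQ_power_zero) auto
    then show "(\<lambda>n. y - (1 / 2) ^ n) \<longlonglongrightarrow> y"
      by simp
  qed auto
  then have "(\<lambda>i. (if odd \<lfloor>2 ^ Suc i * y\<rfloor> then 2 - 1 else 0) / 2 ^ Suc i) sums y"
    unfolding sums_def partial .
  then show ?thesis
    unfolding digits_val_def by (rule sums_unique[symmetric])
qed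


text \<open>The separating functions embed the space into a Cantor set on the line, where Helly's theorem
  applies; compactness makes the inverse of the embedding continuous up to small mass.\<close>

theorem tight_imp_weakly_convergent_subsequence:
  fixes \<mu> :: "nat \<Rightarrow> 'a::topological_space measure" and f :: "nat \<Rightarrow> 'a \<Rightarrow> real" and K :: "nat \<Rightarrow> 'a set"
  assumes f_cont: "\<And>j. continuous_on UNIV (f j)" and f_range: "\<And>j x. 0 \<le> f j x" "\<And>j x. f j x < 1"
    and sep: "\<And>x y. (\<And>j. f j x = f j y) \<Longrightarrow> x = y"
    and K: "\<And>m. seq_compact (K m)" "\<And>m. K m \<in> sets borel"
    and \<mu>: "\<And>n. prob_space (\<mu> n)" "\<And>n. sets (\<mu> n) = sets borel"
    and tight: "\<And>n m. measure (\<mu> n) (K m) \<ge> 1 - 1 / 2 ^ m"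
  shows "\<exists>r \<nu>. strict_mono r \<and> prob_space \<nu> \<and> sets \<nu> = sets borel \<and>
    weakly_converges (\<lambda>n. \<mu> (r n)) \<nu> sequentially"
proof -
  \<comment> \<open>All binary digits of all values \<open>f j x\<close> in one sequence: position
    \<open>k\<close> encodes the pair of function index and digit index.\<close>
  define bits where "bits x k = (case prod_decode k of (j, i) \<Rightarrow> odd \<lfloor>2 ^ Suc i * f j x\<rfloor>)" for x k
  define val where "val b j = digits_val 2 (\<lambda>i. b (prod_encode (j, i)))" for b j
  define e where "e x = digits_val 3 (bits x)" for x
  \<comment> \<open>\<open>S m\<close> relates a Cantor point to \<open>x\<close> through any binary
    expansions of the values \<open>f j x\<close>, not just those chosen by the floor function. The
    latter jump at dyadic values, so \<open>e\<close> need not be continuous and its image need not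
    be closed; the enlarged relation is closed over the compact set \<open>K m\<close>.\<close>
  define S where "S m = {(u, x). x \<in> K m \<and> (\<exists>b. u = digits_val 3 b \<and> (\<forall>j. val b j = f j x))}" for m
  define C where "C m = fst ` S m" for m
  define D where "D = (\<Union>m. C m)"
  define G where "G u = (if u \<in> D then THE x. \<exists>m. (u, x) \<in> S m else undefined)" for u
  have val_bits: "val (bits x) j = f j x" for x j
    using digits_val_binary[OF f_range, of j x] by (simp add: val_def bits_def)
  have eS: "(e x, x) \<in> S m" if "x \<in> K m" for x m
    using that val_bits by (auto simp: S_def e_def)
  have inj3: "b = b'" if "digits_val 3 b = digits_val 3 b'" for b b'
    using digits_val_3_inj[of b b' k k for k] that by auto
  have S_fun: "x = y" if xy: "(u, x) \<in> S m" "(u, y) \<in> S m'" for u x y m m'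
  proof (rule sep)
    fix j
    obtain b b' where "u = digits_val 3 b" "u = digits_val 3 b'" "val b j = f j x" "val b' j = f j y"
      using xy unfolding S_def by blast
    with inj3[of b b'] show "f j x = f j y"
      by simp
  qed
  have G_eq: "G u = x" if "(u, x) \<in> S m" for u x m
  proof -
    have "u \<in> D"
      using that by (force simp: D_def C_def)
    moreover have "(THE x. \<exists>m. (u, x) \<in> S m) = x"
      using that S_fun by (intro the_equality) blast+
    ultimately show ?thesis
      by (simp add: G_def)
  qed
  \<comment> \<open>Convergence of Cantor points fixes each bit eventually, because of the gaps in
    base 3. The values \<open>val\<close> then converge, and compactness of \<open>K m\<close>
    supplies the matching \<open>x\<close>.\<close>
  have S_limit: "\<exists>x r. strict_mono r \<and> (u, x) \<in> S m \<and> (\<lambda>n. xs (r n)) \<longlonglongrightarrow> x"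
    if S: "\<And>n. (us n, xs n) \<in> S m" and lim: "us \<longlonglongrightarrow> u" for us xs u m
  proof -
    obtain b where b: "\<And>n. us n = digits_val 3 (b n)" "\<And>n j. val (b n) j = f j (xs n)"
      using S unfolding S_def by simp metis
    obtain r x where r: "strict_mono r" "x \<in> K m" "(\<lambda>n. xs (r n)) \<longlonglongrightarrow> x"
    proof -
      have "\<forall>n. xs n \<in> K m"
        using S by (auto simp: S_def)
      with K(1)[of m] have "\<exists>x\<in>K m. \<exists>r. strict_mono r \<and> (xs \<circ> r) \<longlonglongrightarrow> x"
        unfolding seq_compact_def by blast
      then show ?thesis
        using that by (auto simp: o_def)
    qed
    have "\<exists>c. \<forall>\<^sub>F n in sequentially. b n k = c" for k
    proof -
      have "Cauchy us"
        using lim by (rule LIMSEQ_imp_Cauchy)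
      then obtain N where N: "\<And>n. n \<ge> N \<Longrightarrow> dist (us n) (us N) < 1 / 3 ^ Suc k"
        unfolding Cauchy_altdef2 by (metis divide_pos_pos zero_less_numeral zero_less_one zero_less_power)
      have "b n k = b N k" if "n \<ge> N" for n
        using N[OF that] b(1) by (intro digits_val_3_inj[of _ _ k]) (auto simp: dist_real_def)
      then show ?thesis
        unfolding eventually_sequentially by blast
    qed
    then obtain c where c: "\<And>k. \<forall>\<^sub>F n in sequentially. b n k = c k"
      by metis
    have "us \<longlonglongrightarrow> digits_val 3 c"
      unfolding b(1) by (intro tendsto_digits_val c) simp
    then have u: "u = digits_val 3 c"
      using lim by (rule LIMSEQ_unique[rotated])
    have "val c j = f j x" for j
    proof (rule LIMSEQ_unique)
      have "(\<lambda>n. val (b n) j) \<longlonglongrightarrow> val c j"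
        unfolding val_def by (intro tendsto_digits_val c) simp
      then show "(\<lambda>n. val (b (r n)) j) \<longlonglongrightarrow> val c j"
        using LIMSEQ_subseq_LIMSEQ[OF _ r(1)] by (auto simp: o_def)
      show "(\<lambda>n. val (b (r n)) j) \<longlonglongrightarrow> f j x"
        unfolding b(2) by (rule continuous_on_tendsto_compose[OF f_cont[of j] r(3)]) auto
    qed
    with u r(2) have "(u, x) \<in> S m"
      by (auto simp: S_def)
    with r show ?thesis
      by blast
  qed
  \<comment> \<open>In other words, \<open>G\<close> is continuous on each closed set
    \<open>C m\<close>.\<close>
  have closed_pre: "closed {u \<in> C m. G u \<in> A}" if A: "closed A" for A m
    unfolding closed_sequential_limits
  proof (intro allI impI, elim conjE)
    fix us u assume us: "\<forall>n. us n \<in> {u \<in> C m. G u \<in> A}" and lim: "us \<longlonglongrightarrow> u"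
    then have "\<exists>x. (us n, x) \<in> S m" for n
      by (force simp: C_def)
    then obtain xs where xs: "\<And>n. (us n, xs n) \<in> S m"
      by metis
    from S_limit[OF this lim] obtain x r where x: "(u, x) \<in> S m" "(\<lambda>n. xs (r n)) \<longlonglongrightarrow> x"
      by blast
    have "xs n \<in> A" for n
      using us G_eq[OF xs] by auto
    then have "x \<in> A"
      by (intro Lim_in_closed_set[OF A _ _ x(2)]) auto
    with x G_eq[OF x(1)] show "u \<in> {u \<in> C m. G u \<in> A}"
      by (force simp: C_def)
  qed
  have closed_C: "closed (C m)" for m
    using closed_pre[of UNIV m] by simp
  have D_borel [measurable]: "D \<in> sets borel"
    unfolding D_def using closed_C by auto
  have G_meas [measurable]: "G \<in> borel_measurable borel"
  proof (rule measurable_sigma_sets[OF borel_eq_sigma_closed])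
    fix A :: "'a set" assume "A \<in> {C. closed C \<and> C \<noteq> {}}"
    then have "closed A"
      by simp
    have "G -` A = (\<Union>m. {u \<in> C m. G u \<in> A}) \<union> (if undefined \<in> A then - D else {})"
    proof (intro set_eqI)
      fix u
      have "u \<notin> D \<Longrightarrow> G u = undefined"
        by (simp add: G_def)
      then show "u \<in> G -` A \<longleftrightarrow> u \<in> (\<Union>m. {u \<in> C m. G u \<in> A}) \<union> (if undefined \<in> A then - D else {})"
        by (cases "u \<in> D") (auto simp: D_def)
    qed
    also have "\<dots> \<in> sets borel"
      using closed_pre[OF \<open>closed A\<close>] by (intro sets.Un sets.countable_UN) auto
    finally show "G -` A \<inter> space borel \<in> sets borel"
      by simp
  qed auto
  have e_meas [measurable]: "e \<in> borel_measurable borel"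
  proof -
    have [measurable]: "f j \<in> borel_measurable borel" for j
      by (intro borel_measurable_continuous_onI f_cont)
    have "(\<lambda>x. (if bits x k then 3 - 1 else 0) / 3 ^ Suc k) \<in> borel_measurable (borel :: 'a measure)" for k
      unfolding bits_def by (cases "prod_decode k") simp
    then show ?thesis
      unfolding e_def digits_val_def by measurable
  qed
  have e_meas' [measurable]: "e \<in> borel_measurable (\<mu> n)" for n
    using e_meas \<mu>(2) by (simp cong: measurable_cong_sets)
  define P where "P n = distr (\<mu> n) borel e" for n
  have real_P: "real_distribution (P n)" for n
    unfolding P_def by (intro prob_space.real_distribution_distr \<mu>) measurable
  \<comment> \<open>Tightness on the line is trivial, as the images lie in the unit interval; the
    sets \<open>K m\<close> serve to come back from the line.\<close>
  have "tight P"
    unfolding tight_def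
  proof (intro conjI allI impI real_P)
    fix \<epsilon> :: real assume "\<epsilon> > 0"
    have "measure (P n) {-1<..1} = 1" for n
    proof -
      have "e -` {-1<..1} \<inter> space (\<mu> n) = space (\<mu> n)"
      proof -
        have "-1 < e x" "e x \<le> 1" for x
          using digits_val_range[of 3 "bits x"] by (simp_all add: e_def)
        then show ?thesis
          by auto
      qed
      then show ?thesis
        using prob_space.prob_space[OF \<mu>(1)[of n]] unfolding P_def by (subst measure_distr) auto
    qed
    with \<open>\<epsilon> > 0\<close> show "\<exists>a b. a < b \<and> (\<forall>n. measure (P n) {a<..b} > 1 - \<epsilon>)"
      by (intro exI[of _ "-1"] exI[of _ 1]) simp
  qed
  from tight_imp_convergent_subsubsequence[OF this strict_mono_id]
  obtain r M where r: "strict_mono r" "real_distribution M" "weak_conv_m (\<lambda>n. P (r n)) M"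
    by (auto simp: o_def)
  interpret M: real_distribution M
    by fact
  have conv: "(\<lambda>n. integral\<^sup>L (P (r n)) h) \<longlonglongrightarrow> integral\<^sup>L M h"
    if "continuous_on UNIV h" "\<And>x. \<bar>h x\<bar> \<le> B" for h :: "real \<Rightarrow> real" and B
    using that by (intro weak_conv_imp_integral_bdd_continuous_conv[OF _ r(2,3), of h B] real_P)
      (auto simp: continuous_on_eq_continuous_at)
  \<comment> \<open>The limit law on the line is transported back by the inverse \<open>G\<close> of
    the embedding.\<close>
  define \<nu> where "\<nu> = distr M borel G"
  have \<nu>: "prob_space \<nu>" "sets \<nu> = sets borel"
    unfolding \<nu>_def by (auto intro: M.prob_space_distr)
  have PC: "measure (P n) (C m) \<ge> 1 - 1 / 2 ^ m" for n m
  proof -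
    interpret prob_space "\<mu> n"
      by (rule \<mu>)
    have "measure (\<mu> n) (K m) \<le> measure (\<mu> n) (e -` C m \<inter> space (\<mu> n))"
    proof (rule finite_measure_mono)
      show "K m \<subseteq> e -` C m \<inter> space (\<mu> n)"
        using eS sets_eq_imp_space_eq[OF \<mu>(2)] by (force simp: C_def)
      show "e -` C m \<inter> space (\<mu> n) \<in> events"
        using closed_C[of m] by measurable
    qed
    then show ?thesis
      unfolding P_def using tight[of m n] closed_C[of m] by (subst measure_distr) auto
  qed
  \<comment> \<open>The portmanteau inequality for the closed set \<open>C m\<close>: bumps dominate
    its indicator, and their integrals pass to the limit.\<close>
  have MC: "measure M (C m) \<ge> 1 - 1 / 2 ^ m" for m
  proof (cases "C m = {}")
    case False
    have "integral\<^sup>L M (bump l (C m)) \<ge> 1 - 1 / 2 ^ m" for l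
    proof (rule LIMSEQ_le_const[OF conv[OF continuous_on_bump abs_bump_le]], intro exI allI impI)
      fix n
      interpret Pn: real_distribution "P (r n)"
        by (rule real_P)
      have "measure (P (r n)) (C m) = integral\<^sup>L (P (r n)) (indicator (C m))"
        using closed_C[of m] by simp
      also have "\<dots> \<le> integral\<^sup>L (P (r n)) (bump l (C m))"
        using closed_C[of m] bump_in[of _ "C m" l] bump_range[of l "C m"] abs_bump_le[of l "C m"]
        by (intro integral_mono Pn.integrable_const_bound[of _ 1]) (auto simp: indicator_def)
      finally show "1 - 1 / 2 ^ m \<le> integral\<^sup>L (P (r n)) (bump l (C m))"
        using PC[of m "r n"] by simp
    qed
    moreover have "(\<lambda>l. integral\<^sup>L M (bump l (C m))) \<longlonglongrightarrow> (\<integral>x. indicator (C m) x \<partial>M)"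
      by (rule integral_dominated_convergence[where w = "\<lambda>_. 1"])
        (use closed_C[of m] tendsto_bump[OF closed_C False] in \<open>auto simp: abs_bump_le\<close>)
    ultimately have "1 - 1 / 2 ^ m \<le> (\<integral>x. indicat_real (C m) x \<partial>M)"
      by (intro LIMSEQ_le_const) auto
    then show ?thesis
      using closed_C[of m] by simp
  next
    case True
    with PC[of m 0] show ?thesis
      by simp
  qed
  have "weakly_converges (\<lambda>n. \<mu> (r n)) \<nu> sequentially"
    unfolding weakly_converges_def
  proof (intro allI impI, elim conjE)
    fix F :: "'a \<Rightarrow> real" assume F: "continuous_on UNIV F" and "bounded (range F)"
    then obtain B where B: "\<And>x. \<bar>F x\<bar> \<le> B"
      unfolding bounded_iff by auto
    then have B0: "B \<ge> 0"
      using order_trans[OF abs_ge_zero] by blast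
    have F_meas [measurable]: "F \<in> borel_measurable borel"
      by (intro borel_measurable_continuous_onI F)
    \<comment> \<open>The composition of \<open>F\<close> with \<open>G\<close> is known to be
      continuous only on \<open>C m\<close>; Tietze's theorem extends it to the line with the same
      bound.\<close>
    have approx: "\<exists>h. continuous_on UNIV h \<and> (\<forall>u. \<bar>h u\<bar> \<le> B) \<and> (\<forall>u\<in>C m. h u = F (G u))" for m
    proof -
      have "continuous_on (C m) (\<lambda>u. F (G u))"
        unfolding continuous_on_closed_vimage[OF closed_C]
      proof (intro allI impI)
        fix A :: "real set" assume "closed A"
        then have "closed {u \<in> C m. G u \<in> F -` A}"
          by (intro closed_pre closed_vimage F)
        then show "closed ((\<lambda>u. F (G u)) -` A \<inter> C m)"
          by (auto simp: vimage_def Collect_conj_eq Int_commute)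
      qed
      then show ?thesis
        using Tietze[of "C m" "\<lambda>u. F (G u)" UNIV B] closed_C[of m] B B0 by (metis UNIV_I closed_closedin
          subtopology_UNIV real_norm_def)
    qed
    have small: "\<bar>(\<integral>x. p x \<partial>L) - (\<integral>x. q x \<partial>L)\<bar> \<le> 2 * B / 2 ^ m"
      if L: "prob_space L" and [measurable]: "p \<in> borel_measurable L" "q \<in> borel_measurable L"
        and bd: "\<And>x. \<bar>p x\<bar> \<le> B" "\<And>x. \<bar>q x\<bar> \<le> B"
        and A: "A \<in> sets L" "measure L A \<ge> 1 - 1 / 2 ^ m" "\<And>x. x \<in> A \<Longrightarrow> p x = q x"
      for L :: "'b measure" and p q :: "'b \<Rightarrow> real" and A m
    proof -
      interpret L: prob_space L
        by fact
      have int: "integrable L p" "integrable L q"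
        using bd by (auto intro!: L.integrable_const_bound[of _ B])
      have "integrable L (indicat_real (space L - A))"
        using A(1) by (intro L.integrable_const_bound[of _ 1] borel_measurable_indicator) (auto simp: indicator_def)
      then have int': "integrable L (\<lambda>x. 2 * B * indicat_real (space L - A) x)"
        by (rule integrable_mult_right)
      have "\<bar>(\<integral>x. p x \<partial>L) - (\<integral>x. q x \<partial>L)\<bar> = \<bar>\<integral>x. p x - q x \<partial>L\<bar>"
        using int by simp
      also have "\<dots> \<le> (\<integral>x. \<bar>p x - q x\<bar> \<partial>L)"
        by (rule integral_abs_bound)
      also have "\<dots> \<le> (\<integral>x. 2 * B * indicator (space L - A) x \<partial>L)"
      proof (rule integral_mono)
        show "\<bar>p x - q x\<bar> \<le> 2 * B * indicator (space L - A) x" if "x \<in> space L" for x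
          using that A(3)[of x] bd(1)[of x] bd(2)[of x] by (auto simp: indicator_def)
      qed (use int int' in auto)
      also have "\<dots> = 2 * B * (1 - measure L A)"
        using A(1) by (simp add: L.prob_compl)
      also have "\<dots> \<le> 2 * B * (1 / 2 ^ m)"
        using A(2) B0 by (intro mult_left_mono) auto
      finally show ?thesis
        by simp
    qed
    show "(\<lambda>n. \<integral>x. F x \<partial>\<mu> (r n)) \<longlonglongrightarrow> (\<integral>x. F x \<partial>\<nu>)"
    proof (rule LIMSEQ_I)
      fix \<epsilon> :: real assume "\<epsilon> > 0"
      \<comment> \<open>Replacing \<open>F\<close> by \<open>h\<close> costs
        \<open>2 * B / 2 ^ m\<close> twice, once for \<open>\<mu> n\<close> and once for the
        limit.\<close>
      then obtain m where m: "4 * B * (1 / 2) ^ m < \<epsilon> / 2"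
      proof -
        have "(\<lambda>m. 4 * B * (1 / 2) ^ m) \<longlonglongrightarrow> 4 * B * 0"
          by (intro tendsto_intros LIMSEQ_power_zero) auto
        then have "\<forall>\<^sub>F m in sequentially. 4 * B * (1 / 2) ^ m < \<epsilon> / 2"
          using \<open>\<epsilon> > 0\<close> by (intro order_tendstoD) auto
        then show ?thesis
          using that by (auto simp: eventually_sequentially)
      qed
      obtain h where h: "continuous_on UNIV h" "\<And>u. \<bar>h u\<bar> \<le> B" "\<And>u. u \<in> C m \<Longrightarrow> h u = F (G u)"
        using approx[of m] by blast
      have [measurable]: "h \<in> borel_measurable borel"
        by (intro borel_measurable_continuous_onI h)
      have F_meas' [measurable]: "F \<in> borel_measurable (\<mu> n)" for n
        using F_meas \<mu>(2) by (simp cong: measurable_cong_sets)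
      have 1: "\<bar>(\<integral>x. F x \<partial>\<mu> n) - (\<integral>u. h u \<partial>P n)\<bar> \<le> 2 * B / 2 ^ m" for n
      proof -
        have "(\<integral>u. h u \<partial>P n) = (\<integral>x. h (e x) \<partial>\<mu> n)"
          unfolding P_def by (rule integral_distr) measurable
        moreover have "h (e x) = F x" if "x \<in> K m" for x
          using h(3)[of "e x"] G_eq[OF eS[OF that]] eS[OF that] by (force simp: C_def)
        ultimately show ?thesis
          using small[OF \<mu>(1)[of n], of F "\<lambda>x. h (e x)" "K m" m] B h(2) K(2) \<mu>(2) tight by auto
      qed
      have 2: "\<bar>(\<integral>x. F x \<partial>\<nu>) - (\<integral>u. h u \<partial>M)\<bar> \<le> 2 * B / 2 ^ m"
      proof -
        have "(\<integral>x. F x \<partial>\<nu>) = (\<integral>u. F (G u) \<partial>M)"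
          unfolding \<nu>_def by (rule integral_distr) auto
        then show ?thesis
          using small[OF M.prob_space_axioms, of "\<lambda>u. F (G u)" h "C m" m] B h(2,3) closed_C MC by auto
      qed
      from LIMSEQ_D[OF conv[OF h(1,2)], of "\<epsilon> / 2"] \<open>\<epsilon> > 0\<close> obtain N where
        N: "\<And>n. n \<ge> N \<Longrightarrow> \<bar>(\<integral>u. h u \<partial>P (r n)) - (\<integral>u. h u \<partial>M)\<bar> < \<epsilon> / 2"
        by auto
      have "\<bar>(\<integral>x. F x \<partial>\<mu> (r n)) - (\<integral>x. F x \<partial>\<nu>)\<bar> < \<epsilon>" if "n \<ge> N" for n
      proof -
        have "4 * B * (1 / 2) ^ m = 2 * (2 * B / 2 ^ m)"
          by (simp add: power_divide)
        with 1[of "r n"] 2 N[OF that] m show ?thesis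
          by linarith
      qed
      then show "\<exists>N. \<forall>n\<ge>N. norm ((\<integral>x. F x \<partial>\<mu> (r n)) - (\<integral>x. F x \<partial>\<nu>)) < \<epsilon>"
        by auto
    qed
  qed
  with r(1) \<nu> show ?thesis
    by blast
qed

section \<open>Brownian motion and its heat semigroup\<close>

locale filtered_bm =
  fixes M :: "'w measure" and F :: "real \<Rightarrow> 'w measure" and W :: "real \<Rightarrow> 'w \<Rightarrow> 'a::euclidean_space"
  assumes fil: "filtered_prob_space M F" and bm: "brownian_motion M F W"
begin

sublocale prob_space M
  using fil by (simp add: filtered_prob_space_def)

lemma sub: "subalgebra M (F t)"
  using fil by (simp add: filtered_prob_space_def)

lemma space_F: "space (F t) = space M"
  using sub[of t] by (simp add: subalgebra_def)

lemma F_mono: "s \<le> t \<Longrightarrow> sets (F s) \<subseteq> sets (F t)"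
  using fil by (auto simp: filtered_prob_space_def filtration_def)

lemma measurable_F_mono: "X \<in> measurable (F s) N \<Longrightarrow> s \<le> t \<Longrightarrow> X \<in> measurable (F t) N"
  by (rule measurable_from_subalg[of "F t" "F s"]) (auto simp: subalgebra_def space_F F_mono[THEN subsetD])

lemma measurable_F_M: "X \<in> measurable (F s) N \<Longrightarrow> X \<in> measurable M N"
  by (rule measurable_from_subalg[OF sub])

lemma W_F: "t \<ge> 0 \<Longrightarrow> W t \<in> borel_measurable (F t)"
  using bm by (simp add: brownian_motion_def adapted_def)

lemma W_M: "t \<ge> 0 \<Longrightarrow> W t \<in> borel_measurable M"
  by (rule measurable_F_M[OF W_F])

lemma distr_increment:
  assumes "0 \<le> u" "u < v"
  shows "distr M borel (\<lambda>\<omega>. W v \<omega> - W u \<omega>) = gauss (v - u)"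
proof -
  have "distributed M lborel (\<lambda>\<omega>. W v \<omega> - W u \<omega>)
      (\<lambda>x. ennreal (\<Prod>b\<in>Basis. normal_density 0 (sqrt (v - u)) (x \<bullet> b)))"
    using bm assms by (auto simp: brownian_motion_def)
  then have "distr M lborel (\<lambda>\<omega>. W v \<omega> - W u \<omega>) = gauss (v - u)"
    by (simp add: distributed_def gauss_def)
  moreover have "distr M lborel (\<lambda>\<omega>. W v \<omega> - W u \<omega>) = distr M borel (\<lambda>\<omega>. W v \<omega> - W u \<omega>)"
    by (rule distr_cong) auto
  ultimately show ?thesis
    by simp
qed

text \<open>Conditioning on the past: the increment may be integrated out with the past frozen.\<close>

lemma freeze:
  fixes h :: "'b \<times> 'a \<Rightarrow> real"
  assumes uv: "0 \<le> u" "u < v" and Y: "Y \<in> measurable (F u) N"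
    and h [measurable]: "h \<in> borel_measurable (N \<Otimes>\<^sub>M borel)" and bd: "\<And>p. \<bar>h p\<bar> \<le> c"
  shows "(\<integral>\<omega>. h (Y \<omega>, W v \<omega> - W u \<omega>) \<partial>M) = (\<integral>\<omega>. (\<integral>z. h (Y \<omega>, z) \<partial>gauss (v - u)) \<partial>M)"
proof -
  let ?D = "\<lambda>\<omega>. W v \<omega> - W u \<omega>"
  have [measurable]: "Y \<in> measurable M N"
    by (rule measurable_F_M[OF Y])
  have [measurable]: "?D \<in> borel_measurable M"
    using uv by (intro borel_measurable_diff W_M) auto
  have ind: "indep_set (sets (F u)) (sets (vimage_algebra (space M) ?D borel))"
    using bm uv by (auto simp: brownian_motion_def)
  interpret G: prob_space "gauss (v - u) :: 'a measure"
    using uv by (intro prob_space_gauss) simp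
  interpret D: prob_space "distr M N Y"
    by (rule prob_space_distr) measurable
  \<comment> \<open>Independence, checked on rectangles, says that the joint law of past and
    increment is a product; Fubini's theorem does the rest.\<close>
  have eq: "distr M N Y \<Otimes>\<^sub>M gauss (v - u) = distr M (N \<Otimes>\<^sub>M borel) (\<lambda>\<omega>. (Y \<omega>, ?D \<omega>))"
  proof (rule pair_measure_eqI)
    fix A and B :: "'a set" assume A: "A \<in> sets (distr M N Y)" and B: "B \<in> sets (gauss (v - u))"
    have [measurable]: "A \<in> sets N" "B \<in> sets borel"
      using A B by auto
    have "Y -` A \<inter> space M \<in> sets (F u)"
      using measurable_sets[OF Y] A space_F[of u] by auto
    moreover have "?D -` B \<inter> space M \<in> sets (vimage_algebra (space M) ?D borel)"
      by (intro in_vimage_algebra) simp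
    ultimately have "prob ((Y -` A \<inter> space M) \<inter> (?D -` B \<inter> space M)) =
        prob (Y -` A \<inter> space M) * prob (?D -` B \<inter> space M)"
      by (rule indep_setD[OF ind])
    moreover have "(\<lambda>\<omega>. (Y \<omega>, ?D \<omega>)) -` (A \<times> B) \<inter> space M = (Y -` A \<inter> space M) \<inter> (?D -` B \<inter> space M)"
      by auto
    ultimately show "emeasure (distr M N Y) A * emeasure (gauss (v - u)) B =
        emeasure (distr M (N \<Otimes>\<^sub>M borel) (\<lambda>\<omega>. (Y \<omega>, ?D \<omega>))) (A \<times> B)"
      unfolding distr_increment[OF uv, symmetric]
      by (simp add: emeasure_distr emeasure_eq_measure ennreal_mult)
  qed (simp_all add: D.sigma_finite_measure_axioms G.sigma_finite_measure_axioms cong: sets_pair_measure_cong)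
  interpret pair_prob_space "distr M N Y" "gauss (v - u) :: 'a measure" ..
  have [measurable]: "h \<in> borel_measurable (distr M N Y \<Otimes>\<^sub>M gauss (v - u))"
    by measurable
  have int: "integrable (distr M N Y \<Otimes>\<^sub>M gauss (v - u)) h"
    using bd by (intro P.integrable_const_bound[of _ c]) auto
  have "(\<integral>\<omega>. h (Y \<omega>, ?D \<omega>) \<partial>M) = integral\<^sup>L (distr M N Y \<Otimes>\<^sub>M gauss (v - u)) h"
    unfolding eq by (rule integral_distr[symmetric]) measurable
  also have "\<dots> = (\<integral>y. (\<integral>z. h (y, z) \<partial>gauss (v - u)) \<partial>distr M N Y)"
    by (rule integral_fst'[OF int, symmetric])
  also have "\<dots> = (\<integral>\<omega>. (\<integral>z. h (Y \<omega>, z) \<partial>gauss (v - u)) \<partial>M)"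
    by (rule integral_distr) measurable
  finally show ?thesis .
qed

lemma integral_increment:
  fixes f :: "'a \<Rightarrow> real"
  assumes "0 \<le> u" "u < v" and [measurable]: "f \<in> borel_measurable borel"
  shows "(\<integral>\<omega>. f (W v \<omega> - W u \<omega>) \<partial>M) = (\<integral>z. f z \<partial>gauss (v - u))"
  unfolding distr_increment[OF assms(1,2), symmetric]
  using W_M assms(1,2) by (intro integral_distr[symmetric]) auto

lemma heat_freeze:
  fixes g :: "'a \<Rightarrow> real"
  assumes uv: "0 \<le> u" "u < v" and Z: "Z \<in> borel_measurable (F u)" "\<And>\<omega>. \<bar>Z \<omega>\<bar> \<le> 1"
    and Y: "Y \<in> borel_measurable (F u)"
    and g [measurable]: "g \<in> borel_measurable borel" and bd: "\<And>x. \<bar>g x\<bar> \<le> c"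
  shows "(\<integral>\<omega>. Z \<omega> * g (Y \<omega> + \<sigma> *\<^sub>R (W v \<omega> - W u \<omega>)) \<partial>M) = (\<integral>\<omega>. Z \<omega> * heat \<sigma> (v - u) g (Y \<omega>) \<partial>M)"
proof -
  \<comment> \<open>\<open>freeze\<close> wants a function bounded for all arguments, whereas only
    the values of \<open>Z\<close> are bounded; clamping leaves these unchanged.\<close>
  define cl where "cl x = max (-1) (min 1 x)" for x :: real
  have cl: "cl (Z \<omega>) = Z \<omega>" and cl1: "\<bar>cl x\<bar> \<le> 1" for \<omega> x
    using Z(2)[of \<omega>] by (auto simp: cl_def max_def min_def)
  have [measurable]: "cl \<in> borel_measurable borel"
    unfolding cl_def by measurable
  define h where "h p = (case p of ((z, y), w) \<Rightarrow> cl z * g (y + \<sigma> *\<^sub>R w))" for p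
  have h: "h \<in> borel_measurable ((borel \<Otimes>\<^sub>M borel) \<Otimes>\<^sub>M borel)"
    unfolding h_def by measurable
  have "\<bar>cl z * g x\<bar> \<le> 1 * c" for z x
    unfolding abs_mult using cl1 bd by (intro mult_mono) auto
  then have "\<bar>h p\<bar> \<le> c" for p
    by (auto simp: h_def split: prod.split)
  from freeze[OF uv _ h this, of "\<lambda>\<omega>. (Z \<omega>, Y \<omega>)"]
  have "(\<integral>\<omega>. h ((Z \<omega>, Y \<omega>), W v \<omega> - W u \<omega>) \<partial>M) =
      (\<integral>\<omega>. (\<integral>z. h ((Z \<omega>, Y \<omega>), z) \<partial>gauss (v - u)) \<partial>M)"
    using Z(1) Y by (auto intro: measurable_Pair)
  then show ?thesis
    by (simp add: h_def cl heat_def)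
qed

text \<open>Read off from Brownian motion by splitting its increment at time \<open>a\<close>, which
  avoids convolving Gaussian densities.\<close>

lemma heat_heat:
  fixes f :: "'a \<Rightarrow> real"
  assumes "a > 0" "c > 0" and f [measurable]: "f \<in> borel_measurable borel" and bd: "\<And>x. \<bar>f x\<bar> \<le> C"
  shows "heat \<sigma> a (heat \<sigma> c f) x = heat \<sigma> (a + c) f x"
proof -
  have [measurable]: "heat \<sigma> t f \<in> borel_measurable borel" if "t > 0" for t
  proof -
    interpret G: prob_space "gauss t :: 'a measure"
      by (rule prob_space_gauss[OF that])
    show ?thesis
      unfolding heat_def by measurable
  qed
  have "heat \<sigma> (a + c) f x = (\<integral>\<omega>. f (x + \<sigma> *\<^sub>R (W (a + c) \<omega> - W 0 \<omega>)) \<partial>M)"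
    using assms integral_increment[of 0 "a + c" "\<lambda>z. f (x + \<sigma> *\<^sub>R z)"] by (simp add: heat_def)
  also have "\<dots> = (\<integral>\<omega>. 1 * f ((x + \<sigma> *\<^sub>R (W a \<omega> - W 0 \<omega>)) + \<sigma> *\<^sub>R (W (a + c) \<omega> - W a \<omega>)) \<partial>M)"
    by (simp add: algebra_simps)
  also have "\<dots> = (\<integral>\<omega>. 1 * heat \<sigma> (a + c - a) f (x + \<sigma> *\<^sub>R (W a \<omega> - W 0 \<omega>)) \<partial>M)"
    using assms W_F[of a] measurable_F_mono[OF W_F[of 0], of a] by (intro heat_freeze[OF _ _ _ _ _ f bd]) auto
  also have "\<dots> = (\<integral>z. heat \<sigma> c f (x + \<sigma> *\<^sub>R z) \<partial>gauss a)"
    using assms integral_increment[of 0 a "\<lambda>z. heat \<sigma> c f (x + \<sigma> *\<^sub>R z)"] by simp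
  finally show ?thesis
    by (simp add: heat_def)
qed

text \<open>The law of an increment depends only on its length, so a violating sequence of intervals
  may be moved to start at 0, where path continuity and dominated convergence contradict it. This
  makes \<open>h\<close> independent of \<open>u\<close>.\<close>

lemma small_increments:
  assumes "\<eta> > 0"
  shows "\<exists>h>0. \<forall>u v. 0 \<le> u \<and> u < v \<and> v < u + h \<longrightarrow> (\<integral>\<omega>. min 1 (norm (W v \<omega> - W u \<omega>)) \<partial>M) \<le> \<eta>"
proof (rule ccontr)
  let ?\<phi> = "\<lambda>z::'a. min 1 (norm z)"
  assume "\<not> ?thesis"
  then have "\<exists>u v. 0 \<le> u \<and> u < v \<and> v < u + 1 / real (Suc n) \<and> \<eta> < (\<integral>\<omega>. ?\<phi> (W v \<omega> - W u \<omega>) \<partial>M)" for n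
    by (simp only: not_ex not_all not_imp not_le de_Morgan_conj conj_assoc) (meson of_nat_0_less_iff zero_less_Suc zero_less_divide_1_iff)
  then obtain u v where uv: "\<And>n. 0 \<le> u n" "\<And>n. u n < v n" "\<And>n. v n < u n + 1 / real (Suc n)"
      "\<And>n. \<eta> < (\<integral>\<omega>. ?\<phi> (W (v n) \<omega> - W (u n) \<omega>) \<partial>M)"
    by metis
  define h where "h n = v n - u n" for n
  have h: "h n > 0" "h n < 1 / real (Suc n)" for n
    using uv(2,3)[of n] by (auto simp: h_def)
  have h0: "h \<longlonglongrightarrow> 0"
  proof (rule real_tendsto_sandwich)
    show "\<forall>\<^sub>F n in sequentially. 0 \<le> h n" "\<forall>\<^sub>F n in sequentially. h n \<le> 1 / real (Suc n)"
      using h by (intro always_eventually allI less_imp_le; blast)+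
    show "(\<lambda>n. 1 / real (Suc n)) \<longlonglongrightarrow> 0"
      by (rule LIMSEQ_Suc[OF lim_1_over_n])
  qed simp
  have eq: "(\<integral>\<omega>. ?\<phi> (W (v n) \<omega> - W (u n) \<omega>) \<partial>M) = (\<integral>\<omega>. ?\<phi> (W (h n) \<omega> - W 0 \<omega>) \<partial>M)" for n
    using integral_increment[of "u n" "v n" ?\<phi>] integral_increment[of 0 "h n" ?\<phi>] uv(1,2)[of n] h(1)[of n]
    by (simp add: h_def)
  have "(\<lambda>n. \<integral>\<omega>. ?\<phi> (W (h n) \<omega> - W 0 \<omega>) \<partial>M) \<longlonglongrightarrow> (\<integral>\<omega>. 0 \<partial>M)"
  proof (rule integral_dominated_convergence[where w = "\<lambda>_. 1"])
    show "(\<lambda>\<omega>. ?\<phi> (W (h n) \<omega> - W 0 \<omega>)) \<in> borel_measurable M" for n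
      using W_M[of "h n"] W_M[of 0] h(1)[of n] by (auto intro!: borel_measurable_min borel_measurable_norm)
    have "AE \<omega> in M. continuous_on {0..} (\<lambda>t. W t \<omega>)"
      using bm by (simp add: brownian_motion_def)
    then show "AE \<omega> in M. (\<lambda>n. ?\<phi> (W (h n) \<omega> - W 0 \<omega>)) \<longlonglongrightarrow> 0"
    proof eventually_elim
      case (elim \<omega>)
      have "(\<lambda>n. W (h n) \<omega>) \<longlonglongrightarrow> W 0 \<omega>"
        using less_imp_le[OF h(1)] by (intro continuous_on_tendsto_compose[OF elim h0] always_eventually) auto
      then have "(\<lambda>n. ?\<phi> (W (h n) \<omega> - W 0 \<omega>)) \<longlonglongrightarrow> ?\<phi> (W 0 \<omega> - W 0 \<omega>)"
        by (intro tendsto_intros)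
      then show ?case
        by simp
    qed
  qed auto
  then have "(\<lambda>n. \<integral>\<omega>. ?\<phi> (W (h n) \<omega> - W 0 \<omega>) \<partial>M) \<longlonglongrightarrow> 0"
    by simp
  from order_tendstoD(2)[OF this assms] obtain n where "(\<integral>\<omega>. ?\<phi> (W (h n) \<omega> - W 0 \<omega>) \<partial>M) < \<eta>"
    by (auto simp: eventually_sequentially)
  with uv(4)[of n] eq[of n] show False
    by simp
qed

end

text \<open>\<open>L\<close> is a set of periods: \<open>int_lattice\<close> for functions that live
  on the torus, \<open>{}\<close> for no periodicity.\<close>

definition tfun :: "'a::euclidean_space set \<Rightarrow> ('a \<Rightarrow> real) \<Rightarrow> bool" where
  "tfun L f \<longleftrightarrow> uniformly_continuous_on UNIV f \<and> (\<forall>x. \<bar>f x\<bar> \<le> 1) \<and> (\<forall>k\<in>L. \<forall>x. f (x + k) = f x)"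

lemma tfun_measurable: "tfun L f \<Longrightarrow> f \<in> borel_measurable borel"
  by (intro borel_measurable_continuous_onI uniformly_continuous_imp_continuous) (simp add: tfun_def)

lemma tfun_abs: "tfun L f \<Longrightarrow> \<bar>f x\<bar> \<le> 1"
  by (simp add: tfun_def)

lemma uniformly_continuous_bounded_mult:
  fixes f g :: "'a::metric_space \<Rightarrow> real"
  assumes "uniformly_continuous_on UNIV f" "uniformly_continuous_on UNIV g"
    and "\<And>x. \<bar>f x\<bar> \<le> 1" "\<And>x. \<bar>g x\<bar> \<le> 1"
  shows "uniformly_continuous_on UNIV (\<lambda>x. f x * g x)"
  unfolding uniformly_continuous_on_def
proof (intro allI impI)
  fix e :: real assume "e > 0"
  then obtain d d' where d: "d > 0" "\<And>x y. dist y x < d \<Longrightarrow> dist (f y) (f x) < e / 2"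
      and d': "d' > 0" "\<And>x y. dist y x < d' \<Longrightarrow> dist (g y) (g x) < e / 2"
    using assms(1,2) unfolding uniformly_continuous_on_def by (metis UNIV_I half_gt_zero)
  have "dist (f y * g y) (f x * g x) < e" if "dist y x < min d d'" for x y
  proof -
    have "f y * g y - f x * g x = (f y - f x) * g y + f x * (g y - g x)"
      by (simp add: algebra_simps)
    then have "\<bar>f y * g y - f x * g x\<bar> \<le> \<bar>f y - f x\<bar> * \<bar>g y\<bar> + \<bar>f x\<bar> * \<bar>g y - g x\<bar>"
      by (metis abs_mult abs_triangle_ineq)
    also have "\<dots> \<le> \<bar>f y - f x\<bar> * 1 + 1 * \<bar>g y - g x\<bar>"
      using assms(3,4) by (intro add_mono mult_mono) auto
    also have "\<dots> < e"
      using d(2)[of y x] d'(2)[of y x] that by (simp add: dist_real_def)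
    finally show ?thesis
      by (simp add: dist_real_def)
  qed
  then show "\<exists>d>0. \<forall>x\<in>UNIV. \<forall>y\<in>UNIV. dist y x < d \<longrightarrow> dist (f y * g y) (f x * g x) < e"
    using d(1) d'(1) by (intro exI[of _ "min d d'"]) auto
qed

lemma tfun_mult: "tfun L f \<Longrightarrow> tfun L g \<Longrightarrow> tfun L (\<lambda>x. f x * g x)"
  unfolding tfun_def
  by (auto intro!: uniformly_continuous_bounded_mult simp: abs_mult intro: mult_le_one)

lemma tfun_heat:
  assumes f: "tfun L f" and t: "t > 0" and \<sigma>: "\<sigma> > 0"
  shows "tfun L (heat \<sigma> t f)"
  unfolding tfun_def
proof (intro conjI allI ballI)
  note m = tfun_measurable[OF f] and bd = tfun_abs[OF f]
  have "(2 / (\<sigma> * sqrt t))-lipschitz_on UNIV (heat \<sigma> t f)"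
    using heat_lipschitz[OF t \<sigma> m bd] t \<sigma> by (intro lipschitz_onI) (auto simp: dist_real_def dist_norm)
  then show "uniformly_continuous_on UNIV (heat \<sigma> t f)"
    by (rule lipschitz_on_uniformly_continuous)
  show "\<bar>heat \<sigma> t f x\<bar> \<le> 1" for x
    by (rule abs_heat_le[OF t m bd])
  show "heat \<sigma> t f (x + k) = heat \<sigma> t f x" if "k \<in> L" for k x
  proof -
    have "f (x + k + \<sigma> *\<^sub>R z) = f (x + \<sigma> *\<^sub>R z)" for z
      using f that by (simp add: tfun_def add.assoc add.commute[of k] flip: add.assoc)
        (metis add.assoc add.commute)
    then show ?thesis
      by (simp add: heat_def)
  qed
qed

section \<open>Processes with drift\<close>

text \<open>Joint measurability in time and outcome, needed for Fubini's theorem in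
  \<open>J_approx\<close>: the process is the limit of its step discretisations of mesh
  \<open>1 / real (Suc n)\<close>. The expression \<open>max 0 t\<close> extends it to negative
  times.\<close>

lemma measurable_continuous_process:
  fixes X :: "real \<Rightarrow> 'w \<Rightarrow> 'a::{metric_space, second_countable_topology}"
  assumes cont: "\<And>\<omega>. \<omega> \<in> space M \<Longrightarrow> continuous_on {0..} (\<lambda>t. X t \<omega>)"
    and meas: "\<And>t. t \<ge> 0 \<Longrightarrow> X t \<in> borel_measurable M"
  shows "(\<lambda>(t, \<omega>). X (max 0 t) \<omega>) \<in> borel_measurable (borel \<Otimes>\<^sub>M M)"
proof (rule borel_measurable_LIMSEQ_metric)
  let ?k = "\<lambda>n t. nat \<lfloor>real (Suc n) * max 0 t\<rfloor>"
  show "(\<lambda>(t, \<omega>). X (real (?k n t) / real (Suc n)) \<omega>) \<in> borel_measurable (borel \<Otimes>\<^sub>M M)" for n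
  proof -
    have "(\<lambda>p. X (real (?k n (fst p)) / real (Suc n)) (snd p)) \<in> borel_measurable (borel \<Otimes>\<^sub>M M)"
    proof (rule measurable_compose_countable[where g = "\<lambda>p. ?k n (fst p)"])
      fix i :: nat
      show "(\<lambda>p. X (real i / real (Suc n)) (snd p)) \<in> borel_measurable (borel \<Otimes>\<^sub>M M)"
        by (rule measurable_compose[OF measurable_snd meas]) simp
    qed measurable
    then show ?thesis
      by (simp add: case_prod_beta)
  qed
  fix p :: "real \<times> 'w" assume "p \<in> space (borel \<Otimes>\<^sub>M M)"
  then obtain t \<omega> where p: "p = (t, \<omega>)" "\<omega> \<in> space M"
    by (auto simp: space_pair_measure)
  define s where "s = max 0 t"
  have s: "s \<ge> 0"
    by (simp add: s_def)
  have "(\<lambda>n. real (nat \<lfloor>real (Suc n) * s\<rfloor>) / real (Suc n)) \<longlonglongrightarrow> s"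
  proof (rule real_tendsto_sandwich)
    have *: "real (nat \<lfloor>real (Suc n) * s\<rfloor>) = real_of_int \<lfloor>real (Suc n) * s\<rfloor>" for n
      using s by (simp del: of_nat_Suc)
    show "\<forall>\<^sub>F n in sequentially. s - 1 / real (Suc n) \<le> real (nat \<lfloor>real (Suc n) * s\<rfloor>) / real (Suc n)"
    proof (intro always_eventually allI)
      fix n
      have "(real (Suc n) * s - 1) / real (Suc n) \<le> real (nat \<lfloor>real (Suc n) * s\<rfloor>) / real (Suc n)"
        unfolding * by (intro divide_right_mono) linarith+
      then show "s - 1 / real (Suc n) \<le> real (nat \<lfloor>real (Suc n) * s\<rfloor>) / real (Suc n)"
        by (simp add: diff_divide_distrib del: of_nat_Suc)
    qed
    show "\<forall>\<^sub>F n in sequentially. real (nat \<lfloor>real (Suc n) * s\<rfloor>) / real (Suc n) \<le> s"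
    proof (intro always_eventually allI)
      fix n
      have "real (nat \<lfloor>real (Suc n) * s\<rfloor>) / real (Suc n) \<le> (real (Suc n) * s) / real (Suc n)"
        unfolding * by (intro divide_right_mono) linarith+
      then show "real (nat \<lfloor>real (Suc n) * s\<rfloor>) / real (Suc n) \<le> s"
        by (simp del: of_nat_Suc)
    qed
    have "(\<lambda>n. s - 1 / real (Suc n)) \<longlonglongrightarrow> s - 0"
      by (intro tendsto_diff tendsto_const LIMSEQ_Suc[OF lim_1_over_n])
    then show "(\<lambda>n. s - 1 / real (Suc n)) \<longlonglongrightarrow> s"
      by simp
  qed simp
  from continuous_on_tendsto_compose[OF cont[OF p(2)] this]
  show "(\<lambda>n. case p of (t, \<omega>) \<Rightarrow> X (real (?k n t) / real (Suc n)) \<omega>) \<longlonglongrightarrow> (case p of (t, \<omega>) \<Rightarrow> X (max 0 t) \<omega>)"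
    using s by (simp add: p s_def)
qed

locale drift_process = filtered_bm M F W
  for M :: "'w measure" and F :: "real \<Rightarrow> 'w measure" and W :: "real \<Rightarrow> 'w \<Rightarrow> 'a::euclidean_space" +
  fixes X :: "real \<Rightarrow> 'w \<Rightarrow> 'a" and b :: "'a \<Rightarrow> 'a" and \<sigma> B :: real
  assumes X_F: "t \<ge> 0 \<Longrightarrow> X t \<in> borel_measurable (F t)"
    and X_cont: "\<omega> \<in> space M \<Longrightarrow> continuous_on {0..} (\<lambda>t. X t \<omega>)"
    and b_uc: "uniformly_continuous_on UNIV b" and b_bd: "norm (b x) \<le> B"
    and B_pos: "B > 0" and \<sigma>_pos: "\<sigma> > 0"
    and X_eq: "AE \<omega> in M. \<forall>t\<ge>0. X t \<omega> = X 0 \<omega> + integral {0..t} (\<lambda>s. b (X s \<omega>)) + \<sigma> *\<^sub>R (W t \<omega> - W 0 \<omega>)"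
begin

lemma X_M: "t \<ge> 0 \<Longrightarrow> X t \<in> borel_measurable M"
  by (rule measurable_F_M[OF X_F])

lemma b_cont: "continuous_on UNIV b"
  by (rule uniformly_continuous_imp_continuous[OF b_uc])

lemma b_diff_bd: "norm (b x - b y) \<le> 2 * B"
  using norm_triangle_ineq4[of "b x" "b y"] b_bd[of x] b_bd[of y] by linarith

lemma b_meas [measurable]: "b \<in> borel_measurable borel"
  by (intro borel_measurable_continuous_onI b_cont)

lemma bX_cont: "\<omega> \<in> space M \<Longrightarrow> u \<ge> 0 \<Longrightarrow> continuous_on {u..v} (\<lambda>t. b (X t \<omega>))"
  by (rule continuous_on_compose2[OF b_cont continuous_on_subset[OF X_cont]]) auto

text \<open>The drift part of an increment, obtained by removing the noise. In this form
  measurability is immediate; almost surely it is the integral of \<open>b\<close> along the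
  path.\<close>

definition J :: "real \<Rightarrow> real \<Rightarrow> 'w \<Rightarrow> 'a" where
  "J u v \<omega> = X v \<omega> - X u \<omega> - \<sigma> *\<^sub>R (W v \<omega> - W u \<omega>)"

lemma J_eq: "AE \<omega> in M. \<forall>u v. 0 \<le> u \<and> u \<le> v \<longrightarrow> J u v \<omega> = integral {u..v} (\<lambda>r. b (X r \<omega>))"
  using X_eq AE_space
proof eventually_elim
  case (elim \<omega>)
  show ?case
  proof (intro allI impI, elim conjE)
    fix u v :: real assume uv: "0 \<le> u" "u \<le> v"
    have c: "integral {0..u} (\<lambda>r. b (X r \<omega>)) + integral {u..v} (\<lambda>r. b (X r \<omega>)) = integral {0..v} (\<lambda>r. b (X r \<omega>))"
      by (rule Henstock_Kurzweil_Integration.integral_combine)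
        (use uv elim(2) in \<open>auto intro: integrable_continuous_interval bX_cont\<close>)
    have "X u \<omega> = X 0 \<omega> + integral {0..u} (\<lambda>s. b (X s \<omega>)) + \<sigma> *\<^sub>R (W u \<omega> - W 0 \<omega>)"
      "X v \<omega> = X 0 \<omega> + integral {0..v} (\<lambda>s. b (X s \<omega>)) + \<sigma> *\<^sub>R (W v \<omega> - W 0 \<omega>)"
      by (rule elim(1)[rule_format], use uv in simp)+
    then have "J u v \<omega> = integral {0..v} (\<lambda>r. b (X r \<omega>)) - integral {0..u} (\<lambda>r. b (X r \<omega>))"
      unfolding J_def by (simp add: scaleR_right_diff_distrib)
    then show "J u v \<omega> = integral {u..v} (\<lambda>r. b (X r \<omega>))"
      unfolding c[symmetric] by simp
  qed
qed

lemma J_M: "0 \<le> u \<Longrightarrow> u \<le> v \<Longrightarrow> J u v \<in> borel_measurable M"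
  unfolding J_def[abs_def] by (intro borel_measurable_diff borel_measurable_scaleR borel_measurable_const X_M W_M) auto

lemma J_bound: "AE \<omega> in M. \<forall>u v. 0 \<le> u \<and> u \<le> v \<longrightarrow> norm (J u v \<omega>) \<le> B * (v - u)"
  using J_eq AE_space
  by eventually_elim (auto intro!: integral_bound bX_cont b_bd)

text \<open>Between \<open>r\<close> and \<open>v\<close> the process moves by at most
  \<open>B * (v - r)\<close> plus \<open>\<sigma>\<close> times an increment of \<open>W\<close>;
  the truncated mean of the latter is small, and uniform continuity of \<open>b\<close> turns this
  into a bound that is uniform in time.\<close>

lemma drift_oscillation:
  assumes "\<kappa> > 0"
  shows "\<exists>h>0. \<forall>r v. 0 \<le> r \<and> r \<le> v \<and> v < r + h \<longrightarrow> (\<integral>\<omega>. norm (b (X r \<omega>) - b (X v \<omega>)) \<partial>M) \<le> \<kappa>"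
proof -
  obtain \<delta> where \<delta>: "\<delta> > 0" "\<And>x y. dist y x < \<delta> \<Longrightarrow> dist (b y) (b x) < \<kappa> / 2"
    using b_uc assms unfolding uniformly_continuous_on_def by (metis UNIV_I half_gt_zero)
  \<comment> \<open>\<open>C\<close> makes uniform continuity linear: points at distance below
    \<open>\<delta>\<close> cost \<open>\<kappa> / 2\<close>, and beyond it the crude bound
    \<open>2 * B\<close> equals \<open>C * min 1 \<delta>\<close>.\<close>
  define C where "C = 2 * B / min 1 \<delta>"
  have C: "C > 0"
    using B_pos \<delta>(1) by (simp add: C_def)
  have b_osc: "norm (b x - b y) \<le> \<kappa> / 2 + C * min 1 (norm (x - y))" for x y
  proof (cases "dist x y < \<delta>")
    case True
    then have "norm (b x - b y) < \<kappa> / 2"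
      using \<delta>(2) by (simp add: dist_norm)
    moreover have "0 \<le> C * min 1 (norm (x - y))"
      using C by simp
    ultimately show ?thesis
      by linarith
  next
    case False
    then have "C * min 1 \<delta> \<le> C * min 1 (norm (x - y))"
      using C by (intro mult_left_mono) (auto simp: dist_norm)
    moreover have "C * min 1 \<delta> = 2 * B"
      using \<delta>(1) by (simp add: C_def)
    moreover note b_diff_bd[of x y]
    ultimately show ?thesis
      using assms by linarith
  qed
  \<comment> \<open>Budget: \<open>\<kappa> / 2\<close> for continuity, \<open>\<kappa> / 4\<close>
    for the displacement by the drift, \<open>\<kappa> / 4\<close> for the noise.\<close>
  define \<eta> where "\<eta> = \<kappa> / 4 / (C * (1 + \<sigma>))"
  have C\<sigma>: "C * (1 + \<sigma>) > 0"
    using C \<sigma>_pos by simp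
  then have "\<eta> > 0"
    using assms by (simp add: \<eta>_def)
  from small_increments[OF this] obtain h1 where h1: "h1 > 0" "\<And>u v. 0 \<le> u \<Longrightarrow> u < v \<Longrightarrow> v < u + h1 \<Longrightarrow>
      (\<integral>\<omega>. min 1 (norm (W v \<omega> - W u \<omega>)) \<partial>M) \<le> \<eta>"
    by auto
  define h where "h = min h1 (\<kappa> / (4 * C * B))"
  have "h > 0"
    using h1(1) assms C B_pos by (simp add: h_def)
  moreover have "(\<integral>\<omega>. norm (b (X r \<omega>) - b (X v \<omega>)) \<partial>M) \<le> \<kappa>" if r: "0 \<le> r" "r \<le> v" "v < r + h" for r v
  proof (cases "r = v")
    case False
    let ?m = "\<lambda>\<omega>. min 1 (norm (W v \<omega> - W r \<omega>))"
    have [measurable]: "W v \<in> borel_measurable M" "W r \<in> borel_measurable M"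
      using r by (auto intro: W_M)
    have mm: "?m \<in> borel_measurable M"
      by measurable
    have int_m: "integrable M ?m"
      by (rule integrable_const_bound[of _ 1]) (use mm in auto)
    have int_b: "integrable M (\<lambda>\<omega>. norm (b (X r \<omega>) - b (X v \<omega>)))"
    proof (rule integrable_const_bound[of _ "2 * B"])
      show "AE \<omega> in M. norm (norm (b (X r \<omega>) - b (X v \<omega>))) \<le> 2 * B"
        using b_diff_bd by simp
      show "(\<lambda>\<omega>. norm (b (X r \<omega>) - b (X v \<omega>))) \<in> borel_measurable M"
      proof -
        have [measurable]: "X r \<in> borel_measurable M" "X v \<in> borel_measurable M"
          using r by (auto intro: X_M)
        show ?thesis
          by measurable
      qed
    qed
    have "(\<integral>\<omega>. norm (b (X r \<omega>) - b (X v \<omega>)) \<partial>M) \<le>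
        (\<integral>\<omega>. \<kappa> / 2 + C * (B * (v - r) + (1 + \<sigma>) * ?m \<omega>) \<partial>M)"
    proof (rule integral_mono_AE[OF int_b])
      show "integrable M (\<lambda>\<omega>. \<kappa> / 2 + C * (B * (v - r) + (1 + \<sigma>) * ?m \<omega>))"
        using int_m by simp
      show "AE \<omega> in M. norm (b (X r \<omega>) - b (X v \<omega>)) \<le> \<kappa> / 2 + C * (B * (v - r) + (1 + \<sigma>) * ?m \<omega>)"
        using J_bound
      proof eventually_elim
        case (elim \<omega>)
        have "X v \<omega> - X r \<omega> = J r v \<omega> + \<sigma> *\<^sub>R (W v \<omega> - W r \<omega>)"
          by (simp add: J_def)
        then have "norm (X v \<omega> - X r \<omega>) \<le> norm (J r v \<omega>) + \<sigma> * norm (W v \<omega> - W r \<omega>)"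
          using norm_triangle_ineq[of "J r v \<omega>" "\<sigma> *\<^sub>R (W v \<omega> - W r \<omega>)"] \<sigma>_pos by simp
        moreover have "norm (J r v \<omega>) \<le> B * (v - r)"
          using elim r by auto
        ultimately have le: "norm (X r \<omega> - X v \<omega>) \<le> B * (v - r) + \<sigma> * norm (W v \<omega> - W r \<omega>)"
          by (simp add: norm_minus_commute)
        \<comment> \<open>The factor \<open>1 + \<sigma>\<close> instead of \<open>\<sigma>\<close>
          absorbs increments larger than 1, where the left side is still at most 1.\<close>
        have "min 1 (norm (X r \<omega> - X v \<omega>)) \<le> B * (v - r) + (1 + \<sigma>) * ?m \<omega>"
        proof (cases "norm (W v \<omega> - W r \<omega>) \<le> 1")
          case True
          then show ?thesis
            using le min.cobounded2[of 1 "norm (X r \<omega> - X v \<omega>)"] norm_ge_zero[of "W v \<omega> - W r \<omega>"]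
            unfolding min_absorb2[OF True] distrib_right by linarith
        next
          case False
          have "0 \<le> B * (v - r)"
            using B_pos r by simp
          with False \<sigma>_pos show ?thesis
            by (simp add: min_def)
        qed
        then have "C * min 1 (norm (X r \<omega> - X v \<omega>)) \<le> C * (B * (v - r) + (1 + \<sigma>) * ?m \<omega>)"
          using C by (intro mult_left_mono) auto
        then show ?case
          using b_osc[of "X r \<omega>" "X v \<omega>"] by linarith
      qed
    qed
    also have "\<dots> = \<kappa> / 2 + C * (B * (v - r)) + C * (1 + \<sigma>) * (\<integral>\<omega>. ?m \<omega> \<partial>M)"
      using int_m prob_space by (simp add: algebra_simps)
    also have "\<dots> \<le> \<kappa> / 2 + \<kappa> / 4 + \<kappa> / 4"
    proof (intro add_mono order_refl)
      have "C * (B * (v - r)) \<le> C * (B * (\<kappa> / (4 * C * B)))"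
        using C B_pos r by (intro mult_left_mono) (auto simp: h_def)
      then show "C * (B * (v - r)) \<le> \<kappa> / 4"
        using C B_pos by (simp add: field_simps)
      have "C * (1 + \<sigma>) * (\<integral>\<omega>. ?m \<omega> \<partial>M) \<le> C * (1 + \<sigma>) * \<eta>"
        using r False C \<sigma>_pos by (intro mult_left_mono h1(2)) (auto simp: h_def)
      also have "C * (1 + \<sigma>) * \<eta> = \<kappa> / 4"
        unfolding \<eta>_def using less_imp_neq[OF C\<sigma>] by (simp only: times_divide_eq_right) (simp del: mult_eq_0_iff)
      finally show "C * (1 + \<sigma>) * (\<integral>\<omega>. ?m \<omega> \<partial>M) \<le> \<kappa> / 4" .
    qed
    finally show ?thesis
      by simp
  qed (use assms in simp)
  ultimately show ?thesis
    by blast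
qed

text \<open>The drift is frozen at the right end point because the test functions below are
  evaluated at \<open>X v\<close>. The error is \<open>\<kappa>\<close> times the length, wherever
  the interval lies, so the errors of many short steps add up to a small total.\<close>

lemma J_approx:
  assumes "\<kappa> > 0"
  shows "\<exists>h>0. \<forall>u v. 0 \<le> u \<and> u \<le> v \<and> v < u + h \<longrightarrow>
    (\<integral>\<omega>. norm (J u v \<omega> - (v - u) *\<^sub>R b (X v \<omega>)) \<partial>M) \<le> \<kappa> * (v - u)"
proof -
  obtain h where h: "h > 0" "\<And>r v. 0 \<le> r \<Longrightarrow> r \<le> v \<Longrightarrow> v < r + h \<Longrightarrow>
      (\<integral>\<omega>. norm (b (X r \<omega>) - b (X v \<omega>)) \<partial>M) \<le> \<kappa>"
    using drift_oscillation[OF assms] by auto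
  have "(\<integral>\<omega>. norm (J u v \<omega> - (v - u) *\<^sub>R b (X v \<omega>)) \<partial>M) \<le> \<kappa> * (v - u)"
    if uv: "0 \<le> u" "u \<le> v" "v < u + h" for u v
  proof -
    \<comment> \<open>The integrand is extended to all times by \<open>max 0\<close> and cut off by
      the indicator, so that Fubini's theorem applies on the whole line.\<close>
    define g where "g r \<omega> = norm (b (X (max 0 r) \<omega>) - b (X v \<omega>)) * indicator {u..v} r" for r \<omega>
    have [measurable]: "X v \<in> borel_measurable M" "J u v \<in> borel_measurable M"
      using uv by (auto intro: X_M J_M)
    have [measurable]: "(\<lambda>(t, \<omega>). X (max 0 t) \<omega>) \<in> borel_measurable (lborel \<Otimes>\<^sub>M M)"
      using measurable_continuous_process[of M X] X_cont X_M by simp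
    have g_meas: "(\<lambda>(r, \<omega>). ennreal (g r \<omega>)) \<in> borel_measurable (lborel \<Otimes>\<^sub>M M)"
    proof -
      have "(\<lambda>p. b ((\<lambda>(t, \<omega>). X (max 0 t) \<omega>) p)) \<in> borel_measurable (lborel \<Otimes>\<^sub>M M)"
        by measurable
      then have [measurable]: "(\<lambda>p. b (X (max 0 (fst p)) (snd p))) \<in> borel_measurable (lborel \<Otimes>\<^sub>M M)"
        by (simp add: case_prod_beta)
      show ?thesis
        unfolding g_def case_prod_beta by measurable
    qed
    interpret pair_sigma_finite lborel M ..
    have "ennreal (\<integral>\<omega>. norm (J u v \<omega> - (v - u) *\<^sub>R b (X v \<omega>)) \<partial>M) =
        (\<integral>\<^sup>+\<omega>. ennreal (norm (J u v \<omega> - (v - u) *\<^sub>R b (X v \<omega>))) \<partial>M)"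
    proof (rule nn_integral_eq_integral[symmetric])
      show "integrable M (\<lambda>\<omega>. norm (J u v \<omega> - (v - u) *\<^sub>R b (X v \<omega>)))"
      proof (rule integrable_const_bound[of _ "B * (v - u) + (v - u) * B"])
        show "AE \<omega> in M. norm (norm (J u v \<omega> - (v - u) *\<^sub>R b (X v \<omega>))) \<le> B * (v - u) + (v - u) * B"
          using J_bound
        proof eventually_elim
          case (elim \<omega>)
          have "norm (J u v \<omega> - (v - u) *\<^sub>R b (X v \<omega>)) \<le> norm (J u v \<omega>) + (v - u) * norm (b (X v \<omega>))"
            using norm_triangle_ineq4[of "J u v \<omega>" "(v - u) *\<^sub>R b (X v \<omega>)"] uv by simp
          also have "\<dots> \<le> B * (v - u) + (v - u) * B"
            using elim uv by (intro add_mono mult_left_mono b_bd) auto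
          finally show ?case
            by simp
        qed
      qed measurable
    qed simp
    also have "\<dots> \<le> (\<integral>\<^sup>+\<omega>. (\<integral>\<^sup>+r. ennreal (g r \<omega>) \<partial>lborel) \<partial>M)"
    proof (rule nn_integral_mono_AE)
      show "AE \<omega> in M. ennreal (norm (J u v \<omega> - (v - u) *\<^sub>R b (X v \<omega>))) \<le> (\<integral>\<^sup>+r. ennreal (g r \<omega>) \<partial>lborel)"
        using J_eq AE_space
      proof eventually_elim
        case (elim \<omega>)
        let ?f = "\<lambda>r. b (X r \<omega>)"
        have c: "continuous_on {u..v} ?f"
          using bX_cont elim uv by auto
        have ci: "continuous_on {u..v} (\<lambda>r. norm (?f r - ?f v))"
          by (intro continuous_intros c)
        have "J u v \<omega> - (v - u) *\<^sub>R ?f v = integral {u..v} ?f - integral {u..v} (\<lambda>r. ?f v)"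
          using elim uv by simp
        also have "\<dots> = integral {u..v} (\<lambda>r. ?f r - ?f v)"
          by (rule Henstock_Kurzweil_Integration.integral_diff[symmetric])
            (auto intro: integrable_continuous_interval c)
        finally have "norm (J u v \<omega> - (v - u) *\<^sub>R ?f v) \<le> integral {u..v} (\<lambda>r. norm (?f r - ?f v))"
          by (auto intro!: Henstock_Kurzweil_Integration.integral_norm_bound_integral
              integrable_continuous_interval continuous_intros c)
        also have "\<dots> = (LINT r:{u..v}|lborel. norm (?f r - ?f v))"
          by (rule set_borel_integral_eq_integral(2)[symmetric]) (rule borel_integrable_atLeastAtMost'[OF ci])
        also have "\<dots> = (\<integral>r. g r \<omega> \<partial>lborel)"
          unfolding set_lebesgue_integral_def g_def using uv
          by (intro Bochner_Integration.integral_cong) (auto simp: indicator_def max_def)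
        finally have "ennreal (norm (J u v \<omega> - (v - u) *\<^sub>R ?f v)) \<le> ennreal (\<integral>r. g r \<omega> \<partial>lborel)"
          by (rule ennreal_leI)
        also have "\<dots> = (\<integral>\<^sup>+r. ennreal (g r \<omega>) \<partial>lborel)"
        proof (rule nn_integral_eq_integral[symmetric])
          have "set_integrable lborel {u..v} (\<lambda>r. norm (?f r - ?f v))"
            by (rule borel_integrable_atLeastAtMost'[OF ci])
          then have "integrable lborel (\<lambda>r. indicator {u..v} r *\<^sub>R norm (?f r - ?f v))"
            by (simp add: set_integrable_def)
          moreover have "indicator {u..v} r *\<^sub>R norm (?f r - ?f v) = g r \<omega>" for r
            using uv by (auto simp: g_def indicator_def max_def)
          ultimately show "integrable lborel (\<lambda>r. g r \<omega>)"
            by simp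
        qed (simp add: g_def)
        finally show ?case .
      qed
    qed
    also have "\<dots> = (\<integral>\<^sup>+r. (\<integral>\<^sup>+\<omega>. ennreal (g r \<omega>) \<partial>M) \<partial>lborel)"
      by (rule Fubini'[OF g_meas])
    also have "\<dots> \<le> (\<integral>\<^sup>+r. ennreal \<kappa> * indicator {u..v} r \<partial>lborel)"
    proof (rule nn_integral_mono)
      fix r
      show "(\<integral>\<^sup>+\<omega>. ennreal (g r \<omega>) \<partial>M) \<le> ennreal \<kappa> * indicator {u..v} r"
      proof (cases "r \<in> {u..v}")
        case True
        have [measurable]: "X r \<in> borel_measurable M"
          using True uv by (auto intro: X_M)
        have "(\<integral>\<^sup>+\<omega>. ennreal (g r \<omega>) \<partial>M) = (\<integral>\<^sup>+\<omega>. ennreal (norm (b (X r \<omega>) - b (X v \<omega>))) \<partial>M)"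
          using True uv by (simp add: g_def max_def)
        also have "\<dots> = ennreal (\<integral>\<omega>. norm (b (X r \<omega>) - b (X v \<omega>)) \<partial>M)"
        proof (rule nn_integral_eq_integral)
          show "integrable M (\<lambda>\<omega>. norm (b (X r \<omega>) - b (X v \<omega>)))"
            by (rule integrable_const_bound[of _ "2 * B"])
              (use b_diff_bd in auto)
        qed simp
        also have "\<dots> \<le> ennreal \<kappa>"
          using True uv by (intro ennreal_leI h(2)) auto
        finally show ?thesis
          using True by simp
      qed (simp add: g_def)
    qed
    also have "\<dots> = ennreal (\<kappa> * (v - u))"
      using uv assms by (simp add: nn_integral_cmult ennreal_mult)
    finally show ?thesis
      using uv assms by (simp add: ennreal_le_iff)
  qed
  with h(1) show ?thesis
    by blast
qed

text \<open>Between \<open>u\<close> and \<open>v\<close> the heat semigroup moves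
  \<open>X u\<close> by the noise alone, which ends at \<open>X v - J u v\<close>.\<close>

lemma heat_step:
  assumes uv: "0 \<le> u" "u < v" and Z: "Z \<in> borel_measurable (F u)" "\<And>\<omega>. \<bar>Z \<omega>\<bar> \<le> 1"
    and g: "g \<in> borel_measurable borel" "\<And>x. \<bar>g x\<bar> \<le> 1"
  shows "(\<integral>\<omega>. Z \<omega> * heat \<sigma> (v - u) g (X u \<omega>) \<partial>M) = (\<integral>\<omega>. Z \<omega> * g (X v \<omega> - J u v \<omega>) \<partial>M)"
proof -
  have "(\<integral>\<omega>. Z \<omega> * g (X u \<omega> + \<sigma> *\<^sub>R (W v \<omega> - W u \<omega>)) \<partial>M) = (\<integral>\<omega>. Z \<omega> * heat \<sigma> (v - u) g (X u \<omega>) \<partial>M)"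
    by (rule heat_freeze[OF uv Z X_F[OF uv(1)] g])
  moreover have "X u \<omega> + \<sigma> *\<^sub>R (W v \<omega> - W u \<omega>) = X v \<omega> - J u v \<omega>" for \<omega>
    by (simp add: J_def)
  ultimately show ?thesis
    by simp
qed

lemma weighted_diff_bound:
  fixes p q :: "'w \<Rightarrow> real"
  assumes [measurable]: "Z \<in> borel_measurable M" "p \<in> borel_measurable M" "q \<in> borel_measurable M"
    and Z: "\<And>\<omega>. \<bar>Z \<omega>\<bar> \<le> 1" and "\<And>\<omega>. \<bar>p \<omega>\<bar> \<le> c" "\<And>\<omega>. \<bar>q \<omega>\<bar> \<le> c"
    and e: "integrable M e" and le: "AE \<omega> in M. \<bar>p \<omega> - q \<omega>\<bar> \<le> e \<omega>"
  shows "\<bar>(\<integral>\<omega>. Z \<omega> * p \<omega> \<partial>M) - (\<integral>\<omega>. Z \<omega> * q \<omega> \<partial>M)\<bar> \<le> (\<integral>\<omega>. e \<omega> \<partial>M)"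
proof -
  have "\<bar>Z \<omega> * p \<omega>\<bar> \<le> 1 * c" "\<bar>Z \<omega> * q \<omega>\<bar> \<le> 1 * c" for \<omega>
    unfolding abs_mult by (rule mult_mono; use Z assms(5,6) in simp)+
  then have int: "integrable M (\<lambda>\<omega>. Z \<omega> * p \<omega>)" "integrable M (\<lambda>\<omega>. Z \<omega> * q \<omega>)"
    by (auto intro!: integrable_const_bound[of _ c])
  have "\<bar>(\<integral>\<omega>. Z \<omega> * p \<omega> \<partial>M) - (\<integral>\<omega>. Z \<omega> * q \<omega> \<partial>M)\<bar> = \<bar>\<integral>\<omega>. Z \<omega> * p \<omega> - Z \<omega> * q \<omega> \<partial>M\<bar>"
    using int by simp
  also have "\<dots> \<le> (\<integral>\<omega>. \<bar>Z \<omega> * p \<omega> - Z \<omega> * q \<omega>\<bar> \<partial>M)"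
    by (rule integral_abs_bound)
  also have "\<dots> \<le> (\<integral>\<omega>. e \<omega> \<partial>M)"
  proof (rule integral_mono_AE[OF _ e])
    show "AE \<omega> in M. \<bar>Z \<omega> * p \<omega> - Z \<omega> * q \<omega>\<bar> \<le> e \<omega>"
      using le
    proof eventually_elim
      case (elim \<omega>)
      have "\<bar>Z \<omega> * p \<omega> - Z \<omega> * q \<omega>\<bar> = \<bar>Z \<omega>\<bar> * \<bar>p \<omega> - q \<omega>\<bar>"
        by (simp add: abs_mult[symmetric] right_diff_distrib)
      also have "\<dots> \<le> \<bar>p \<omega> - q \<omega>\<bar>"
        using Z by (intro mult_left_le_one_le) auto
      finally show ?case
        using elim by simp
    qed
  qed (use int in auto)
  finally show ?thesis .
qed

text \<open>One step of the Duhamel expansion. The change of \<open>g\<close> along the drift is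
  replaced by \<open>g (X v) - g (X v - (v - u) *\<^sub>R b (X v))\<close>, a function of
  \<open>X v\<close> alone, which can again serve as a test function; the replacement costs the
  Lipschitz constant \<open>c\<close> times the error in \<open>J\<close>.\<close>

lemma lipschitz_step:
  assumes uv: "0 \<le> u" "u < v" and Z: "Z \<in> borel_measurable (F u)" "\<And>\<omega>. \<bar>Z \<omega>\<bar> \<le> 1"
    and g [measurable]: "g \<in> borel_measurable borel" and g1: "\<And>x. \<bar>g x\<bar> \<le> 1"
    and lip: "\<And>x y. \<bar>g x - g y\<bar> \<le> c * norm (x - y)" and "c \<ge> 0"
    and J: "(\<integral>\<omega>. norm (J u v \<omega> - (v - u) *\<^sub>R b (X v \<omega>)) \<partial>M) \<le> \<kappa> * (v - u)"
  shows "\<bar>(\<integral>\<omega>. Z \<omega> * g (X v \<omega>) \<partial>M) - (\<integral>\<omega>. Z \<omega> * heat \<sigma> (v - u) g (X u \<omega>) \<partial>M) -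
      (\<integral>\<omega>. Z \<omega> * (g (X v \<omega>) - g (X v \<omega> - (v - u) *\<^sub>R b (X v \<omega>))) \<partial>M)\<bar> \<le> c * (\<kappa> * (v - u))"
proof -
  have [measurable]: "Z \<in> borel_measurable M" "X v \<in> borel_measurable M" "J u v \<in> borel_measurable M"
    using uv Z by (auto intro: measurable_F_M X_M J_M)
  have int: "integrable M (\<lambda>\<omega>. Z \<omega> * p \<omega>)" if [measurable]: "p \<in> borel_measurable M" and "\<And>\<omega>. \<bar>p \<omega>\<bar> \<le> 1" for p :: "'w \<Rightarrow> real"
    by (rule integrable_const_bound[of _ 1]) (use that Z(2) in \<open>auto simp: abs_mult intro!: mult_le_one\<close>)
  have eq: "(\<integral>\<omega>. Z \<omega> * g (X v \<omega>) \<partial>M) - (\<integral>\<omega>. Z \<omega> * heat \<sigma> (v - u) g (X u \<omega>) \<partial>M) -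
      (\<integral>\<omega>. Z \<omega> * (g (X v \<omega>) - g (X v \<omega> - (v - u) *\<^sub>R b (X v \<omega>))) \<partial>M) =
      (\<integral>\<omega>. Z \<omega> * g (X v \<omega> - (v - u) *\<^sub>R b (X v \<omega>)) \<partial>M) - (\<integral>\<omega>. Z \<omega> * g (X v \<omega> - J u v \<omega>) \<partial>M)"
    unfolding heat_step[OF uv Z g g1] using int g1 by (simp add: right_diff_distrib)
  have intJ: "integrable M (\<lambda>\<omega>. norm (J u v \<omega> - (v - u) *\<^sub>R b (X v \<omega>)))"
  proof (rule integrable_const_bound[of _ "B * (v - u) + (v - u) * B"])
    show "AE \<omega> in M. norm (norm (J u v \<omega> - (v - u) *\<^sub>R b (X v \<omega>))) \<le> B * (v - u) + (v - u) * B"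
      using J_bound
    proof eventually_elim
      case (elim \<omega>)
      have "norm (J u v \<omega> - (v - u) *\<^sub>R b (X v \<omega>)) \<le> norm (J u v \<omega>) + (v - u) * norm (b (X v \<omega>))"
        using norm_triangle_ineq4[of "J u v \<omega>" "(v - u) *\<^sub>R b (X v \<omega>)"] uv by simp
      also have "\<dots> \<le> B * (v - u) + (v - u) * B"
        using elim uv by (intro add_mono mult_left_mono b_bd) auto
      finally show ?case
        by simp
    qed
  qed measurable
  have "\<bar>(\<integral>\<omega>. Z \<omega> * g (X v \<omega> - (v - u) *\<^sub>R b (X v \<omega>)) \<partial>M) - (\<integral>\<omega>. Z \<omega> * g (X v \<omega> - J u v \<omega>) \<partial>M)\<bar>
      \<le> (\<integral>\<omega>. c * norm (J u v \<omega> - (v - u) *\<^sub>R b (X v \<omega>)) \<partial>M)"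
    using intJ g1 Z(2) lip[of "X v \<omega> - (v - u) *\<^sub>R b (X v \<omega>)" "X v \<omega> - J u v \<omega>" for \<omega>]
    by (intro weighted_diff_bound[of _ _ _ 1]) auto
  also have "\<dots> \<le> c * (\<kappa> * (v - u))"
    using J \<open>c \<ge> 0\<close> by (simp add: mult_left_mono)
  finally show ?thesis
    unfolding eq .
qed

text \<open>Meant for the step ending at the terminal time, where the test function has not been
  smoothed and only its modulus of continuity is at hand.\<close>

lemma last_step:
  assumes uv: "0 \<le> u" "u < v" and Z: "Z \<in> borel_measurable (F u)" "\<And>\<omega>. \<bar>Z \<omega>\<bar> \<le> 1"
    and g [measurable]: "g \<in> borel_measurable borel" and g1: "\<And>x. \<bar>g x\<bar> \<le> 1"
    and osc: "\<And>x y. norm (x - y) \<le> B * (v - u) \<Longrightarrow> \<bar>g x - g y\<bar> \<le> c"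
  shows "\<bar>(\<integral>\<omega>. Z \<omega> * g (X v \<omega>) \<partial>M) - (\<integral>\<omega>. Z \<omega> * heat \<sigma> (v - u) g (X u \<omega>) \<partial>M)\<bar> \<le> c"
proof -
  have [measurable]: "Z \<in> borel_measurable M" "X v \<in> borel_measurable M" "J u v \<in> borel_measurable M"
    using uv Z by (auto intro: measurable_F_M X_M J_M)
  have "\<bar>(\<integral>\<omega>. Z \<omega> * g (X v \<omega>) \<partial>M) - (\<integral>\<omega>. Z \<omega> * g (X v \<omega> - J u v \<omega>) \<partial>M)\<bar> \<le> (\<integral>\<omega>. c \<partial>M)"
  proof (rule weighted_diff_bound[of _ _ _ 1])
    show "AE \<omega> in M. \<bar>g (X v \<omega>) - g (X v \<omega> - J u v \<omega>)\<bar> \<le> c"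
      using J_bound by eventually_elim (use uv in \<open>auto intro!: osc\<close>)
  qed (use g1 Z in auto)
  then show ?thesis
    unfolding heat_step[OF uv Z g g1] using prob_space by simp
qed

end

section \<open>Uniqueness in law by a discrete Duhamel expansion\<close>

lemma sum_inverse_sqrt: "(\<Sum>j<m. 1 / sqrt (real (m - j))) \<le> 2 * sqrt (real m)"
proof -
  have "(\<Sum>j<m. 1 / sqrt (real (m - j))) = (\<Sum>j<m. 1 / sqrt (real (Suc (m - Suc j))))"
    by (intro sum.cong refl) (auto simp: Suc_diff_Suc)
  also have "\<dots> = (\<Sum>j<m. 1 / sqrt (real (Suc j)))"
    by (rule sum.nat_diff_reindex)
  also have "\<dots> \<le> 2 * sqrt (real m)"
  proof (induction m)
    case (Suc m)
    define x y where "x = sqrt (real m)" and "y = sqrt (real (Suc m))"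
    have xy: "x \<ge> 0" "y > 0" "y\<^sup>2 = x\<^sup>2 + 1"
      by (auto simp: x_def y_def)
    \<comment> \<open>The comparison of \<open>1 / sqrt\<close> with its integral, in algebraic
      form: since \<open>y\<^sup>2 = x\<^sup>2 + 1\<close>, this square gives
      \<open>1 / y \<le> 2 * (y - x)\<close>.\<close>
    have "0 \<le> (y - x)\<^sup>2"
      by simp
    then have "1 \<le> 2 * y * (y - x)"
      using xy(3) by (simp add: power2_eq_square algebra_simps)
    then have "1 / y \<le> 2 * (y - x)"
      using xy(2) by (simp add: field_simps)
    then show ?case
      using Suc by (simp add: x_def y_def)
  qed simp
  finally show ?thesis .
qed

locale two_drift_processes =
  A: drift_process M F W X b \<sigma> B + A': drift_process M' F' W' X' b \<sigma> B
  for M :: "'w measure" and F W and X :: "real \<Rightarrow> 'w \<Rightarrow> 'a::euclidean_space"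
    and M' :: "'v measure" and F' W' and X' :: "real \<Rightarrow> 'v \<Rightarrow> 'a" and b \<sigma> B +
  fixes L :: "'a set"
  assumes b_periodic: "k \<in> L \<Longrightarrow> b (x + k) = b x"
begin

text \<open>\<open>Z\<close> and \<open>Z'\<close> will be the same cylinder function of the two
  pasts; carrying them along lets an argument about single times yield the joint laws.\<close>

definition D :: "('w \<Rightarrow> real) \<Rightarrow> ('v \<Rightarrow> real) \<Rightarrow> real \<Rightarrow> ('a \<Rightarrow> real) \<Rightarrow> real" where
  "D Z Z' t f = (\<integral>\<omega>. Z \<omega> * f (X t \<omega>) \<partial>M) - (\<integral>\<omega>. Z' \<omega> * f (X' t \<omega>) \<partial>M')"

definition weights :: "real \<Rightarrow> ('w \<Rightarrow> real) \<Rightarrow> ('v \<Rightarrow> real) \<Rightarrow> bool" where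
  "weights s Z Z' \<longleftrightarrow> Z \<in> borel_measurable (F s) \<and> Z' \<in> borel_measurable (F' s) \<and>
     (\<forall>\<omega>. \<bar>Z \<omega>\<bar> \<le> 1) \<and> (\<forall>\<omega>. \<bar>Z' \<omega>\<bar> \<le> 1)"

lemma weights_mono: "weights s Z Z' \<Longrightarrow> s \<le> t \<Longrightarrow> weights t Z Z'"
  by (auto simp: weights_def intro: A.measurable_F_mono A'.measurable_F_mono)

lemma D_bound:
  assumes "weights s Z Z'" "tfun L f" "0 \<le> t"
  shows "\<bar>D Z Z' t f\<bar> \<le> 2"
proof -
  have *: "\<bar>\<integral>\<omega>. Y \<omega> * g \<omega> \<partial>N\<bar> \<le> 1" if "prob_space N" "\<And>\<omega>. \<bar>Y \<omega>\<bar> \<le> 1" "\<And>\<omega>. \<bar>g \<omega>\<bar> \<le> 1"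
    for N :: "'c measure" and Y g :: "'c \<Rightarrow> real"
  proof (cases "integrable N (\<lambda>\<omega>. Y \<omega> * g \<omega>)")
    case True
    interpret prob_space N by fact
    have "\<bar>\<integral>\<omega>. Y \<omega> * g \<omega> \<partial>N\<bar> \<le> (\<integral>\<omega>. \<bar>Y \<omega> * g \<omega>\<bar> \<partial>N)"
      by (rule integral_abs_bound)
    also have "\<dots> \<le> (\<integral>\<omega>. 1 \<partial>N)"
      using that(2,3) by (intro integral_mono integrable_abs True) (simp_all add: abs_mult mult_le_one)
    finally show ?thesis
      using prob_space by simp
  qed (simp add: not_integrable_integral_eq)
  have "\<bar>\<integral>\<omega>. Z \<omega> * f (X t \<omega>) \<partial>M\<bar> \<le> 1" "\<bar>\<integral>\<omega>. Z' \<omega> * f (X' t \<omega>) \<partial>M'\<bar> \<le> 1"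
    using assms(1) tfun_abs[OF assms(2)]
    by (auto intro!: * A.prob_space_axioms A'.prob_space_axioms simp: weights_def)
  then show ?thesis
    by (simp add: D_def)
qed

lemma D_scale: "D Z Z' t (\<lambda>x. c * f x) = c * D Z Z' t f"
proof -
  have "(\<integral>\<omega>. Z \<omega> * (c * f (X t \<omega>)) \<partial>M) = (\<integral>\<omega>. c * (Z \<omega> * f (X t \<omega>)) \<partial>M)"
    "(\<integral>\<omega>. Z' \<omega> * (c * f (X' t \<omega>)) \<partial>M') = (\<integral>\<omega>. c * (Z' \<omega> * f (X' t \<omega>)) \<partial>M')"
    by (simp_all add: mult.left_commute)
  then show ?thesis
    by (simp add: D_def right_diff_distrib)
qed

text \<open>The difference is itself uniformly continuous and periodic and has size at most
  \<open>c * h * B\<close>; divided by this number it is an admissible test function, to which the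
  bound \<open>\<Lambda>\<close> applies. This is how the bound feeds back into itself.\<close>

lemma D_shift_bound:
  assumes g: "tfun L g" and lip: "\<And>x y. \<bar>g x - g y\<bar> \<le> c * norm (x - y)" and c: "c > 0" and h: "h > 0"
    and \<Lambda>: "\<And>f. tfun L f \<Longrightarrow> \<bar>D Z Z' t f\<bar> \<le> \<Lambda>"
  shows "\<bar>D Z Z' t (\<lambda>x. g x - g (x - h *\<^sub>R b x))\<bar> \<le> c * h * B * \<Lambda>"
proof -
  define a where "a = c * h * B"
  have a: "a > 0"
    using c h A.B_pos by (simp add: a_def)
  define k where "k x = (g x - g (x - h *\<^sub>R b x)) / a" for x
  have "tfun L k"
    unfolding tfun_def
  proof (intro conjI allI ballI)
    have gu: "uniformly_continuous_on UNIV g"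
      using g by (simp add: tfun_def)
    have "uniformly_continuous_on UNIV (\<lambda>x. x - h *\<^sub>R b x)"
      by (intro uniformly_continuous_on_diff uniformly_continuous_on_id uniformly_continuous_on_cmul A.b_uc)
    then have "uniformly_continuous_on UNIV (\<lambda>x. g (x - h *\<^sub>R b x))"
      by (rule uniformly_continuous_on_compose[unfolded o_def]) (use gu in \<open>unfold uniformly_continuous_on_def, blast\<close>)
    then have "uniformly_continuous_on UNIV (\<lambda>x. (1 / a) *\<^sub>R (g x - g (x - h *\<^sub>R b x)))"
      by (intro uniformly_continuous_on_cmul uniformly_continuous_on_diff gu)
    then show "uniformly_continuous_on UNIV k"
      by (simp add: k_def[abs_def])
    show "\<bar>k x\<bar> \<le> 1" for x
    proof -
      have "\<bar>g x - g (x - h *\<^sub>R b x)\<bar> \<le> c * norm (h *\<^sub>R b x)"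
        using lip[of x "x - h *\<^sub>R b x"] by simp
      also have "\<dots> \<le> c * (h * B)"
        using c h A.b_bd[of x] by (intro mult_left_mono) auto
      finally show ?thesis
        using a by (simp add: k_def abs_divide a_def mult.assoc)
    qed
    show "k (x + l) = k x" if "l \<in> L" for l x
    proof -
      have "g (x + l - h *\<^sub>R b (x + l)) = g ((x - h *\<^sub>R b x) + l)"
        using b_periodic[OF that, of x] by (simp add: algebra_simps)
      then show ?thesis
        using g that by (simp add: k_def tfun_def)
    qed
  qed
  then have "\<bar>D Z Z' t (\<lambda>x. a * k x)\<bar> \<le> a * \<Lambda>"
    unfolding D_scale abs_mult using \<Lambda>[of k] a by simp
  moreover have "(\<lambda>x. a * k x) = (\<lambda>x. g x - g (x - h *\<^sub>R b x))"
    using a by (simp add: k_def)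
  ultimately show ?thesis
    by (simp add: a_def)
qed

text \<open>Duhamel's formula in discrete form: replacing the drift by its value costs at each step the
  Lipschitz constant of the heat semigroup, which is integrable in time.\<close>

lemma D_contraction:
  assumes s: "0 \<le> s" and w: "weights s Z Z'" and zero: "\<And>f. tfun L f \<Longrightarrow> D Z Z' s f = 0"
    and \<Lambda>: "\<And>t f. s \<le> t \<Longrightarrow> t \<le> T \<Longrightarrow> tfun L f \<Longrightarrow> \<bar>D Z Z' t f\<bar> \<le> \<Lambda>"
    and T: "s < T" and f: "tfun L f"
  shows "\<bar>D Z Z' T f\<bar> \<le> 4 * B / \<sigma> * sqrt (T - s) * \<Lambda>"
proof -
  note \<sigma> = A.\<sigma>_pos and B = A.B_pos
  define \<tau> where "\<tau> = T - s"
  have \<tau>: "\<tau> > 0"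
    using T by (simp add: \<tau>_def)
  have \<Lambda>0: "\<Lambda> \<ge> 0"
    using \<Lambda>[of s f] T f by auto
  have main: "\<bar>D Z Z' T f\<bar> \<le> 4 / \<sigma> * sqrt \<tau> * (B * \<Lambda> + 2 * \<kappa>) + 2 * \<kappa>" if \<kappa>: "\<kappa> > 0" for \<kappa>
  proof -
    obtain h1 where h1: "h1 > 0" "\<And>u v. 0 \<le> u \<Longrightarrow> u \<le> v \<Longrightarrow> v < u + h1 \<Longrightarrow>
        (\<integral>\<omega>. norm (A.J u v \<omega> - (v - u) *\<^sub>R b (X v \<omega>)) \<partial>M) \<le> \<kappa> * (v - u)"
      using A.J_approx[OF \<kappa>] by auto
    obtain h2 where h2: "h2 > 0" "\<And>u v. 0 \<le> u \<Longrightarrow> u \<le> v \<Longrightarrow> v < u + h2 \<Longrightarrow>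
        (\<integral>\<omega>. norm (A'.J u v \<omega> - (v - u) *\<^sub>R b (X' v \<omega>)) \<partial>M') \<le> \<kappa> * (v - u)"
      using A'.J_approx[OF \<kappa>] by auto
    obtain \<delta> where \<delta>: "\<delta> > 0" "\<And>x y. dist y x < \<delta> \<Longrightarrow> dist (f y) (f x) < \<kappa>"
      using f \<kappa> unfolding tfun_def uniformly_continuous_on_def by (metis UNIV_I)
    \<comment> \<open>Steps below \<open>h1\<close> and \<open>h2\<close> control the drift of both
      processes; a step below \<open>\<delta> / B\<close> keeps the drift displacement in the last
      step below \<open>\<delta>\<close>.\<close>
    define h0 where "h0 = min (min h1 h2) (\<delta> / B)"
    have "h0 > 0"
      using h1(1) h2(1) \<delta>(1) B by (simp add: h0_def)
    obtain m :: nat where m: "\<tau> / h0 < real (Suc m)"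
      using reals_Archimedean2[of "\<tau> / h0"] by (metis less_trans of_nat_less_iff lessI)
    define h where "h = \<tau> / real (Suc m)"
    have h: "h > 0" "real (Suc m) * h = \<tau>" "h < h0"
      using \<tau> m \<open>h0 > 0\<close> by (auto simp: h_def field_simps simp del: of_nat_Suc)
    define t where "t i = s + real i * h" for i
    have tT: "T - t i = real (Suc m - i) * h" if "i \<le> Suc m" for i
      using h(2) that by (simp add: t_def \<tau>_def of_nat_diff algebra_simps)
    have t0: "s \<le> t i" for i
      using h(1) by (simp add: t_def)
    have tS: "t (Suc i) - t i = h" for i
      by (simp add: t_def algebra_simps)
    have tlt: "t i < t (Suc i)" for i
      using tS[of i] h(1) by simp
    \<comment> \<open>These functions solve the backward heat equation with terminal value
      \<open>f\<close>. They are used up to index \<open>m\<close>, one step before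
      \<open>T\<close>, since their Lipschitz constant blows up at \<open>T\<close>.\<close>
    define g where "g i = heat \<sigma> (T - t i) f" for i
    have pos: "T - t i > 0" if "i \<le> m" for i
      using tT[of i] that h(1) by simp
    have g: "tfun L (g i)" if "i \<le> m" for i
      unfolding g_def by (rule tfun_heat[OF f pos[OF that] \<sigma>])
    define c where "c i = 2 / (\<sigma> * sqrt (T - t i))" for i
    have lip: "\<bar>g i x - g i y\<bar> \<le> c i * norm (x - y)" if "i \<le> m" for i x y
      unfolding g_def c_def by (rule heat_lipschitz[OF pos[OF that] \<sigma> tfun_measurable[OF f] tfun_abs[OF f]])
    have c: "c i > 0" if "i \<le> m" for i
      using pos[OF that] \<sigma> by (simp add: c_def)
    have heat_g: "heat \<sigma> (t (Suc i) - t i) (g (Suc i)) = g i" if "Suc i \<le> m" for i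
    proof
      fix x
      have "heat \<sigma> h (heat \<sigma> (T - t (Suc i)) f) x = heat \<sigma> (h + (T - t (Suc i))) f x"
        by (rule A.heat_heat[OF h(1) pos[OF that] tfun_measurable[OF f] tfun_abs[OF f]])
      moreover have "h + (T - t (Suc i)) = T - t i"
        using tS[of i] by simp
      ultimately show "heat \<sigma> (t (Suc i) - t i) (g (Suc i)) x = g i x"
        by (simp add: g_def tS)
    qed
    have Zm: "Z \<in> borel_measurable (F (t i))" "Z' \<in> borel_measurable (F' (t i))"
      "\<bar>Z \<omega>\<bar> \<le> 1" "\<bar>Z' \<omega>'\<bar> \<le> 1" for i \<omega> \<omega>'
      using weights_mono[OF w t0[of i]] by (auto simp: weights_def)
    have step: "\<bar>D Z Z' (t (Suc i)) (g (Suc i)) - D Z Z' (t i) (g i)\<bar> \<le> c (Suc i) * h * (B * \<Lambda> + 2 * \<kappa>)"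
      if i: "Suc i \<le> m" for i
    proof -
      let ?k = "\<lambda>x. g (Suc i) x - g (Suc i) (x - h *\<^sub>R b x)"
      note gm = tfun_measurable[OF g[OF i]] and g1 = tfun_abs[OF g[OF i]]
      have ti: "0 \<le> t i"
        using s t0[of i] by linarith
      have lt: "t (Suc i) < t i + h1" "t (Suc i) < t i + h2"
        using tS[of i] h(3) by (auto simp: h0_def)
      have 1: "\<bar>(\<integral>\<omega>. Z \<omega> * g (Suc i) (X (t (Suc i)) \<omega>) \<partial>M) - (\<integral>\<omega>. Z \<omega> * g i (X (t i) \<omega>) \<partial>M) -
          (\<integral>\<omega>. Z \<omega> * ?k (X (t (Suc i)) \<omega>) \<partial>M)\<bar> \<le> c (Suc i) * (\<kappa> * h)"
        using A.lipschitz_step[OF ti tlt[of i] Zm(1,3) gm g1 lip[OF i] less_imp_le[OF c[OF i]]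
            h1(2)[OF ti less_imp_le[OF tlt] lt(1)]]
        unfolding heat_g[OF i] unfolding tS by simp
      have 2: "\<bar>(\<integral>\<omega>. Z' \<omega> * g (Suc i) (X' (t (Suc i)) \<omega>) \<partial>M') - (\<integral>\<omega>. Z' \<omega> * g i (X' (t i) \<omega>) \<partial>M') -
          (\<integral>\<omega>. Z' \<omega> * ?k (X' (t (Suc i)) \<omega>) \<partial>M')\<bar> \<le> c (Suc i) * (\<kappa> * h)"
        using A'.lipschitz_step[OF ti tlt[of i] Zm(2,4) gm g1 lip[OF i] less_imp_le[OF c[OF i]]
            h2(2)[OF ti less_imp_le[OF tlt] lt(2)]]
        unfolding heat_g[OF i] unfolding tS by simp
      have 3: "\<bar>D Z Z' (t (Suc i)) ?k\<bar> \<le> c (Suc i) * h * B * \<Lambda>"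
      proof (rule D_shift_bound[OF g[OF i] lip[OF i] c[OF i] h(1)])
        show "\<bar>D Z Z' (t (Suc i)) f\<bar> \<le> \<Lambda>" if "tfun L f" for f
          using pos[OF i] t0 by (intro \<Lambda> that) auto
      qed
      have "\<bar>(a1 - a1') - (a2 - a2')\<bar> \<le> e + e + d"
        if "\<bar>a1 - a2 - a3\<bar> \<le> e" "\<bar>a1' - a2' - a3'\<bar> \<le> e" "\<bar>a3 - a3'\<bar> \<le> d" for a1 a2 a3 a1' a2' a3' e d :: real
        using that by linarith
      from this[OF 1 2 3[unfolded D_def]]
      have "\<bar>D Z Z' (t (Suc i)) (g (Suc i)) - D Z Z' (t i) (g i)\<bar> \<le>
          c (Suc i) * (\<kappa> * h) + c (Suc i) * (\<kappa> * h) + c (Suc i) * h * B * \<Lambda>"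
        unfolding D_def .
      also have "\<dots> = c (Suc i) * h * (B * \<Lambda> + 2 * \<kappa>)"
        by (simp add: algebra_simps)
      finally show ?thesis .
    qed
    have acc: "\<bar>D Z Z' (t i) (g i)\<bar> \<le> (\<Sum>j<i. c (Suc j) * h) * (B * \<Lambda> + 2 * \<kappa>)" if "i \<le> m" for i
      using that
    proof (induction i)
      case 0
      have "t 0 = s"
        by (simp add: t_def)
      then show ?case
        using zero[OF g[of 0]] by simp
    next
      case (Suc i)
      then show ?case
        using step[of i] by (simp add: distrib_right)
    qed
    \<comment> \<open>A Riemann sum of the Lipschitz constants
      \<open>2 / (\<sigma> * sqrt t)\<close>, whose integral over an interval of length
      \<open>\<tau>\<close> at the origin is \<open>4 / \<sigma> * sqrt \<tau>\<close>.\<close>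
    have "(\<Sum>j<m. c (Suc j) * h) \<le> 4 / \<sigma> * sqrt \<tau>"
    proof -
      have "c (Suc j) * h = 2 * sqrt h / \<sigma> * (1 / sqrt (real (m - j)))" if "j < m" for j
      proof -
        have "T - t (Suc j) = real (m - j) * h"
          using tT[of "Suc j"] that by simp
        moreover have "h = sqrt h * sqrt h"
          using h(1) by simp
        ultimately have "c (Suc j) * h = 2 / (\<sigma> * (sqrt (real (m - j)) * sqrt h)) * (sqrt h * sqrt h)"
          by (simp add: c_def real_sqrt_mult)
        also have "\<dots> = 2 * sqrt h / \<sigma> * (1 / sqrt (real (m - j)))"
          using h(1) that \<sigma> by (simp add: field_simps del: real_sqrt_mult_self)
        finally show ?thesis .
      qed
      then have "(\<Sum>j<m. c (Suc j) * h) = 2 * sqrt h / \<sigma> * (\<Sum>j<m. 1 / sqrt (real (m - j)))"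
        by (simp add: sum_distrib_left)
      also have "\<dots> \<le> 2 * sqrt h / \<sigma> * (2 * sqrt (real m))"
        using h(1) \<sigma> by (intro mult_left_mono sum_inverse_sqrt) auto
      also have "\<dots> = 4 / \<sigma> * sqrt (real m * h)"
        by (simp add: real_sqrt_mult)
      also have "\<dots> \<le> 4 / \<sigma> * sqrt \<tau>"
      proof -
        have "real m * h \<le> real (Suc m) * h"
          using h(1) by (intro mult_right_mono) auto
        then show ?thesis
          using \<sigma> h(2) by (intro mult_left_mono) auto
      qed
      finally show ?thesis .
    qed
    then have "\<bar>D Z Z' (t m) (g m)\<bar> \<le> 4 / \<sigma> * sqrt \<tau> * (B * \<Lambda> + 2 * \<kappa>)"
      using B \<Lambda>0 \<kappa> by (intro order_trans[OF acc] mult_right_mono) auto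
    moreover have "\<bar>D Z Z' T f - D Z Z' (t m) (g m)\<bar> \<le> 2 * \<kappa>"
    proof -
      have Tm: "T - t m = h"
        using tT[of m] by simp
      have lt: "t m < T" and ti: "0 \<le> t m"
        using Tm h(1) s t0[of m] by linarith+
      have osc: "\<bar>f x - f y\<bar> \<le> \<kappa>" if "norm (x - y) \<le> B * (T - t m)" for x y
      proof -
        have "B * h < B * (\<delta> / B)"
          using h(3) B by (intro mult_strict_left_mono) (auto simp: h0_def)
        then have "dist x y < \<delta>"
          using that B by (simp add: dist_norm Tm)
        then show ?thesis
          using \<delta>(2)[of x y] by (simp add: dist_real_def)
      qed
      have "\<bar>(\<integral>\<omega>. Z \<omega> * f (X T \<omega>) \<partial>M) - (\<integral>\<omega>. Z \<omega> * g m (X (t m) \<omega>) \<partial>M)\<bar> \<le> \<kappa>"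
        unfolding g_def using A.last_step[OF ti lt Zm(1,3) tfun_measurable[OF f] tfun_abs[OF f] osc] .
      moreover have "\<bar>(\<integral>\<omega>. Z' \<omega> * f (X' T \<omega>) \<partial>M') - (\<integral>\<omega>. Z' \<omega> * g m (X' (t m) \<omega>) \<partial>M')\<bar> \<le> \<kappa>"
        unfolding g_def using A'.last_step[OF ti lt Zm(2,4) tfun_measurable[OF f] tfun_abs[OF f] osc] .
      ultimately show ?thesis
        by (simp add: D_def)
    qed
    ultimately show ?thesis
      by linarith
  qed
  show ?thesis
  proof (rule field_le_epsilon)
    fix e :: real assume "e > 0"
    \<comment> \<open>The total coefficient of \<open>\<kappa>\<close> in \<open>main\<close>, so
      that \<open>\<kappa> = e / q\<close> spends exactly \<open>e\<close>.\<close>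
    define q where "q = 8 / \<sigma> * sqrt \<tau> + 2"
    have q: "q > 0"
      using \<sigma> \<tau> by (simp add: q_def add_pos_pos)
    have "\<bar>D Z Z' T f\<bar> \<le> 4 / \<sigma> * sqrt \<tau> * (B * \<Lambda> + 2 * (e / q)) + 2 * (e / q)"
      using \<open>e > 0\<close> q by (intro main) simp
    also have "\<dots> = 4 * B / \<sigma> * sqrt \<tau> * \<Lambda> + q * (e / q)"
      unfolding q_def distrib_right distrib_left by (simp add: mult_ac)
    also have "q * (e / q) = e"
      using q by simp
    finally show "\<bar>D Z Z' T f\<bar> \<le> 4 * B / \<sigma> * sqrt (T - s) * \<Lambda> + e"
      by (simp add: \<tau>_def)
  qed
qed

text \<open>The length \<open>(\<sigma> / (8 * B))\<^sup>2\<close> makes the factor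
  \<open>4 * B / \<sigma> * sqrt (t - s)\<close> at most 1/2. Starting from the trivial bound 2,
  each application of the contraction halves the bound.\<close>

lemma D_propagate_short:
  assumes s: "0 \<le> s" and w: "weights s Z Z'" and zero: "\<And>f. tfun L f \<Longrightarrow> D Z Z' s f = 0"
    and t: "s \<le> t" "t \<le> s + (\<sigma> / (8 * B))\<^sup>2" and f: "tfun L f"
  shows "D Z Z' t f = 0"
proof -
  note \<sigma> = A.\<sigma>_pos and B = A.B_pos
  have *: "\<bar>D Z Z' t f\<bar> \<le> 2 * (1 / 2) ^ j" if "s \<le> t" "t \<le> s + (\<sigma> / (8 * B))\<^sup>2" "tfun L f" for j t f
    using that
  proof (induction j arbitrary: t f)
    case 0
    then show ?case
      using D_bound[OF w, of f t] s by simp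
  next
    case (Suc j)
    show ?case
    proof (cases "t = s")
      case True
      then show ?thesis
        using zero[OF Suc.prems(3)] by simp
    next
      case False
      then have "\<bar>D Z Z' t f\<bar> \<le> 4 * B / \<sigma> * sqrt (t - s) * (2 * (1 / 2) ^ j)"
        using Suc.prems by (intro D_contraction[OF s w zero] Suc.IH) auto
      also have "\<dots> \<le> 4 * B / \<sigma> * (\<sigma> / (8 * B)) * (2 * (1 / 2) ^ j)"
        using Suc.prems B \<sigma> by (intro mult_right_mono mult_left_mono real_le_lsqrt) auto
      also have "\<dots> = 2 * (1 / 2) ^ Suc j"
        using B \<sigma> by simp
      finally show ?thesis .
    qed
  qed
  have "(\<lambda>j. 2 * (1 / 2) ^ j) \<longlonglongrightarrow> 2 * (0 :: real)"
    by (intro tendsto_intros LIMSEQ_power_zero) auto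
  from LIMSEQ_le_const[OF this, of "\<bar>D Z Z' t f\<bar>"] * t f show ?thesis
    by auto
qed

text \<open>The length of the short interval does not depend on \<open>s\<close>, so finitely many
  of them, each starting from the zero reached by the previous one, cover any time.\<close>

lemma D_propagate:
  assumes s: "0 \<le> s" and w: "weights s Z Z'" and zero: "\<And>f. tfun L f \<Longrightarrow> D Z Z' s f = 0"
    and t: "s \<le> t" and f: "tfun L f"
  shows "D Z Z' t f = 0"
proof -
  define T0 where "T0 = (\<sigma> / (8 * B))\<^sup>2"
  have T0: "T0 > 0"
    using A.\<sigma>_pos A.B_pos by (simp add: T0_def)
  have *: "D Z Z' t f = 0" if "s \<le> t" "t \<le> s + real n * T0" "tfun L f" for n t f
    using that
  proof (induction n arbitrary: t f)
    case 0
    then show ?case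
      using zero by simp
  next
    case (Suc n)
    show ?case
    proof (cases "t \<le> s + real n * T0")
      case False
      let ?u = "s + real n * T0"
      have u: "s \<le> ?u"
        using T0 by simp
      have ut: "?u \<le> t" "t \<le> ?u + (\<sigma> / (8 * B))\<^sup>2"
        using False Suc.prems(2) by (simp_all add: T0_def[symmetric] distrib_right)
      have u0: "0 \<le> ?u"
        using s u by simp
      have "D Z Z' ?u f = 0" if "tfun L f" for f
        by (rule Suc.IH[OF u order_refl that])
      from D_propagate_short[OF u0 weights_mono[OF w u] this ut Suc.prems(3)]
      show ?thesis .
    qed (use Suc in auto)
  qed
  obtain n :: nat where "(t - s) / T0 < real n"
    using reals_Archimedean2 by blast
  then show ?thesis
    using *[of t n f] t f T0 by (simp add: field_simps)
qed

end

section \<open>Laws of processes\<close>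

lemma abs_cyl_le:
  assumes "\<And>t f. (t, f) \<in> set I \<Longrightarrow> tfun L f"
  shows "\<bar>cyl I x\<bar> \<le> 1"
  using assms
proof (induction I)
  case (Cons a I)
  obtain t f where a: "a = (t, f)"
    by (cases a)
  have "\<bar>cyl I x\<bar> \<le> 1" "\<bar>f (x t)\<bar> \<le> 1"
    using Cons.prems[of t f] by (auto intro!: Cons.IH Cons.prems tfun_abs[of L f] simp: a)
  then show ?case
    by (simp add: a abs_mult mult_le_one)
qed simp

lemma measurable_cyl_tfun:
  assumes "\<And>t f. (t, f) \<in> set I \<Longrightarrow> tfun L f \<and> (\<lambda>\<omega>. X t \<omega>) \<in> borel_measurable M"
  shows "(\<lambda>\<omega>. cyl I (\<lambda>t. X t \<omega>)) \<in> borel_measurable M"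
  using assms
proof (induction I)
  case (Cons a I)
  obtain t f where a: "a = (t, f)"
    by (cases a)
  have "(\<lambda>\<omega>. f (X t \<omega>)) \<in> borel_measurable M"
    using Cons.prems[of t f] by (auto simp: a intro: measurable_compose[OF _ tfun_measurable])
  then show ?case
    using Cons by (auto simp: a intro!: borel_measurable_times)
qed simp

text \<open>The passage from one time to many, shared by Brownian motion and the drift processes:
  \<open>propagate\<close> moves an equality of weighted expectations forward in time, and the
  factors already treated become part of the weight.\<close>

lemma cylinder_integrals_eq:
  fixes X :: "real \<Rightarrow> 'w \<Rightarrow> 'a::euclidean_space" and X' :: "real \<Rightarrow> 'v \<Rightarrow> 'a"
  assumes bm: "filtered_bm M F W" "filtered_bm M' F' W'"
    and X: "\<And>t. t \<ge> 0 \<Longrightarrow> X t \<in> borel_measurable (F t)" "\<And>t. t \<ge> 0 \<Longrightarrow> X' t \<in> borel_measurable (F' t)"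
    and propagate: "\<And>s t Z Z' f. 0 \<le> s \<Longrightarrow> s \<le> t \<Longrightarrow> Z \<in> borel_measurable (F s) \<Longrightarrow> Z' \<in> borel_measurable (F' s) \<Longrightarrow>
      (\<And>\<omega>. \<bar>Z \<omega>\<bar> \<le> 1) \<Longrightarrow> (\<And>\<omega>. \<bar>Z' \<omega>\<bar> \<le> 1) \<Longrightarrow>
      (\<And>f. tfun L f \<Longrightarrow> (\<integral>\<omega>. Z \<omega> * f (X s \<omega>) \<partial>M) = (\<integral>\<omega>. Z' \<omega> * f (X' s \<omega>) \<partial>M')) \<Longrightarrow> tfun L f \<Longrightarrow>
      (\<integral>\<omega>. Z \<omega> * f (X t \<omega>) \<partial>M) = (\<integral>\<omega>. Z' \<omega> * f (X' t \<omega>) \<partial>M')"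
    and init: "\<And>f. tfun L f \<Longrightarrow> (\<integral>\<omega>. f (X 0 \<omega>) \<partial>M) = (\<integral>\<omega>. f (X' 0 \<omega>) \<partial>M')"
    and I: "sorted (map fst I)" "\<And>t f. (t, f) \<in> set I \<Longrightarrow> 0 \<le> t \<and> tfun L f"
  shows "(\<integral>\<omega>. cyl I (\<lambda>t. X t \<omega>) \<partial>M) = (\<integral>\<omega>. cyl I (\<lambda>t. X' t \<omega>) \<partial>M')"
proof -
  interpret A: filtered_bm M F W by (rule bm)
  interpret A': filtered_bm M' F' W' by (rule bm)
  \<comment> \<open>Stated with one further factor at a later time \<open>s\<close>, which is what
    the induction on the last element needs.\<close>
  have *: "(\<integral>\<omega>. cyl I (\<lambda>t. X t \<omega>) * f (X s \<omega>) \<partial>M) = (\<integral>\<omega>. cyl I (\<lambda>t. X' t \<omega>) * f (X' s \<omega>) \<partial>M')"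
    if "sorted (map fst I)" "\<And>t f. (t, f) \<in> set I \<Longrightarrow> 0 \<le> t \<and> t \<le> s \<and> tfun L f" "0 \<le> s" "tfun L f" for I s f
    using that
  proof (induction I arbitrary: s f rule: rev_induct)
    case Nil
    have "(\<integral>\<omega>. 1 * f (X s \<omega>) \<partial>M) = (\<integral>\<omega>. 1 * f (X' s \<omega>) \<partial>M')"
      by (rule propagate[of 0 s "\<lambda>_. 1" "\<lambda>_. 1"]) (use Nil init in auto)
    then show ?case
      by simp
  next
    case (snoc a I)
    obtain t g where a: "a = (t, g)"
      by (cases a)
    have t: "0 \<le> t" "t \<le> s" and g: "tfun L g"
      using snoc.prems(2)[of t g] by (auto simp: a)
    have I: "0 \<le> r \<and> r \<le> t \<and> tfun L h" if "(r, h) \<in> set I" for r h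
      using snoc.prems(1) snoc.prems(2)[of r h] that by (auto simp: a sorted_append)
    have e: "cyl (I @ [a]) x = cyl I x * g (x t)" for x
      by (simp add: cyl_append a)
    show ?case
    proof (rule propagate[OF t])
      have "tfun L h \<and> (\<lambda>\<omega>. X r \<omega>) \<in> borel_measurable (F t)" if "(r, h) \<in> set (I @ [a])" for r h
        using that I g t by (auto simp: a intro: A.measurable_F_mono[OF X(1)])
      then show "(\<lambda>\<omega>. cyl (I @ [a]) (\<lambda>t. X t \<omega>)) \<in> borel_measurable (F t)"
        by (rule measurable_cyl_tfun)
      have "tfun L h \<and> (\<lambda>\<omega>. X' r \<omega>) \<in> borel_measurable (F' t)" if "(r, h) \<in> set (I @ [a])" for r h
        using that I g t by (auto simp: a intro: A'.measurable_F_mono[OF X(2)])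
      then show "(\<lambda>\<omega>. cyl (I @ [a]) (\<lambda>t. X' t \<omega>)) \<in> borel_measurable (F' t)"
        by (rule measurable_cyl_tfun)
      show "\<bar>cyl (I @ [a]) (\<lambda>t. X t \<omega>)\<bar> \<le> 1" for \<omega>
        by (rule abs_cyl_le[of _ L]) (use snoc.prems in blast)
      show "\<bar>cyl (I @ [a]) (\<lambda>t. X' t \<omega>)\<bar> \<le> 1" for \<omega>
        by (rule abs_cyl_le[of _ L]) (use snoc.prems in blast)
      show "tfun L f"
        by (rule snoc.prems)
      \<comment> \<open>At time \<open>t\<close> the factors \<open>g\<close> and \<open>h\<close>
        merge into one test function, and the induction hypothesis applies to the shorter
        list.\<close>
      show "(\<integral>\<omega>. cyl (I @ [a]) (\<lambda>t. X t \<omega>) * h (X t \<omega>) \<partial>M) = (\<integral>\<omega>. cyl (I @ [a]) (\<lambda>t. X' t \<omega>) * h (X' t \<omega>) \<partial>M')"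
        if h: "tfun L h" for h
      proof -
        have "sorted (map fst I)"
          using snoc.prems(1) by (simp add: sorted_append)
        from snoc.IH[OF this I t(1) tfun_mult[OF g h]] show ?thesis
          unfolding e by (simp add: mult.assoc)
      qed
    qed
  qed
  show ?thesis
  proof (cases "I = []")
    case True
    then show ?thesis
      using A.prob_space A'.prob_space by simp
  next
    case False
    define s where "s = Max (fst ` set I)"
    have s: "t \<le> s" if "(t, f) \<in> set I" for t f
      unfolding s_def using that by (intro Max_ge) force+
    \<comment> \<open>The constant 1 as the further factor removes it again.\<close>
    have "tfun L (\<lambda>_. 1)"
      by (auto simp: tfun_def uniformly_continuous_on_const)
    from *[OF I(1), of "max s 0", OF _ _ this] show ?thesis
      using I(2) s by (fastforce simp: le_max_iff_disj)
  qed
qed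

lemma tfun_empty: "uniformly_continuous_on UNIV f \<Longrightarrow> (\<And>x. 0 \<le> f x \<and> f x \<le> 1) \<Longrightarrow> tfun {} f"
  by (auto simp: tfun_def abs_le_iff intro: order_trans[of _ 0])

lemma space_cpath_law [simp]: "space (path_law M X) = UNIV"
  and sets_path_law [simp, measurable_cong]: "sets (path_law M X) = sets borel"
  by (simp_all add: path_law_def)

lemma integral_path_law:
  fixes X :: "real \<Rightarrow> 'w \<Rightarrow> 'a::{metric_space, second_countable_topology}" and G :: "'a cpath \<Rightarrow> real"
  assumes "\<And>\<omega>. \<omega> \<in> space M \<Longrightarrow> continuous_on {0..} (\<lambda>t. X t \<omega>)" "\<And>t. t \<ge> 0 \<Longrightarrow> X t \<in> borel_measurable M"
    and "G \<in> borel_measurable borel"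
  shows "(\<integral>p. G p \<partial>path_law M X) = (\<integral>\<omega>. G (path_of (\<lambda>t. X t \<omega>)) \<partial>M)"
  unfolding path_law_def by (rule integral_distr[OF borel_measurable_path_of]) (use assms in auto)

lemma prob_space_path_law:
  fixes X :: "real \<Rightarrow> 'w \<Rightarrow> 'a::{metric_space, second_countable_topology}"
  assumes "prob_space M"
    and "\<And>\<omega>. \<omega> \<in> space M \<Longrightarrow> continuous_on {0..} (\<lambda>t. X t \<omega>)" "\<And>t. t \<ge> 0 \<Longrightarrow> X t \<in> borel_measurable M"
  shows "prob_space (path_law M X)"
  unfolding path_law_def by (intro prob_space.prob_space_distr[OF assms(1)] borel_measurable_path_of assms)

lemma measurable_cyl_eval: "test_list I \<Longrightarrow> (\<lambda>p. cyl I (eval_path p)) \<in> borel_measurable borel"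
  by (rule borel_measurable_cyl) (auto simp: test_list_def intro: measurable_eval_path)

lemma cyl_cong: "(\<And>t f. (t, f) \<in> set I \<Longrightarrow> x t = y t) \<Longrightarrow> cyl I x = cyl I y"
  unfolding cyl_def by (intro arg_cong[where f = prod_list] map_cong) auto

lemma path_law_eqI:
  fixes X :: "real \<Rightarrow> 'w \<Rightarrow> 'a::{metric_space, second_countable_topology}" and X' :: "real \<Rightarrow> 'v \<Rightarrow> 'a"
  assumes "prob_space M" "prob_space M'"
    and X: "\<And>\<omega>. \<omega> \<in> space M \<Longrightarrow> continuous_on {0..} (\<lambda>t. X t \<omega>)" "\<And>t. t \<ge> 0 \<Longrightarrow> X t \<in> borel_measurable M"
    and X': "\<And>\<omega>. \<omega> \<in> space M' \<Longrightarrow> continuous_on {0..} (\<lambda>t. X' t \<omega>)" "\<And>t. t \<ge> 0 \<Longrightarrow> X' t \<in> borel_measurable M'"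
    and eq: "\<And>I. test_list I \<Longrightarrow> sorted (map fst I) \<Longrightarrow> (\<integral>\<omega>. cyl I (\<lambda>t. X t \<omega>) \<partial>M) = (\<integral>\<omega>. cyl I (\<lambda>t. X' t \<omega>) \<partial>M')"
  shows "path_law M X = path_law M' X'"
proof (rule cpath_measure_eqI)
  show "finite_measure (path_law M X)" "finite_measure (path_law M' X')"
    using prob_space_path_law[OF assms(1) X] prob_space_path_law[OF assms(2) X'] by (simp_all add: prob_space.finite_measure)
  fix I :: "(real \<times> ('a \<Rightarrow> real)) list" assume I: "test_list I" "sorted (map fst I)"
  have *: "(\<integral>p. cyl I (eval_path p) \<partial>path_law N Y) = (\<integral>\<omega>. cyl I (\<lambda>t. Y t \<omega>) \<partial>N)"
    if Y: "\<And>\<omega>. \<omega> \<in> space N \<Longrightarrow> continuous_on {0..} (\<lambda>t. Y t \<omega>)" "\<And>t. t \<ge> 0 \<Longrightarrow> Y t \<in> borel_measurable N"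
    for N :: "'b measure" and Y :: "real \<Rightarrow> 'b \<Rightarrow> 'a"
  proof -
    have "(\<integral>p. cyl I (eval_path p) \<partial>path_law N Y) = (\<integral>\<omega>. cyl I (eval_path (path_of (\<lambda>t. Y t \<omega>))) \<partial>N)"
      by (rule integral_path_law[OF Y measurable_cyl_eval[OF I(1)]])
    also have "\<dots> = (\<integral>\<omega>. cyl I (\<lambda>t. Y t \<omega>) \<partial>N)"
      using I(1) Y(1) by (intro Bochner_Integration.integral_cong refl cyl_cong)
        (auto simp: test_list_def eval_path_of)
    finally show ?thesis .
  qed
  show "(\<integral>p. cyl I (eval_path p) \<partial>path_law M X) = (\<integral>p. cyl I (eval_path p) \<partial>path_law M' X')"
    by (rule trans[OF *[OF X] trans[OF eq[OF I] *[OF X', symmetric]]])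
qed simp_all

text \<open>\<open>U\<close> and \<open>U'\<close> are versions with all paths continuous. As their
  laws are equal, an estimate for one Brownian motion holds with the same constants for a whole
  sequence of them.\<close>

lemma bm_path_law_unique:
  fixes W U :: "real \<Rightarrow> 'w \<Rightarrow> 'a::euclidean_space" and W' U' :: "real \<Rightarrow> 'v \<Rightarrow> 'a"
  assumes bm: "filtered_bm M F W" "filtered_bm M' F' W'"
    and U: "\<And>\<omega>. \<omega> \<in> space M \<Longrightarrow> continuous_on {0..} (\<lambda>t. U t \<omega>)" "\<And>t. t \<ge> 0 \<Longrightarrow> U t \<in> borel_measurable M"
      "AE \<omega> in M. \<forall>t\<ge>0. U t \<omega> = W t \<omega>"
    and U': "\<And>\<omega>. \<omega> \<in> space M' \<Longrightarrow> continuous_on {0..} (\<lambda>t. U' t \<omega>)" "\<And>t. t \<ge> 0 \<Longrightarrow> U' t \<in> borel_measurable M'"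
      "AE \<omega> in M'. \<forall>t\<ge>0. U' t \<omega> = W' t \<omega>"
  shows "path_law M U = path_law M' U'"
proof -
  interpret A: filtered_bm M F W by (rule bm)
  interpret A': filtered_bm M' F' W' by (rule bm)
  show ?thesis
  proof (rule path_law_eqI[OF A.prob_space_axioms A'.prob_space_axioms U(1,2) U'(1,2)])
    fix I :: "(real \<times> ('a \<Rightarrow> real)) list" assume I: "test_list I" "sorted (map fst I)"
    have "(\<integral>\<omega>. cyl I (\<lambda>t. W t \<omega>) \<partial>M) = (\<integral>\<omega>. cyl I (\<lambda>t. W' t \<omega>) \<partial>M')"
    proof (rule cylinder_integrals_eq[OF bm A.W_F A'.W_F, of "{}"])
      fix s t :: real and Z :: "'w \<Rightarrow> real" and Z' :: "'v \<Rightarrow> real" and f :: "'a \<Rightarrow> real"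
      assume st: "0 \<le> s" "s \<le> t" and Z: "Z \<in> borel_measurable (F s)" "Z' \<in> borel_measurable (F' s)"
        "\<And>\<omega>. \<bar>Z \<omega>\<bar> \<le> 1" "\<And>\<omega>. \<bar>Z' \<omega>\<bar> \<le> 1"
        and eq: "\<And>f. tfun {} f \<Longrightarrow> (\<integral>\<omega>. Z \<omega> * f (W s \<omega>) \<partial>M) = (\<integral>\<omega>. Z' \<omega> * f (W' s \<omega>) \<partial>M')"
        and f: "tfun {} f"
      show "(\<integral>\<omega>. Z \<omega> * f (W t \<omega>) \<partial>M) = (\<integral>\<omega>. Z' \<omega> * f (W' t \<omega>) \<partial>M')"
      proof (cases "s = t")
        case False
        with st have lt: "s < t"
          by simp
        note fm = tfun_measurable[OF f] and f1 = tfun_abs[OF f]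
        have "(\<integral>\<omega>. Z \<omega> * f (W t \<omega>) \<partial>M) = (\<integral>\<omega>. Z \<omega> * heat 1 (t - s) f (W s \<omega>) \<partial>M)"
          using A.heat_freeze[OF st(1) lt Z(1,3) A.W_F[OF st(1)] fm f1, of 1] by simp
        moreover have "(\<integral>\<omega>. Z' \<omega> * f (W' t \<omega>) \<partial>M') = (\<integral>\<omega>. Z' \<omega> * heat 1 (t - s) f (W' s \<omega>) \<partial>M')"
          using A'.heat_freeze[OF st(1) lt Z(2,4) A'.W_F[OF st(1)] fm f1, of 1] by simp
        ultimately show ?thesis
          using eq[OF tfun_heat[OF f, of "t - s" 1]] lt by simp
      qed (use eq f in simp)
    next
      fix f :: "'a \<Rightarrow> real" assume f: "tfun {} f"
      have "(\<integral>\<omega>. f (W 0 \<omega>) \<partial>M) = (\<integral>\<omega>. f 0 \<partial>M)"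
        using A.bm measurable_compose[OF A.W_M[of 0] tfun_measurable[OF f]]
        by (intro integral_cong_AE) (auto simp: brownian_motion_def)
      moreover have "(\<integral>\<omega>. f (W' 0 \<omega>) \<partial>M') = (\<integral>\<omega>. f 0 \<partial>M')"
        using A'.bm measurable_compose[OF A'.W_M[of 0] tfun_measurable[OF f]]
        by (intro integral_cong_AE) (auto simp: brownian_motion_def)
      ultimately show "(\<integral>\<omega>. f (W 0 \<omega>) \<partial>M) = (\<integral>\<omega>. f (W' 0 \<omega>) \<partial>M')"
        using A.prob_space A'.prob_space by simp
    next
      show "0 \<le> t \<and> tfun {} f" if "(t, f) \<in> set I" for t f
        using I(1) that by (auto simp: test_list_def intro!: tfun_empty)
    qed (use I in auto)
    moreover have "(\<integral>\<omega>. cyl I (\<lambda>t. U t \<omega>) \<partial>M) = (\<integral>\<omega>. cyl I (\<lambda>t. W t \<omega>) \<partial>M)"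
    proof (rule integral_cong_AE)
      show "AE \<omega> in M. cyl I (\<lambda>t. U t \<omega>) = cyl I (\<lambda>t. W t \<omega>)"
        using U(3) by eventually_elim (use I in \<open>auto intro!: cyl_cong simp: test_list_def\<close>)
    qed (use I U(2) A.W_M in \<open>auto intro!: borel_measurable_cyl simp: test_list_def\<close>)
    moreover have "(\<integral>\<omega>. cyl I (\<lambda>t. U' t \<omega>) \<partial>M') = (\<integral>\<omega>. cyl I (\<lambda>t. W' t \<omega>) \<partial>M')"
    proof (rule integral_cong_AE)
      show "AE \<omega> in M'. cyl I (\<lambda>t. U' t \<omega>) = cyl I (\<lambda>t. W' t \<omega>)"
        using U'(3) by eventually_elim (use I in \<open>auto intro!: cyl_cong simp: test_list_def\<close>)
    qed (use I U'(2) A'.W_M in \<open>auto intro!: borel_measurable_cyl simp: test_list_def\<close>)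
    ultimately show "(\<integral>\<omega>. cyl I (\<lambda>t. U t \<omega>) \<partial>M) = (\<integral>\<omega>. cyl I (\<lambda>t. U' t \<omega>) \<partial>M')"
      by simp
  qed
qed

section \<open>The torus and the overdamped equation\<close>

lemma to_torus_add: "k \<in> int_lattice \<Longrightarrow> to_torus (x + k) = to_torus x"
  by (simp add: to_torus_eq_iff)

lemma dist_to_torus_le: "dist (to_torus x) (to_torus y) \<le> dist x y"
  using infdist_int_lattice_le[OF int_lattice_0, of "x - y"] by (simp add: dist_to_torus dist_norm)

lemma uniformly_continuous_to_torus: "uniformly_continuous_on UNIV to_torus"
  unfolding uniformly_continuous_on_def using dist_to_torus_le by (meson le_less_trans)

lemma continuous_to_torus: "continuous_on UNIV to_torus"
  by (rule uniformly_continuous_imp_continuous[OF uniformly_continuous_to_torus])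

lemma borel_measurable_to_torus [measurable]: "to_torus \<in> borel_measurable borel"
  by (intro borel_measurable_continuous_onI continuous_to_torus)

text \<open>The lattice translation that brings a lift into the unit cube, so that initial positions
  stay in a compact set although the lifts may start anywhere.\<close>

definition floor_vec :: "real ^ 'n::finite \<Rightarrow> real ^ 'n" where
  "floor_vec x = (\<chi> i. of_int \<lfloor>x $ i\<rfloor>)"

lemma floor_vec_lattice: "floor_vec x \<in> int_lattice"
  by (simp add: floor_vec_def int_lattice_def)

lemma minus_floor_vec_cbox: "x - floor_vec x \<in> cbox 0 1"
  by (auto simp: floor_vec_def mem_box_cart) linarith

lemma to_torus_minus_floor: "to_torus (x - floor_vec y) = to_torus x"
  using to_torus_add[OF int_lattice_minus[OF floor_vec_lattice[of y]], of x] by simp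

lemma borel_measurable_floor_vec [measurable]: "floor_vec \<in> borel_measurable borel"
  unfolding borel_measurable_euclidean_space[of floor_vec]
proof
  fix b :: "real ^ 'n" assume "b \<in> Basis"
  then obtain i where b: "b = axis i 1"
    by (auto simp: Basis_vec_def)
  have "(\<lambda>x :: real ^ 'n. real_of_int \<lfloor>x \<bullet> axis i 1\<rfloor>) \<in> borel_measurable borel"
    by measurable
  then show "(\<lambda>x. floor_vec x \<bullet> b) \<in> borel_measurable borel"
    by (simp add: b floor_vec_def inner_axis)
qed

lemma compact_torus: "compact (UNIV :: 'n::finite torus set)"
proof -
  have "(UNIV :: 'n torus set) = to_torus ` cbox 0 1"
  proof (intro equalityI subsetI)
    fix q :: "'n torus"
    have "q = to_torus (rep_torus q - floor_vec (rep_torus q))"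
      by (simp add: to_torus_minus_floor)
    then show "q \<in> to_torus ` cbox 0 1"
      using minus_floor_vec_cbox by blast
  qed simp
  then show ?thesis
    using compact_continuous_image[OF continuous_on_subset[OF continuous_to_torus] compact_cbox]
    by (metis subset_UNIV)
qed

lemma periodic_grad:
  assumes "C1_torus V"
  obtains B where "B > 0" "\<And>q. norm (torus_grad V q) \<le> B"
proof -
  have "bounded (range (torus_grad V))"
    using assms by (intro compact_imp_bounded compact_continuous_image compact_torus) (simp add: C1_torus_def)
  then obtain B where "\<And>q. norm (torus_grad V q) \<le> B"
    unfolding bounded_iff by auto
  then show ?thesis
    by (intro that[of "max B 1"]) (auto simp: le_max_iff_disj)
qed

lemma uniformly_continuous_grad:
  assumes "C1_torus V"
  shows "uniformly_continuous_on UNIV (torus_grad V)"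
  using assms by (intro compact_uniformly_continuous compact_torus) (simp add: C1_torus_def)

lemma uniformly_continuous_lift:
  fixes f :: "'n::finite torus \<Rightarrow> 'b::metric_space"
  assumes "uniformly_continuous_on UNIV f"
  shows "uniformly_continuous_on UNIV (\<lambda>x. f (to_torus x))"
  unfolding uniformly_continuous_on_def
proof (intro allI impI)
  fix e :: real assume "e > 0"
  with assms obtain d where d: "d > 0" "\<And>x y. dist y x < d \<Longrightarrow> dist (f y) (f x) < e"
    unfolding uniformly_continuous_on_def by auto
  show "\<exists>d>0. \<forall>x\<in>UNIV. \<forall>y\<in>UNIV. dist y x < d \<longrightarrow> dist (f (to_torus y)) (f (to_torus x)) < e"
    using d dist_to_torus_le by (meson le_less_trans)
qed

lemma uniformly_continuous_drift:
  assumes "C1_torus V"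
  shows "uniformly_continuous_on UNIV (\<lambda>x. - torus_grad V (to_torus x))"
  by (intro uniformly_continuous_on_minus uniformly_continuous_lift uniformly_continuous_grad assms)

lemma set_lint_eq_integral:
  fixes f :: "real \<Rightarrow> 'a::euclidean_space"
  assumes "continuous_on {0..} f"
  shows "(LINT s:{0..t}|lborel. f s) = integral {0..t} f" "set_integrable lborel {0..t} f"
proof -
  have "continuous_on {0..t} f"
    by (rule continuous_on_subset[OF assms]) auto
  then show "set_integrable lborel {0..t} f"
    by (rule borel_integrable_atLeastAtMost')
  then show "(LINT s:{0..t}|lborel. f s) = integral {0..t} f"
    by (rule set_borel_integral_eq_integral(2))
qed

lemma filtered_bmI: "filtered_prob_space M F \<Longrightarrow> brownian_motion M F W \<Longrightarrow> filtered_bm M F W"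
  by (rule filtered_bm.intro)

text \<open>The Lebesgue integral in the notion of solution becomes the Henstock-Kurzweil integral,
  in which the pathwise estimates are carried out.\<close>

lemma overdamped_driftE:
  fixes V :: "'n::finite torus \<Rightarrow> real"
  assumes sol: "overdamped_solution \<beta> V M Q" and \<beta>: "\<beta> > 0" and V: "C1_torus V"
    and B: "B > 0" "\<And>q. norm (torus_grad V q) \<le> B"
  obtains F W X where "drift_process M F W X (\<lambda>x. - torus_grad V (to_torus x)) (sqrt (2 * inverse \<beta>)) B"
    "\<And>t \<omega>. t \<ge> 0 \<Longrightarrow> \<omega> \<in> space M \<Longrightarrow> Q t \<omega> = to_torus (X t \<omega>)"
proof -
  obtain X where ws: "weak_solution (\<lambda>x. - torus_grad V (to_torus x))
      (\<lambda>w :: real ^ 'n. sqrt (2 * inverse \<beta>) *\<^sub>R w) M X"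
    and Q: "\<And>t \<omega>. t \<ge> 0 \<Longrightarrow> \<omega> \<in> space M \<Longrightarrow> Q t \<omega> = to_torus (X t \<omega>)"
    using sol unfolding overdamped_solution_def by blast
  let ?b = "\<lambda>x. - torus_grad V (to_torus x)"
  from ws have c: "\<And>\<omega>. \<omega> \<in> space M \<Longrightarrow> continuous_on {0..} (\<lambda>t. X t \<omega>)"
    by (simp add: weak_solution_def)
  from ws obtain F and W :: "real \<Rightarrow> 'a \<Rightarrow> real ^ 'n" where FW: "filtered_prob_space M F" "brownian_motion M F W" "adapted F X"
      and eq: "AE \<omega> in M. \<forall>t\<ge>0. set_integrable lborel {0..t} (\<lambda>s. ?b (X s \<omega>)) \<and>
           X t \<omega> = X 0 \<omega> + (LINT s:{0..t}|lborel. ?b (X s \<omega>)) + sqrt (2 * inverse \<beta>) *\<^sub>R (W t \<omega> - W 0 \<omega>)"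
    unfolding weak_solution_def by blast
  interpret bm: filtered_bm M F W
    using FW by (intro filtered_bmI)
  have "drift_process M F W X ?b (sqrt (2 * inverse \<beta>)) B"
  proof (unfold_locales)
    show "AE \<omega> in M. \<forall>t\<ge>0. X t \<omega> = X 0 \<omega> + integral {0..t} (\<lambda>s. ?b (X s \<omega>)) + sqrt (2 * inverse \<beta>) *\<^sub>R (W t \<omega> - W 0 \<omega>)"
      using eq
    proof eventually_elim
      case (elim \<omega>)
      show ?case
      proof (intro allI impI)
        fix t :: real assume "t \<ge> 0"
        then have *: "set_integrable lborel {0..t} (\<lambda>s. ?b (X s \<omega>))"
          "X t \<omega> = X 0 \<omega> + (LINT s:{0..t}|lborel. ?b (X s \<omega>)) + sqrt (2 * inverse \<beta>) *\<^sub>R (W t \<omega> - W 0 \<omega>)"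
          using elim by blast+
        show "X t \<omega> = X 0 \<omega> + integral {0..t} (\<lambda>s. ?b (X s \<omega>)) + sqrt (2 * inverse \<beta>) *\<^sub>R (W t \<omega> - W 0 \<omega>)"
          using *(2) unfolding set_borel_integral_eq_integral(2)[OF *(1)] .
      qed
    qed
  qed (use \<beta> B FW(3) c uniformly_continuous_drift[OF V] in \<open>auto simp: adapted_def\<close>)
  then show ?thesis
    using Q by (rule that)
qed

lemma cyl_map: "cyl (map (\<lambda>(t, f). (t, \<lambda>x. f (h x))) I) x = cyl I (\<lambda>t. h (x t))"
  by (induction I) auto

text \<open>The lifts of two solutions may start in different cells of the lattice, so their laws
  need not agree; periodic test functions see only the projections.\<close>

theorem overdamped_law_unique:
  fixes V :: "'n::finite torus \<Rightarrow> real" and N :: "'w measure" and N' :: "'v measure"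
  assumes \<beta>: "\<beta> > 0" and V: "C1_torus V"
    and sol: "overdamped_solution \<beta> V N R" and sol': "overdamped_solution \<beta> V N' R'"
    and init: "distr N borel (R 0) = distr N' borel (R' 0)"
  shows "path_law N R = path_law N' R'"
proof -
  obtain B where B: "B > 0" "\<And>q. norm (torus_grad V q) \<le> B"
    using periodic_grad[OF V] by blast
  let ?b = "\<lambda>x. - torus_grad V (to_torus x)" and ?\<sigma> = "sqrt (2 * inverse \<beta>)"
  obtain F W X where X: "drift_process N F W X ?b ?\<sigma> B"
    "\<And>t \<omega>. t \<ge> 0 \<Longrightarrow> \<omega> \<in> space N \<Longrightarrow> R t \<omega> = to_torus (X t \<omega>)"
    using overdamped_driftE[OF sol \<beta> V B] by metis
  obtain F' W' X' where X': "drift_process N' F' W' X' ?b ?\<sigma> B"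
    "\<And>t \<omega>. t \<ge> 0 \<Longrightarrow> \<omega> \<in> space N' \<Longrightarrow> R' t \<omega> = to_torus (X' t \<omega>)"
    using overdamped_driftE[OF sol' \<beta> V B] by metis
  interpret A: drift_process N F W X ?b ?\<sigma> B by (rule X)
  interpret A': drift_process N' F' W' X' ?b ?\<sigma> B by (rule X')
  interpret T: two_drift_processes N F W X N' F' W' X' ?b ?\<sigma> B int_lattice
    by unfold_locales (simp add: to_torus_add)
  have R0: "R 0 \<in> borel_measurable N" "R' 0 \<in> borel_measurable N'"
    using measurable_compose[OF A.X_M[of 0] borel_measurable_to_torus]
      measurable_compose[OF A'.X_M[of 0] borel_measurable_to_torus]
    by (simp_all add: X(2) X'(2) cong: measurable_cong)
  have law: "path_law N (\<lambda>t \<omega>. to_torus (X t \<omega>)) = path_law N' (\<lambda>t \<omega>. to_torus (X' t \<omega>))"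
  proof (rule path_law_eqI[OF A.prob_space_axioms A'.prob_space_axioms])
    show "continuous_on {0..} (\<lambda>t. to_torus (X t \<omega>))" if "\<omega> \<in> space N" for \<omega>
      by (rule continuous_on_compose2[OF continuous_to_torus A.X_cont[OF that]]) simp
    show "continuous_on {0..} (\<lambda>t. to_torus (X' t \<omega>))" if "\<omega> \<in> space N'" for \<omega>
      by (rule continuous_on_compose2[OF continuous_to_torus A'.X_cont[OF that]]) simp
    show "(\<lambda>\<omega>. to_torus (X t \<omega>)) \<in> borel_measurable N" if "t \<ge> 0" for t
      by (rule measurable_compose[OF A.X_M[OF that] borel_measurable_to_torus])
    show "(\<lambda>\<omega>. to_torus (X' t \<omega>)) \<in> borel_measurable N'" if "t \<ge> 0" for t
      by (rule measurable_compose[OF A'.X_M[OF that] borel_measurable_to_torus])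
    fix I :: "(real \<times> ('n torus \<Rightarrow> real)) list" assume I: "test_list I" "sorted (map fst I)"
    define I' where "I' = map (\<lambda>(t, f). (t, \<lambda>x. f (to_torus x))) I"
    have "(\<integral>\<omega>. cyl I' (\<lambda>t. X t \<omega>) \<partial>N) = (\<integral>\<omega>. cyl I' (\<lambda>t. X' t \<omega>) \<partial>N')"
    proof (rule cylinder_integrals_eq[of N F W N' F' W' X X' int_lattice])
      fix s t Z Z' and f :: "real ^ 'n \<Rightarrow> real"
      assume "0 \<le> s" "s \<le> t" "Z \<in> borel_measurable (F s)" "Z' \<in> borel_measurable (F' s)"
        "\<And>\<omega>. \<bar>Z \<omega>\<bar> \<le> 1" "\<And>\<omega>. \<bar>Z' \<omega>\<bar> \<le> 1"
        "\<And>f. tfun int_lattice f \<Longrightarrow> (\<integral>\<omega>. Z \<omega> * f (X s \<omega>) \<partial>N) = (\<integral>\<omega>. Z' \<omega> * f (X' s \<omega>) \<partial>N')"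
        "tfun int_lattice f"
      then show "(\<integral>\<omega>. Z \<omega> * f (X t \<omega>) \<partial>N) = (\<integral>\<omega>. Z' \<omega> * f (X' t \<omega>) \<partial>N')"
        using T.D_propagate[of s Z Z' t f] by (simp add: T.D_def T.weights_def)
    next
      fix f :: "real ^ 'n \<Rightarrow> real" assume f: "tfun int_lattice f"
      \<comment> \<open>A periodic function factors through the torus; \<open>g\<close> is
        continuous because the metric topology is the quotient topology.\<close>
      define g where "g q = f (rep_torus q)" for q
      have fg: "f x = g (to_torus x)" for x
      proof -
        have "f (x + (rep_torus (to_torus x) - x)) = f x"
          using f rep_to_torus[of x] unfolding tfun_def by blast
        then show ?thesis
          by (simp add: g_def)
      qed
      have "open (g -` S)" if "open S" for S
      proof -
        have "to_torus -` (g -` S) = f -` S"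
          using fg by auto
        moreover have "open (f -` S)"
          using f that by (intro open_vimage uniformly_continuous_imp_continuous) (auto simp: tfun_def)
        ultimately show ?thesis
          by (simp add: open_torus_iff)
      qed
      then have [measurable]: "g \<in> borel_measurable borel"
        by (intro borel_measurable_continuous_onI) (simp add: continuous_on_open_vimage)
      have "(\<integral>\<omega>. f (X 0 \<omega>) \<partial>N) = (\<integral>\<omega>. g (R 0 \<omega>) \<partial>N)"
        by (intro Bochner_Integration.integral_cong) (simp_all add: fg X(2))
      also have "\<dots> = (\<integral>q. g q \<partial>distr N borel (R 0))"
        using R0 by (intro integral_distr[symmetric]) auto
      also have "\<dots> = (\<integral>\<omega>. g (R' 0 \<omega>) \<partial>N')"
        unfolding init using R0 by (intro integral_distr) auto
      also have "\<dots> = (\<integral>\<omega>. f (X' 0 \<omega>) \<partial>N')"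
        by (intro Bochner_Integration.integral_cong) (simp_all add: fg X'(2))
      finally show "(\<integral>\<omega>. f (X 0 \<omega>) \<partial>N) = (\<integral>\<omega>. f (X' 0 \<omega>) \<partial>N')" .
    next
      show "sorted (map fst I')"
        using I(2) by (simp add: I'_def o_def case_prod_beta)
      show "0 \<le> t \<and> tfun int_lattice f" if tf: "(t, f) \<in> set I'" for t f
      proof -
        obtain g where g: "(t, g) \<in> set I" "f = (\<lambda>x. g (to_torus x))"
          using tf by (auto simp: I'_def)
        then have "0 \<le> t" "uniformly_continuous_on UNIV g" "\<And>x. 0 \<le> g x \<and> g x \<le> 1"
          using I(1) by (auto simp: test_list_def)
        then show ?thesis
          unfolding tfun_def g(2)
          by (auto intro!: uniformly_continuous_lift simp: to_torus_add abs_le_iff intro: order_trans[of _ 0])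
      qed
    qed (auto intro: A.X_F A'.X_F A.filtered_bm_axioms A'.filtered_bm_axioms)
    then show "(\<integral>\<omega>. cyl I (\<lambda>t. to_torus (X t \<omega>)) \<partial>N) = (\<integral>\<omega>. cyl I (\<lambda>t. to_torus (X' t \<omega>)) \<partial>N')"
      unfolding I'_def cyl_map .
  qed
  have "path_law N R = path_law N (\<lambda>t \<omega>. to_torus (X t \<omega>))"
    "path_law N' R' = path_law N' (\<lambda>t \<omega>. to_torus (X' t \<omega>))"
    unfolding path_law_def by (auto intro!: distr_cong path_of_cong simp: X(2) X'(2))
  with law show ?thesis
    by simp
qed

text \<open>A strongly damped linear equation forgets its past on the time scale \<open>1 / \<gamma>\<close>, on which the
  noise moves by at most \<open>\<eta>\<close>.\<close>

lemma damped_step: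
  fixes R w g :: "real \<Rightarrow> 'a::euclidean_space"
  assumes cont: "continuous_on {0..} R" "continuous_on {0..} g" "continuous_on {0..} w"
    and eq: "\<And>t. t \<ge> 0 \<Longrightarrow> R t = R 0 + integral {0..t} (\<lambda>s. - g s - \<gamma> *\<^sub>R R s) + w t"
    and g: "\<And>s. s \<ge> 0 \<Longrightarrow> norm (g s) \<le> B" and \<gamma>: "\<gamma> > 0"
    and a: "0 \<le> a" "a < t" and osc: "\<And>s. a \<le> s \<Longrightarrow> s \<le> t \<Longrightarrow> norm (w s - w t) \<le> \<eta>"
  shows "norm (R t) \<le> exp (- \<gamma> * (t - a)) * (norm (R a) + \<eta>) + (B / \<gamma> + \<eta>)"
proof -
  let ?r = "\<lambda>s. - g s - \<gamma> *\<^sub>R R s"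
  \<comment> \<open>The noise \<open>w\<close> need not be differentiable, so the differentiable
    part \<open>U\<close> of \<open>R\<close> is split off.\<close>
  define U where "U s = R 0 + integral {0..s} ?r" for s
  have contr: "continuous_on {0..t} ?r"
    by (intro continuous_intros continuous_on_subset[OF cont(1)] continuous_on_subset[OF cont(2)]) auto
  have RU: "R s = U s + w s" if "s \<ge> 0" for s
    using eq[OF that] by (simp add: U_def)
  have dU: "(U has_vector_derivative ?r s) (at s)" if "a < s" "s < t" for s
  proof -
    have "((\<lambda>u. integral {0..u} ?r) has_vector_derivative ?r s) (at s within {0..t})"
      using that a by (intro integral_has_vector_derivative contr) auto
    then have "((\<lambda>u. integral {0..u} ?r) has_vector_derivative ?r s) (at s)"
      using that a by (simp add: at_within_Icc_at)
    from has_vector_derivative_add[OF has_vector_derivative_const this] show ?thesis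
      unfolding U_def by simp
  qed
  \<comment> \<open>The integrating factor is applied with the noise frozen at its terminal value,
    so that only differences \<open>w s - w t\<close> enter the derivative; these are at most
    \<open>\<eta>\<close>. The majorant \<open>\<phi>\<close> is an antiderivative of the resulting
    bound \<open>exp (\<gamma> * s) * (B + \<gamma> * \<eta>)\<close>.\<close>
  define f where "f s = exp (\<gamma> * s) *\<^sub>R (U s + w t)" for s
  define \<phi> where "\<phi> s = (B / \<gamma> + \<eta>) * exp (\<gamma> * s)" for s
  have "norm (f t - f a) \<le> \<phi> t - \<phi> a"
  proof (rule differentiable_bound_general[OF a(2)])
    have "continuous_on {0..t} U"
      unfolding U_def by (intro continuous_intros indefinite_integral_continuous_1 integrable_continuous_interval contr)
    then have "continuous_on {a..t} U"
      by (rule continuous_on_subset) (use a in auto)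
    then show "continuous_on {a..t} f"
      unfolding f_def by (intro continuous_intros)
    show "continuous_on {a..t} \<phi>"
      unfolding \<phi>_def by (intro continuous_intros)
    fix s assume s: "a < s" "s < t"
    have de: "((\<lambda>s. exp (\<gamma> * s)) has_vector_derivative \<gamma> * exp (\<gamma> * s)) (at s)"
      by (auto intro!: derivative_eq_intros simp: has_real_derivative_iff_has_vector_derivative[symmetric])
    have dV: "((\<lambda>s. U s + w t) has_vector_derivative ?r s) (at s)"
      using has_vector_derivative_add[OF dU[OF s] has_vector_derivative_const[of "w t"]] by simp
    show "(f has_vector_derivative exp (\<gamma> * s) *\<^sub>R ?r s + (\<gamma> * exp (\<gamma> * s)) *\<^sub>R (U s + w t)) (at s)"
      unfolding f_def
      using has_vector_derivative_scaleR[OF de[folded has_real_derivative_iff_has_vector_derivative] dV] .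
    show "(\<phi> has_vector_derivative (B / \<gamma> + \<eta>) * (\<gamma> * exp (\<gamma> * s))) (at s)"
      unfolding \<phi>_def by (auto intro!: derivative_eq_intros simp: has_real_derivative_iff_has_vector_derivative[symmetric])
    have "exp (\<gamma> * s) *\<^sub>R ?r s + (\<gamma> * exp (\<gamma> * s)) *\<^sub>R (U s + w t) = exp (\<gamma> * s) *\<^sub>R (- g s - \<gamma> *\<^sub>R (w s - w t))"
      using RU[of s] s a by (simp add: algebra_simps)
    moreover have "norm (- g s - \<gamma> *\<^sub>R (w s - w t)) \<le> B + \<gamma> * \<eta>"
    proof -
      have "norm (- g s - \<gamma> *\<^sub>R (w s - w t)) \<le> norm (g s) + \<gamma> * norm (w s - w t)"
        using norm_triangle_ineq4[of "- g s" "\<gamma> *\<^sub>R (w s - w t)"] \<gamma> by simp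
      also have "\<dots> \<le> B + \<gamma> * \<eta>"
        using s a \<gamma> by (intro add_mono mult_left_mono g osc) auto
      finally show ?thesis .
    qed
    ultimately have "norm (exp (\<gamma> * s) *\<^sub>R ?r s + (\<gamma> * exp (\<gamma> * s)) *\<^sub>R (U s + w t)) \<le> exp (\<gamma> * s) * (B + \<gamma> * \<eta>)"
      by simp
    also have "\<dots> = (B / \<gamma> + \<eta>) * (\<gamma> * exp (\<gamma> * s))"
      using \<gamma> by (simp add: field_simps)
    finally show "norm (exp (\<gamma> * s) *\<^sub>R ?r s + (\<gamma> * exp (\<gamma> * s)) *\<^sub>R (U s + w t)) \<le> (B / \<gamma> + \<eta>) * (\<gamma> * exp (\<gamma> * s))" .
  qed
  moreover have "norm (f t) \<le> norm (f a) + norm (f t - f a)"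
    by (metis add.commute norm_triangle_sub)
  moreover have "f t = exp (\<gamma> * t) *\<^sub>R R t"
    using RU[of t] a by (simp add: f_def)
  moreover have "norm (f a) \<le> exp (\<gamma> * a) * (norm (R a) + \<eta>)"
  proof -
    have e: "U a + w t = R a - (w a - w t)"
      using RU[of a] a by simp
    have "norm (U a + w t) \<le> norm (R a) + \<eta>"
      unfolding e using norm_triangle_ineq4[of "R a" "w a - w t"] osc[of a] a by linarith
    then show ?thesis
      by (simp add: f_def)
  qed
  ultimately have "exp (\<gamma> * t) * norm (R t) \<le> exp (\<gamma> * a) * (norm (R a) + \<eta>) + \<phi> t - \<phi> a"
    by simp
  also have "\<dots> \<le> exp (\<gamma> * a) * (norm (R a) + \<eta>) + \<phi> t"
  proof -
    have "B \<ge> 0" "\<eta> \<ge> 0"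
      using order_trans[OF norm_ge_zero g[of 0]] order_trans[OF norm_ge_zero osc[of t]] a by auto
    then show ?thesis
      using \<gamma> by (simp add: \<phi>_def)
  qed
  finally have "exp (- (\<gamma> * t)) * (exp (\<gamma> * t) * norm (R t)) \<le>
      exp (- (\<gamma> * t)) * (exp (\<gamma> * a) * (norm (R a) + \<eta>) + \<phi> t)"
    by (intro mult_left_mono) auto
  moreover have e: "exp (- (\<gamma> * t)) * exp (\<gamma> * t) = 1" "exp (- (\<gamma> * t)) * exp (\<gamma> * a) = exp (- \<gamma> * (t - a))"
    by (simp_all add: exp_add[symmetric] algebra_simps)
  moreover have "p * (q * n) = (p * q) * n" "p * (r * n + c * q) = (p * r) * n + c * (p * q)" for p q r n c :: real
    by (simp_all add: algebra_simps)
  ultimately show ?thesis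
    unfolding \<phi>_def by (simp only: e mult_1_left mult_1_right)
qed

text \<open>At the point \<open>m\<close> where \<open>norm (R m)\<close> is largest, looking back
  by \<open>\<tau>\<close> bounds it by half of itself plus
  \<open>B / \<gamma> + 3 / 2 * \<eta>\<close>, and the half is absorbed. If
  \<open>m \<le> \<tau>\<close>, one step from time 0 suffices.\<close>

lemma damped_bound:
  fixes R w g :: "real \<Rightarrow> 'a::euclidean_space"
  assumes cont: "continuous_on {0..} R" "continuous_on {0..} g" "continuous_on {0..} w"
    and eq: "\<And>t. t \<ge> 0 \<Longrightarrow> R t = R 0 + integral {0..t} (\<lambda>s. - g s - \<gamma> *\<^sub>R R s) + w t"
    and g: "\<And>s. s \<ge> 0 \<Longrightarrow> norm (g s) \<le> B" and \<gamma>: "\<gamma> > 0"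
    and osc: "\<And>s t. s \<in> {0..T} \<Longrightarrow> t \<in> {0..T} \<Longrightarrow> \<bar>s - t\<bar> \<le> \<tau> \<Longrightarrow> norm (w s - w t) \<le> \<eta>"
    and \<tau>: "\<tau> > 0" "exp (- \<gamma> * \<tau>) \<le> 1 / 2" and t: "t \<in> {0..T}"
  shows "norm (R t) \<le> norm (R 0) + 4 * \<eta> + 2 * (B / \<gamma>)"
proof -
  have nn: "B / \<gamma> \<ge> 0" "\<eta> \<ge> 0"
    using order_trans[OF norm_ge_zero g[of 0]] order_trans[OF norm_ge_zero osc[OF t t]] \<tau>(1) \<gamma> by auto
  have "continuous_on {0..T} (\<lambda>s. norm (R s))"
    by (intro continuous_intros continuous_on_subset[OF cont(1)]) auto
  then obtain m where m: "m \<in> {0..T}" "\<And>s. s \<in> {0..T} \<Longrightarrow> norm (R s) \<le> norm (R m)"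
    using continuous_attains_sup[of "{0..T}" "\<lambda>s. norm (R s)"] t by auto
  have "norm (R m) \<le> norm (R 0) + 4 * \<eta> + 2 * (B / \<gamma>)"
  proof (cases "m \<le> \<tau>")
    case True
    show ?thesis
    proof (cases "m = 0")
      case False
      with m have m0: "0 < m"
        by auto
      have "norm (R m) \<le> exp (- \<gamma> * (m - 0)) * (norm (R 0) + \<eta>) + (B / \<gamma> + \<eta>)"
        using m(1) True m0 by (intro damped_step[OF cont eq g \<gamma>] osc) auto
      also have "\<dots> \<le> 1 * (norm (R 0) + \<eta>) + (B / \<gamma> + \<eta>)"
        using \<gamma> m0 nn by (intro add_mono mult_right_mono) auto
      finally show ?thesis
        using nn by simp
    qed (use nn in simp)
  next
    case False
    have "norm (R m) \<le> exp (- \<gamma> * (m - (m - \<tau>))) * (norm (R (m - \<tau>)) + \<eta>) + (B / \<gamma> + \<eta>)"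
      using m(1) False \<tau> by (intro damped_step[OF cont eq g \<gamma>] osc) auto
    also have "\<dots> \<le> 1 / 2 * (norm (R m) + \<eta>) + (B / \<gamma> + \<eta>)"
      using \<tau> m False nn by (intro add_mono mult_mono order_refl m(2)) auto
    finally show ?thesis
      using nn norm_ge_zero[of "R 0"] by argo
  qed
  with m(2)[OF t] show ?thesis
    by linarith
qed

section \<open>Brownian motion on path space\<close>

lemma closure_Rats_nonneg: "closure (\<rat> \<inter> {0<..}) = {0::real..}"
proof -
  have "closure ({0::real<..} \<inter> \<rat>) = closure {0<..}"
    by (rule closure_open_Int_superset) (simp_all add: Rats_closure_real)
  then show ?thesis
    by (simp add: Int_commute)
qed

text \<open>Paths are separated by their coordinates at positive rational times, squeezed into the
  open unit interval by \<open>arctan\<close>; time 0 is recovered by continuity.\<close>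

lemma cpath_tight_subsequence:
  fixes \<mu> :: "nat \<Rightarrow> 'a::euclidean_space cpath measure" and K :: "nat \<Rightarrow> 'a cpath set"
  assumes K: "\<And>m. seq_compact (K m)" "\<And>m. K m \<in> sets borel"
    and \<mu>: "\<And>n. prob_space (\<mu> n)" "\<And>n. sets (\<mu> n) = sets borel"
    and tight: "\<And>n m. measure (\<mu> n) (K m) \<ge> 1 - 1 / 2 ^ m"
  shows "\<exists>r \<nu>. strict_mono r \<and> prob_space \<nu> \<and> sets \<nu> = sets borel \<and>
    weakly_converges (\<lambda>n. \<mu> (r n)) \<nu> sequentially"
proof -
  define S where "S = (\<rat> \<inter> {0::real<..}) \<times> (Basis :: 'a set)"
  have cS: "countable S"
    unfolding S_def by (intro countable_SIGMA countable_Int1 countable_rat countable_finite finite_Basis)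
  obtain b0 :: 'a where "b0 \<in> Basis"
    using nonempty_Basis by blast
  then have "(1, b0) \<in> S"
    by (simp add: S_def)
  then have ne: "S \<noteq> {}"
    by blast
  define e where "e = from_nat_into S"
  have eS: "e j \<in> S" for j
    unfolding e_def by (rule from_nat_into[OF ne])
  define f where "f j p = arctan (eval_path p (fst (e j)) \<bullet> snd (e j)) / pi + 1 / 2" for j and p :: "'a cpath"
  show ?thesis
  proof (rule tight_imp_weakly_convergent_subsequence[of f, OF _ _ _ _ K \<mu> tight])
    fix j
    have "fst (e j) \<ge> 0"
      using eS[of j] by (auto simp: S_def)
    then show "continuous_on UNIV (f j)"
      unfolding f_def by (intro continuous_intros continuous_on_eval) auto
    fix p
    let ?a = "arctan (eval_path p (fst (e j)) \<bullet> snd (e j))"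
    have "- (pi / 2) < ?a" "?a < pi / 2"
      by (rule arctan_lbound, rule arctan_ubound)
    then have "- (1 / 2) < ?a / pi" "?a / pi < 1 / 2"
      by (simp_all add: field_simps)
    then show "0 \<le> f j p" "f j p < 1"
      unfolding f_def by linarith+
  next
    fix p q :: "'a cpath" assume eq: "\<And>j. f j p = f j q"
    have *: "eval_path p t = eval_path q t" if "t \<in> \<rat> \<inter> {0<..}" for t
    proof (rule euclidean_eqI)
      fix b :: 'a assume "b \<in> Basis"
      then have "(t, b) \<in> S"
        using that by (simp add: S_def)
      then obtain j where "e j = (t, b)"
        unfolding e_def using from_nat_into_surj[OF cS] by blast
      with eq[of j] show "eval_path p t \<bullet> b = eval_path q t \<bullet> b"
        by (simp add: f_def arctan_eq_iff)
    qed
    show "p = q"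
    proof (rule cpath_eqI)
      fix t :: real assume "t \<ge> 0"
      then have t: "t \<in> closure (\<rat> \<inter> {0<..})"
        by (simp add: closure_Rats_nonneg)
      have c: "continuous_on (closure (\<rat> \<inter> {0::real<..})) (\<lambda>t. dist (eval_path p t) (eval_path q t))"
        unfolding closure_Rats_nonneg by (intro continuous_on_dist continuous_on_eval_path)
      have "dist (eval_path p t) (eval_path q t) = 0"
        by (rule continuous_constant_on_closure[OF c _ t]) (use * in simp)
      then show "eval_path p t = eval_path q t"
        by simp
    qed
  qed
qed


lemma continuous_on_stop_path:
  assumes "s \<ge> 0"
  shows "continuous_on UNIV (stop_path s :: 'a::metric_space cpath \<Rightarrow> 'a cpath)"
  unfolding continuous_on_def
proof
  fix p :: "'a cpath"
  show "(stop_path s \<longlongrightarrow> stop_path s p) (at p within UNIV)"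
    unfolding tendsto_cpath_iff
  proof (intro allI impI uniform_limitI)
    fix K :: "real set" and e :: real
    assume K: "compact K \<and> K \<subseteq> {0..}" and "e > 0"
    let ?L = "(\<lambda>t. min t s) ` K"
    have "compact ?L"
      using K by (intro compact_continuous_image continuous_intros) auto
    moreover have "?L \<subseteq> {0..}"
      using K assms by auto
    ultimately have "uniform_limit ?L (\<lambda>q. eval_path q) (eval_path p) (at p within UNIV)"
      using tendsto_ident_at[of p UNIV] unfolding tendsto_cpath_iff by blast
    from uniform_limitD[OF this \<open>e > 0\<close>]
    show "\<forall>\<^sub>F q in at p within UNIV. \<forall>t\<in>K. dist (eval_path (stop_path s q) t) (eval_path (stop_path s p) t) < e"
      by eventually_elim (use K assms in \<open>auto simp: eval_stop_path subset_iff\<close>)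
  qed
qed

lemma measurable_stop_path: "s \<ge> 0 \<Longrightarrow> stop_path s \<in> borel_measurable borel"
  by (intro borel_measurable_continuous_onI continuous_on_stop_path)

text \<open>The canonical filtration of path space; \<open>max 0 t\<close> repeats the sigma-algebra
  of time 0 at negative times.\<close>

definition path_filtration :: "real \<Rightarrow> 'a::metric_space cpath measure" where
  "path_filtration t = vimage_algebra UNIV (stop_path (max 0 t)) borel"

lemma space_path_filtration [simp]: "space (path_filtration t) = UNIV"
  by (simp add: path_filtration_def)

lemma measurable_stop_path_filtration: "s \<ge> 0 \<Longrightarrow> stop_path s \<in> borel_measurable (path_filtration s)"
  unfolding path_filtration_def using measurable_vimage_algebra1[of "stop_path s" UNIV borel] by simp

lemma sets_path_filtrationE:
  assumes "A \<in> sets (path_filtration s)" "s \<ge> 0"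
  obtains B where "B \<in> sets borel" "A = stop_path s -` B"
  using assms by (auto simp: path_filtration_def sets_vimage_algebra2)

lemma stop_path_stop_path: "0 \<le> s \<Longrightarrow> s \<le> t \<Longrightarrow> stop_path s (stop_path t p) = stop_path s p"
  by (rule cpath_eqI) (simp add: eval_stop_path min_def)

lemma filtered_path_filtration:
  fixes \<nu> :: "'a::metric_space cpath measure"
  assumes "prob_space \<nu>" "sets \<nu> = sets borel"
  shows "filtered_prob_space \<nu> path_filtration"
proof -
  have sp: "space \<nu> = UNIV"
    using sets_eq_imp_space_eq[OF assms(2)] by simp
  have "filtration (space \<nu>) (path_filtration :: real \<Rightarrow> 'a cpath measure)"
  proof
    fix i j :: real assume "i \<le> j"
    show "sets (path_filtration i) \<subseteq> sets (path_filtration j :: 'a cpath measure)"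
    proof
      fix A :: "'a cpath set" assume "A \<in> sets (path_filtration i)"
      then obtain B where B: "B \<in> sets borel" "A = stop_path (max 0 i) -` B"
        by (auto simp: path_filtration_def sets_vimage_algebra2)
      have "A = stop_path (max 0 j) -` (stop_path (max 0 i) -` B)"
        using \<open>i \<le> j\<close> by (auto simp: B(2) stop_path_stop_path)
      moreover have "stop_path (max 0 i) -` B \<in> sets borel"
        using measurable_sets[OF measurable_stop_path B(1), of "max 0 i"] by simp
      ultimately show "A \<in> sets (path_filtration j)"
        by (auto simp: path_filtration_def sets_vimage_algebra2)
    qed
  qed (simp add: sp)
  moreover have "subalgebra \<nu> (path_filtration t)" for t
    unfolding subalgebra_def
  proof
    show "sets (path_filtration t) \<subseteq> sets \<nu>"
    proof
      fix A :: "'a cpath set" assume "A \<in> sets (path_filtration t)"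
      then obtain B where B: "B \<in> sets borel" "A = stop_path (max 0 t) -` B"
        by (auto simp: path_filtration_def sets_vimage_algebra2)
      then show "A \<in> sets \<nu>"
        using measurable_sets[OF measurable_stop_path B(1), of "max 0 t"] assms(2) by simp
    qed
  qed (simp add: sp)
  ultimately show ?thesis
    using assms(1) by (simp add: filtered_prob_space_def)
qed

lemma adapted_eval_path:
  assumes [measurable]: "h \<in> borel_measurable borel"
  shows "adapted path_filtration (\<lambda>t p. h (eval_path p t))"
  unfolding adapted_def
proof (intro allI impI)
  fix t :: real assume t: "t \<ge> 0"
  have "(\<lambda>p. h (eval_path (stop_path t p) t)) \<in> borel_measurable (path_filtration t)"
    by (rule measurable_compose[OF measurable_compose[OF measurable_stop_path_filtration measurable_eval_path] assms])
      (use t in auto)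
  then show "(\<lambda>p. h (eval_path p t)) \<in> borel_measurable (path_filtration t)"
    using t by (simp add: eval_stop_path)
qed

lemma cyl_stop_path:
  assumes "test_list I" "s \<ge> 0"
  shows "cyl I (eval_path (stop_path s p)) = cyl (map (\<lambda>(u, f). (min u s, f)) I) (eval_path p)"
  using assms
proof (induction I)
  case (Cons a I)
  then have "test_list I"
    by (simp add: test_list_def)
  with Cons show ?case
    by (cases a) (auto simp: test_list_def eval_stop_path)
qed simp

text \<open>Independence of the past is tested on cylinder functions times functions of the increment.\<close>

lemma brownian_motion_pathI:
  fixes \<nu> :: "'a::{metric_space, second_countable_topology} cpath measure" and h :: "'a \<Rightarrow> 'b::euclidean_space"
  assumes \<nu>: "prob_space \<nu>" "sets \<nu> = sets borel" and h: "continuous_on UNIV h"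
    and zero: "AE p in \<nu>. h (eval_path p 0) = 0"
    and incr: "\<And>s t I f. 0 \<le> s \<Longrightarrow> s < t \<Longrightarrow> test_list I \<Longrightarrow> (\<And>u g. (u, g) \<in> set I \<Longrightarrow> u \<le> s) \<Longrightarrow>
      uniformly_continuous_on UNIV f \<Longrightarrow> (\<And>x. 0 \<le> f x \<and> f x \<le> (1 :: real)) \<Longrightarrow>
      (\<integral>p. cyl I (eval_path p) * f (h (eval_path p t) - h (eval_path p s)) \<partial>\<nu>) =
      (\<integral>p. cyl I (eval_path p) \<partial>\<nu>) * (\<integral>z. f z \<partial>gauss (t - s))"
  shows "brownian_motion \<nu> path_filtration (\<lambda>t p. h (eval_path p t))"
proof -
  interpret prob_space \<nu> by fact
  have sp: "space \<nu> = UNIV"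
    using sets_eq_imp_space_eq[OF \<nu>(2)] by simp
  note [measurable_cong] = \<nu>(2)
  have hm [measurable]: "h \<in> borel_measurable borel"
    by (intro borel_measurable_continuous_onI h)
  have "distributed \<nu> lborel (\<lambda>p. h (eval_path p t) - h (eval_path p s))
          (\<lambda>x. ennreal (\<Prod>b\<in>Basis. normal_density 0 (sqrt (t - s)) (x \<bullet> b))) \<and>
        indep_set (sets (path_filtration s))
          (sets (vimage_algebra (space \<nu>) (\<lambda>p. h (eval_path p t) - h (eval_path p s)) borel))"
    if st: "0 \<le> s" "s < t" for s t
  proof
    define D where "D p = h (eval_path p t) - h (eval_path p s)" for p
    have [measurable]: "(\<lambda>p. eval_path p t) \<in> borel_measurable borel" "(\<lambda>p. eval_path p s) \<in> borel_measurable borel"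
      using st by (auto intro: measurable_eval_path)
    have [measurable]: "D \<in> borel_measurable borel"
      unfolding D_def by measurable
    have [measurable]: "stop_path s \<in> borel_measurable borel"
      using st by (intro measurable_stop_path)
    have [measurable]: "D \<in> borel_measurable \<nu>" "stop_path s \<in> borel_measurable \<nu>"
      by (simp_all cong: measurable_cong_sets)
    interpret G: prob_space "gauss (t - s) :: 'b measure"
      using st by (intro prob_space_gauss) simp
    have G1: "emeasure (gauss (t - s) :: 'b measure) UNIV = 1"
      using G.emeasure_space_1 by simp
    \<comment> \<open>First extension: for fixed \<open>f\<close> both sides are finite measures in
      the past, so agreement on cylinder functions passes to all Borel sets \<open>A\<close> of
      stopped paths.\<close>
    have main: "\<integral>p. indicator A (stop_path s p) * f (D p) \<partial>\<nu> = (\<integral>p. indicator A (stop_path s p) \<partial>\<nu>) * (\<integral>z. f z \<partial>gauss (t - s))"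
      if A: "A \<in> sets borel" and f: "uniformly_continuous_on UNIV f" "\<And>x. 0 \<le> f x \<and> f x \<le> (1 :: real)" for A f
    proof -
      have [measurable]: "f \<in> borel_measurable borel" "A \<in> sets borel"
        using A by (auto intro!: borel_measurable_continuous_onI uniformly_continuous_imp_continuous f)
      define c where "c = (\<integral>z. f z \<partial>gauss (t - s))"
      have c: "0 \<le> c"
        unfolding c_def using f by (intro integral_nonneg_AE) auto
      define m1 where "m1 = distr (density \<nu> (\<lambda>p. ennreal (f (D p)))) borel (stop_path s)"
      define m2 where "m2 = distr (density \<nu> (\<lambda>p. ennreal c)) borel (stop_path s)"
      have i1: "(\<integral>q. g q \<partial>m1) = (\<integral>p. f (D p) * g (stop_path s p) \<partial>\<nu>)" if [measurable]: "g \<in> borel_measurable borel" for g :: "_ \<Rightarrow> real"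
        unfolding m1_def using f(2) by (subst integral_distr) (auto simp: integral_density)
      have i2: "(\<integral>q. g q \<partial>m2) = (\<integral>p. c * g (stop_path s p) \<partial>\<nu>)" if [measurable]: "g \<in> borel_measurable borel" for g :: "_ \<Rightarrow> real"
        unfolding m2_def using c by (subst integral_distr) (auto simp: integral_density)
      have fin: "finite_measure m1" "finite_measure m2"
      proof -
        have "(\<integral>\<^sup>+p. ennreal (f (D p)) \<partial>\<nu>) \<le> (\<integral>\<^sup>+p. 1 \<partial>\<nu>)"
          using f(2) by (intro nn_integral_mono) simp
        then have *: "(\<integral>\<^sup>+p. ennreal (f (D p)) \<partial>\<nu>) \<noteq> \<infinity>"
          using emeasure_space_1 by (auto simp: top_unique)
        show "finite_measure m1"
          unfolding m1_def by (rule finite_measure.finite_measure_distr[OF finite_measureI])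
            (use * in \<open>auto simp: emeasure_density sp\<close>)
        show "finite_measure m2"
          unfolding m2_def by (rule finite_measure.finite_measure_distr[OF finite_measureI])
            (auto simp: emeasure_density nn_integral_cmult sp ennreal_mult_eq_top_iff emeasure_eq_measure)
      qed
      have "m1 = m2"
      proof (rule cpath_measure_eqI[OF fin])
        fix I :: "(real \<times> ('a \<Rightarrow> real)) list" assume I: "test_list I"
        \<comment> \<open>A cylinder function of the stopped path is one of the full path with times
          cut at \<open>s\<close>, as \<open>incr\<close> demands.\<close>
        define I' where "I' = map (\<lambda>(u, f). (min u s, f)) I"
        have I': "test_list I'"
          using I st(1) by (auto simp: I'_def test_list_def)
        have Is: "u \<le> s" if "(u, g) \<in> set I'" for u g
          using that by (auto simp: I'_def)
        have mI: "(\<lambda>q. cyl I (eval_path q)) \<in> borel_measurable borel"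
          by (rule measurable_cyl_eval[OF I])
        have "(\<integral>q. cyl I (eval_path q) \<partial>m1) = (\<integral>p. cyl I' (eval_path p) * f (D p) \<partial>\<nu>)"
          unfolding i1[OF mI] cyl_stop_path[OF I st(1)] I'_def by (simp add: mult.commute)
        also have "\<dots> = (\<integral>p. cyl I' (eval_path p) \<partial>\<nu>) * c"
          unfolding D_def c_def by (rule incr[OF st I' Is f])
        also have "\<dots> = (\<integral>q. cyl I (eval_path q) \<partial>m2)"
          unfolding i2[OF mI] cyl_stop_path[OF I st(1)] I'_def by simp
        finally show "(\<integral>q. cyl I (eval_path q) \<partial>m1) = (\<integral>q. cyl I (eval_path q) \<partial>m2)" .
      qed (simp_all add: m1_def m2_def)
      then have "(\<integral>q. indicat_real A q \<partial>m1) = (\<integral>q. indicat_real A q \<partial>m2)"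
        by simp
      from this[unfolded i1[OF borel_measurable_indicator[OF A]] i2[OF borel_measurable_indicator[OF A]]]
      show ?thesis
        by (simp add: c_def mult.commute del: integral_indicator)
    qed
    \<comment> \<open>Second extension, now in the increment for fixed \<open>A\<close>: finite
      measures are determined by uniformly continuous \<open>f\<close>.\<close>
    have eqG: "distr (density \<nu> (\<lambda>p. ennreal (indicator A (stop_path s p)))) borel D =
        density (gauss (t - s)) (\<lambda>_. ennreal (\<integral>p. indicator A (stop_path s p) \<partial>\<nu>))"
      (is "?m1 = ?m2") if A: "A \<in> sets borel" for A
    proof (rule finite_measure_eqI_uniformly_continuous)
      note [measurable] = A
      let ?a = "\<integral>p. indicat_real A (stop_path s p) \<partial>\<nu>"
      have a: "?a \<ge> 0"
        by simp
      have "(\<integral>\<^sup>+p. ennreal (indicator A (stop_path s p)) \<partial>\<nu>) \<le> (\<integral>\<^sup>+p. 1 \<partial>\<nu>)"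
        by (intro nn_integral_mono) (simp add: indicator_def)
      then have *: "(\<integral>\<^sup>+p. ennreal (indicator A (stop_path s p)) \<partial>\<nu>) \<noteq> \<infinity>"
        using emeasure_space_1 by (auto simp: top_unique)
      show "finite_measure ?m1"
        by (rule finite_measure.finite_measure_distr[OF finite_measureI])
          (use * in \<open>auto simp: emeasure_density sp\<close>)
      show "finite_measure ?m2"
        by (rule finite_measureI)
          (simp add: emeasure_density nn_integral_cmult G1)
      fix f :: "'b \<Rightarrow> real" assume f: "uniformly_continuous_on UNIV f" "\<And>x. 0 \<le> f x \<and> f x \<le> 1"
      have [measurable]: "f \<in> borel_measurable borel"
        by (intro borel_measurable_continuous_onI uniformly_continuous_imp_continuous f)
      have "integral\<^sup>L ?m1 f = (\<integral>p. indicator A (stop_path s p) * f (D p) \<partial>\<nu>)"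
        by (subst integral_distr) (auto simp: integral_density)
      also have "\<dots> = ?a * (\<integral>z. f z \<partial>gauss (t - s))"
        by (rule main[OF A f])
      also have "\<dots> = integral\<^sup>L ?m2 f"
        using a by (subst integral_density) auto
      finally show "integral\<^sup>L ?m1 f = integral\<^sup>L ?m2 f" .
    qed simp_all
    \<comment> \<open>Taking the whole space as event of the past gives the Gaussian law of the
      increment.\<close>
    have law: "distr \<nu> borel D = gauss (t - s)"
    proof -
      have "density \<nu> (\<lambda>p. ennreal (indicator UNIV (stop_path s p))) = \<nu>"
        by (simp add: density_1)
      moreover have "(\<integral>p. indicator UNIV (stop_path s p) \<partial>\<nu>) = (1 :: real)"
        using prob_space by (simp add: sp)
      ultimately show ?thesis
        using eqG[of UNIV] by (simp add: density_1)
    qed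
    have "distr \<nu> lborel D = distr \<nu> borel D"
      by (rule distr_cong) auto
    then show "distributed \<nu> lborel (\<lambda>p. h (eval_path p t) - h (eval_path p s))
        (\<lambda>x. ennreal (\<Prod>b\<in>Basis. normal_density 0 (sqrt (t - s)) (x \<bullet> b)))"
      unfolding distributed_def D_def[symmetric] by (simp add: law) (simp add: gauss_def)
    show "indep_set (sets (path_filtration s)) (sets (vimage_algebra (space \<nu>) (\<lambda>p. h (eval_path p t) - h (eval_path p s)) borel))"
      unfolding D_def[symmetric]
    proof (rule indep_setI)
      show "sets (path_filtration s) \<subseteq> events"
        using filtered_path_filtration[OF \<nu>] by (auto simp: filtered_prob_space_def subalgebra_def)
      show "sets (vimage_algebra (space \<nu>) D borel) \<subseteq> events"
        by (auto simp: sets_vimage_algebra2)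
      fix a b :: "'a cpath set" assume "a \<in> sets (path_filtration s)" and "b \<in> sets (vimage_algebra (space \<nu>) D borel)"
      then obtain A C where A: "A \<in> sets borel" "a = stop_path s -` A" and C: "C \<in> sets borel" "b = D -` C"
        using st(1) by (auto simp: sets_vimage_algebra2 sp elim: sets_path_filtrationE)
      note [measurable] = A(1) C(1)
      have DC [measurable]: "D -` C \<in> sets \<nu>"
        using measurable_sets[of D \<nu> borel C] C(1) by (simp add: sp)
      have "emeasure (distr (density \<nu> (\<lambda>p. ennreal (indicator A (stop_path s p)))) borel D) C =
          emeasure (density (gauss (t - s)) (\<lambda>_. ennreal (\<integral>p. indicator A (stop_path s p) \<partial>\<nu>))) C"
        unfolding eqG[OF A(1)] ..
      moreover have "emeasure (distr (density \<nu> (\<lambda>p. ennreal (indicator A (stop_path s p)))) borel D) C = emeasure \<nu> (a \<inter> b)"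
      proof -
        have "emeasure (distr (density \<nu> (\<lambda>p. ennreal (indicator A (stop_path s p)))) borel D) C =
            (\<integral>\<^sup>+p. ennreal (indicator A (stop_path s p)) * indicator (D -` C) p \<partial>\<nu>)"
          by (subst emeasure_distr) (auto simp: sp emeasure_density)
        also have "\<dots> = (\<integral>\<^sup>+p. indicator (a \<inter> b) p \<partial>\<nu>)"
          by (intro nn_integral_cong) (auto simp: A(2) C(2) indicator_def)
        also have "\<dots> = emeasure \<nu> (a \<inter> b)"
          using measurable_sets[of "stop_path s" \<nu> borel A] measurable_sets[of D \<nu> borel C]
          by (intro nn_integral_indicator) (auto simp: sp A(2) C(2))
        finally show ?thesis .
      qed
      moreover have "emeasure (density (gauss (t - s)) (\<lambda>_. ennreal (\<integral>p. indicator A (stop_path s p) \<partial>\<nu>))) C = ennreal (prob a * prob b)"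
      proof -
        have "(\<integral>p. indicator A (stop_path s p) \<partial>\<nu>) = (\<integral>p. indicator a p \<partial>\<nu>)"
          by (intro Bochner_Integration.integral_cong) (auto simp: A(2) indicator_def)
        also have "\<dots> = prob a"
          using measurable_sets[of "stop_path s" \<nu> borel A] by (simp add: sp A(2))
        finally have 1: "(\<integral>p. indicator A (stop_path s p) \<partial>\<nu>) = prob a" .
        have "emeasure (gauss (t - s)) C = emeasure \<nu> b"
          unfolding law[symmetric] by (subst emeasure_distr) (auto simp: sp C(2))
        then show ?thesis
          unfolding 1 by (simp add: emeasure_density nn_integral_cmult emeasure_eq_measure ennreal_mult)
      qed
      ultimately show "prob (a \<inter> b) = prob a * prob b"
        by (simp add: emeasure_eq_measure)
    qed
  qed
  moreover have "continuous_on {0..} (\<lambda>t. h (eval_path p t))" for p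
    by (rule continuous_on_compose2[OF h continuous_on_eval_path]) simp
  ultimately show ?thesis
    unfolding brownian_motion_def using zero adapted_eval_path[OF hm] by blast
qed

section \<open>Tightness\<close>

text \<open>The weak inequality on the distance keeps the set closed, hence Borel.\<close>

definition modulus_set :: "real \<Rightarrow> real \<Rightarrow> real \<Rightarrow> 'a::metric_space cpath set" where
  "modulus_set T \<delta> \<eta> = {p. \<forall>s\<in>{0..T}. \<forall>t\<in>{0..T}. \<bar>s - t\<bar> \<le> \<delta> \<longrightarrow> dist (eval_path p s) (eval_path p t) \<le> \<eta>}"

lemma closed_modulus_set: "closed (modulus_set T \<delta> \<eta>)"
proof -
  have "modulus_set T \<delta> \<eta> = (\<Inter>(s, t)\<in>{(s, t). s \<in> {0..T} \<and> t \<in> {0..T} \<and> \<bar>s - t\<bar> \<le> \<delta>}.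
      {p. dist (eval_path p s) (eval_path p t) \<le> \<eta>})"
    by (auto simp: modulus_set_def)
  also have "closed \<dots>"
    by (intro closed_INT ballI) (auto intro!: closed_Collect_le continuous_on_dist continuous_on_eval)
  finally show ?thesis .
qed

lemma modulus_set_borel [measurable]: "modulus_set T \<delta> \<eta> \<in> sets borel"
  by (intro borel_closed closed_modulus_set)

lemma modulus_set_exhausts:
  assumes "\<eta> > 0"
  shows "(\<Union>l. modulus_set T (1 / real (Suc l)) \<eta>) = UNIV"
proof (intro set_eqI iffI UNIV_I)
  fix p :: "'a cpath"
  have "uniformly_continuous_on {0..T} (eval_path p)"
    by (intro compact_uniformly_continuous continuous_on_subset[OF continuous_on_eval_path]) auto
  then obtain d where d: "d > 0" "\<And>s t. s \<in> {0..T} \<Longrightarrow> t \<in> {0..T} \<Longrightarrow> dist t s < d \<Longrightarrow> dist (eval_path p t) (eval_path p s) < \<eta>"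
    using assms unfolding uniformly_continuous_on_def by metis
  obtain l where "1 / real (Suc l) < d"
    using nat_approx_posE[OF d(1)] by blast
  then have "p \<in> modulus_set T (1 / real (Suc l)) \<eta>"
    unfolding modulus_set_def using d(2) by (auto simp: dist_real_def intro!: less_imp_le simp del: of_nat_Suc)
  then show "p \<in> (\<Union>l. modulus_set T (1 / real (Suc l)) \<eta>)"
    by blast
qed

text \<open>Continuity of the measure from below: the sets increase as \<open>\<delta>\<close>
  decreases, and every continuous path belongs to one of them.\<close>

lemma modulus_set_large_measure:
  fixes L :: "'a::metric_space cpath measure"
  assumes "prob_space L" and s: "sets L = sets borel" and "\<eta> > 0" "e > 0"
  shows "\<exists>\<delta>>0. measure L (modulus_set T \<delta> \<eta>) \<ge> 1 - e"
proof -
  interpret prob_space L by fact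
  have "space L = UNIV"
    using sets_eq_imp_space_eq[OF s] by simp
  have "(\<lambda>l. measure L (modulus_set T (1 / real (Suc l)) \<eta>)) \<longlonglongrightarrow> measure L (\<Union>l. modulus_set T (1 / real (Suc l)) \<eta>)"
  proof (rule finite_Lim_measure_incseq)
    show "incseq (\<lambda>l. modulus_set T (1 / real (Suc l)) \<eta> :: 'a cpath set)"
    proof (rule incseq_SucI, rule subsetI)
      fix l and p :: "'a cpath" assume p: "p \<in> modulus_set T (1 / real (Suc l)) \<eta>"
      have "1 / real (Suc (Suc l)) \<le> 1 / real (Suc l)"
        by (intro divide_left_mono) auto
      with p show "p \<in> modulus_set T (1 / real (Suc (Suc l))) \<eta>"
        unfolding modulus_set_def by (auto simp del: of_nat_Suc)
    qed
    show "range (\<lambda>l. modulus_set T (1 / real (Suc l)) \<eta>) \<subseteq> sets L"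
      unfolding s using modulus_set_borel by blast
  qed
  then have "(\<lambda>l. measure L (modulus_set T (1 / real (Suc l)) \<eta>)) \<longlonglongrightarrow> 1"
    using prob_space unfolding modulus_set_exhausts[OF \<open>\<eta> > 0\<close>] \<open>space L = UNIV\<close> by (simp only:)
  from order_tendstoD(1)[OF this, of "1 - e"] \<open>e > 0\<close>
  obtain l where "1 - e < measure L (modulus_set T (1 / real (Suc l)) \<eta>)"
    by (auto simp: eventually_sequentially)
  then show ?thesis
    by (intro exI[of _ "1 / real (Suc l)"]) auto
qed

section \<open>Moduli of continuity shared by a sequence of Brownian motions\<close>

locale bm_sequence =
  fixes M :: "nat \<Rightarrow> 'w measure" and F and W U :: "nat \<Rightarrow> real \<Rightarrow> 'w \<Rightarrow> 'a::euclidean_space"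
  assumes bm: "filtered_bm (M n) (F n) (W n)"
    and U_M: "t \<ge> 0 \<Longrightarrow> U n t \<in> borel_measurable (M n)"
    and U_cont: "\<omega> \<in> space (M n) \<Longrightarrow> continuous_on {0..} (\<lambda>t. U n t \<omega>)"
    and UW: "AE \<omega> in M n. \<forall>t\<ge>0. U n t \<omega> = W n t \<omega>"
begin

lemma prob_M: "prob_space (M n)"
proof -
  interpret filtered_bm "M n" "F n" "W n" by (rule bm)
  show ?thesis by (rule prob_space_axioms)
qed

lemma prob_U: "prob_space (path_law (M n) (U n))"
  by (rule prob_space_path_law[OF prob_M U_cont U_M])

lemma U_law: "path_law (M n) (U n) = path_law (M 0) (U 0)"
  by (rule bm_path_law_unique[OF bm bm U_cont U_M UW U_cont U_M UW])

lemma measure_U_law: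
  assumes [measurable]: "C \<in> sets borel"
  shows "measure (path_law (M n) (U n)) C = measure (M n) {\<omega> \<in> space (M n). path_of (\<lambda>t. U n t \<omega>) \<in> C}"
  unfolding path_law_def
  by (subst measure_distr[OF borel_measurable_path_of[OF U_cont U_M] assms]) (auto simp: vimage_def Int_def conj_commute)

lemma U_modulus_iff:
  assumes "\<omega> \<in> space (M n)"
  shows "path_of (\<lambda>t. U n t \<omega>) \<in> modulus_set T \<delta> \<eta> \<longleftrightarrow>
    (\<forall>s\<in>{0..T}. \<forall>t\<in>{0..T}. \<bar>s - t\<bar> \<le> \<delta> \<longrightarrow> dist (U n s \<omega>) (U n t \<omega>) \<le> \<eta>)"
  by (simp add: modulus_set_def eval_path_of[OF U_cont[OF assms]])

lemma uniform_modulus: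
  assumes "\<eta> > 0" "e > 0"
  shows "\<exists>\<delta>>0. \<forall>n. measure (path_law (M n) (U n)) (modulus_set T \<delta> \<eta>) \<ge> 1 - e"
proof -
  obtain \<delta> where "\<delta> > 0" "measure (path_law (M 0) (U 0)) (modulus_set T \<delta> \<eta>) \<ge> 1 - e"
    using modulus_set_large_measure[OF prob_U[of 0] sets_path_law assms] by blast
  then show ?thesis
    by (metis U_law)
qed

text \<open>The failure probabilities \<open>(1 / 2) ^ m * (1 / 2) ^ Suc j\<close> sum to
  \<open>(1 / 2) ^ m\<close> over \<open>j\<close>, so one family of moduli holds for all horizons
  at once.\<close>

lemma uniform_modulus_all:
  "\<exists>\<delta> :: nat \<Rightarrow> real. (\<forall>j. \<delta> j > 0) \<and>
    (\<forall>n. measure (path_law (M n) (U n)) (\<Inter>j. modulus_set (real j) (\<delta> j) (1 / real (Suc j))) \<ge> 1 - 1 / 2 ^ m)"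
proof -
  have "\<exists>\<delta>>0. \<forall>n. measure (path_law (M n) (U n)) (modulus_set (real j) \<delta> (1 / real (Suc j))) \<ge> 1 - (1 / 2) ^ m * (1 / 2) ^ Suc j" for j
    by (intro uniform_modulus) auto
  then obtain \<delta> where \<delta>: "\<And>j. \<delta> j > 0" "\<And>j n. measure (path_law (M n) (U n)) (modulus_set (real j) (\<delta> j) (1 / real (Suc j))) \<ge> 1 - (1 / 2) ^ m * (1 / 2) ^ Suc j"
    by metis
  have "measure (path_law (M n) (U n)) (\<Inter>j. modulus_set (real j) (\<delta> j) (1 / real (Suc j))) \<ge> 1 - 1 / 2 ^ m" for n
  proof -
    interpret L: prob_space "path_law (M n) (U n)" by (rule prob_U)
    let ?S = "\<lambda>j. modulus_set (real j) (\<delta> j) (1 / real (Suc j)) :: 'a cpath set"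
    have le: "measure (path_law (M n) (U n)) (- ?S j) \<le> (1 / 2) ^ m * (1 / 2) ^ Suc j" for j
      using L.prob_compl[of "?S j"] \<delta>(2)[of j n] by (simp add: Compl_eq_Diff_UNIV)
    have sums: "(\<lambda>j. (1 / 2) ^ m * (1 / 2) ^ Suc j) sums ((1 / 2) ^ m * (1 :: real))"
      by (intro sums_mult power_half_series)
    have summ: "summable (\<lambda>j. measure (path_law (M n) (U n)) (- ?S j))"
      by (rule summable_comparison_test'[OF sums_summable[OF sums], of 0]) (use le in auto)
    have "measure (path_law (M n) (U n)) (\<Union>j. - ?S j) \<le> (\<Sum>j. measure (path_law (M n) (U n)) (- ?S j))"
      by (rule L.finite_measure_subadditive_countably[OF _ summ]) auto
    also have "\<dots> \<le> (\<Sum>j. (1 / 2) ^ m * (1 / 2) ^ Suc j)"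
      by (intro suminf_le le summ sums_summable[OF sums])
    also have "\<dots> = (1 / 2) ^ m"
      using sums_unique[OF sums] by simp
    finally have "measure (path_law (M n) (U n)) (- (\<Inter>j. ?S j)) \<le> (1 / 2) ^ m"
      by (simp add: Compl_INT)
    then show ?thesis
      using L.prob_compl[of "\<Inter>j. ?S j"] by (simp add: Compl_eq_Diff_UNIV power_divide)
  qed
  with \<delta>(1) show ?thesis
    by blast
qed

end

text \<open>What the limit argument needs to know about the Langevin dynamics. \<open>U\<close> is
  kept beside \<open>W\<close> because altering \<open>W\<close> on a null set makes all paths
  continuous but may destroy adaptedness; independence is therefore taken from \<open>W\<close> and
  pathwise statements from \<open>U\<close>.\<close>

locale overdamped_approximation = bm_sequence M F W U
  for M :: "nat \<Rightarrow> 'w measure" and F and W U :: "nat \<Rightarrow> real \<Rightarrow> 'w \<Rightarrow> real ^ 'n::finite" +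
  fixes A :: "nat \<Rightarrow> real \<Rightarrow> 'w \<Rightarrow> real ^ 'n" and Q :: "nat \<Rightarrow> real \<Rightarrow> 'w \<Rightarrow> 'n torus"
    and gn :: "nat \<Rightarrow> 'n torus \<Rightarrow> real ^ 'n" and g :: "'n torus \<Rightarrow> real ^ 'n" and \<sigma> B :: real
  assumes A_F: "t \<ge> 0 \<Longrightarrow> A n t \<in> borel_measurable (F n t)"
    and A_cont: "\<omega> \<in> space (M n) \<Longrightarrow> continuous_on {0..} (\<lambda>t. A n t \<omega>)"
    and U0: "\<omega> \<in> space (M n) \<Longrightarrow> U n 0 \<omega> = 0"
    and A0: "\<omega> \<in> space (M n) \<Longrightarrow> A n 0 \<omega> \<in> cbox 0 1"
    and Q_cont: "\<omega> \<in> space (M n) \<Longrightarrow> continuous_on {0..} (\<lambda>t. Q n t \<omega>)"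
    and Q_M: "t \<ge> 0 \<Longrightarrow> Q n t \<in> borel_measurable (M n)"
    and A_eq: "AE \<omega> in M n. \<forall>t\<ge>0. A n t \<omega> = A n 0 \<omega> + integral {0..t} (\<lambda>s. - gn n (Q n s \<omega>)) + \<sigma> *\<^sub>R U n t \<omega>"
    and gn_cont: "continuous_on UNIV (gn n)" and gn_bd: "norm (gn n q) \<le> B"
    and g_uc: "uniformly_continuous_on UNIV g"
    and gn_conv: "e > 0 \<Longrightarrow> \<forall>\<^sub>F n in sequentially. \<forall>q. norm (gn n q - g q) \<le> e"
    and close: "d > 0 \<Longrightarrow> e > 0 \<Longrightarrow> \<forall>\<^sub>F n in sequentially. \<exists>G\<in>sets (M n). measure (M n) G \<ge> 1 - e \<and>
        (\<forall>\<omega>\<in>G. \<forall>t\<in>{0..T}. dist (Q n t \<omega>) (to_torus (A n t \<omega>)) \<le> d)"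
    and \<sigma>_pos: "\<sigma> > 0" and B_pos: "B > 0"
begin

lemma A_M: "t \<ge> 0 \<Longrightarrow> A n t \<in> borel_measurable (M n)"
proof -
  interpret filtered_bm "M n" "F n" "W n" by (rule bm)
  assume "t \<ge> 0"
  then show ?thesis by (rule measurable_F_M[OF A_F])
qed

lemma pair_cont: "\<omega> \<in> space (M n) \<Longrightarrow> continuous_on {0..} (\<lambda>t. (A n t \<omega>, U n t \<omega>))"
  by (intro continuous_on_Pair A_cont U_cont)

lemma pair_M: "t \<ge> 0 \<Longrightarrow> (\<lambda>\<omega>. (A n t \<omega>, U n t \<omega>)) \<in> borel_measurable (M n)"
  using A_M U_M by (intro borel_measurable_Pair)

definition pair_path :: "nat \<Rightarrow> 'w \<Rightarrow> ((real ^ 'n) \<times> (real ^ 'n)) cpath" where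
  "pair_path n \<omega> = path_of (\<lambda>t. (A n t \<omega>, U n t \<omega>))"

lemma eval_pair_path: "\<omega> \<in> space (M n) \<Longrightarrow> t \<ge> 0 \<Longrightarrow> eval_path (pair_path n \<omega>) t = (A n t \<omega>, U n t \<omega>)"
  unfolding pair_path_def by (rule eval_path_of[OF pair_cont])

lemma pair_path_M: "pair_path n \<in> borel_measurable (M n)"
  unfolding pair_path_def[abs_def] by (rule borel_measurable_path_of[OF pair_cont pair_M])

definition law :: "nat \<Rightarrow> ((real ^ 'n) \<times> (real ^ 'n)) cpath measure" where
  "law n = distr (M n) borel (pair_path n)"

lemma prob_law: "prob_space (law n)" and sets_law: "sets (law n) = sets borel"
  unfolding law_def by (auto intro: prob_space.prob_space_distr[OF prob_M] pair_path_M)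

lemma integral_law: "G \<in> borel_measurable borel \<Longrightarrow> (\<integral>p. G p \<partial>law n) = (\<integral>\<omega>. G (pair_path n \<omega>) \<partial>M n)" for G :: "_ \<Rightarrow> real"
  unfolding law_def by (rule integral_distr[OF pair_path_M])

lemma gnQ_cont: "\<omega> \<in> space (M n) \<Longrightarrow> continuous_on {0..} (\<lambda>s. gn n (Q n s \<omega>))"
  by (rule continuous_on_compose2[OF gn_cont Q_cont]) auto

lemma A_lipschitz: "AE \<omega> in M n. \<forall>s\<ge>0. \<forall>t\<ge>0.
  norm ((A n s \<omega> - \<sigma> *\<^sub>R U n s \<omega>) - (A n t \<omega> - \<sigma> *\<^sub>R U n t \<omega>)) \<le> B * \<bar>s - t\<bar>"
  using A_eq[of n] AE_space
proof eventually_elim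
  case (elim \<omega>)
  let ?f = "\<lambda>s. - gn n (Q n s \<omega>)"
  have c: "continuous_on {a..b} ?f" if "a \<ge> 0" for a b
    using continuous_on_subset[OF gnQ_cont[OF elim(2)], of "{a..b}"] that by (intro continuous_on_minus) auto
  have *: "norm ((A n s \<omega> - \<sigma> *\<^sub>R U n s \<omega>) - (A n t \<omega> - \<sigma> *\<^sub>R U n t \<omega>)) \<le> B * (t - s)" if st: "0 \<le> s" "s \<le> t" for s t
  proof -
    have e: "A n r \<omega> - \<sigma> *\<^sub>R U n r \<omega> = A n 0 \<omega> + integral {0..r} ?f" if "r \<ge> 0" for r
    proof -
      have "A n r \<omega> = A n 0 \<omega> + integral {0..r} ?f + \<sigma> *\<^sub>R U n r \<omega>"
        using elim(1) that by blast
      then show ?thesis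
        by (simp only: add_diff_cancel_right')
    qed
    have comb: "integral {0..t} ?f = integral {0..s} ?f + integral {s..t} ?f"
      by (rule Henstock_Kurzweil_Integration.integral_combine[OF st integrable_continuous_interval[OF c], symmetric]) simp
    have gen: "(a + x) - (a + (x + y)) = - y" for a x y :: "real ^ 'n"
      by simp
    have t0: "0 \<le> t"
      using st by simp
    have "(A n s \<omega> - \<sigma> *\<^sub>R U n s \<omega>) - (A n t \<omega> - \<sigma> *\<^sub>R U n t \<omega>) = - integral {s..t} ?f"
      unfolding e[OF st(1)] e[OF t0] comb by (rule gen)
    then have "norm ((A n s \<omega> - \<sigma> *\<^sub>R U n s \<omega>) - (A n t \<omega> - \<sigma> *\<^sub>R U n t \<omega>)) = norm (integral {s..t} ?f)"
      by (simp only: norm_minus_cancel)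
    also have "\<dots> \<le> B * (t - s)"
      by (rule integral_bound[OF st(2) c[OF st(1)]]) (simp add: gn_bd)
    finally show ?thesis .
  qed
  show ?case
  proof (intro allI impI)
    fix s t :: real assume "0 \<le> s" "0 \<le> t"
    then show "norm ((A n s \<omega> - \<sigma> *\<^sub>R U n s \<omega>) - (A n t \<omega> - \<sigma> *\<^sub>R U n t \<omega>)) \<le> B * \<bar>s - t\<bar>"
      using *[of s t] *[of t s] by (cases "s \<le> t") (simp_all add: norm_minus_commute)
  qed
qed

text \<open>An Arzela-Ascoli set for pairs. The Lipschitz condition on the difference transfers the
  modulus of the noise to the corrected position.\<close>

definition compact_paths :: "(nat \<Rightarrow> real) \<Rightarrow> ((real ^ 'n) \<times> (real ^ 'n)) cpath set" where
  "compact_paths \<delta> = {p. fst (eval_path p 0) \<in> cbox 0 1} \<inter> {p. snd (eval_path p 0) \<in> {0}} \<inter>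
    (\<Inter>(s, t)\<in>{0..} \<times> {0..}. {p. norm ((fst (eval_path p s) - \<sigma> *\<^sub>R snd (eval_path p s)) -
      (fst (eval_path p t) - \<sigma> *\<^sub>R snd (eval_path p t))) \<le> B * \<bar>s - t\<bar>}) \<inter>
    (\<Inter>(j, s, t)\<in>{(j, s, t). s \<in> {0..real j} \<and> t \<in> {0..real j} \<and> \<bar>s - t\<bar> \<le> \<delta> j}.
      {p. dist (snd (eval_path p s)) (snd (eval_path p t)) \<le> 1 / real (Suc j)})"

lemma closed_compact_paths: "closed (compact_paths \<delta>)"
proof -
  note c = continuous_on_fst[OF continuous_on_eval] continuous_on_snd[OF continuous_on_eval]
  have "closed {p :: ((real ^ 'n) \<times> (real ^ 'n)) cpath. fst (eval_path p 0) \<in> cbox 0 1}"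
    using closed_vimage[OF closed_cbox c(1)[OF order_refl]] by (simp add: vimage_def)
  moreover have "closed {p :: ((real ^ 'n) \<times> (real ^ 'n)) cpath. snd (eval_path p 0) \<in> {0}}"
    using closed_vimage[OF closed_singleton c(2)[OF order_refl]] by (simp add: vimage_def)
  ultimately show ?thesis
    unfolding compact_paths_def
    by (intro closed_Int closed_INT ballI)
      (auto intro!: closed_Collect_le continuous_intros c)
qed

lemma seq_compact_compact_paths:
  assumes \<delta>: "\<And>j. \<delta> j > 0"
  shows "seq_compact (compact_paths \<delta>)"
proof (rule seq_compact_cpath)
  have "(\<lambda>p. eval_path p 0) ` compact_paths \<delta> \<subseteq> cbox 0 1 \<times> {0}"
  proof (rule image_subsetI)
    fix p assume "p \<in> compact_paths \<delta>"
    then have "fst (eval_path p 0) \<in> cbox 0 1" "snd (eval_path p 0) \<in> {0}"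
      unfolding compact_paths_def by blast+
    then show "eval_path p 0 \<in> cbox 0 1 \<times> {0}"
      by (rule mem_Times_iff[THEN iffD2, OF conjI])
  qed
  then show "bounded ((\<lambda>p. eval_path p 0) ` compact_paths \<delta>)"
    by (rule bounded_subset[rotated]) (intro bounded_Times bounded_cbox, simp)
  show "closed (compact_paths \<delta>)"
    by (rule closed_compact_paths)
  fix T e :: real assume e: "e > 0"
  obtain j1 :: nat where j1: "T \<le> real j1"
    using real_arch_simple by blast
  obtain j2 :: nat where j2: "2 * (1 + \<sigma>) / e < real j2"
    using reals_Archimedean2 by blast
  \<comment> \<open>\<open>j\<close> must cover the horizon \<open>T\<close> and bring
    \<open>(1 + \<sigma>) / real (Suc j)\<close> below \<open>e / 2\<close>: the summand 1 is for
    the noise itself, \<open>\<sigma>\<close> for its share in the position. The other half of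
    \<open>e\<close> pays for the Lipschitz part.\<close>
  define j where "j = max j1 j2"
  have jT: "T \<le> real j" and je: "(1 + \<sigma>) * (1 / real (Suc j)) < e / 2"
  proof -
    show "T \<le> real j"
      using j1 by (simp add: j_def)
    have "2 * (1 + \<sigma>) / e < real (Suc j)"
      using j2 by (simp add: j_def)
    then have "2 * (1 + \<sigma>) < real (Suc j) * e"
      using e by (simp only: pos_divide_less_eq)
    then show "(1 + \<sigma>) * (1 / real (Suc j)) < e / 2"
      by (simp add: divide_less_eq mult.commute del: of_nat_Suc)
  qed
  define d where "d = min (\<delta> j) (e / (2 * B))"
  have "d > 0"
    using \<delta>[of j] e B_pos by (simp add: d_def)
  moreover have "dist (eval_path p s) (eval_path p t) < e"
    if p: "p \<in> compact_paths \<delta>" and st: "s \<in> {0..T}" "t \<in> {0..T}" "\<bar>s - t\<bar> < d" for p s t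
  proof -
    let ?a = "\<lambda>r. fst (eval_path p r)" and ?w = "\<lambda>r. snd (eval_path p r)"
    have w: "norm (?w s - ?w t) \<le> 1 / real (Suc j)"
      using p st jT by (auto simp: compact_paths_def dist_norm d_def simp del: of_nat_Suc)
    have l: "norm ((?a s - \<sigma> *\<^sub>R ?w s) - (?a t - \<sigma> *\<^sub>R ?w t)) \<le> B * \<bar>s - t\<bar>"
      using p st by (auto simp: compact_paths_def)
    have e: "?a s - ?a t = ((?a s - \<sigma> *\<^sub>R ?w s) - (?a t - \<sigma> *\<^sub>R ?w t)) + \<sigma> *\<^sub>R (?w s - ?w t)"
      by (simp add: algebra_simps)
    have "norm (?a s - ?a t) \<le> norm ((?a s - \<sigma> *\<^sub>R ?w s) - (?a t - \<sigma> *\<^sub>R ?w t)) + norm (\<sigma> *\<^sub>R (?w s - ?w t))"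
      by (subst e) (rule norm_triangle_ineq)
    moreover have "norm (\<sigma> *\<^sub>R (?w s - ?w t)) = \<sigma> * norm (?w s - ?w t)"
      unfolding norm_scaleR using \<sigma>_pos by (simp only: abs_of_pos)
    ultimately have "norm (?a s - ?a t) \<le> B * \<bar>s - t\<bar> + \<sigma> * norm (?w s - ?w t)"
      using l by linarith
    then have "norm (?a s - ?a t) + norm (?w s - ?w t) \<le> B * \<bar>s - t\<bar> + (1 + \<sigma>) * norm (?w s - ?w t)"
      by (simp add: algebra_simps)
    also have "\<dots> \<le> B * \<bar>s - t\<bar> + (1 + \<sigma>) * (1 / real (Suc j))"
      using w \<sigma>_pos by (intro add_left_mono mult_left_mono) auto
    also have "\<dots> < B * (e / (2 * B)) + e / 2"
    proof (rule add_le_less_mono[OF mult_left_mono je])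
      show "\<bar>s - t\<bar> \<le> e / (2 * B)"
        using st(3) by (simp add: d_def)
    qed (use B_pos in simp)
    also have "\<dots> = e"
      using B_pos by simp
    finally have "norm (?a s - ?a t) + norm (?w s - ?w t) < e" .
    moreover have "dist (eval_path p s) (eval_path p t) \<le> norm (?a s - ?a t) + norm (?w s - ?w t)"
      unfolding dist_norm using norm_Pair_le[of "?a s - ?a t" "?w s - ?w t"]
      by (metis fst_diff prod.collapse snd_diff)
    ultimately show ?thesis
      by linarith
  qed
  ultimately show "\<exists>d>0. \<forall>p\<in>compact_paths \<delta>. \<forall>s\<in>{0..T}. \<forall>t\<in>{0..T}. \<bar>s - t\<bar> < d \<longrightarrow> dist (eval_path p s) (eval_path p t) < e"
    by blast
qed

text \<open>All other conditions of \<open>compact_paths\<close> hold almost surely, so only the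
  moduli of the noise can fail; these have the same law for all \<open>n\<close>.\<close>

lemma law_compact_paths:
  "measure (path_law (M n) (U n)) (\<Inter>j. modulus_set (real j) (\<delta> j) (1 / real (Suc j))) \<le> measure (law n) (compact_paths \<delta>)"
proof -
  interpret prob_space "M n" by (rule prob_M)
  let ?S = "\<Inter>j. modulus_set (real j) (\<delta> j) (1 / real (Suc j)) :: (real ^ 'n) cpath set"
  have [measurable]: "?S \<in> sets borel" "compact_paths \<delta> \<in> sets borel"
    by (auto intro: borel_closed closed_compact_paths)
  have [measurable]: "(\<lambda>\<omega>. path_of (\<lambda>t. U n t \<omega>)) \<in> borel_measurable (M n)" "pair_path n \<in> borel_measurable (M n)"
    by (auto intro: borel_measurable_path_of U_cont U_M pair_path_M)
  have "measure (path_law (M n) (U n)) ?S = prob {\<omega> \<in> space (M n). path_of (\<lambda>t. U n t \<omega>) \<in> ?S}"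
    by (rule measure_U_law) measurable
  also have "\<dots> \<le> prob {\<omega> \<in> space (M n). pair_path n \<omega> \<in> compact_paths \<delta>}"
  proof (rule finite_measure_mono_AE)
    show "AE \<omega> in M n. \<omega> \<in> {\<omega> \<in> space (M n). path_of (\<lambda>t. U n t \<omega>) \<in> ?S} \<longrightarrow>
        \<omega> \<in> {\<omega> \<in> space (M n). pair_path n \<omega> \<in> compact_paths \<delta>}"
      using A_lipschitz[of n]
    proof eventually_elim
      case (elim \<omega>)
      show ?case
      proof
        assume a: "\<omega> \<in> {\<omega> \<in> space (M n). path_of (\<lambda>t. U n t \<omega>) \<in> ?S}"
        then have \<omega>: "\<omega> \<in> space (M n)"
          by simp
        have "dist (U n s \<omega>) (U n t \<omega>) \<le> 1 / real (Suc j)"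
          if "s \<in> {0..real j}" "t \<in> {0..real j}" "\<bar>s - t\<bar> \<le> \<delta> j" for s t j
        proof -
          have "path_of (\<lambda>t. U n t \<omega>) \<in> modulus_set (real j) (\<delta> j) (1 / real (Suc j))"
            using a by blast
          then show ?thesis
            using that unfolding U_modulus_iff[OF \<omega>] by blast
        qed
        then show "\<omega> \<in> {\<omega> \<in> space (M n). pair_path n \<omega> \<in> compact_paths \<delta>}"
          using \<omega> elim A0[OF \<omega>] U0[OF \<omega>] by (auto simp: compact_paths_def eval_pair_path simp del: of_nat_Suc)
      qed
    qed
  qed measurable
  also have "\<dots> = measure (law n) (compact_paths \<delta>)"
    unfolding law_def by (subst measure_distr) (auto simp: vimage_def Int_def conj_commute)
  finally show ?thesis .
qed

lemma tight_sets:
  obtains \<delta> where "\<And>m j. \<delta> m j > (0 :: real)" "\<And>m n. measure (law n) (compact_paths (\<delta> m)) \<ge> 1 - 1 / 2 ^ m"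
proof -
  obtain \<delta> :: "nat \<Rightarrow> nat \<Rightarrow> real" where "\<And>m j. \<delta> m j > 0"
    "\<And>m n. measure (path_law (M n) (U n)) (\<Inter>j. modulus_set (real j) (\<delta> m j) (1 / real (Suc j))) \<ge> 1 - 1 / 2 ^ m"
    using uniform_modulus_all by metis
  then show ?thesis
    using law_compact_paths order_trans by (intro that[of \<delta>]) blast+
qed

lemma limit_exists: "\<exists>r \<nu>. strict_mono r \<and> prob_space \<nu> \<and> sets \<nu> = sets borel \<and>
    weakly_converges (\<lambda>n. law (r n)) \<nu> sequentially"
proof -
  obtain \<delta> where \<delta>: "\<And>m j. \<delta> m j > (0 :: real)" "\<And>m n. measure (law n) (compact_paths (\<delta> m)) \<ge> 1 - 1 / 2 ^ m"
    by (rule tight_sets) blast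
  show ?thesis
    by (rule cpath_tight_subsequence[where K = "\<lambda>m. compact_paths (\<delta> m)"])
      (use \<delta> prob_law sets_law in \<open>auto intro: seq_compact_compact_paths borel_closed closed_compact_paths\<close>)
qed

end

section \<open>Identification of the limit\<close>

text \<open>Convergence of paths is uniform on \<open>{0..t}\<close>, and uniform continuity of
  \<open>f\<close> carries this to the integrands. Needed for the drift term of the limiting
  equation.\<close>

lemma continuous_on_path_integral:
  fixes f :: "'a::metric_space \<Rightarrow> 'b::euclidean_space"
  assumes f: "uniformly_continuous_on UNIV f" and t: "t \<ge> 0"
  shows "continuous_on UNIV (\<lambda>p. integral {0..t} (\<lambda>s. f (eval_path p s)))"
  unfolding continuous_on_def
proof
  fix p :: "'a cpath"
  show "((\<lambda>p. integral {0..t} (\<lambda>s. f (eval_path p s))) \<longlongrightarrow> integral {0..t} (\<lambda>s. f (eval_path p s))) (at p within UNIV)"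
  proof (cases "at p = bot")
    case False
    have u: "uniform_limit {0..t} (\<lambda>q s. f (eval_path q s)) (\<lambda>s. f (eval_path p s)) (at p)"
    proof (rule uniform_limitI)
      fix e :: real assume "e > 0"
      then obtain d where d: "d > 0" "\<And>x y. dist y x < d \<Longrightarrow> dist (f y) (f x) < e"
        using f unfolding uniformly_continuous_on_def by auto
      have "compact {0..t}" "{0..t} \<subseteq> {0..}"
        by auto
      then have "uniform_limit {0..t} eval_path (eval_path p) (at p)"
        using tendsto_ident_at[of p UNIV] unfolding tendsto_cpath_iff by blast
      from uniform_limitD[OF this d(1)]
      show "\<forall>\<^sub>F q in at p. \<forall>s\<in>{0..t}. dist (f (eval_path q s)) (f (eval_path p s)) < e"
        by eventually_elim (auto intro: d(2))
    qed
    have c: "continuous_on {0..t} (\<lambda>s. f (eval_path q s))" for q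
      by (rule continuous_on_compose2[OF uniformly_continuous_imp_continuous[OF f]
          continuous_on_subset[OF continuous_on_eval_path]]) auto
    obtain I J where IJ: "\<And>q. ((\<lambda>s. f (eval_path q s)) has_integral I q) {0..t}"
        "((\<lambda>s. f (eval_path p s)) has_integral J) {0..t}" "(I \<longlongrightarrow> J) (at p)"
      using uniform_limit_integral[OF u c False] by blast
    have "I = (\<lambda>q. integral {0..t} (\<lambda>s. f (eval_path q s)))" "J = integral {0..t} (\<lambda>s. f (eval_path p s))"
      using integral_unique[OF IJ(1)] integral_unique[OF IJ(2)] by auto
    with IJ(3) show ?thesis
      by simp
  qed simp
qed

lemma continuous_on_cyl:
  assumes "test_list I"
  shows "continuous_on UNIV (\<lambda>p. cyl I (eval_path p))"
  using assms
proof (induction I)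
  case (Cons a I)
  obtain t f where a: "a = (t, f)"
    by (cases a)
  from Cons.prems have t: "t \<ge> 0" and f: "uniformly_continuous_on UNIV f" and I: "test_list I"
    by (auto simp: test_list_def a)
  have "continuous_on UNIV (\<lambda>p. f (eval_path p t))"
    by (rule continuous_on_compose2[OF uniformly_continuous_imp_continuous[OF f] continuous_on_eval[OF t]]) simp
  then show ?case
    unfolding a cyl_Cons by (intro continuous_on_mult Cons.IH I)
qed (simp add: continuous_on_const)

text \<open>Continuity of \<open>\<Phi>\<close> becomes uniform near the image of a compact set:
  violating pairs with \<open>T = real n\<close> and \<open>d = 1 / real (Suc n)\<close> would have
  a common limit along a subsequence. It is applied to \<open>Q\<close>, which is close to the image
  of the pair on finite horizons only.\<close>

lemma seq_compact_nbhd: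
  fixes h :: "'a::metric_space \<Rightarrow> 'b::metric_space" and \<Phi> :: "'b cpath \<Rightarrow> real"
  assumes K: "seq_compact K" and h: "uniformly_continuous_on UNIV h" and \<Phi>: "continuous_on UNIV \<Phi>" and "\<eta> > 0"
  shows "\<exists>T d. d > 0 \<and> (\<forall>p\<in>K. \<forall>q. (\<forall>t\<in>{0..T}. dist (eval_path q t) (h (eval_path p t)) \<le> d) \<longrightarrow>
    \<bar>\<Phi> q - \<Phi> (cpath_map h p)\<bar> < \<eta>)"
proof (rule ccontr)
  have hc: "continuous_on UNIV h"
    by (rule uniformly_continuous_imp_continuous[OF h])
  assume neg: "\<not> ?thesis"
  have "\<exists>p\<in>K. \<exists>q. (\<forall>t\<in>{0..real n}. dist (eval_path q t) (h (eval_path p t)) \<le> 1 / real (Suc n)) \<and>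
      \<not> \<bar>\<Phi> q - \<Phi> (cpath_map h p)\<bar> < \<eta>" for n
  proof -
    have "1 / real (Suc n) > 0"
      by simp
    with neg show ?thesis
      by blast
  qed
  then obtain p q where pq: "\<And>n. p n \<in> K" "\<And>n t. t \<in> {0..real n} \<Longrightarrow> dist (eval_path (q n) t) (h (eval_path (p n) t)) \<le> 1 / real (Suc n)"
      "\<And>n. \<not> \<bar>\<Phi> (q n) - \<Phi> (cpath_map h (p n))\<bar> < \<eta>"
    by metis
  obtain l r where r: "strict_mono (r :: nat \<Rightarrow> nat)" "(\<lambda>n. p (r n)) \<longlonglongrightarrow> l"
  proof -
    have "\<forall>n. p n \<in> K"
      using pq(1) by blast
    with K have "\<exists>l\<in>K. \<exists>r. strict_mono r \<and> (p \<circ> r) \<longlonglongrightarrow> l"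
      unfolding seq_compact_def by blast
    then show ?thesis
      using that by (auto simp: o_def)
  qed
  have lim1: "(\<lambda>n. cpath_map h (p (r n))) \<longlonglongrightarrow> cpath_map h l"
    by (rule continuous_on_tendsto_compose[OF continuous_on_cpath_map[OF h] r(2)]) auto
  have lim2: "(\<lambda>n. q (r n)) \<longlonglongrightarrow> cpath_map h l"
    unfolding tendsto_cpath_iff
  proof (intro allI impI uniform_limitI)
    fix C :: "real set" and e :: real assume C: "compact C \<and> C \<subseteq> {0..}" and e: "e > 0"
    then obtain T where T: "\<And>t. t \<in> C \<Longrightarrow> norm t \<le> T"
      using compact_imp_bounded[of C] unfolding bounded_iff by auto
    obtain N1 :: nat where N1: "T \<le> real N1"
      using real_arch_simple by blast
    obtain N2 where N2: "1 / real (Suc N2) < e / 2"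
      using nat_approx_posE[of "e / 2"] e by auto
    have "\<forall>\<^sub>F n in sequentially. \<forall>t\<in>C. dist (eval_path (cpath_map h (p (r n))) t) (eval_path (cpath_map h l) t) < e / 2"
      using lim1 C e unfolding tendsto_cpath_iff by (intro uniform_limitD) auto
    moreover have "\<forall>\<^sub>F n in sequentially. n \<ge> max N1 N2"
      by (rule eventually_ge_at_top)
    ultimately show "\<forall>\<^sub>F n in sequentially. \<forall>t\<in>C. dist (eval_path (q (r n)) t) (eval_path (cpath_map h l) t) < e"
    proof eventually_elim
      case (elim n)
      have rn: "r n \<ge> N1" "r n \<ge> N2"
        using elim(2) seq_suble[OF r(1), of n] by auto
      show ?case
      proof
        fix t assume t: "t \<in> C"
        then have t0: "0 \<le> t"
          using C by auto
        have "t \<le> real (r n)"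
          using T[OF t] N1 rn(1) by (simp add: le_trans)
        then have "dist (eval_path (q (r n)) t) (h (eval_path (p (r n)) t)) \<le> 1 / real (Suc (r n))"
          using t0 by (intro pq(2)) auto
        also have "\<dots> \<le> 1 / real (Suc N2)"
          using rn(2) by (intro divide_left_mono) auto
        also have "\<dots> < e / 2"
          by (rule N2)
        finally have "dist (eval_path (q (r n)) t) (eval_path (cpath_map h (p (r n))) t) < e / 2"
          by (simp add: eval_cpath_map[OF hc t0])
        with elim(1) t show "dist (eval_path (q (r n)) t) (eval_path (cpath_map h l) t) < e"
          using dist_triangle[of "eval_path (q (r n)) t" "eval_path (cpath_map h l) t" "eval_path (cpath_map h (p (r n))) t"]
          by fastforce
      qed
    qed
  qed
  have "(\<lambda>n. \<Phi> (q (r n)) - \<Phi> (cpath_map h (p (r n)))) \<longlonglongrightarrow> \<Phi> (cpath_map h l) - \<Phi> (cpath_map h l)"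
    by (intro tendsto_diff continuous_on_tendsto_compose[OF \<Phi> lim1] continuous_on_tendsto_compose[OF \<Phi> lim2]) auto
  then have "(\<lambda>n. \<bar>\<Phi> (q (r n)) - \<Phi> (cpath_map h (p (r n)))\<bar>) \<longlonglongrightarrow> 0"
    using tendsto_rabs_zero by simp
  from order_tendstoD(2)[OF this \<open>\<eta> > 0\<close>] pq(3) show False
    by (auto simp: eventually_sequentially)
qed

locale overdamped_limit = overdamped_approximation M F W U A Q gn g \<sigma> B
  for M :: "nat \<Rightarrow> 'w measure" and F and W U :: "nat \<Rightarrow> real \<Rightarrow> 'w \<Rightarrow> real ^ 'n::finite"
    and A :: "nat \<Rightarrow> real \<Rightarrow> 'w \<Rightarrow> real ^ 'n" and Q :: "nat \<Rightarrow> real \<Rightarrow> 'w \<Rightarrow> 'n torus"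
    and gn :: "nat \<Rightarrow> 'n torus \<Rightarrow> real ^ 'n" and g :: "'n torus \<Rightarrow> real ^ 'n" and \<sigma> B :: real +
  fixes r :: "nat \<Rightarrow> nat" and \<nu> :: "((real ^ 'n) \<times> (real ^ 'n)) cpath measure"
  assumes r: "strict_mono r" and prob_\<nu>: "prob_space \<nu>" and sets_\<nu>: "sets \<nu> = sets borel"
    and wc: "weakly_converges (\<lambda>n. law (r n)) \<nu> sequentially"
begin

lemma test_limit:
  fixes G :: "((real ^ 'n) \<times> (real ^ 'n)) cpath \<Rightarrow> real"
  assumes G: "continuous_on UNIV G" and bd: "\<And>p. \<bar>G p\<bar> \<le> c"
  shows "(\<lambda>n. \<integral>\<omega>. G (pair_path (r n) \<omega>) \<partial>M (r n)) \<longlonglongrightarrow> (\<integral>p. G p \<partial>\<nu>)"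
proof -
  have "bounded (range G)"
    unfolding bounded_iff using bd by auto
  then have "(\<lambda>n. \<integral>p. G p \<partial>law (r n)) \<longlonglongrightarrow> (\<integral>p. G p \<partial>\<nu>)"
    using wc G unfolding weakly_converges_def by blast
  then show ?thesis
    by (simp add: integral_law borel_measurable_continuous_onI[OF G])
qed

text \<open>The way in which identities reach the limit: \<open>G\<close> measures their failure,
  truncated at 1 to be bounded, and a nonnegative function of mean 0 vanishes almost surely.\<close>

lemma null_limit:
  fixes G :: "((real ^ 'n) \<times> (real ^ 'n)) cpath \<Rightarrow> real"
  assumes G: "continuous_on UNIV G" and bd: "\<And>p. 0 \<le> G p \<and> G p \<le> 1"
    and small: "\<And>e. e > 0 \<Longrightarrow> \<forall>\<^sub>F n in sequentially. (\<integral>\<omega>. G (pair_path n \<omega>) \<partial>M n) \<le> e"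
  shows "AE p in \<nu>. G p = 0"
proof -
  interpret N: prob_space \<nu> by (rule prob_\<nu>)
  have bd': "\<bar>G p\<bar> \<le> 1" for p
    using bd[of p] by simp
  have "(\<integral>p. G p \<partial>\<nu>) \<le> e" if "e > 0" for e
    by (rule tendsto_upperbound[OF test_limit[OF G bd']])
      (use eventually_subseq[OF r small[OF that]] in auto)
  then have le: "(\<integral>p. G p \<partial>\<nu>) \<le> 0"
    by (rule field_le_epsilon) simp
  have ge: "0 \<le> (\<integral>p. G p \<partial>\<nu>)"
    using bd by (intro integral_nonneg_AE) auto
  have int: "integrable \<nu> G"
    using bd' borel_measurable_continuous_onI[OF G]
    by (intro N.integrable_const_bound[of _ 1]) (auto simp: measurable_cong_sets[OF sets_\<nu> refl])
  have "AE p in \<nu>. 0 \<le> G p"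
    using bd by simp
  then show ?thesis
    using integral_nonneg_eq_0_iff_AE[OF int] antisym[OF le ge] by blast
qed

lemma \<nu>_W0: "AE p in \<nu>. snd (eval_path p 0) = 0"
proof -
  have "AE p in \<nu>. min 1 (norm (snd (eval_path p 0))) = 0"
  proof (rule null_limit)
    show "continuous_on UNIV (\<lambda>p :: ((real ^ 'n) \<times> (real ^ 'n)) cpath. min 1 (norm (snd (eval_path p 0))))"
      by (intro continuous_intros continuous_on_eval) simp
    fix e :: real assume "e > 0"
    have "(\<integral>\<omega>. min 1 (norm (snd (eval_path (pair_path n \<omega>) 0))) \<partial>M n) = (\<integral>\<omega>. 0 \<partial>M n)" for n
      by (intro Bochner_Integration.integral_cong) (simp_all add: eval_pair_path U0)
    then show "\<forall>\<^sub>F n in sequentially. (\<integral>\<omega>. min 1 (norm (snd (eval_path (pair_path n \<omega>) 0))) \<partial>M n) \<le> e"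
      using \<open>e > 0\<close> by simp
  qed auto
  then show ?thesis
    by eventually_elim (auto simp: min_def split: if_splits)
qed

text \<open>Its vanishing is the limiting equation; the integral has a plus sign because the drift
  is \<open>- g\<close>. It is a continuous function of the path and can hence be tested under weak
  convergence.\<close>

definition residual :: "real \<Rightarrow> ((real ^ 'n) \<times> (real ^ 'n)) cpath \<Rightarrow> real ^ 'n" where
  "residual t p = fst (eval_path p t) - fst (eval_path p 0) +
    integral {0..t} (\<lambda>s. g (to_torus (fst (eval_path p s)))) - \<sigma> *\<^sub>R snd (eval_path p t)"

lemma lift_uc: "uniformly_continuous_on UNIV (\<lambda>x :: (real ^ 'n) \<times> (real ^ 'n). g (to_torus (fst x)))"
proof -
  have 1: "uniformly_continuous_on UNIV (\<lambda>x. g (to_torus x))"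
    by (rule uniformly_continuous_lift[OF g_uc])
  show ?thesis
    unfolding uniformly_continuous_on_def
  proof (intro allI impI)
    fix e :: real assume "e > 0"
    with 1 obtain d where d: "d > 0" "\<And>x y. dist y x < d \<Longrightarrow> dist (g (to_torus y)) (g (to_torus x)) < e"
      unfolding uniformly_continuous_on_def by auto
    show "\<exists>d>0. \<forall>x\<in>UNIV. \<forall>y\<in>UNIV. dist y x < d \<longrightarrow> dist (g (to_torus (fst y))) (g (to_torus (fst x))) < e"
      using d dist_fst_le by (meson le_less_trans)
  qed
qed

lemma residual_small:
  assumes t: "t \<ge> 0" and e: "e > 0"
  shows "\<forall>\<^sub>F n in sequentially. (\<integral>\<omega>. min 1 (norm (residual t (pair_path n \<omega>))) \<partial>M n) \<le> e"
proof -
  \<comment> \<open>Two errors of at most \<open>\<eta>\<close> per unit of time: one for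
    \<open>gn\<close> against \<open>g\<close>, one for \<open>g\<close> at \<open>Q\<close> against
    \<open>g\<close> at \<open>A\<close>; \<open>t + 1\<close> avoids division by 0. The distance
    \<open>d / 2\<close> below turns a weak inequality into a strict one.\<close>
  define \<eta> where "\<eta> = e / (4 * (t + 1))"
  have \<eta>: "\<eta> > 0" "2 * \<eta> * t \<le> e / 2"
    using e t by (auto simp: \<eta>_def field_simps)
  obtain d where d: "d > 0" "\<And>x y. dist y x < d \<Longrightarrow> dist (g y) (g x) < \<eta>"
    using g_uc \<eta>(1) unfolding uniformly_continuous_on_def by auto
  have "\<forall>\<^sub>F n in sequentially. \<exists>G\<in>sets (M n). measure (M n) G \<ge> 1 - e / 4 \<and>
        (\<forall>\<omega>\<in>G. \<forall>s\<in>{0..t}. dist (Q n s \<omega>) (to_torus (A n s \<omega>)) \<le> d / 2)"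
    using d(1) e by (intro close) auto
  with gn_conv[OF \<eta>(1)] show ?thesis
  proof eventually_elim
    case (elim n)
    then obtain G where G: "G \<in> sets (M n)" "measure (M n) G \<ge> 1 - e / 4"
        "\<And>\<omega> s. \<omega> \<in> G \<Longrightarrow> s \<in> {0..t} \<Longrightarrow> dist (Q n s \<omega>) (to_torus (A n s \<omega>)) \<le> d / 2"
      by blast
    interpret prob_space "M n" by (rule prob_M)
    let ?m = "\<lambda>\<omega>. min 1 (norm (residual t (pair_path n \<omega>)))"
    have AE: "AE \<omega> in M n. ?m \<omega> \<le> 2 * \<eta> * t + indicator (space (M n) - G) \<omega>"
      using A_eq[of n] AE_space
    proof eventually_elim
      case (elim \<omega>)
      note \<omega> = elim(2)
      show ?case
      proof (cases "\<omega> \<in> G")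
        case True
        have cg: "continuous_on {0..t} (\<lambda>s. g (to_torus (A n s \<omega>)))"
          using uniformly_continuous_imp_continuous[OF uniformly_continuous_lift[OF g_uc]]
          by (rule continuous_on_compose2[OF _ continuous_on_subset[OF A_cont[OF \<omega>]]]) auto
        have cn: "continuous_on {0..t} (\<lambda>s. gn n (Q n s \<omega>))"
          by (rule continuous_on_subset[OF gnQ_cont[OF \<omega>]]) auto
        have "integral {0..t} (\<lambda>s. g (to_torus (fst (eval_path (pair_path n \<omega>) s)))) = integral {0..t} (\<lambda>s. g (to_torus (A n s \<omega>)))"
          by (intro Henstock_Kurzweil_Integration.integral_cong) (simp add: eval_pair_path[OF \<omega>])
        moreover have "A n t \<omega> = A n 0 \<omega> + integral {0..t} (\<lambda>s. - gn n (Q n s \<omega>)) + \<sigma> *\<^sub>R U n t \<omega>"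
          using elim(1) t by blast
        ultimately have "residual t (pair_path n \<omega>) = integral {0..t} (\<lambda>s. g (to_torus (A n s \<omega>))) - integral {0..t} (\<lambda>s. gn n (Q n s \<omega>))"
          unfolding residual_def eval_pair_path[OF \<omega> t] eval_pair_path[OF \<omega> order_refl] by simp
        also have "\<dots> = integral {0..t} (\<lambda>s. g (to_torus (A n s \<omega>)) - gn n (Q n s \<omega>))"
          by (intro Henstock_Kurzweil_Integration.integral_diff[symmetric] integrable_continuous_interval cg cn)
        also have "norm \<dots> \<le> (2 * \<eta>) * (t - 0)"
        proof (rule integral_bound[OF t])
          show "continuous_on {0..t} (\<lambda>s. g (to_torus (A n s \<omega>)) - gn n (Q n s \<omega>))"
            by (intro continuous_on_diff cg cn)
          fix s assume s: "s \<in> {0..t}"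
          have "dist (Q n s \<omega>) (to_torus (A n s \<omega>)) < d"
            using G(3)[OF True s] d(1) by linarith
          then have "norm (g (Q n s \<omega>) - g (to_torus (A n s \<omega>))) < \<eta>"
            using d(2) by (simp add: dist_norm)
          moreover have "norm (gn n (Q n s \<omega>) - g (Q n s \<omega>)) \<le> \<eta>"
            using \<open>\<forall>q. norm (gn n q - g q) \<le> \<eta>\<close> by blast
          ultimately show "norm (g (to_torus (A n s \<omega>)) - gn n (Q n s \<omega>)) \<le> 2 * \<eta>"
            using norm_triangle_ineq[of "gn n (Q n s \<omega>) - g (Q n s \<omega>)" "g (Q n s \<omega>) - g (to_torus (A n s \<omega>))"]
            by (simp add: norm_minus_commute)
        qed
        finally have "norm (residual t (pair_path n \<omega>)) \<le> 2 * \<eta> * t"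
          by simp
        then show ?thesis
          using \<omega> True by (simp add: min_def)
      next
        case False
        have "0 \<le> 2 * \<eta> * t"
          using \<eta>(1) t by simp
        with False \<omega> show ?thesis
          by (simp add: min_def)
      qed
    qed
    have i: "integrable (M n) (indicat_real (space (M n) - G))"
      using G(1) by (intro integrable_real_indicator) (auto simp: emeasure_eq_measure)
    have "(\<integral>\<omega>. ?m \<omega> \<partial>M n) \<le> (\<integral>\<omega>. 2 * \<eta> * t + indicator (space (M n) - G) \<omega> \<partial>M n)"
    \<comment> \<open>Without integrability the integral is 0 by convention, so the bound holds in
      both cases.\<close>
    proof (cases "integrable (M n) ?m")
      case True
      then show ?thesis
        using AE i by (intro integral_mono_AE) auto
    next
      case False
      have "0 \<le> 2 * \<eta> * t"
        using \<eta>(1) t by simp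
      then show ?thesis
        unfolding not_integrable_integral_eq[OF False] by (intro integral_nonneg_AE) auto
    qed
    also have "\<dots> = 2 * \<eta> * t + prob (space (M n) - G)"
      using i G(1) prob_space by simp
    also have "\<dots> \<le> e / 2 + e / 4"
      using \<eta>(2) G(1,2) by (simp add: prob_compl)
    finally show ?case
      using e by simp
  qed
qed

lemma \<nu>_residual:
  assumes t: "t \<ge> 0"
  shows "AE p in \<nu>. residual t p = 0"
proof -
  have "AE p in \<nu>. min 1 (norm (residual t p)) = 0"
  proof (rule null_limit)
    show "continuous_on UNIV (\<lambda>p. min 1 (norm (residual t p)))"
      unfolding residual_def
      by (intro continuous_on_min continuous_on_const continuous_on_norm continuous_on_diff continuous_on_add
          continuous_on_fst continuous_on_snd continuous_on_scaleR continuous_on_eval t order_refl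
          continuous_on_path_integral[OF lift_uc])
  qed (use residual_small[OF t] in auto)
  then show ?thesis
    by eventually_elim (auto simp: min_def split: if_splits)
qed

text \<open>For each \<open>n\<close> this is independence of the increment from the past of the
  pair; both sides are built from integrals of bounded continuous functionals and pass to the
  limit.\<close>

lemma \<nu>_increments:
  assumes st: "0 \<le> s" "s < t" and I: "test_list I" "\<And>u h. (u, h) \<in> set I \<Longrightarrow> u \<le> s"
    and f: "uniformly_continuous_on UNIV f" "\<And>x. 0 \<le> f x \<and> f x \<le> (1 :: real)"
  shows "(\<integral>p. cyl I (eval_path p) * f (snd (eval_path p t) - snd (eval_path p s)) \<partial>\<nu>) =
    (\<integral>p. cyl I (eval_path p) \<partial>\<nu>) * (\<integral>z. f z \<partial>gauss (t - s))"
proof -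
  let ?c = "\<integral>z. f z \<partial>gauss (t - s)"
  have fc: "continuous_on UNIV f"
    by (rule uniformly_continuous_imp_continuous[OF f(1)])
  have fm [measurable]: "f \<in> borel_measurable borel"
    by (intro borel_measurable_continuous_onI fc)
  have cyl1: "\<bar>cyl I x\<bar> \<le> 1" for x
    using cyl_range[OF I(1), of x] by simp
  have t0: "0 \<le> t"
    using st by simp
  have 1: "(\<lambda>n. \<integral>\<omega>. cyl I (eval_path (pair_path (r n) \<omega>)) *
      f (snd (eval_path (pair_path (r n) \<omega>) t) - snd (eval_path (pair_path (r n) \<omega>) s)) \<partial>M (r n)) \<longlonglongrightarrow>
      (\<integral>p. cyl I (eval_path p) * f (snd (eval_path p t) - snd (eval_path p s)) \<partial>\<nu>)"
  proof (rule test_limit[of _ 1])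
    have "continuous_on UNIV (\<lambda>p :: ((real ^ 'n) \<times> (real ^ 'n)) cpath. f (snd (eval_path p t) - snd (eval_path p s)))"
      by (rule continuous_on_compose2[OF fc]) (auto intro!: continuous_intros continuous_on_eval st t0)
    then show "continuous_on UNIV (\<lambda>p. cyl I (eval_path p) * f (snd (eval_path p t) - snd (eval_path p s)))"
      by (intro continuous_on_mult continuous_on_cyl I)
    show "\<bar>cyl I (eval_path p) * f (snd (eval_path p t) - snd (eval_path p s))\<bar> \<le> 1" for p
      unfolding abs_mult using cyl1 f(2) by (intro mult_le_one) auto
  qed
  have 2: "(\<lambda>n. (\<integral>\<omega>. cyl I (eval_path (pair_path (r n) \<omega>)) \<partial>M (r n)) * ?c) \<longlonglongrightarrow> (\<integral>p. cyl I (eval_path p) \<partial>\<nu>) * ?c"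
    by (intro tendsto_mult tendsto_const test_limit[of _ 1] continuous_on_cyl I cyl1)
  have eq: "(\<integral>\<omega>. cyl I (eval_path (pair_path n \<omega>)) * f (snd (eval_path (pair_path n \<omega>) t) - snd (eval_path (pair_path n \<omega>) s)) \<partial>M n) =
      (\<integral>\<omega>. cyl I (eval_path (pair_path n \<omega>)) \<partial>M n) * ?c" for n
  proof -
    interpret B: filtered_bm "M n" "F n" "W n" by (rule bm)
    \<comment> \<open>Written with \<open>W\<close>, not \<open>U\<close>, since only
      \<open>W\<close> is known to be adapted; the two agree almost surely.\<close>
    define Z where "Z \<omega> = cyl I (\<lambda>u. (A n u \<omega>, W n u \<omega>))" for \<omega>
    have Z: "Z \<in> borel_measurable (F n s)"
      unfolding Z_def
    proof (rule borel_measurable_cyl[OF I(1)])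
      fix u h assume "(u, h) \<in> set I"
      then have u: "0 \<le> u" "u \<le> s"
        using I by (auto simp: test_list_def)
      show "(\<lambda>\<omega>. (A n u \<omega>, W n u \<omega>)) \<in> borel_measurable (F n s)"
        using B.measurable_F_mono[OF A_F[OF u(1)] u(2)] B.measurable_F_mono[OF B.W_F[OF u(1)] u(2)]
        by (intro borel_measurable_Pair)
    qed
    have Z1: "\<bar>Z \<omega>\<bar> \<le> 1" for \<omega>
      unfolding Z_def by (rule cyl1)
    have ZM: "Z \<in> borel_measurable (M n)"
      by (rule B.measurable_F_M[OF Z])
    have WM [measurable]: "W n t \<in> borel_measurable (M n)" "W n s \<in> borel_measurable (M n)"
      using B.W_M st t0 by auto
    have pm: "(\<lambda>\<omega>. cyl I (eval_path (pair_path n \<omega>))) \<in> borel_measurable (M n)"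
      by (rule measurable_compose[OF pair_path_M measurable_cyl_eval[OF I(1)]])
    have pe: "(\<lambda>\<omega>. snd (eval_path (pair_path n \<omega>) u)) \<in> borel_measurable (M n)" if "u \<ge> 0" for u
      using measurable_compose[OF pair_path_M borel_measurable_continuous_onI[OF continuous_on_snd[OF continuous_on_eval[OF that]]]] .
    have aeZ: "AE \<omega> in M n. cyl I (eval_path (pair_path n \<omega>)) = Z \<omega>"
      and aeW: "AE \<omega> in M n. snd (eval_path (pair_path n \<omega>) t) - snd (eval_path (pair_path n \<omega>) s) = W n t \<omega> - W n s \<omega>"
      using UW[of n] AE_space
      by (eventually_elim, use I st t0 in \<open>auto simp: Z_def eval_pair_path test_list_def intro!: cyl_cong\<close>)+
    have "(\<integral>\<omega>. cyl I (eval_path (pair_path n \<omega>)) * f (snd (eval_path (pair_path n \<omega>) t) - snd (eval_path (pair_path n \<omega>) s)) \<partial>M n) =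
        (\<integral>\<omega>. Z \<omega> * f (0 + 1 *\<^sub>R (W n t \<omega> - W n s \<omega>)) \<partial>M n)"
    proof (rule integral_cong_AE)
      show "(\<lambda>\<omega>. cyl I (eval_path (pair_path n \<omega>)) * f (snd (eval_path (pair_path n \<omega>) t) - snd (eval_path (pair_path n \<omega>) s))) \<in> borel_measurable (M n)"
        using pm pe[OF t0] pe[OF st(1)] by measurable
      show "(\<lambda>\<omega>. Z \<omega> * f (0 + 1 *\<^sub>R (W n t \<omega> - W n s \<omega>))) \<in> borel_measurable (M n)"
        using ZM by measurable
      show "AE \<omega> in M n. cyl I (eval_path (pair_path n \<omega>)) * f (snd (eval_path (pair_path n \<omega>) t) - snd (eval_path (pair_path n \<omega>) s)) =
          Z \<omega> * f (0 + 1 *\<^sub>R (W n t \<omega> - W n s \<omega>))"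
        using aeZ aeW by eventually_elim simp
    qed
    \<comment> \<open>With starting point 0 and unit noise, \<open>heat_freeze\<close> integrates
      the increment out.\<close>
    also have "\<dots> = (\<integral>\<omega>. Z \<omega> * heat 1 (t - s) f 0 \<partial>M n)"
      using f(2) by (intro B.heat_freeze[OF st Z Z1 _ fm, of _ 1]) auto
    also have "\<dots> = (\<integral>\<omega>. Z \<omega> \<partial>M n) * ?c"
      by (simp add: heat_def)
    also have "(\<integral>\<omega>. Z \<omega> \<partial>M n) = (\<integral>\<omega>. cyl I (eval_path (pair_path n \<omega>)) \<partial>M n)"
      by (rule integral_cong_AE[OF ZM pm]) (use aeZ in auto)
    finally show ?thesis .
  qed
  show ?thesis
    by (rule LIMSEQ_unique[OF 1 2[folded eq]])
qed

theorem limit_weak_solution: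
  "weak_solution (\<lambda>x. - g (to_torus x)) (\<lambda>w. \<sigma> *\<^sub>R w) \<nu> (\<lambda>t p. fst (eval_path p t))"
proof -
  have bm: "brownian_motion \<nu> path_filtration (\<lambda>t p. snd (eval_path p t))"
    by (rule brownian_motion_pathI[OF prob_\<nu> sets_\<nu> _ \<nu>_W0 \<nu>_increments]) (intro continuous_intros)
  have ad: "adapted path_filtration (\<lambda>t p :: ((real ^ 'n) \<times> (real ^ 'n)) cpath. fst (eval_path p t))"
    by (intro adapted_eval_path borel_measurable_continuous_onI continuous_intros)
  have c: "continuous_on {0..} (\<lambda>t. fst (eval_path p t))" "continuous_on {0..} (\<lambda>t. snd (eval_path p t))"
    for p :: "((real ^ 'n) \<times> (real ^ 'n)) cpath"
    by (intro continuous_on_fst continuous_on_snd continuous_on_eval_path)+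
  have cg: "continuous_on {0..} (\<lambda>s. g (to_torus (fst (eval_path p s))))" for p :: "((real ^ 'n) \<times> (real ^ 'n)) cpath"
    by (rule continuous_on_compose2[OF uniformly_continuous_imp_continuous[OF lift_uc] continuous_on_eval_path]) simp
  \<comment> \<open>Each fixed time has its own null set; the countably many positive rational times
    share one, and continuity of the residual extends its vanishing to all times.\<close>
  have "AE p in \<nu>. \<forall>t\<in>\<rat> \<inter> {0<..}. residual t p = 0"
    using \<nu>_residual by (intro AE_ball_countable' countable_Int1 countable_rat) auto
  then have "AE p in \<nu>. \<forall>t\<ge>0. set_integrable lborel {0..t} (\<lambda>s. - g (to_torus (fst (eval_path p s)))) \<and>
      fst (eval_path p t) = fst (eval_path p 0) + (LINT s:{0..t}|lborel. - g (to_torus (fst (eval_path p s)))) +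
        \<sigma> *\<^sub>R (snd (eval_path p t) - snd (eval_path p 0))"
    using \<nu>_W0
  proof eventually_elim
    case (elim p)
    have cr: "continuous_on {0..} (\<lambda>t. residual t p)"
      unfolding residual_def
    proof (intro continuous_on_diff continuous_on_add continuous_on_const continuous_on_scaleR c continuous_on_atLeast_0I)
      fix T
      have "continuous_on {0..T} (\<lambda>s. g (to_torus (fst (eval_path p s))))"
        by (rule continuous_on_subset[OF cg]) auto
      then show "continuous_on {0..T} (\<lambda>t. integral {0..t} (\<lambda>s. g (to_torus (fst (eval_path p s)))))"
        by (intro indefinite_integral_continuous_1 integrable_continuous_interval)
    qed
    show ?case
    proof (intro allI impI conjI)
      fix t :: real assume t: "t \<ge> 0"
      have "residual t p = 0"
        by (rule continuous_constant_on_closure[of "\<rat> \<inter> {0<..}" "\<lambda>t. residual t p"])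
          (use elim(1) cr t in \<open>auto simp: closure_Rats_nonneg\<close>)
      moreover note set_lint_eq_integral[OF continuous_on_minus[OF cg[of p]], of t]
      ultimately show "set_integrable lborel {0..t} (\<lambda>s. - g (to_torus (fst (eval_path p s))))"
        "fst (eval_path p t) = fst (eval_path p 0) + (LINT s:{0..t}|lborel. - g (to_torus (fst (eval_path p s)))) +
          \<sigma> *\<^sub>R (snd (eval_path p t) - snd (eval_path p 0))"
        using elim(2) by (simp_all add: residual_def algebra_simps)
    qed
  qed
  with bm ad filtered_path_filtration[OF prob_\<nu> sets_\<nu>] show ?thesis
    unfolding weak_solution_def using c(1) by blast
qed

lemma initial_limit:
  fixes f :: "'n torus \<Rightarrow> real"
  assumes f: "continuous_on UNIV f" and bd: "\<And>q. \<bar>f q\<bar> \<le> c"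
  shows "(\<lambda>n. \<integral>\<omega>. f (to_torus (A (r n) 0 \<omega>)) \<partial>M (r n)) \<longlonglongrightarrow> (\<integral>p. f (to_torus (fst (eval_path p 0))) \<partial>\<nu>)"
proof -
  have "continuous_on UNIV (\<lambda>x. f (to_torus x))"
    by (rule continuous_on_compose2[OF f continuous_to_torus]) simp
  then have "continuous_on UNIV (\<lambda>p :: ((real ^ 'n) \<times> (real ^ 'n)) cpath. f (to_torus (fst (eval_path p 0))))"
    by (rule continuous_on_compose2[OF _ continuous_on_fst[OF continuous_on_eval]]) auto
  from test_limit[OF this bd] have "(\<lambda>n. \<integral>\<omega>. f (to_torus (fst (eval_path (pair_path (r n) \<omega>) 0))) \<partial>M (r n)) \<longlonglongrightarrow>
      (\<integral>p. f (to_torus (fst (eval_path p 0))) \<partial>\<nu>)" .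
  moreover have "(\<integral>\<omega>. f (to_torus (fst (eval_path (pair_path n \<omega>) 0))) \<partial>M n) = (\<integral>\<omega>. f (to_torus (A n 0 \<omega>)) \<partial>M n)" for n
    by (intro Bochner_Integration.integral_cong) (simp_all add: eval_pair_path)
  ultimately show ?thesis
    by simp
qed

text \<open>A Slutsky argument: on an event of probability close to 1 the pair path lies in a
  compact set and \<open>Q\<close> is close to its projection, so that \<open>\<Phi>\<close> of the
  two differ little; weak convergence is then applied to the projection.\<close>

theorem position_limit:
  fixes \<Phi> :: "'n torus cpath \<Rightarrow> real"
  assumes \<Phi>: "continuous_on UNIV \<Phi>" and bd: "\<And>q. \<bar>\<Phi> q\<bar> \<le> c"
  shows "(\<lambda>n. \<integral>q. \<Phi> q \<partial>path_law (M (r n)) (Q (r n))) \<longlonglongrightarrow>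
    (\<integral>q. \<Phi> q \<partial>path_law \<nu> (\<lambda>t p. to_torus (fst (eval_path p t))))"
proof -
  define h where "h x = to_torus (fst x)" for x :: "(real ^ 'n) \<times> (real ^ 'n)"
  have h: "uniformly_continuous_on UNIV h"
    unfolding uniformly_continuous_on_def h_def
    by (meson dist_fst_le dist_to_torus_le le_less_trans)
  note hc = uniformly_continuous_imp_continuous[OF h]
  have \<Phi>m: "\<Phi> \<in> borel_measurable borel"
    by (intro borel_measurable_continuous_onI \<Phi>)
  have hp: "continuous_on {0..} (\<lambda>t. h (eval_path p t))" for p
    by (rule continuous_on_compose2[OF hc continuous_on_eval_path]) simp
  have hm: "(\<lambda>p. h (eval_path p t)) \<in> borel_measurable \<nu>" if "t \<ge> 0" for t
    unfolding measurable_cong_sets[OF sets_\<nu> refl]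
    by (rule measurable_compose[OF measurable_eval_path[OF that] borel_measurable_continuous_onI[OF hc]])
  have target: "(\<integral>q. \<Phi> q \<partial>path_law \<nu> (\<lambda>t p. to_torus (fst (eval_path p t)))) = (\<integral>p. \<Phi> (cpath_map h p) \<partial>\<nu>)"
    using integral_path_law[of \<nu> "\<lambda>t p. h (eval_path p t)", OF hp hm \<Phi>m] by (simp add: h_def cpath_map_def)
  have c0: "c \<ge> 0"
    using order_trans[OF abs_ge_zero bd] .
  have Qm: "(\<lambda>\<omega>. path_of (\<lambda>t. Q n t \<omega>)) \<in> borel_measurable (M n)" for n
    by (rule borel_measurable_path_of[OF Q_cont Q_M])
  have source: "(\<integral>q. \<Phi> q \<partial>path_law (M n) (Q n)) = (\<integral>\<omega>. \<Phi> (path_of (\<lambda>t. Q n t \<omega>)) \<partial>M n)" for n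
    by (rule integral_path_law[OF Q_cont Q_M \<Phi>m])
  have cont: "continuous_on UNIV (\<lambda>p. \<Phi> (cpath_map h p))"
    by (rule continuous_on_compose2[OF \<Phi> continuous_on_cpath_map[OF h]]) simp
  have lim: "(\<lambda>n. \<integral>\<omega>. \<Phi> (cpath_map h (pair_path (r n) \<omega>)) \<partial>M (r n)) \<longlonglongrightarrow> (\<integral>p. \<Phi> (cpath_map h p) \<partial>\<nu>)"
    by (rule test_limit[OF cont bd])
  obtain \<delta> where \<delta>: "\<And>m j. \<delta> m j > (0 :: real)" "\<And>m n. measure (law n) (compact_paths (\<delta> m)) \<ge> 1 - 1 / 2 ^ m"
    by (rule tight_sets) blast
  have "\<forall>\<^sub>F n in sequentially. \<bar>(\<integral>\<omega>. \<Phi> (path_of (\<lambda>t. Q n t \<omega>)) \<partial>M n) - (\<integral>\<omega>. \<Phi> (cpath_map h (pair_path n \<omega>)) \<partial>M n)\<bar> \<le> e"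
    if e: "e > 0" for e
  proof -
    \<comment> \<open>Two events, closeness and compactness, may each fail with probability at most
      \<open>a\<close>, and every failure costs at most \<open>2 * c\<close>; \<open>c + 1\<close>
      guards against \<open>c = 0\<close>.\<close>
    define a where "a = e / (8 * (c + 1))"
    have a: "a > 0" and ca: "2 * c * (2 * a) \<le> e / 2"
      using e c0 by (auto simp: a_def field_simps)
    obtain m where m: "(1 / 2) ^ m < a"
      using real_arch_pow_inv[OF a, of "1 / 2"] by auto
    let ?K = "compact_paths (\<delta> m)"
    have "e / 2 > 0"
      using e by simp
    from seq_compact_nbhd[OF seq_compact_compact_paths[of "\<delta> m", OF \<delta>(1)] h \<Phi> this]
    obtain T d where Td: "d > 0" and Td': "\<forall>p\<in>?K. \<forall>q. (\<forall>t\<in>{0..T}. dist (eval_path q t) (h (eval_path p t)) \<le> d) \<longrightarrow>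
        \<bar>\<Phi> q - \<Phi> (cpath_map h p)\<bar> < e / 2"
      by blast
    from close[OF Td a, of T] show ?thesis
    proof eventually_elim
      case (elim n)
      then obtain G where G: "G \<in> sets (M n)" "measure (M n) G \<ge> 1 - a"
          "\<And>\<omega> s. \<omega> \<in> G \<Longrightarrow> s \<in> {0..T} \<Longrightarrow> dist (Q n s \<omega>) (to_torus (A n s \<omega>)) \<le> d"
        by blast
      interpret prob_space "M n" by (rule prob_M)
      define H where "H = {\<omega> \<in> space (M n). pair_path n \<omega> \<in> ?K}"
      have H: "H \<in> events"
        unfolding H_def using measurable_sets[OF pair_path_M[of n] borel_closed[OF closed_compact_paths[of "\<delta> m"]]]
        by (simp add: vimage_def Int_def conj_commute)
      have "measure (law n) ?K = prob H"
        unfolding law_def H_def using pair_path_M[of n]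
        by (subst measure_distr) (auto simp: vimage_def Int_def conj_commute borel_closed closed_compact_paths)
      then have PH: "prob H \<ge> 1 - a"
        using \<delta>(2)[of m n] m by (simp add: power_divide)
      let ?D = "space (M n) - (G \<inter> H)"
      have D: "?D \<in> events"
        using G(1) H by auto
      have PD: "prob ?D \<le> 2 * a"
      proof -
        have eq: "?D = (space (M n) - G) \<union> (space (M n) - H)"
          by auto
        have "prob ?D \<le> prob (space (M n) - G) + prob (space (M n) - H)"
          unfolding eq using G(1) H by (intro measure_Un_le) auto
        then show ?thesis
          using G PH H by (simp add: prob_compl)
      qed
      let ?x = "\<lambda>\<omega>. \<Phi> (path_of (\<lambda>t. Q n t \<omega>))" and ?y = "\<lambda>\<omega>. \<Phi> (cpath_map h (pair_path n \<omega>))"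
      have xm: "?x \<in> borel_measurable (M n)"
        by (rule measurable_compose[OF Qm \<Phi>m])
      have ym: "?y \<in> borel_measurable (M n)"
        by (rule measurable_compose[OF pair_path_M borel_measurable_continuous_onI[OF cont]])
      have xi: "integrable (M n) ?x" and yi: "integrable (M n) ?y"
        using bd xm ym by (auto intro!: integrable_const_bound[of _ c])
      have i: "integrable (M n) (\<lambda>\<omega>. e / 2 + 2 * c * indicat_real ?D \<omega>)"
        using integrable_real_indicator[OF D] by (simp add: emeasure_eq_measure)
      have "\<bar>(\<integral>\<omega>. ?x \<omega> \<partial>M n) - (\<integral>\<omega>. ?y \<omega> \<partial>M n)\<bar> = \<bar>\<integral>\<omega>. ?x \<omega> - ?y \<omega> \<partial>M n\<bar>"
        using xi yi by simp
      also have "\<dots> \<le> (\<integral>\<omega>. \<bar>?x \<omega> - ?y \<omega>\<bar> \<partial>M n)"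
        by (rule integral_abs_bound)
      also have "\<dots> \<le> (\<integral>\<omega>. e / 2 + 2 * c * indicat_real ?D \<omega> \<partial>M n)"
      proof (rule integral_mono[OF _ i])
        show "integrable (M n) (\<lambda>\<omega>. \<bar>?x \<omega> - ?y \<omega>\<bar>)"
          using xi yi by auto
        fix \<omega> assume \<omega>: "\<omega> \<in> space (M n)"
        show "\<bar>?x \<omega> - ?y \<omega>\<bar> \<le> e / 2 + 2 * c * indicat_real ?D \<omega>"
        proof (cases "\<omega> \<in> G \<inter> H")
          case True
          have "\<bar>?x \<omega> - ?y \<omega>\<bar> < e / 2"
          proof (rule Td'[rule_format])
            show "pair_path n \<omega> \<in> ?K"
              using True by (simp add: H_def)
            show "dist (eval_path (path_of (\<lambda>t. Q n t \<omega>)) t) (h (eval_path (pair_path n \<omega>) t)) \<le> d" if "t \<in> {0..T}" for t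
              using G(3)[of \<omega> t] True that \<omega> by (simp add: eval_path_of[OF Q_cont] eval_pair_path h_def)
          qed
          then show ?thesis
            using True by simp
        next
          case False
          have "\<bar>?x \<omega> - ?y \<omega>\<bar> \<le> 2 * c"
            using bd[of "path_of (\<lambda>t. Q n t \<omega>)"] bd[of "cpath_map h (pair_path n \<omega>)"] by linarith
          then show ?thesis
            using False \<omega> e by simp
        qed
      qed
      also have "\<dots> = e / 2 + 2 * c * prob ?D"
        using integrable_real_indicator[OF D] D prob_space by (simp add: emeasure_eq_measure)
      also have "\<dots> \<le> e / 2 + 2 * c * (2 * a)"
        using PD c0 by (intro add_left_mono mult_left_mono) auto
      also have "\<dots> \<le> e"
        using ca by simp
      finally show ?case .
    qed
  qed
  then have near: "\<forall>\<^sub>F n in sequentially. \<bar>(\<integral>\<omega>. \<Phi> (path_of (\<lambda>t. Q (r n) t \<omega>)) \<partial>M (r n)) -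
      (\<integral>\<omega>. \<Phi> (cpath_map h (pair_path (r n) \<omega>)) \<partial>M (r n))\<bar> \<le> e" if "e > 0" for e
    using eventually_subseq[OF r] that by blast
  have "(\<lambda>n. (\<integral>\<omega>. \<Phi> (path_of (\<lambda>t. Q (r n) t \<omega>)) \<partial>M (r n)) -
      (\<integral>\<omega>. \<Phi> (cpath_map h (pair_path (r n) \<omega>)) \<partial>M (r n))) \<longlonglongrightarrow> 0"
  proof (rule tendstoI)
    fix e :: real assume "e > 0"
    then have "e / 2 > 0"
      by simp
    from near[OF this]
    show "\<forall>\<^sub>F n in sequentially. dist ((\<integral>\<omega>. \<Phi> (path_of (\<lambda>t. Q (r n) t \<omega>)) \<partial>M (r n)) -
        (\<integral>\<omega>. \<Phi> (cpath_map h (pair_path (r n) \<omega>)) \<partial>M (r n))) 0 < e"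
    proof eventually_elim
      case (elim n)
      then show ?case
        unfolding dist_real_def diff_0_right using \<open>e > 0\<close> by linarith
    qed
  qed
  from tendsto_add[OF this lim] show ?thesis
    unfolding source target by simp
qed

end

section \<open>The Langevin equation\<close>

text \<open>\<open>A\<close> is the lifted position corrected by \<open>\<epsilon> (P\<^sub>t - P\<^sub>0)\<close> and shifted to start in the unit cube; \<open>U\<close> is
  a version of \<open>W\<close> all of whose paths are continuous. The last clause holds for all moduli at once, so
  that the exceptional null set does not depend on them.\<close>

definition langevin_path ::
  "real \<Rightarrow> ('n::finite torus \<Rightarrow> real) \<Rightarrow> real \<Rightarrow> real \<Rightarrow> 'w measure \<Rightarrow> (real \<Rightarrow> 'w \<Rightarrow> 'n torus) \<Rightarrow>
    (real \<Rightarrow> 'w \<Rightarrow> real ^ 'n) \<Rightarrow> (real \<Rightarrow> 'w measure) \<Rightarrow> (real \<Rightarrow> 'w \<Rightarrow> real ^ 'n) \<Rightarrow>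
    (real \<Rightarrow> 'w \<Rightarrow> real ^ 'n) \<Rightarrow> (real \<Rightarrow> 'w \<Rightarrow> real ^ 'n) \<Rightarrow> bool" where
  "langevin_path \<beta> V B \<epsilon> M Q P F W A U \<longleftrightarrow>
    (filtered_bm M F W) \<and>
    (\<forall>t. t \<ge> 0 \<longrightarrow> A t \<in> borel_measurable (F t)) \<and>
    (\<forall>\<omega>. \<omega> \<in> space M \<longrightarrow> continuous_on {0..} (\<lambda>t. A t \<omega>)) \<and>
    (\<forall>t. t \<ge> 0 \<longrightarrow> U t \<in> borel_measurable M) \<and>
    (\<forall>\<omega>. \<omega> \<in> space M \<longrightarrow> continuous_on {0..} (\<lambda>t. U t \<omega>)) \<and>
    (AE \<omega> in M. \<forall>t\<ge>0. U t \<omega> = W t \<omega>) \<and>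
    (\<forall>\<omega>. \<omega> \<in> space M \<longrightarrow> U 0 \<omega> = 0) \<and>
    (\<forall>\<omega>. \<omega> \<in> space M \<longrightarrow> A 0 \<omega> \<in> cbox 0 1) \<and>
    (\<forall>\<omega>. \<omega> \<in> space M \<longrightarrow> to_torus (A 0 \<omega>) = Q 0 \<omega>) \<and>
    (\<forall>\<omega>. \<omega> \<in> space M \<longrightarrow> continuous_on {0..} (\<lambda>t. Q t \<omega>)) \<and>
    (\<forall>t. t \<ge> 0 \<longrightarrow> Q t \<in> borel_measurable M) \<and>
    (P 0 \<in> borel_measurable M) \<and>
    (AE \<omega> in M. \<forall>t\<ge>0. A t \<omega> = A 0 \<omega> + integral {0..t} (\<lambda>s. - torus_grad V (Q s \<omega>)) + sqrt (2 * inverse \<beta>) *\<^sub>R U t \<omega>) \<and>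
    (AE \<omega> in M. \<forall>T \<tau> \<eta>. \<tau> > 0 \<longrightarrow> exp (- (1 / \<epsilon>\<^sup>2) * \<tau>) \<le> 1 / 2 \<longrightarrow>
      (\<forall>s\<in>{0..T}. \<forall>t\<in>{0..T}. \<bar>s - t\<bar> \<le> \<tau> \<longrightarrow> norm (U s \<omega> - U t \<omega>) \<le> \<eta>) \<longrightarrow>
      (\<forall>t\<in>{0..T}. dist (Q t \<omega>) (to_torus (A t \<omega>)) \<le> 2 * (\<epsilon> * norm (P 0 \<omega>)) + 4 * (sqrt (2 * inverse \<beta>) * \<eta>) + 2 * (B * \<epsilon>\<^sup>2)))"

lemma langevin_path_exists:
  fixes V :: "'n::finite torus \<Rightarrow> real" and M :: "'w measure"
  assumes sol: "langevin_solution \<beta> V \<epsilon> M Q P" and \<beta>: "\<beta> > 0" and \<epsilon>: "\<epsilon> > 0"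
    and V: "C1_torus V" and B: "\<And>q. norm (torus_grad V q) \<le> B"
  shows "\<exists>F W A U. langevin_path \<beta> V B \<epsilon> M Q P F W A U"
proof -
  define \<sigma> where "\<sigma> = sqrt (2 * inverse \<beta>)"
  have \<sigma>: "\<sigma> > 0"
    using \<beta> by (simp add: \<sigma>_def)
  let ?b = "\<lambda>(x, p). ((1 / \<epsilon>) *\<^sub>R p, - (1 / \<epsilon>) *\<^sub>R torus_grad V (to_torus x) - (1 / \<epsilon>\<^sup>2) *\<^sub>R p)"
  obtain X where ws: "weak_solution ?b (\<lambda>w :: real ^ 'n. (0, (1 / \<epsilon> * \<sigma>) *\<^sub>R w)) M (\<lambda>t \<omega>. (X t \<omega>, P t \<omega>))"
    and QX: "\<And>t \<omega>. t \<ge> 0 \<Longrightarrow> \<omega> \<in> space M \<Longrightarrow> Q t \<omega> = to_torus (X t \<omega>)"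
    using sol unfolding langevin_solution_def \<sigma>_def by blast
  have c: "continuous_on {0..} (\<lambda>t. (X t \<omega>, P t \<omega>))" if "\<omega> \<in> space M" for \<omega>
    using ws that by (simp add: weak_solution_def)
  have Xc: "continuous_on {0..} (\<lambda>t. X t \<omega>)" and Pc: "continuous_on {0..} (\<lambda>t. P t \<omega>)" if "\<omega> \<in> space M" for \<omega>
    using continuous_on_fst[OF c[OF that]] continuous_on_snd[OF c[OF that]] by simp_all
  from ws obtain F and W :: "real \<Rightarrow> 'w \<Rightarrow> real ^ 'n" where FW: "filtered_prob_space M F" "brownian_motion M F W"
      "adapted F (\<lambda>t \<omega>. (X t \<omega>, P t \<omega>))"
      and eq: "AE \<omega> in M. \<forall>t\<ge>0. set_integrable lborel {0..t} (\<lambda>s. ?b (X s \<omega>, P s \<omega>)) \<and>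
           (X t \<omega>, P t \<omega>) = (X 0 \<omega>, P 0 \<omega>) + (LINT s:{0..t}|lborel. ?b (X s \<omega>, P s \<omega>)) +
             (0, (1 / \<epsilon> * \<sigma>) *\<^sub>R (W t \<omega> - W 0 \<omega>))"
    unfolding weak_solution_def by blast
  interpret bm: filtered_bm M F W
    using FW by (intro filtered_bmI)
  have XP: "(\<lambda>\<omega>. (X t \<omega>, P t \<omega>)) \<in> borel_measurable (F t)" if "t \<ge> 0" for t
    using FW(3) that by (simp add: adapted_def)
  have fs: "fst \<in> borel_measurable (borel :: ((real ^ 'n) \<times> (real ^ 'n)) measure)"
    "snd \<in> borel_measurable (borel :: ((real ^ 'n) \<times> (real ^ 'n)) measure)"
    by (intro borel_measurable_continuous_onI continuous_on_fst continuous_on_snd continuous_on_id)+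
  have XF: "X t \<in> borel_measurable (F t)" and PF: "P t \<in> borel_measurable (F t)" if "t \<ge> 0" for t
    using measurable_compose[OF XP[OF that] fs(1)] measurable_compose[OF XP[OF that] fs(2)] by simp_all
  have gc: "continuous_on {0..} (\<lambda>s. torus_grad V (Q s \<omega>))" and Qc: "continuous_on {0..} (\<lambda>s. Q s \<omega>)"
    if "\<omega> \<in> space M" for \<omega>
  proof -
    have "continuous_on {0..} (\<lambda>s. to_torus (X s \<omega>))"
      by (rule continuous_on_compose2[OF continuous_to_torus Xc[OF that]]) simp
    then show 1: "continuous_on {0..} (\<lambda>s. Q s \<omega>)"
      by (rule continuous_on_eq) (use QX that in simp)
    have "continuous_on UNIV (torus_grad V)"
      using V by (simp add: C1_torus_def)
    from continuous_on_compose2[OF this 1] show "continuous_on {0..} (\<lambda>s. torus_grad V (Q s \<omega>))"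
      by simp
  qed
  have "AE \<omega> in M. W 0 \<omega> = 0 \<and> continuous_on {0..} (\<lambda>t. W t \<omega>)"
    using FW(2) unfolding brownian_motion_def by auto
  from AE_E[OF this] obtain N where N: "{\<omega> \<in> space M. \<not> (W 0 \<omega> = 0 \<and> continuous_on {0..} (\<lambda>t. W t \<omega>))} \<subseteq> N"
      "emeasure M N = 0" "N \<in> sets M"
    by blast
  \<comment> \<open>Resetting the noise on the null set \<open>N\<close> keeps measurability for
    \<open>M\<close>, but \<open>N\<close> need not belong to the filtration.\<close>
  define U where "U t \<omega> = (if \<omega> \<in> N then 0 else W t \<omega>)" for t \<omega>
  have notN: "AE \<omega> in M. \<omega> \<notin> N"
    using N by (intro AE_not_in) (simp add: null_sets_def)
  have UW: "AE \<omega> in M. \<forall>t\<ge>0. U t \<omega> = W t \<omega>"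
    using notN by eventually_elim (simp add: U_def)
  have UM: "U t \<in> borel_measurable M" if "t \<ge> 0" for t
    unfolding U_def using bm.W_M[OF that] N(3) by (intro measurable_If_set) (auto simp: sets.Int_space_eq2)
  have Uc: "continuous_on {0..} (\<lambda>t. U t \<omega>)" and U0: "U 0 \<omega> = 0" if "\<omega> \<in> space M" for \<omega>
    using that N(1) by (cases "\<omega> \<in> N"; auto simp: U_def continuous_on_const)+
  define A where "A t \<omega> = X t \<omega> + \<epsilon> *\<^sub>R (P t \<omega> - P 0 \<omega>) - floor_vec (X 0 \<omega>)" for t \<omega>
  have AF: "A t \<in> borel_measurable (F t)" if "t \<ge> 0" for t
    unfolding A_def using XF[OF that] PF[OF that] bm.measurable_F_mono[OF PF[of 0] that]
      measurable_compose[OF bm.measurable_F_mono[OF XF[of 0] that] borel_measurable_floor_vec]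
    by simp
  have Ac: "continuous_on {0..} (\<lambda>t. A t \<omega>)" if "\<omega> \<in> space M" for \<omega>
    unfolding A_def by (intro continuous_intros Xc Pc that)
  have A0: "A 0 \<omega> = X 0 \<omega> - floor_vec (X 0 \<omega>)" for \<omega>
    by (simp add: A_def)
  \<comment> \<open>The momentum equation is multiplied by \<open>\<epsilon>\<close>: the noise then
    has the coefficient \<open>\<sigma>\<close>, and the damping term \<open>(1 /
    \<epsilon>\<^sup>2) *\<^sub>R (\<epsilon> *\<^sub>R P s \<omega>)\<close> equals the velocity in
    the position equation, with which it cancels when the two are added.\<close>
  have eqs: "AE \<omega> in M. \<omega> \<in> space M \<and> (\<forall>t\<ge>0. X t \<omega> = X 0 \<omega> + integral {0..t} (\<lambda>s. (1 / \<epsilon>) *\<^sub>R P s \<omega>) \<and>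
      \<epsilon> *\<^sub>R P t \<omega> = \<epsilon> *\<^sub>R P 0 \<omega> + integral {0..t} (\<lambda>s. - torus_grad V (Q s \<omega>) - (1 / \<epsilon>\<^sup>2) *\<^sub>R (\<epsilon> *\<^sub>R P s \<omega>)) + \<sigma> *\<^sub>R U t \<omega>)"
    using eq notN AE_space
  proof eventually_elim
    case (elim \<omega>)
    have W0: "W 0 \<omega> = 0"
      using elim(2,3) N(1) by auto
    show ?case
    proof (intro conjI allI impI elim(3))
      fix t :: real assume t: "t \<ge> 0"
      let ?f = "\<lambda>s. ?b (X s \<omega>, P s \<omega>)"
      have si: "set_integrable lborel {0..t} ?f"
        and e: "(X t \<omega>, P t \<omega>) = (X 0 \<omega>, P 0 \<omega>) + (LINT s:{0..t}|lborel. ?f s) + (0, (1 / \<epsilon> * \<sigma>) *\<^sub>R (W t \<omega> - W 0 \<omega>))"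
        using elim(1) t by blast+
      have i: "?f integrable_on {0..t}"
        by (rule set_borel_integral_eq_integral(1)[OF si])
      have e': "(X t \<omega>, P t \<omega>) = (X 0 \<omega>, P 0 \<omega>) + integral {0..t} ?f + (0, (1 / \<epsilon> * \<sigma>) *\<^sub>R (W t \<omega> - W 0 \<omega>))"
        using e unfolding set_borel_integral_eq_integral(2)[OF si] .
      have f1: "fst (integral {0..t} ?f) = integral {0..t} (\<lambda>s. (1 / \<epsilon>) *\<^sub>R P s \<omega>)"
        using integral_linear[OF i bounded_linear_fst] by (simp add: o_def)
      have f2: "snd (integral {0..t} ?f) = integral {0..t} (\<lambda>s. - (1 / \<epsilon>) *\<^sub>R torus_grad V (to_torus (X s \<omega>)) - (1 / \<epsilon>\<^sup>2) *\<^sub>R P s \<omega>)"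
        using integral_linear[OF i bounded_linear_snd] by (simp add: o_def)
      show "X t \<omega> = X 0 \<omega> + integral {0..t} (\<lambda>s. (1 / \<epsilon>) *\<^sub>R P s \<omega>)"
        using arg_cong[OF e', of fst] unfolding fst_add f1 by simp
      have "P t \<omega> = P 0 \<omega> + integral {0..t} (\<lambda>s. - (1 / \<epsilon>) *\<^sub>R torus_grad V (to_torus (X s \<omega>)) - (1 / \<epsilon>\<^sup>2) *\<^sub>R P s \<omega>) +
          (1 / \<epsilon> * \<sigma>) *\<^sub>R (W t \<omega> - W 0 \<omega>)"
        using arg_cong[OF e', of snd] unfolding snd_add f2 by simp
      then have "\<epsilon> *\<^sub>R P t \<omega> = \<epsilon> *\<^sub>R P 0 \<omega> +
          \<epsilon> *\<^sub>R integral {0..t} (\<lambda>s. - (1 / \<epsilon>) *\<^sub>R torus_grad V (to_torus (X s \<omega>)) - (1 / \<epsilon>\<^sup>2) *\<^sub>R P s \<omega>) +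
          \<epsilon> *\<^sub>R ((1 / \<epsilon> * \<sigma>) *\<^sub>R (W t \<omega> - W 0 \<omega>))"
        by (simp only: scaleR_add_right)
      also have "\<epsilon> *\<^sub>R ((1 / \<epsilon> * \<sigma>) *\<^sub>R (W t \<omega> - W 0 \<omega>)) = \<sigma> *\<^sub>R U t \<omega>"
        using \<epsilon> elim(2) W0 by (simp add: U_def)
      also have "\<epsilon> *\<^sub>R integral {0..t} (\<lambda>s. - (1 / \<epsilon>) *\<^sub>R torus_grad V (to_torus (X s \<omega>)) - (1 / \<epsilon>\<^sup>2) *\<^sub>R P s \<omega>) =
          integral {0..t} (\<lambda>s. \<epsilon> *\<^sub>R (- (1 / \<epsilon>) *\<^sub>R torus_grad V (to_torus (X s \<omega>)) - (1 / \<epsilon>\<^sup>2) *\<^sub>R P s \<omega>))"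
        by simp
      also have "\<dots> = integral {0..t} (\<lambda>s. - torus_grad V (Q s \<omega>) - (1 / \<epsilon>\<^sup>2) *\<^sub>R (\<epsilon> *\<^sub>R P s \<omega>))"
        using \<epsilon> QX elim(3) by (intro Henstock_Kurzweil_Integration.integral_cong)
          (simp add: scaleR_diff_right mult.commute)
      finally show "\<epsilon> *\<^sub>R P t \<omega> = \<epsilon> *\<^sub>R P 0 \<omega> +
          integral {0..t} (\<lambda>s. - torus_grad V (Q s \<omega>) - (1 / \<epsilon>\<^sup>2) *\<^sub>R (\<epsilon> *\<^sub>R P s \<omega>)) + \<sigma> *\<^sub>R U t \<omega>" .
    qed
  qed
  have A_eq: "AE \<omega> in M. \<forall>t\<ge>0. A t \<omega> = A 0 \<omega> + integral {0..t} (\<lambda>s. - torus_grad V (Q s \<omega>)) + \<sigma> *\<^sub>R U t \<omega>"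
    using eqs
  proof eventually_elim
    case (elim \<omega>)
    then have \<omega>: "\<omega> \<in> space M"
      by blast
    show ?case
    proof (intro allI impI)
      fix t :: real assume t: "t \<ge> 0"
      have cP: "continuous_on {0..t} (\<lambda>s. P s \<omega>)" and cg: "continuous_on {0..t} (\<lambda>s. torus_grad V (Q s \<omega>))"
        by (rule continuous_on_subset[OF Pc[OF \<omega>]], simp) (rule continuous_on_subset[OF gc[OF \<omega>]], simp)
      have eqf: "- torus_grad V (Q s \<omega>) - (1 / \<epsilon>\<^sup>2) *\<^sub>R (\<epsilon> *\<^sub>R P s \<omega>) = - torus_grad V (Q s \<omega>) - (1 / \<epsilon>) *\<^sub>R P s \<omega>" for s
        using \<epsilon> by (simp add: power2_eq_square)
      have "integral {0..t} (\<lambda>s. - torus_grad V (Q s \<omega>) - (1 / \<epsilon>) *\<^sub>R P s \<omega>) =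
          integral {0..t} (\<lambda>s. - torus_grad V (Q s \<omega>)) - integral {0..t} (\<lambda>s. (1 / \<epsilon>) *\<^sub>R P s \<omega>)"
        by (intro Henstock_Kurzweil_Integration.integral_diff integrable_continuous_interval continuous_intros cP cg)
      moreover have "X t \<omega> = X 0 \<omega> + integral {0..t} (\<lambda>s. (1 / \<epsilon>) *\<^sub>R P s \<omega>)"
        and "\<epsilon> *\<^sub>R P t \<omega> = \<epsilon> *\<^sub>R P 0 \<omega> + integral {0..t} (\<lambda>s. - torus_grad V (Q s \<omega>) - (1 / \<epsilon>) *\<^sub>R P s \<omega>) + \<sigma> *\<^sub>R U t \<omega>"
        using elim t unfolding eqf by blast+
      ultimately show "A t \<omega> = A 0 \<omega> + integral {0..t} (\<lambda>s. - torus_grad V (Q s \<omega>)) + \<sigma> *\<^sub>R U t \<omega>"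
        unfolding A0 unfolding A_def by (simp add: scaleR_diff_right)
    qed
  qed
  have damp: "AE \<omega> in M. \<forall>T \<tau> \<eta>. \<tau> > 0 \<longrightarrow> exp (- (1 / \<epsilon>\<^sup>2) * \<tau>) \<le> 1 / 2 \<longrightarrow>
      (\<forall>s\<in>{0..T}. \<forall>t\<in>{0..T}. \<bar>s - t\<bar> \<le> \<tau> \<longrightarrow> norm (U s \<omega> - U t \<omega>) \<le> \<eta>) \<longrightarrow>
      (\<forall>t\<in>{0..T}. dist (Q t \<omega>) (to_torus (A t \<omega>)) \<le> 2 * (\<epsilon> * norm (P 0 \<omega>)) + 4 * (\<sigma> * \<eta>) + 2 * (B * \<epsilon>\<^sup>2))"
    using eqs
  proof eventually_elim
    case (elim \<omega>)
    then have \<omega>: "\<omega> \<in> space M"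
      by blast
    show ?case
    proof (intro allI impI ballI)
      fix T \<tau> \<eta> t :: real
      assume \<tau>: "\<tau> > 0" "exp (- (1 / \<epsilon>\<^sup>2) * \<tau>) \<le> 1 / 2"
        and osc: "\<forall>s\<in>{0..T}. \<forall>t\<in>{0..T}. \<bar>s - t\<bar> \<le> \<tau> \<longrightarrow> norm (U s \<omega> - U t \<omega>) \<le> \<eta>"
        and t: "t \<in> {0..T}"
      \<comment> \<open>The damped equation for \<open>\<epsilon> *\<^sub>R P t \<omega>\<close> has
        the rate \<open>\<gamma> = 1 / \<epsilon>\<^sup>2\<close>, whence
        \<open>B / \<gamma> = B * \<epsilon>\<^sup>2\<close>.\<close>
      have "norm (\<epsilon> *\<^sub>R P t \<omega>) \<le> norm (\<epsilon> *\<^sub>R P 0 \<omega>) + 4 * (\<sigma> * \<eta>) + 2 * (B / (1 / \<epsilon>\<^sup>2))"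
      proof (rule damped_bound[where g = "\<lambda>s. torus_grad V (Q s \<omega>)" and w = "\<lambda>s. \<sigma> *\<^sub>R U s \<omega>" and \<gamma> = "1 / \<epsilon>\<^sup>2"
          and R = "\<lambda>s. \<epsilon> *\<^sub>R P s \<omega>"])
        show "continuous_on {0..} (\<lambda>s. \<epsilon> *\<^sub>R P s \<omega>)" "continuous_on {0..} (\<lambda>s. torus_grad V (Q s \<omega>))"
          "continuous_on {0..} (\<lambda>s. \<sigma> *\<^sub>R U s \<omega>)"
          by (intro continuous_intros Pc gc Uc \<omega>)+
        show "\<epsilon> *\<^sub>R P t \<omega> = \<epsilon> *\<^sub>R P 0 \<omega> +
            integral {0..t} (\<lambda>s. - torus_grad V (Q s \<omega>) - (1 / \<epsilon>\<^sup>2) *\<^sub>R (\<epsilon> *\<^sub>R P s \<omega>)) + \<sigma> *\<^sub>R U t \<omega>" if "t \<ge> 0" for t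
          using elim that by blast
        show "norm (\<sigma> *\<^sub>R U s \<omega> - \<sigma> *\<^sub>R U t \<omega>) \<le> \<sigma> * \<eta>" if "s \<in> {0..T}" "t \<in> {0..T}" "\<bar>s - t\<bar> \<le> \<tau>" for s t
        proof -
          have "norm (\<sigma> *\<^sub>R U s \<omega> - \<sigma> *\<^sub>R U t \<omega>) = \<sigma> * norm (U s \<omega> - U t \<omega>)"
            using \<sigma> by (simp add: scaleR_diff_right[symmetric])
          also have "\<dots> \<le> \<sigma> * \<eta>"
            using \<sigma> osc that by (intro mult_left_mono) auto
          finally show ?thesis .
        qed
      qed (use \<epsilon> B \<tau> t in auto)
      then have 1: "norm (\<epsilon> *\<^sub>R P t \<omega>) \<le> \<epsilon> * norm (P 0 \<omega>) + 4 * (\<sigma> * \<eta>) + 2 * (B * \<epsilon>\<^sup>2)"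
        using \<epsilon> by simp
      have "dist (Q t \<omega>) (to_torus (A t \<omega>)) = dist (to_torus (X t \<omega> - floor_vec (X 0 \<omega>))) (to_torus (A t \<omega>))"
        using t \<omega> by (simp add: QX to_torus_minus_floor)
      \<comment> \<open>The initial momentum enters twice, here through the correction term and once
        more through the damped bound; this explains the factor 2 in front of
        \<open>\<epsilon> * norm (P 0 \<omega>)\<close>.\<close>
      also have "\<dots> \<le> norm (\<epsilon> *\<^sub>R P t \<omega> - \<epsilon> *\<^sub>R P 0 \<omega>)"
        using dist_to_torus_le[of "X t \<omega> - floor_vec (X 0 \<omega>)" "A t \<omega>"]
        by (simp add: dist_norm A_def scaleR_diff_right norm_minus_commute)
      also have "\<dots> \<le> norm (\<epsilon> *\<^sub>R P t \<omega>) + \<epsilon> * norm (P 0 \<omega>)"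
        using norm_triangle_ineq4[of "\<epsilon> *\<^sub>R P t \<omega>" "\<epsilon> *\<^sub>R P 0 \<omega>"] \<epsilon> by simp
      finally show "dist (Q t \<omega>) (to_torus (A t \<omega>)) \<le> 2 * (\<epsilon> * norm (P 0 \<omega>)) + 4 * (\<sigma> * \<eta>) + 2 * (B * \<epsilon>\<^sup>2)"
        using 1 by simp
    qed
  qed
  have QM: "Q t \<in> borel_measurable M" if "t \<ge> 0" for t
    using measurable_compose[OF bm.measurable_F_M[OF XF[OF that]] borel_measurable_to_torus]
    by (simp add: QX[OF that] cong: measurable_cong)
  have "A 0 \<omega> \<in> cbox 0 1" for \<omega>
    unfolding A0 by (rule minus_floor_vec_cbox)
  moreover have "to_torus (A 0 \<omega>) = Q 0 \<omega>" if "\<omega> \<in> space M" for \<omega>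
    using QX[of 0 \<omega>] that by (simp add: A0 to_torus_minus_floor)
  moreover have "P 0 \<in> borel_measurable M"
    by (rule bm.measurable_F_M[OF PF]) simp
  ultimately have "langevin_path \<beta> V B \<epsilon> M Q P F W A U"
    unfolding langevin_path_def \<sigma>_def[symmetric]
    using bm.filtered_bm_axioms AF Ac UM Uc UW U0 Qc QM A_eq damp by (intro conjI allI impI)
  then show ?thesis
    by blast
qed

section \<open>Closeness in probability of position and corrected position\<close>

lemma langevin_path_close:
  fixes V :: "nat \<Rightarrow> 'n::finite torus \<Rightarrow> real" and M :: "nat \<Rightarrow> 'w measure"
  assumes path: "\<And>n. langevin_path \<beta> (V n) B (\<epsilon> n) (M n) (Q n) (P n) (F n) (W n) (A n) (U n)"
    and \<beta>: "\<beta> > 0" and \<epsilon>: "\<And>n. \<epsilon> n > 0" "\<epsilon> \<longlonglongrightarrow> 0"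
    and momentum: "(\<lambda>n. ennreal (\<epsilon> n) * (\<integral>\<^sup>+\<omega>. ennreal (norm (P n 0 \<omega>) ^ 3) \<partial>M n)) \<longlonglongrightarrow> 0"
    and d: "d > 0" and e: "e > 0"
  shows "\<forall>\<^sub>F n in sequentially. \<exists>G\<in>sets (M n). measure (M n) G \<ge> 1 - e \<and>
    (\<forall>\<omega>\<in>G. \<forall>t\<in>{0..T}. dist (Q n t \<omega>) (to_torus (A n t \<omega>)) \<le> d)"
proof -
  interpret bm_sequence M F W U
    by (rule bm_sequence.intro) (use path in \<open>simp_all add: langevin_path_def\<close>)
  define \<sigma> where "\<sigma> = sqrt (2 * inverse \<beta>)"
  have \<sigma>: "\<sigma> > 0"
    using \<beta> by (simp add: \<sigma>_def)
  \<comment> \<open>Three contributions of at most \<open>d / 4\<close> each: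
    \<open>4 * (\<sigma> * \<eta>)\<close> from the noise, \<open>2 * a\<close> from the initial
    momentum and \<open>2 * (B * (\<epsilon> n)\<^sup>2)\<close> from the force.\<close>
  define \<eta> where "\<eta> = d / (16 * \<sigma>)"
  have \<eta>: "\<eta> > 0" "4 * (\<sigma> * \<eta>) = d / 4"
    using d \<sigma> by (simp_all add: \<eta>_def)
  define a where "a = d / 8"
  have a: "a > 0"
    using d by (simp add: a_def)
  obtain \<tau> where \<tau>: "\<tau> > 0" "\<And>n. measure (path_law (M n) (U n)) (modulus_set T \<tau> \<eta>) \<ge> 1 - e / 2"
    using uniform_modulus[OF \<eta>(1), of "e / 2" T] e by auto
  have sq: "(\<lambda>n. (\<epsilon> n)\<^sup>2) \<longlonglongrightarrow> 0"
    using tendsto_power[OF \<epsilon>(2), of 2] by simp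
  have "(\<lambda>n. 2 * (B * (\<epsilon> n)\<^sup>2)) \<longlonglongrightarrow> 2 * (B * 0)"
    by (intro tendsto_intros sq)
  then have "\<forall>\<^sub>F n in sequentially. 2 * (B * (\<epsilon> n)\<^sup>2) < d / 4"
    by (rule order_tendstoD) (use d in simp)
  moreover have "\<forall>\<^sub>F n in sequentially. (\<epsilon> n)\<^sup>2 < \<tau>" "\<forall>\<^sub>F n in sequentially. \<epsilon> n < 1"
    using \<tau>(1) by (auto intro: order_tendstoD[OF sq] order_tendstoD[OF \<epsilon>(2)])
  moreover have "\<forall>\<^sub>F n in sequentially. ennreal (\<epsilon> n) * (\<integral>\<^sup>+\<omega>. ennreal (norm (P n 0 \<omega>) ^ 3) \<partial>M n) < ennreal (e / 2 * a ^ 3)"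
    using e a by (intro order_tendstoD[OF momentum]) simp
  ultimately show ?thesis
  proof eventually_elim
    case (elim n)
    interpret prob_space "M n" by (rule prob_M)
    have P0 [measurable]: "P n 0 \<in> borel_measurable (M n)"
      using path[of n] by (simp add: langevin_path_def)
    have Um: "(\<lambda>\<omega>. path_of (\<lambda>t. U n t \<omega>)) \<in> borel_measurable (M n)"
      by (rule borel_measurable_path_of[OF U_cont U_M])
    let ?damp = "\<lambda>\<omega>. \<forall>T \<tau> \<eta>. \<tau> > 0 \<longrightarrow> exp (- (1 / (\<epsilon> n)\<^sup>2) * \<tau>) \<le> 1 / 2 \<longrightarrow>
      (\<forall>s\<in>{0..T}. \<forall>t\<in>{0..T}. \<bar>s - t\<bar> \<le> \<tau> \<longrightarrow> norm (U n s \<omega> - U n t \<omega>) \<le> \<eta>) \<longrightarrow>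
      (\<forall>t\<in>{0..T}. dist (Q n t \<omega>) (to_torus (A n t \<omega>)) \<le>
        2 * (\<epsilon> n * norm (P n 0 \<omega>)) + 4 * (\<sigma> * \<eta>) + 2 * (B * (\<epsilon> n)\<^sup>2))"
    have "AE \<omega> in M n. ?damp \<omega>"
      using path[of n] unfolding langevin_path_def \<sigma>_def by blast
    from AE_E[OF this] obtain N where N: "{\<omega> \<in> space (M n). \<not> ?damp \<omega>} \<subseteq> N" "emeasure (M n) N = 0" "N \<in> sets (M n)"
      by blast
    define G1 where "G1 = {\<omega> \<in> space (M n). path_of (\<lambda>t. U n t \<omega>) \<in> modulus_set T \<tau> \<eta>}"
    define G2 where "G2 = {\<omega> \<in> space (M n). a \<le> \<epsilon> n * norm (P n 0 \<omega>)}"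
    have G1: "G1 \<in> events"
      unfolding G1_def using measurable_sets[OF Um modulus_set_borel[of T \<tau> \<eta>]]
      by (simp add: vimage_def Int_def conj_commute)
    have G2: "G2 \<in> events"
      unfolding G2_def by measurable
    have p1: "prob G1 \<ge> 1 - e / 2"
      using \<tau>(2)[of n] measure_U_law[OF modulus_set_borel, of n T \<tau> \<eta>] by (simp add: G1_def)
    \<comment> \<open>Markov's inequality for the third power: the bound is
      \<open>(\<epsilon> n)\<^sup>2 / a ^ 3\<close> times the quantity that tends to 0 by
      assumption, where \<open>(\<epsilon> n)\<^sup>2 \<le> 1\<close>.\<close>
    have p2: "prob G2 \<le> e / 2"
    proof -
      let ?c = "(\<epsilon> n) ^ 3 / a ^ 3"
      have "G2 = {\<omega> \<in> space (M n). 1 \<le> ennreal ?c * ennreal (norm (P n 0 \<omega>) ^ 3)}"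
      proof -
        have "a \<le> \<epsilon> n * norm (P n 0 \<omega>) \<longleftrightarrow> 1 \<le> ennreal ?c * ennreal (norm (P n 0 \<omega>) ^ 3)" for \<omega>
        proof -
          have "a \<le> \<epsilon> n * norm (P n 0 \<omega>) \<longleftrightarrow> a ^ 3 \<le> (\<epsilon> n * norm (P n 0 \<omega>)) ^ 3"
            using a \<epsilon>(1)[of n] by (intro power_mono_iff[symmetric]) auto
          also have "\<dots> \<longleftrightarrow> 1 \<le> ?c * norm (P n 0 \<omega>) ^ 3"
            using a by (simp add: power_mult_distrib le_divide_eq)
          also have "\<dots> \<longleftrightarrow> 1 \<le> ennreal (?c * norm (P n 0 \<omega>) ^ 3)"
            by simp
          also have "ennreal (?c * norm (P n 0 \<omega>) ^ 3) = ennreal ?c * ennreal (norm (P n 0 \<omega>) ^ 3)"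
            using a \<epsilon>(1)[of n] by (intro ennreal_mult) auto
          finally show ?thesis .
        qed
        then show ?thesis
          by (simp add: G2_def)
      qed
      also have "emeasure (M n) \<dots> \<le> ennreal ?c * (\<integral>\<^sup>+\<omega>. ennreal (norm (P n 0 \<omega>) ^ 3) * indicator (space (M n)) \<omega> \<partial>M n)"
        by (rule nn_integral_Markov_inequality) auto
      also have "\<dots> = ennreal ((\<epsilon> n)\<^sup>2 / a ^ 3) * (ennreal (\<epsilon> n) * (\<integral>\<^sup>+\<omega>. ennreal (norm (P n 0 \<omega>) ^ 3) \<partial>M n))"
      proof -
        have "ennreal ?c = ennreal ((\<epsilon> n)\<^sup>2 / a ^ 3) * ennreal (\<epsilon> n)"
          using a \<epsilon>(1)[of n] by (simp add: ennreal_mult[symmetric] power3_eq_cube power2_eq_square)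
        moreover have "(\<integral>\<^sup>+\<omega>. ennreal (norm (P n 0 \<omega>) ^ 3) * indicator (space (M n)) \<omega> \<partial>M n) = (\<integral>\<^sup>+\<omega>. ennreal (norm (P n 0 \<omega>) ^ 3) \<partial>M n)"
          by (intro nn_integral_cong) simp
        ultimately show ?thesis
          by (simp add: mult.assoc)
      qed
      also have "\<dots> \<le> ennreal (1 / a ^ 3) * ennreal (e / 2 * a ^ 3)"
      proof (rule mult_mono)
        have "(\<epsilon> n)\<^sup>2 \<le> 1"
          using elim(3) \<epsilon>(1)[of n] by (simp add: power_le_one)
        then show "ennreal ((\<epsilon> n)\<^sup>2 / a ^ 3) \<le> ennreal (1 / a ^ 3)"
          using a by (intro ennreal_leI divide_right_mono) auto
      qed (use elim(4) in auto)
      also have "\<dots> = ennreal (e / 2)"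
        using a e by (simp add: ennreal_mult[symmetric])
      finally show ?thesis
        using e by (simp add: emeasure_eq_measure)
    qed
    define G where "G = (G1 - G2) - N"
    have "G \<in> events"
      using G1 G2 N(3) by (auto simp: G_def)
    moreover have "prob G \<ge> 1 - e"
    proof -
      have "prob G = prob (G1 - G2)"
        unfolding G_def using G1 G2 N by (intro measure_Diff_null_set) (auto simp: null_sets_def)
      moreover have "prob G1 \<le> prob (G1 - G2) + prob G2"
      proof -
        have "prob G1 \<le> prob ((G1 - G2) \<union> G2)"
          using G1 G2 by (intro finite_measure_mono) auto
        also have "\<dots> \<le> prob (G1 - G2) + prob G2"
          using G1 G2 by (intro measure_Un_le) auto
        finally show ?thesis .
      qed
      ultimately show ?thesis
        using p1 p2 by linarith
    qed
    moreover have "dist (Q n t \<omega>) (to_torus (A n t \<omega>)) \<le> d" if \<omega>: "\<omega> \<in> G" and t: "t \<in> {0..T}" for \<omega> t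
    proof -
      have sp: "\<omega> \<in> space (M n)" and mod: "path_of (\<lambda>t. U n t \<omega>) \<in> modulus_set T \<tau> \<eta>"
        and small: "\<epsilon> n * norm (P n 0 \<omega>) \<le> a"
        using \<omega> by (auto simp: G_def G1_def G2_def)
      have damp: "?damp \<omega>"
        using \<omega> sp N(1) unfolding G_def by blast
      have osc: "\<forall>s\<in>{0..T}. \<forall>t\<in>{0..T}. \<bar>s - t\<bar> \<le> \<tau> \<longrightarrow> norm (U n s \<omega> - U n t \<omega>) \<le> \<eta>"
        using mod unfolding U_modulus_iff[OF sp] dist_norm .
      \<comment> \<open>From \<open>(\<epsilon> n)\<^sup>2 < \<tau>\<close>: the inequality
        \<open>exp x \<ge> 1 + x\<close> at
        \<open>x = \<tau> / (\<epsilon> n)\<^sup>2 \<ge> 1\<close> gives the factor 2.\<close>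
      have "exp (- (1 / (\<epsilon> n)\<^sup>2) * \<tau>) \<le> 1 / 2"
      proof -
        have "1 \<le> \<tau> / (\<epsilon> n)\<^sup>2"
          using elim(2) \<epsilon>(1)[of n] by (simp add: le_divide_eq)
        then have "2 \<le> exp (\<tau> / (\<epsilon> n)\<^sup>2)"
          using exp_ge_add_one_self[of "\<tau> / (\<epsilon> n)\<^sup>2"] by linarith
        then show ?thesis
          by (simp add: exp_minus divide_simps)
      qed
      from damp[rule_format, OF \<tau>(1) this osc[rule_format] t]
      have "dist (Q n t \<omega>) (to_torus (A n t \<omega>)) \<le> 2 * (\<epsilon> n * norm (P n 0 \<omega>)) + 4 * (\<sigma> * \<eta>) + 2 * (B * (\<epsilon> n)\<^sup>2)" .
      then show ?thesis
        using small \<eta>(2) elim(1) d unfolding a_def by linarith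
    qed
    ultimately show ?case
      by blast
  qed
qed

text \<open>The limit is the projected first coordinate on the space of pair paths, which is why the
  solution is asserted on that concrete type. The common bound \<open>B\<close> on the gradients
  makes the Lipschitz condition of the compact sets uniform along the sequence.\<close>

theorem langevin_subsequence_limit:
  fixes V :: "'n::finite torus \<Rightarrow> real" and Vn :: "nat \<Rightarrow> 'n torus \<Rightarrow> real" and M :: "nat \<Rightarrow> 'w measure"
    and \<mu>\<^sub>0 :: "'n torus measure"
  assumes \<beta>: "\<beta> > 0" and \<epsilon>: "\<And>n. \<epsilon> n > 0" "\<epsilon> \<longlonglongrightarrow> 0"
    and sol: "\<And>n. langevin_solution \<beta> (Vn n) (\<epsilon> n) (M n) (Q n) (P n)"
    and C1: "\<And>n. C1_torus (Vn n)" "C1_torus V"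
    and B: "B > 0" "\<And>n q. norm (torus_grad (Vn n) q) \<le> B"
    and conv: "\<And>e. e > 0 \<Longrightarrow> \<forall>\<^sub>F n in sequentially. \<forall>q. norm (torus_grad (Vn n) q - torus_grad V q) \<le> e"
    and momentum: "(\<lambda>n. ennreal (\<epsilon> n) * (\<integral>\<^sup>+\<omega>. ennreal (norm (P n 0 \<omega>) ^ 3) \<partial>M n)) \<longlonglongrightarrow> 0"
    and \<mu>\<^sub>0: "prob_space \<mu>\<^sub>0" "sets \<mu>\<^sub>0 = sets borel"
    and init: "weakly_converges (\<lambda>n. distr (M n) borel (Q n 0)) \<mu>\<^sub>0 sequentially"
  shows "\<exists>r (\<nu> :: ((real ^ 'n) \<times> (real ^ 'n)) cpath measure) R. strict_mono r \<and> overdamped_solution \<beta> V \<nu> R \<and>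
    distr \<nu> borel (R 0) = \<mu>\<^sub>0 \<and> weakly_converges (\<lambda>n. path_law (M (r n)) (Q (r n))) (path_law \<nu> R) sequentially"
proof -
  define \<sigma> where "\<sigma> = sqrt (2 * inverse \<beta>)"
  have \<sigma>: "\<sigma> > 0"
    using \<beta> by (simp add: \<sigma>_def)
  have "\<forall>n. \<exists>F W A U. langevin_path \<beta> (Vn n) B (\<epsilon> n) (M n) (Q n) (P n) F W A U"
    using langevin_path_exists[OF sol \<beta> \<epsilon>(1) C1(1) B(2)] by blast
  then obtain F W A U where path: "\<And>n. langevin_path \<beta> (Vn n) B (\<epsilon> n) (M n) (Q n) (P n) (F n) (W n) (A n) (U n)"
    by metis
  note pf = path[unfolded langevin_path_def, folded \<sigma>_def]
  interpret bm_sequence M F W U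
    by (rule bm_sequence.intro) (use path in \<open>simp_all add: langevin_path_def\<close>)
  interpret overdamped_approximation M F W U A Q "\<lambda>n. torus_grad (Vn n)" "torus_grad V" \<sigma> B
  proof unfold_locales
    fix d e T :: real assume "d > 0" "e > 0"
    then show "\<forall>\<^sub>F n in sequentially. \<exists>G\<in>sets (M n). measure (M n) G \<ge> 1 - e \<and>
        (\<forall>\<omega>\<in>G. \<forall>t\<in>{0..T}. dist (Q n t \<omega>) (to_torus (A n t \<omega>)) \<le> d)"
      by (rule langevin_path_close[OF path \<beta> \<epsilon> momentum])
  next
    show "continuous_on UNIV (torus_grad (Vn n))" for n
      using C1(1)[of n] by (simp add: C1_torus_def)
    show "AE \<omega> in M n. \<forall>t\<ge>0. A n t \<omega> = A n 0 \<omega> + integral {0..t} (\<lambda>s. - torus_grad (Vn n) (Q n s \<omega>)) + \<sigma> *\<^sub>R U n t \<omega>" for n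
      using pf[of n] by blast
  qed (use pf B \<sigma> conv uniformly_continuous_grad[OF C1(2)] in auto)
  obtain r \<nu> where r: "strict_mono r" "prob_space \<nu>" "sets \<nu> = sets borel" "weakly_converges (\<lambda>n. law (r n)) \<nu> sequentially"
    using limit_exists by blast
  interpret overdamped_limit M F W U A Q "\<lambda>n. torus_grad (Vn n)" "torus_grad V" \<sigma> B r \<nu>
    by (intro overdamped_limit.intro overdamped_limit_axioms.intro overdamped_approximation_axioms r)
  define R where "R t p = to_torus (fst (eval_path p t))" for t and p :: "((real ^ 'n) \<times> (real ^ 'n)) cpath"
  have "overdamped_solution \<beta> V \<nu> R"
    unfolding overdamped_solution_def R_def using limit_weak_solution by (auto simp: \<sigma>_def)
  moreover have "distr \<nu> borel (R 0) = \<mu>\<^sub>0"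
  proof (rule finite_measure_eqI_uniformly_continuous)
    have R0: "R 0 \<in> borel_measurable \<nu>"
      unfolding R_def[abs_def] measurable_cong_sets[OF sets_\<nu> refl]
      by (intro borel_measurable_continuous_onI continuous_on_compose2[OF continuous_to_torus]
          continuous_on_fst continuous_on_eval) auto
    then have "prob_space (distr \<nu> borel (R 0))"
      by (rule prob_space.prob_space_distr[OF prob_\<nu>])
    then show "finite_measure (distr \<nu> borel (R 0))"
      by (rule prob_space.finite_measure)
    show "finite_measure \<mu>\<^sub>0"
      by (rule prob_space.finite_measure[OF \<mu>\<^sub>0(1)])
    fix f :: "'n torus \<Rightarrow> real" assume f: "uniformly_continuous_on UNIV f" "\<And>x. 0 \<le> f x \<and> f x \<le> 1"
    have fc: "continuous_on UNIV f"
      by (rule uniformly_continuous_imp_continuous[OF f(1)])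
    have fm: "f \<in> borel_measurable borel"
      by (rule borel_measurable_continuous_onI[OF fc])
    have bd: "\<bar>f q\<bar> \<le> 1" for q
      using f(2)[of q] by simp
    have "bounded (range f)"
      unfolding bounded_iff using bd by auto
    then have "(\<lambda>n. \<integral>q. f q \<partial>distr (M n) borel (Q n 0)) \<longlonglongrightarrow> (\<integral>q. f q \<partial>\<mu>\<^sub>0)"
      using init fc unfolding weakly_converges_def by blast
    moreover have "(\<integral>q. f q \<partial>distr (M n) borel (Q n 0)) = (\<integral>\<omega>. f (to_torus (A n 0 \<omega>)) \<partial>M n)" for n
    proof -
      have "(\<integral>q. f q \<partial>distr (M n) borel (Q n 0)) = (\<integral>\<omega>. f (Q n 0 \<omega>) \<partial>M n)"
        by (rule integral_distr[OF Q_M fm]) simp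
      also have "\<dots> = (\<integral>\<omega>. f (to_torus (A n 0 \<omega>)) \<partial>M n)"
        using pf[of n] by (intro Bochner_Integration.integral_cong) simp_all
      finally show ?thesis .
    qed
    ultimately have "(\<lambda>n. \<integral>\<omega>. f (to_torus (A n 0 \<omega>)) \<partial>M n) \<longlonglongrightarrow> (\<integral>q. f q \<partial>\<mu>\<^sub>0)"
      by simp
    from LIMSEQ_subseq_LIMSEQ[OF this r(1)]
    have "(\<lambda>n. \<integral>\<omega>. f (to_torus (A (r n) 0 \<omega>)) \<partial>M (r n)) \<longlonglongrightarrow> (\<integral>q. f q \<partial>\<mu>\<^sub>0)"
      by (simp add: o_def)
    then have "(\<integral>q. f q \<partial>\<mu>\<^sub>0) = (\<integral>p. f (R 0 p) \<partial>\<nu>)"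
      unfolding R_def using initial_limit[OF fc bd] by (rule LIMSEQ_unique)
    also have "\<dots> = (\<integral>q. f q \<partial>distr \<nu> borel (R 0))"
      by (rule integral_distr[OF R0 fm, symmetric])
    finally show "(\<integral>q. f q \<partial>distr \<nu> borel (R 0)) = (\<integral>q. f q \<partial>\<mu>\<^sub>0)"
      by simp
  qed (simp_all add: \<mu>\<^sub>0)
  moreover have "weakly_converges (\<lambda>n. path_law (M (r n)) (Q (r n))) (path_law \<nu> R) sequentially"
    unfolding weakly_converges_def
  proof (intro allI impI, elim conjE)
    fix \<Phi> :: "'n torus cpath \<Rightarrow> real" assume \<Phi>: "continuous_on UNIV \<Phi>" "bounded (range \<Phi>)"
    then obtain c where "\<And>q. \<bar>\<Phi> q\<bar> \<le> c"
      unfolding bounded_iff by auto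
    from position_limit[OF \<Phi>(1) this]
    show "(\<lambda>n. \<integral>q. \<Phi> q \<partial>path_law (M (r n)) (Q (r n))) \<longlonglongrightarrow> (\<integral>q. \<Phi> q \<partial>path_law \<nu> R)"
      unfolding R_def[abs_def] .
  qed
  ultimately show ?thesis
    using r(1) by blast
qed

theorem theorem1p1:
  fixes \<beta> :: real
    and V :: "'n::finite torus \<Rightarrow> real"
    and V\<^sub>\<epsilon> :: "real \<Rightarrow> 'n torus \<Rightarrow> real"
    and M :: "real \<Rightarrow> 'w measure"
    and Q :: "real \<Rightarrow> real \<Rightarrow> 'w \<Rightarrow> 'n torus"
    and P :: "real \<Rightarrow> real \<Rightarrow> 'w \<Rightarrow> real ^ 'n"
    and M\<^sub>0 :: "'u measure"
    and Q\<^sub>0 :: "'u \<Rightarrow> 'n torus"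
  assumes "\<beta> > 0"
    and "\<And>\<epsilon>. \<epsilon> > 0 \<Longrightarrow> C1_torus (V\<^sub>\<epsilon> \<epsilon>)"
    and "\<And>\<epsilon>. \<epsilon> > 0 \<Longrightarrow> langevin_solution \<beta> (V\<^sub>\<epsilon> \<epsilon>) \<epsilon> (M \<epsilon>) (Q \<epsilon>) (P \<epsilon>)"
    and "C1_torus V"
    and "((\<lambda>\<epsilon>. SUP q. norm (torus_grad (V\<^sub>\<epsilon> \<epsilon>) q - torus_grad V q)) \<longlongrightarrow> 0) (at_right 0)"
    and "((\<lambda>\<epsilon>. ennreal \<epsilon> * (\<integral>\<^sup>+\<omega>. ennreal (norm (P \<epsilon> 0 \<omega>) ^ 3) \<partial>M \<epsilon>)) \<longlongrightarrow> 0) (at_right 0)"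
    and "prob_space M\<^sub>0" and "Q\<^sub>0 \<in> borel_measurable M\<^sub>0"
    and "weakly_converges (\<lambda>\<epsilon>. distr (M \<epsilon>) borel (Q \<epsilon> 0)) (distr M\<^sub>0 borel Q\<^sub>0) (at_right 0)"
  shows "\<exists>\<mu> :: 'n torus cpath measure.
      (\<exists>(N :: ((real ^ 'n) \<times> (real ^ 'n)) cpath measure) R.
         overdamped_solution \<beta> V N R \<and>
         distr N borel (R 0) = distr M\<^sub>0 borel Q\<^sub>0 \<and>
         path_law N R = \<mu>) \<and>
      (\<forall>(N :: 'v measure) R.
         overdamped_solution \<beta> V N R \<and>
         distr N borel (R 0) = distr M\<^sub>0 borel Q\<^sub>0 \<longrightarrow>
         path_law N R = \<mu>) \<and>
      weakly_converges (\<lambda>\<epsilon>. path_law (M \<epsilon>) (Q \<epsilon>)) \<mu> (at_right 0)"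
proof -
  note \<beta> = assms(1) and C1\<epsilon> = assms(2) and sol = assms(3) and C1 = assms(4) and sup = assms(5)
    and momentum = assms(6) and init = assms(9)
  let ?\<mu>\<^sub>0 = "distr M\<^sub>0 borel Q\<^sub>0"
  have \<mu>\<^sub>0: "prob_space ?\<mu>\<^sub>0" "sets ?\<mu>\<^sub>0 = sets borel"
    using assms(7,8) by (auto intro: prob_space.prob_space_distr)
  obtain B where B: "B > 0" "\<And>q. norm (torus_grad V q) \<le> B"
    using periodic_grad[OF C1] by blast
  have grad_conv: "\<forall>\<^sub>F \<epsilon> in at_right 0. \<forall>q. norm (torus_grad (V\<^sub>\<epsilon> \<epsilon>) q - torus_grad V q) \<le> e" if "e > 0" for e
  proof -
    have "\<forall>\<^sub>F \<epsilon> in at_right 0. (SUP q. norm (torus_grad (V\<^sub>\<epsilon> \<epsilon>) q - torus_grad V q)) < e"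
      by (rule order_tendstoD(2)[OF sup that])
    moreover have "\<forall>\<^sub>F \<epsilon> in at_right (0 :: real). \<epsilon> > 0"
      by (rule eventually_at_right_less)
    ultimately show ?thesis
    proof eventually_elim
      case (elim \<epsilon>)
      \<comment> \<open>A real supremum dominates the values only if they are bounded above, so the
        bound on gradients over the compact torus comes first.\<close>
      obtain B' where B': "\<And>q. norm (torus_grad (V\<^sub>\<epsilon> \<epsilon>) q) \<le> B'"
        using periodic_grad[OF C1\<epsilon>[OF elim(2)]] by blast
      have "bdd_above (range (\<lambda>q. norm (torus_grad (V\<^sub>\<epsilon> \<epsilon>) q - torus_grad V q)))"
        by (intro bdd_aboveI[of _ "B' + B"]) (auto intro!: order_trans[OF norm_triangle_ineq4] add_mono B B')
      then have "norm (torus_grad (V\<^sub>\<epsilon> \<epsilon>) q - torus_grad V q) \<le> (SUP q. norm (torus_grad (V\<^sub>\<epsilon> \<epsilon>) q - torus_grad V q))" for q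
        by (intro cSUP_upper) auto
      with elim(1) show ?case
        by (meson le_less_trans less_imp_le)
    qed
  qed
  \<comment> \<open>Below this threshold all gradients share the bound \<open>B + 1\<close>; only
    such parameters enter the sequences.\<close>
  obtain \<epsilon>\<^sub>0 where \<epsilon>\<^sub>0: "\<epsilon>\<^sub>0 > 0" "\<And>\<epsilon> q. 0 < \<epsilon> \<Longrightarrow> \<epsilon> < \<epsilon>\<^sub>0 \<Longrightarrow> norm (torus_grad (V\<^sub>\<epsilon> \<epsilon>) q - torus_grad V q) \<le> 1"
    using grad_conv[of 1] unfolding eventually_at_right_field by auto
  have bound: "norm (torus_grad (V\<^sub>\<epsilon> \<epsilon>) q) \<le> B + 1" if "0 < \<epsilon>" "\<epsilon> < \<epsilon>\<^sub>0" for \<epsilon> q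
    using \<epsilon>\<^sub>0(2)[OF that, of q] B(2)[of q]
      norm_triangle_ineq[of "torus_grad (V\<^sub>\<epsilon> \<epsilon>) q - torus_grad V q" "torus_grad V q"] by simp
  have subseq: "\<exists>r (\<nu> :: ((real ^ 'n) \<times> (real ^ 'n)) cpath measure) R. strict_mono r \<and> overdamped_solution \<beta> V \<nu> R \<and>
      distr \<nu> borel (R 0) = ?\<mu>\<^sub>0 \<and>
      weakly_converges (\<lambda>n. path_law (M (\<epsilon> (r n))) (Q (\<epsilon> (r n)))) (path_law \<nu> R) sequentially"
    if \<epsilon>: "\<And>n. 0 < \<epsilon> n" "\<And>n. \<epsilon> n < \<epsilon>\<^sub>0" "\<epsilon> \<longlonglongrightarrow> 0" for \<epsilon> :: "nat \<Rightarrow> real"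
  proof -
    have lim: "filterlim \<epsilon> (at_right 0) sequentially"
      using \<epsilon> by (intro tendsto_imp_filterlim_at_right) auto
    show ?thesis
    proof (rule langevin_subsequence_limit[OF \<beta> \<epsilon>(1,3) sol[OF \<epsilon>(1)] C1\<epsilon>[OF \<epsilon>(1)] C1 _ bound[OF \<epsilon>(1,2)] _ _ \<mu>\<^sub>0])
      show "\<forall>\<^sub>F n in sequentially. \<forall>q. norm (torus_grad (V\<^sub>\<epsilon> (\<epsilon> n)) q - torus_grad V q) \<le> e" if "e > 0" for e
        by (rule eventually_compose_filterlim[OF grad_conv[OF that] lim])
      show "(\<lambda>n. ennreal (\<epsilon> n) * (\<integral>\<^sup>+\<omega>. ennreal (norm (P (\<epsilon> n) 0 \<omega>) ^ 3) \<partial>M (\<epsilon> n))) \<longlonglongrightarrow> 0"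
        by (rule filterlim_compose[OF momentum lim])
      show "weakly_converges (\<lambda>n. distr (M (\<epsilon> n)) borel (Q (\<epsilon> n) 0)) ?\<mu>\<^sub>0 sequentially"
        unfolding weakly_converges_def
      proof (intro allI impI)
        fix f :: "'n torus \<Rightarrow> real" assume "continuous_on UNIV f \<and> bounded (range f)"
        with init have "((\<lambda>\<epsilon>. \<integral>x. f x \<partial>distr (M \<epsilon>) borel (Q \<epsilon> 0)) \<longlongrightarrow> (\<integral>x. f x \<partial>?\<mu>\<^sub>0)) (at_right 0)"
          unfolding weakly_converges_def by blast
        from filterlim_compose[OF this lim]
        show "(\<lambda>n. \<integral>x. f x \<partial>distr (M (\<epsilon> n)) borel (Q (\<epsilon> n) 0)) \<longlonglongrightarrow> (\<integral>x. f x \<partial>?\<mu>\<^sub>0)" .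
      qed
    qed (use B(1) in simp)
  qed
  \<comment> \<open>\<open>Suc (Suc n)\<close> keeps even the first term strictly below
    \<open>\<epsilon>\<^sub>0\<close>. The sequence serves twice: to obtain some solution at all,
    and to bound the parameters of a counterexample to convergence.\<close>
  have "(\<lambda>n. \<epsilon>\<^sub>0 * (1 / real (Suc (Suc n)))) \<longlonglongrightarrow> \<epsilon>\<^sub>0 * 0"
    by (intro tendsto_mult tendsto_const LIMSEQ_Suc[OF LIMSEQ_Suc[OF lim_1_over_n]])
  then have scale: "(\<lambda>n. \<epsilon>\<^sub>0 * (1 / real (Suc (Suc n)))) \<longlonglongrightarrow> 0"
    by simp
  have scale_pos: "0 < \<epsilon>\<^sub>0 * (1 / real (Suc (Suc n)))" "\<epsilon>\<^sub>0 * (1 / real (Suc (Suc n))) < \<epsilon>\<^sub>0" for n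
    using \<epsilon>\<^sub>0(1) by (simp_all add: divide_less_eq)
  obtain \<nu> :: "((real ^ 'n) \<times> (real ^ 'n)) cpath measure" and R where
    \<nu>: "overdamped_solution \<beta> V \<nu> R" "distr \<nu> borel (R 0) = ?\<mu>\<^sub>0"
    using subseq[OF scale_pos scale] by blast
  have "weakly_converges (\<lambda>\<epsilon>. path_law (M \<epsilon>) (Q \<epsilon>)) (path_law \<nu> R) (at_right 0)"
    unfolding weakly_converges_def
  proof (intro allI impI)
    fix \<Phi> :: "'n torus cpath \<Rightarrow> real" assume \<Phi>: "continuous_on UNIV \<Phi> \<and> bounded (range \<Phi>)"
    show "((\<lambda>\<epsilon>. \<integral>q. \<Phi> q \<partial>path_law (M \<epsilon>) (Q \<epsilon>)) \<longlongrightarrow> (\<integral>q. \<Phi> q \<partial>path_law \<nu> R)) (at_right 0)"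
    \<comment> \<open>If convergence failed for \<open>\<Phi>\<close>, some sequence of parameters
      would keep the integrals at distance \<open>e\<close> from the limit; a subsequence of it
      converges to the law of a solution, which by uniqueness is again
      \<open>path_law \<nu> R\<close>.\<close>
    proof (rule ccontr)
      assume "\<not> ?thesis"
      then obtain e where e: "e > 0"
        "\<not> (\<forall>\<^sub>F \<epsilon> in at_right 0. dist (\<integral>q. \<Phi> q \<partial>path_law (M \<epsilon>) (Q \<epsilon>)) (\<integral>q. \<Phi> q \<partial>path_law \<nu> R) < e)"
        unfolding tendsto_iff by blast
      have "\<exists>\<epsilon>>0. \<epsilon> < \<epsilon>\<^sub>0 * (1 / real (Suc (Suc n))) \<and>
          \<not> dist (\<integral>q. \<Phi> q \<partial>path_law (M \<epsilon>) (Q \<epsilon>)) (\<integral>q. \<Phi> q \<partial>path_law \<nu> R) < e" for n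
        using e(2) scale_pos(1)[of n] unfolding eventually_at_right_field by blast
      then obtain \<epsilon> where \<epsilon>: "\<And>n. 0 < \<epsilon> n" "\<And>n. \<epsilon> n < \<epsilon>\<^sub>0 * (1 / real (Suc (Suc n)))"
          "\<And>n. \<not> dist (\<integral>q. \<Phi> q \<partial>path_law (M (\<epsilon> n)) (Q (\<epsilon> n))) (\<integral>q. \<Phi> q \<partial>path_law \<nu> R) < e"
        by metis
      have lim: "\<epsilon> \<longlonglongrightarrow> 0"
        by (rule real_tendsto_sandwich[OF _ _ tendsto_const scale])
          (intro always_eventually allI less_imp_le \<epsilon>)+
      have below: "\<epsilon> n < \<epsilon>\<^sub>0" for n
        using \<epsilon>(2)[of n] scale_pos(2)[of n] by (rule less_trans)
      obtain r and \<nu>' :: "((real ^ 'n) \<times> (real ^ 'n)) cpath measure" and R' where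
        \<nu>': "overdamped_solution \<beta> V \<nu>' R'" "distr \<nu>' borel (R' 0) = ?\<mu>\<^sub>0"
          "weakly_converges (\<lambda>n. path_law (M (\<epsilon> (r n))) (Q (\<epsilon> (r n)))) (path_law \<nu>' R') sequentially"
        using subseq[OF \<epsilon>(1) below lim] by blast
      have "path_law \<nu>' R' = path_law \<nu> R"
        by (rule overdamped_law_unique[OF \<beta> C1 \<nu>'(1) \<nu>(1)]) (simp add: \<nu> \<nu>')
      then have "(\<lambda>n. \<integral>q. \<Phi> q \<partial>path_law (M (\<epsilon> (r n))) (Q (\<epsilon> (r n)))) \<longlonglongrightarrow> (\<integral>q. \<Phi> q \<partial>path_law \<nu> R)"
        using \<nu>'(3) \<Phi> unfolding weakly_converges_def by auto
      from tendstoD[OF this e(1)] \<epsilon>(3) show False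
        by (auto simp: eventually_sequentially)
    qed
  qed
  moreover have "path_law N R' = path_law \<nu> R"
    if "overdamped_solution \<beta> V N R'" "distr N borel (R' 0) = ?\<mu>\<^sub>0" for N :: "'v measure" and R'
    by (rule overdamped_law_unique[OF \<beta> C1 that(1) \<nu>(1)]) (simp add: that \<nu>)
  ultimately show ?thesis
    using \<nu> by blast
qed

end
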